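(* Let $G$ be a connected reductive algebraic group over $\mathbb{C}$ whose Lie algebra $\mathfrak{g}$ is simple. Let $\mathfrak{l}$ be a Levi subalgebra of $\mathfrak{g}$ with a center of dimension one and such that $\mathfrak{a}:=[\mathfrak{l},\mathfrak{l}]$ is simple. Denote by $A$ the connected subgroup of $G$ whose Lie algebra is $\mathfrak{a}$. Let $e$ be a nonzero nilpotent element of $\mathfrak{a}$ and suppose that the following conditions are satisfied: (i) $\mathfrak{a}$ contains a regular semisimple element of $\mathfrak{g}$; (ii) $2\dim G.e<\dim\mathfrak{g}$. Then the nilpotent orbit $A.e$ of $\mathfrak{a}$ verifies $\mathrm{RC}_1$.
   Context: The ground field is $\mathbb{C}$; groups act on their Lie algebras by the adjoint action. For a scheme $X$ of finite type over $\mathbb{C}$ and $m\in\mathbb{N}$, $\mathcal{J}_m(X)$ denotes the $m$-th jet scheme of $X$, i.e. the scheme with $\mathrm{Hom}(Z,\mathcal{J}_m(X))=\mathrm{Hom}(Z\times \mathrm{Spec}\,\mathbb{C}[t]/(t^{m+1}),X)$ for every scheme $Z$ over $\mathbb{C}$, and $\pi_{X,m}:\mathcal{J}_m(X)\to X$ is the canonical projection. Closures $\overline{\mathcal{O}}$ of nilpotent orbits are regarded as reduced affine schemes. Definition of $\mathrm{RC}_1$: a nilpotent orbit $\mathcal{O}$ of a reductive Lie algebra verifies $\mathrm{RC}_1$ if $\pi_{\overline{\mathcal{O}},1}^{-1}(0)$ is not contained in the closure of $\pi_{\overline{\mathcal{O}},1}^{-1}(\mathcal{O})$. A regular semisimple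 element of $\mathfrak{g}$ is a semisimple element whose centralizer in $\mathfrak{g}$ is a Cartan subalgebra. *)

theory Defs
  imports "HOL-Analysis.Analysis" "HOL-Computational_Algebra.Polynomial" "HOL-Library.Extended_Nat"
begin

section \<open>Zariski topology and dimension\<close>

text \<open>
  A space is coordinatised by a set of coordinate functions; the regular functions are the
  polynomials in them, and the Zariski topology is generated by the principal open sets.
\<close>

inductive_set polyfun :: "('a \<Rightarrow> complex) set \<Rightarrow> ('a \<Rightarrow> complex) set"
  for C :: "('a \<Rightarrow> complex) set" where
  coord: "c \<in> C \<Longrightarrow> c \<in> polyfun C"
| const: "(\<lambda>_. a) \<in> polyfun C"
| add: "f \<in> polyfun C \<Longrightarrow> g \<in> polyfun C \<Longrightarrow> (\<lambda>x. f x + g x) \<in> polyfun C"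
| mult: "f \<in> polyfun C \<Longrightarrow> g \<in> polyfun C \<Longrightarrow> (\<lambda>x. f x * g x) \<in> polyfun C"

definition vanishing_ideal :: "('a \<Rightarrow> complex) set \<Rightarrow> 'a set \<Rightarrow> ('a \<Rightarrow> complex) set" where
  "vanishing_ideal C X = {f \<in> polyfun C. \<forall>x\<in>X. f x = 0}"

definition zariski :: "('a \<Rightarrow> complex) set \<Rightarrow> 'a topology" where
  "zariski C = topology_generated_by {{x. f x \<noteq> 0} |f. f \<in> polyfun C}"

lemma topspace_zariski [simp]: "topspace (zariski C) = UNIV"
proof -
  have "UNIV \<in> {{x. f x \<noteq> 0} |f. f \<in> polyfun C}"
    by (rule CollectI, rule exI[of _ "\<lambda>_. 1"]) (simp add: polyfun.const)
  then show ?thesis unfolding zariski_def topology_generated_by_topspace by blast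
qed

lemma openin_zariski_iff:
  "openin (zariski C) U \<longleftrightarrow> (\<exists>F \<subseteq> polyfun C. U = {x. \<exists>f\<in>F. f x \<noteq> 0})"
proof
  assume "openin (zariski C) U"
  then have "generate_topology_on {{x. f x \<noteq> 0} |f. f \<in> polyfun C} U"
    by (simp add: zariski_def openin_topology_generated_by_iff)
  then show "\<exists>F \<subseteq> polyfun C. U = {x. \<exists>f\<in>F. f x \<noteq> 0}"
  proof induction
    case Empty
    show ?case by (rule exI[of _ "{}"]) simp
  next
    case (Int a b)
    then obtain F H where F: "F \<subseteq> polyfun C" "a = {x. \<exists>f\<in>F. f x \<noteq> 0}"
      and H: "H \<subseteq> polyfun C" "b = {x. \<exists>f\<in>H. f x \<noteq> 0}" by blast
    let ?P = "(\<lambda>(f, h) x. f x * h x) ` (F \<times> H)"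
    have "?P \<subseteq> polyfun C" using F(1) H(1) by (auto intro: polyfun.mult)
    moreover have "a \<inter> b = {x. \<exists>f\<in>?P. f x \<noteq> 0}" unfolding F(2) H(2) by auto
    ultimately show ?case by blast
  next
    case (UN K)
    let ?F = "{f \<in> polyfun C. {x. f x \<noteq> 0} \<subseteq> \<Union>K}"
    have "\<exists>f\<in>?F. f x \<noteq> 0" if "x \<in> \<Union>K" for x
    proof -
      from that obtain k where k: "k \<in> K" "x \<in> k" by blast
      with UN.IH obtain F where F: "F \<subseteq> polyfun C" "k = {x. \<exists>f\<in>F. f x \<noteq> 0}" by meson
      with k obtain f where "f \<in> F" "f x \<noteq> 0" by blast
      moreover have "{x. f x \<noteq> 0} \<subseteq> k" using F(2) \<open>f \<in> F\<close> by blast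
      ultimately show ?thesis using F(1) k(1) by blast
    qed
    then have "\<Union>K = {x. \<exists>f\<in>?F. f x \<noteq> 0}" by blast
    then show ?case by (intro exI[of _ ?F]) simp
  next
    case (Basis s)
    then obtain f where "f \<in> polyfun C" "s = {x. f x \<noteq> 0}" by blast
    then show ?case by (intro exI[of _ "{f}"]) simp
  qed
next
  assume "\<exists>F \<subseteq> polyfun C. U = {x. \<exists>f\<in>F. f x \<noteq> 0}"
  then obtain F where F: "F \<subseteq> polyfun C" "U = (\<Union>f\<in>F. {x. f x \<noteq> 0})" by blast
  show "openin (zariski C) U"
    unfolding F(2) zariski_def using F(1)
    by (intro openin_Union ballI) (auto intro!: topology_generated_by_Basis)
qed

lemma closedin_zariski_iff:
  "closedin (zariski C) Z \<longleftrightarrow> (\<exists>F \<subseteq> polyfun C. Z = {x. \<forall>f\<in>F. f x = 0})"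
proof -
  have eq: "(UNIV - Z = {x. \<exists>f\<in>F. f x \<noteq> 0}) = (Z = {x. \<forall>f\<in>F. f x = 0})"
    for F :: "('a \<Rightarrow> complex) set"
    by blast
  show ?thesis
    unfolding closedin_def openin_zariski_iff topspace_zariski eq by simp
qed

definition irreducible_closedin :: "'a topology \<Rightarrow> 'a set \<Rightarrow> bool" where
  "irreducible_closedin T Z \<longleftrightarrow> closedin T Z \<and> Z \<noteq> {} \<and>
     (\<forall>A B. closedin T A \<and> closedin T B \<and> Z \<subseteq> A \<union> B \<longrightarrow> Z \<subseteq> A \<or> Z \<subseteq> B)"

definition krull_dim :: "'a topology \<Rightarrow> enat" where
  "krull_dim T = Sup {enat n |n. \<exists>Z :: nat \<Rightarrow> 'a set.
     (\<forall>i\<le>n. irreducible_closedin T (Z i)) \<and> (\<forall>i<n. Z i \<subset> Z (Suc i))}"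


section \<open>Complex matrices\<close>

definition cscale :: "complex \<Rightarrow> complex^'n^'m \<Rightarrow> complex^'n^'m" where
  "cscale c X = (\<chi> i j. c * X $ i $ j)"

text \<open>Real scaling is the default for \<open>span\<close> and \<open>dim\<close>; everything below is over the complex numbers.\<close>

interpretation cmat: vector_space "cscale :: complex \<Rightarrow> complex^'n^'m \<Rightarrow> complex^'n^'m"
  by standard (simp_all add: cscale_def vec_eq_iff algebra_simps)

definition mat_coords :: "(complex^'n^'n \<Rightarrow> complex) set" where
  "mat_coords = {\<lambda>X. X $ i $ j |i j. True}"

abbreviation mat_zariski :: "(complex^'n^'n) topology" where
  "mat_zariski \<equiv> zariski mat_coords"

definition zdim :: "(complex^'n^'n) set \<Rightarrow> enat" where
  "zdim X = krull_dim (subtopology mat_zariski X)"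


section \<open>Lie algebras of matrices\<close>

definition lie_bracket :: "complex^'n^'n \<Rightarrow> complex^'n^'n \<Rightarrow> complex^'n^'n" where
  "lie_bracket X Y = X ** Y - Y ** X"

definition lie_subalgebra :: "(complex^'n^'n) set \<Rightarrow> (complex^'n^'n) set \<Rightarrow> bool" where
  "lie_subalgebra H L \<longleftrightarrow> H \<subseteq> L \<and> cmat.subspace H \<and> (\<forall>x\<in>H. \<forall>y\<in>H. lie_bracket x y \<in> H)"

definition lie_ideal :: "(complex^'n^'n) set \<Rightarrow> (complex^'n^'n) set \<Rightarrow> bool" where
  "lie_ideal I L \<longleftrightarrow> I \<subseteq> L \<and> cmat.subspace I \<and> (\<forall>x\<in>L. \<forall>y\<in>I. lie_bracket x y \<in> I)"

definition lie_comm :: "(complex^'n^'n) set \<Rightarrow> (complex^'n^'n) set \<Rightarrow> (complex^'n^'n) set" where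
  "lie_comm H K = cmat.span {lie_bracket x y |x y. x \<in> H \<and> y \<in> K}"

definition lie_solvable :: "(complex^'n^'n) set \<Rightarrow> bool" where
  "lie_solvable L \<longleftrightarrow> (\<exists>k. ((\<lambda>I. lie_comm I I) ^^ k) L = {0})"

definition lie_nilpotent :: "(complex^'n^'n) set \<Rightarrow> bool" where
  "lie_nilpotent L \<longleftrightarrow> (\<exists>k. (lie_comm L ^^ k) L = {0})"

definition lie_simple :: "(complex^'n^'n) set \<Rightarrow> bool" where
  "lie_simple L \<longleftrightarrow> lie_subalgebra L UNIV \<and> lie_comm L L \<noteq> {0} \<and>
     (\<forall>I. lie_ideal I L \<longrightarrow> I = {0} \<or> I = L)"

definition lie_center :: "(complex^'n^'n) set \<Rightarrow> (complex^'n^'n) set" where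
  "lie_center L = {x \<in> L. \<forall>y\<in>L. lie_bracket x y = 0}"

definition lie_centralizer :: "(complex^'n^'n) set \<Rightarrow> complex^'n^'n \<Rightarrow> (complex^'n^'n) set" where
  "lie_centralizer L x = {y \<in> L. lie_bracket x y = 0}"

definition direct_sum_decomp ::
    "(complex^'n^'n) set \<Rightarrow> (complex^'n^'n) set \<Rightarrow> (complex^'n^'n) set \<Rightarrow> bool" where
  "direct_sum_decomp V U W \<longleftrightarrow> U \<inter> W = {0} \<and> V = {u + w |u w. u \<in> U \<and> w \<in> W}"

definition lie_reductive :: "(complex^'n^'n) set \<Rightarrow> bool" where
  "lie_reductive L \<longleftrightarrow> lie_subalgebra L UNIV \<and>
     (\<forall>I. lie_ideal I L \<longrightarrow> (\<exists>J. lie_ideal J L \<and> direct_sum_decomp L I J))"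

text \<open>A sum of nilpotent ideals is a nilpotent ideal, so this is the largest one.\<close>

definition lie_nilradical :: "(complex^'n^'n) set \<Rightarrow> (complex^'n^'n) set" where
  "lie_nilradical L = cmat.span (\<Union>{I. lie_ideal I L \<and> lie_nilpotent I})"

definition borel_subalgebra :: "(complex^'n^'n) set \<Rightarrow> (complex^'n^'n) set \<Rightarrow> bool" where
  "borel_subalgebra B L \<longleftrightarrow> lie_subalgebra B L \<and> lie_solvable B \<and>
     (\<forall>B'. lie_subalgebra B' L \<and> lie_solvable B' \<and> B \<subseteq> B' \<longrightarrow> B' = B)"

definition parabolic_subalgebra :: "(complex^'n^'n) set \<Rightarrow> (complex^'n^'n) set \<Rightarrow> bool" where
  "parabolic_subalgebra P L \<longleftrightarrow> lie_subalgebra P L \<and> (\<exists>B. borel_subalgebra B L \<and> B \<subseteq> P)"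

text \<open>
  Levi subalgebras of a semisimple \<open>L\<close>: reductive complements of the nilradical in a parabolic
  subalgebra. (If \<open>L\<close> had a centre, the nilradical of a parabolic would contain it.)
\<close>

definition levi_subalgebra :: "(complex^'n^'n) set \<Rightarrow> (complex^'n^'n) set \<Rightarrow> bool" where
  "levi_subalgebra H L \<longleftrightarrow> lie_subalgebra H L \<and> lie_reductive H \<and>
     (\<exists>P. parabolic_subalgebra P L \<and> direct_sum_decomp P H (lie_nilradical P))"

definition cartan_subalgebra :: "(complex^'n^'n) set \<Rightarrow> (complex^'n^'n) set \<Rightarrow> bool" where
  "cartan_subalgebra H L \<longleftrightarrow> lie_subalgebra H L \<and> lie_nilpotent H \<and>
     {x \<in> L. \<forall>y\<in>H. lie_bracket x y \<in> H} = H"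

text \<open>
  Nilpotency and semisimplicity of elements are intrinsic to the Lie algebra \<open>L\<close>, i.e. refer to
  the adjoint representation. For nilpotency, membership in the derived algebra excludes
  nonzero central elements of a reductive \<open>L\<close>; it is automatic when \<open>L\<close> is semisimple.
\<close>

definition nilpotent_element :: "(complex^'n^'n) set \<Rightarrow> complex^'n^'n \<Rightarrow> bool" where
  "nilpotent_element L x \<longleftrightarrow> x \<in> lie_comm L L \<and> (\<exists>k. \<forall>y\<in>L. (lie_bracket x ^^ k) y = 0)"

definition semisimple_element :: "(complex^'n^'n) set \<Rightarrow> complex^'n^'n \<Rightarrow> bool" where
  "semisimple_element L x \<longleftrightarrow> x \<in> L \<and>
     cmat.span {y \<in> L. \<exists>c. lie_bracket x y = cscale c y} = L"

definition regular_semisimple_element :: "(complex^'n^'n) set \<Rightarrow> complex^'n^'n \<Rightarrow> bool" where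
  "regular_semisimple_element L x \<longleftrightarrow>
     semisimple_element L x \<and> cartan_subalgebra (lie_centralizer L x) L"


section \<open>Linear algebraic groups\<close>

definition algebraic_group :: "(complex^'n^'n) set \<Rightarrow> bool" where
  "algebraic_group G \<longleftrightarrow>
     mat 1 \<in> G \<and> (\<forall>g\<in>G. \<forall>h\<in>G. g ** h \<in> G) \<and> (\<forall>g\<in>G. matrix_inv g \<in> G) \<and>
     closedin (subtopology mat_zariski {g. invertible g}) G"

definition unipotent :: "complex^'n^'n \<Rightarrow> bool" where
  "unipotent u \<longleftrightarrow> (\<exists>k. (((**) (u - mat 1)) ^^ k) (mat 1) = 0)"

text \<open>Reductive means trivial unipotent radical.\<close>

definition reductive_group :: "(complex^'n^'n) set \<Rightarrow> bool" where
  "reductive_group G \<longleftrightarrow> algebraic_group G \<and>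
     (\<forall>U. U \<subseteq> G \<and> algebraic_group U \<and> connectedin mat_zariski U \<and>
          (\<forall>g\<in>G. \<forall>u\<in>U. g ** u ** matrix_inv g \<in> U) \<and> (\<forall>u\<in>U. unipotent u)
          \<longrightarrow> U = {mat 1})"

text \<open>The tangent space at the identity.\<close>

definition lie_algebra :: "(complex^'n^'n) set \<Rightarrow> (complex^'n^'n) set" where
  "lie_algebra G = {X. \<forall>f \<in> vanishing_ideal mat_coords G.
     ((\<lambda>t. f (mat 1 + cscale t X)) has_field_derivative 0) (at 0)}"

definition adjoint_orbit :: "(complex^'n^'n) set \<Rightarrow> complex^'n^'n \<Rightarrow> (complex^'n^'n) set" where
  "adjoint_orbit G x = {g ** x ** matrix_inv g |g. g \<in> G}"


section \<open>Jet schemes\<close>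

text \<open>
  For a Zariski closed \<open>X\<close> with its reduced structure, \<open>jet_scheme m X\<close> is the set of closed
  points of the \<open>m\<close>-th jet scheme, i.e. of \<open>\<complex>[t]/(t^(m+1))\<close>-valued points of \<open>X\<close>.
  Such a point is \<open>\<gamma> 0 + t \<gamma> 1 + ... + t^m \<gamma> m\<close>, subject to \<open>f\<close> of it being divisible by
  \<open>t^(m+1)\<close> for every \<open>f\<close> in the ideal of \<open>X\<close>. The projection to \<open>X\<close> is \<open>\<gamma> \<mapsto> \<gamma> 0\<close>.
\<close>

definition jet_scheme :: "nat \<Rightarrow> (complex^'n^'n) set \<Rightarrow> (nat \<Rightarrow> complex^'n^'n) set" where
  "jet_scheme m X = {\<gamma>. (\<forall>k>m. \<gamma> k = 0) \<and>
     (\<forall>f \<in> vanishing_ideal mat_coords X. \<exists>p :: complex poly.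
        \<forall>t. f (\<Sum>k\<le>m. cscale (t ^ k) (\<gamma> k)) = t ^ (m + 1) * poly p t)}"

definition jet_coords :: "((nat \<Rightarrow> complex^'n^'n) \<Rightarrow> complex) set" where
  "jet_coords = {\<lambda>\<gamma>. \<gamma> k $ i $ j |k i j. True}"

definition jet_topology :: "nat \<Rightarrow> (complex^'n^'n) set \<Rightarrow> (nat \<Rightarrow> complex^'n^'n) topology" where
  "jet_topology m X = subtopology (zariski jet_coords) (jet_scheme m X)"

definition jet_preimage ::
    "nat \<Rightarrow> (complex^'n^'n) set \<Rightarrow> (complex^'n^'n) set \<Rightarrow> (nat \<Rightarrow> complex^'n^'n) set" where
  "jet_preimage m X S = {\<gamma> \<in> jet_scheme m X. \<gamma> 0 \<in> S}"

definition RC1 :: "(complex^'n^'n) set \<Rightarrow> bool" where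
  "RC1 Orb \<longleftrightarrow> (let X = mat_zariski closure_of Orb in
     \<not> jet_preimage 1 X {0} \<subseteq> jet_topology 1 X closure_of jet_preimage 1 X Orb)"

end

theory Submission
  imports Defs "HOL-Computational_Algebra.Fundamental_Theorem_Algebra"
    "HOL-Computational_Algebra.Field_as_Ring" "HOL-Computational_Algebra.Polynomial_Factorial"
    "HOL-Library.Function_Algebras"
begin

text \<open>
  Suppose that every 1-jet over \<open>0\<close> is a limit of jets over \<open>A.e\<close>. Let \<open>x\<close> be an element of \<open>\<aa>\<close> that is
  regular semisimple in \<open>\<gg>\<close>, let \<open>U\<close> be the set of its eigenvectors in \<open>\<gg>\<close> with nonzero eigenvalue, and
  \<open>E\<close> the group generated by the \<open>exp u\<close> with \<open>u \<in> U\<close>. The elements of \<open>U\<close> are nilpotent matrices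
  generating \<open>\<gg>\<close>, and \<open>U + \<aa>\<close> spans a subspace of codimension at most one since \<open>\<ll>\<close> contains the
  centralizer of \<open>x\<close> and has a centre of dimension one.

  A map \<open>\<phi>(t) = exp (t\<^sub>k u\<^sub>k) \<cdots> exp (t\<^sub>1 u\<^sub>1).e\<close> with \<open>k \<le> dim G.e\<close> maximal for strictly increasing
  closures of images has an image whose closure \<open>Y\<close> is stable under \<open>E\<close>, hence under the vector fields
  of \<open>\<gg>\<close> and under \<open>A\<close>. The tangent spaces of \<open>Y\<close> are generically spanned by at most \<open>k\<close> polynomial
  vector fields, so the jets over \<open>E.A.e\<close> lie in the closure of a polynomial image of a space of
  dimension \<open>2k < dim \<gg>\<close>.

  The tangent space of the closure of \<open>A.e\<close> at \<open>0\<close> is an ideal of \<open>\<aa>\<close> containing \<open>e\<close>, hence contains \<open>\<aa>\<close>, and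
  the limits contain \<open>{0} \<times> E.\<aa>\<close>. On it, near \<open>(0, x)\<close>, some \<open>2k\<close> linear functions of the second component
  are algebraically independent. Together with a coordinate of the base point that does not vanish on
  the orbit they are \<open>2k + 1\<close> functions satisfying a polynomial relation. A relation of minimal degree
  would be divisible by the variable of that coordinate, a contradiction.
\<close>

text \<open>Behind the relation stands a dimension count. The jets and their limits lie in an
  irreducible closed set of dimension at most \<open>2k\<close>. Its part over the base point 0 is
  proper, as \<open>e\<close> is nonzero, so its dimension is below \<open>2k\<close>; yet it
  contains {0} \<times> E.\<aa>, of dimension at least dim \<gg> - 1 \<ge> 2k.

  Condition (i) enters in three ways: the eigenvectors of \<open>x\<close> provide the directions of
  \<open>E\<close>; \<open>x\<close> acts on them by nonzero scalars, so that E.\<aa> is as large as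
  U + \<aa> near \<open>x\<close>; and \<open>x\<close> is not nilpotent, which makes the trace
  forms of \<gg> and \<aa> nondegenerate.

  The group \<open>E\<close> stands in for \<open>G\<close> because the exponential of a nilpotent
  matrix is polynomial in its parameter: orbits are swept by maps from affine spaces, irreducibility
  reduces to polynomials on a line, and dimensions become numbers of variables. The price is the
  passage from the vector fields of \<gg> to the group \<open>A\<close>, where a determinant,
  constant on the irreducible group because \<aa> is perfect, takes the place of the
  exponential.\<close>

definition munit :: "'m \<Rightarrow> 'n \<Rightarrow> complex^'n^'m" where
  "munit a b = (\<chi> i j. if i = a \<and> j = b then 1 else 0)"

lemma munit_nth [simp]: "munit a b $ i $ j = (if i = a \<and> j = b then 1 else 0)"
  by (simp add: munit_def)

lemma cscale_nth [simp]: "cscale c X $ i $ j = c * X $ i $ j"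
  by (simp add: cscale_def)

lemma matrix_eqI: "(\<And>i j. A $ i $ j = B $ i $ j) \<Longrightarrow> A = B"
  by (simp add: vec_eq_iff)

lemma munit_expansion:
  "X = (\<Sum>p\<in>UNIV. cscale (X $ fst p $ snd p) (munit (fst p) (snd p)))"
proof (rule matrix_eqI)
  fix i j
  have "(\<Sum>p\<in>UNIV. cscale (X $ fst p $ snd p) (munit (fst p) (snd p))) $ i $ j =
     (\<Sum>p\<in>UNIV. if p = (i, j) then X $ i $ j else 0)"
    by (subst sum_component, subst sum_component, rule sum.cong) (auto simp: prod_eq_iff)
  then show "X $ i $ j = (\<Sum>p\<in>UNIV. cscale (X $ fst p $ snd p) (munit (fst p) (snd p))) $ i $ j"
    by simp
qed

text \<open>The matrix units are a basis, which makes dimension over the complex numbers available.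
  Rectangular matrices are included because column vectors appear later as matrices with one
  column.\<close>

interpretation cmatf: finite_dimensional_vector_space
  "cscale :: complex \<Rightarrow> complex^'n^'m \<Rightarrow> complex^'n^'m" "range (\<lambda>p. munit (fst p) (snd p))"
proof unfold_locales
  let ?m = "\<lambda>p. munit (fst p) (snd p) :: complex^'n^'m"
  have inj: "inj ?m"
  proof (rule injI)
    fix p q :: "'m \<times> 'n" assume "?m p = ?m q"
    then have "?m p $ fst p $ snd p = ?m q $ fst p $ snd p" by simp
    then show "p = q" by (simp split: if_splits add: prod_eq_iff)
  qed
  show "finite (range ?m)" by simp
  show "cmat.independent (range ?m)"
  proof (rule cmat.independent_if_scalars_zero)
    fix f x assume z: "(\<Sum>x\<in>range ?m. cscale (f x) x) = 0" and "x \<in> range ?m"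
    then obtain q where q: "x = ?m q" by auto
    have "(\<Sum>x\<in>range ?m. cscale (f x) x) $ fst q $ snd q = (\<Sum>p\<in>UNIV. f (?m p) * ?m p $ fst q $ snd q)"
      by (simp add: sum_component sum.reindex[OF inj] del: munit_nth)
    also have "\<dots> = (\<Sum>p\<in>UNIV. if p = q then f (?m q) else 0)"
      by (rule sum.cong) (auto simp: prod_eq_iff)
    finally show "f x = 0" using z q by simp
  qed simp
  show "cmat.span (range ?m) = UNIV"
  proof -
    have "X \<in> cmat.span (range ?m)" for X
      by (subst munit_expansion[of X]) (intro cmat.span_sum cmat.span_scale cmat.span_base, auto)
    then show ?thesis by auto
  qed
qed

section \<open>Linear operators and polynomials in them\<close>

abbreviation clin :: "(complex^'n^'m \<Rightarrow> complex^'q^'p) \<Rightarrow> bool" where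
  "clin \<equiv> Vector_Spaces.linear cscale cscale"

lemma clinI:
  assumes "\<And>x y. f (x + y) = f x + f y" "\<And>c x. f (cscale c x) = cscale c (f x)"
  shows "clin f"
  by (simp add: Vector_Spaces.linear_iff cmat.vector_space_axioms assms)

lemma clin_add: "clin f \<Longrightarrow> f (x + y) = f x + f y"
  and clin_scale: "clin f \<Longrightarrow> f (cscale c x) = cscale c (f x)"
  by (simp_all add: Vector_Spaces.linear_iff)

lemma clin_0: "clin f \<Longrightarrow> f 0 = 0"
  using clin_add[of f 0 0] by simp

lemma clin_diff: "clin f \<Longrightarrow> f (x - y) = f x - f y"
  using clin_add[of f "x - y" y] by simp

lemma clin_sum:
  assumes "clin f" shows "f (sum g S) = (\<Sum>a\<in>S. f (g a))"
  by (induction S rule: infinite_finite_induct) (simp_all add: clin_0[OF assms] clin_add[OF assms])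

definition papp :: "complex poly \<Rightarrow> (complex^'n^'m \<Rightarrow> complex^'n^'m) \<Rightarrow> complex^'n^'m \<Rightarrow> complex^'n^'m" where
  "papp p T v = (\<Sum>i\<le>degree p. cscale (coeff p i) ((T ^^ i) v))"

lemma papp_altdef: "degree p \<le> n \<Longrightarrow> papp p T v = (\<Sum>i\<le>n. cscale (coeff p i) ((T ^^ i) v))"
  unfolding papp_def by (rule sum.mono_neutral_left) (auto simp: coeff_eq_0)

lemma papp_0 [simp]: "papp 0 T v = 0"
  by (simp add: papp_def)

lemma papp_pCons: "clin T \<Longrightarrow> papp (pCons a p) T v = cscale a v + T (papp p T v)"
proof -
  assume T: "clin T"
  have "papp (pCons a p) T v = (\<Sum>i\<le>Suc (degree p). cscale (coeff (pCons a p) i) ((T ^^ i) v))"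
    by (rule papp_altdef) (simp add: degree_pCons_le)
  also have "\<dots> = cscale a v + (\<Sum>i\<le>degree p. cscale (coeff p i) (T ((T ^^ i) v)))"
    by (subst sum.atMost_Suc_shift) simp
  finally show ?thesis by (simp add: papp_def clin_sum[OF T] clin_scale[OF T])
qed

lemma papp_1 [simp]: "papp 1 T v = v"
  by (simp add: papp_def)

lemma papp_add: "papp (p + q) T v = papp p T v + papp q T v"
proof -
  let ?n = "max (degree p) (degree q)"
  have "degree (p + q) \<le> ?n" by (simp add: degree_add_le_max)
  then show ?thesis
    by (simp add: papp_altdef[of _ ?n] cmat.scale_left_distrib sum.distrib)
qed

lemma papp_smult: "papp (smult a p) T v = cscale a (papp p T v)"
  by (simp add: papp_altdef[OF degree_smult_le] cmat.scale_sum_right papp_def)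

lemma papp_sum: "papp (sum f S) T v = (\<Sum>a\<in>S. papp (f a) T v)"
  by (induction S rule: infinite_finite_induct) (simp_all add: papp_add)

lemma clin_papp:
  assumes T: "clin T" shows "clin (papp p T)"
proof (induction p)
  case 0
  then show ?case by (auto intro!: clinI)
next
  case (pCons a p)
  show ?case
    by (rule clinI) (simp_all add: papp_pCons[OF T] clin_add[OF pCons.IH] clin_scale[OF pCons.IH]
        clin_add[OF T] clin_scale[OF T] cmat.scale_right_distrib mult.commute)
qed

lemma papp_mult:
  assumes T: "clin T" shows "papp (p * q) T v = papp p T (papp q T v)"
  by (induction p) (simp_all add: papp_pCons[OF T] papp_add papp_smult mult_pCons_left)

lemma papp_in_subspace:
  assumes "clin T" "cmat.subspace W" "\<And>w. w \<in> W \<Longrightarrow> T w \<in> W" "v \<in> W"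
  shows "papp p T v \<in> W"
  using assms(4) by (induction p)
    (simp_all add: papp_pCons[OF assms(1)] assms(2-4) cmat.subspace_0 cmat.subspace_add cmat.subspace_scale)

lemma papp_linear_factor: "clin T \<Longrightarrow> papp [:- c, 1:] T v = T v - cscale c v"
  by (simp add: papp_pCons clin_0)

lemma papp_eigenvector:
  assumes "clin T" "T v = cscale c v"
  shows "papp p T v = cscale (poly p c) v"
  by (induction p) (simp_all add: papp_pCons[OF assms(1)] assms(2) clin_scale[OF assms(1)] cmat.scale_left_distrib mult.commute)

lemma papp_pow:
  assumes T: "clin T" shows "papp (p ^ k) T v = (papp p T ^^ k) v"
  by (induction k arbitrary: v) (simp_all add: papp_mult[OF T])

text \<open>Either two iterates of \<open>v\<close> coincide and a difference of two monomials
  annihilates \<open>v\<close>, or the iterates form an infinite set, which is dependent in a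
  finite-dimensional space.\<close>

lemma annihilating_poly_at:
  fixes T :: "complex^'n^'m \<Rightarrow> complex^'n^'m"
  shows "\<exists>p. p \<noteq> 0 \<and> papp p T v = 0"
proof (cases "inj (\<lambda>i. (T ^^ i) v)")
  case False
  then obtain i j where ij: "i \<noteq> j" "(T ^^ i) v = (T ^^ j) v" by (auto simp: inj_def)
  define n where "n = max i j"
  let ?p = "monom 1 i - monom 1 j :: complex poly"
  have "coeff ?p i \<noteq> 0" using ij(1) by (simp add: coeff_monom)
  then have "?p \<noteq> 0" by (metis coeff_0)
  have "degree ?p \<le> n"
    unfolding n_def by (rule order_trans[OF degree_diff_le_max]) (simp add: degree_monom_eq)
  then have "papp ?p T v = (\<Sum>k\<le>n. cscale (if k = i then 1 else 0) ((T ^^ k) v) - cscale (if k = j then 1 else 0) ((T ^^ k) v))"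
    by (subst papp_altdef, assumption) (auto intro!: sum.cong simp: cmat.scale_left_diff_distrib)
  also have "\<dots> = (\<Sum>k\<le>n. (if k = i then (T ^^ i) v else 0)) - (\<Sum>k\<le>n. if k = j then (T ^^ j) v else 0)"
    unfolding sum_subtractf by (intro arg_cong2[where f = "(-)"] sum.cong) auto
  also have "\<dots> = 0" using ij by (simp add: n_def)
  finally show ?thesis using \<open>?p \<noteq> 0\<close> by blast
next
  case True
  let ?S = "range (\<lambda>i. (T ^^ i) v)"
  have "infinite ?S" using True by (simp add: finite_image_iff)
  then have "cmat.dependent ?S" using cmatf.finiteI_independent by blast
  then obtain t u w where t: "finite t" "t \<subseteq> ?S" "(\<Sum>w\<in>t. cscale (u w) w) = 0" "w \<in> t" "u w \<noteq> 0"
    by (auto simp: cmat.dependent_explicit)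
  define I where "I = (\<lambda>i. (T ^^ i) v) -` t"
  have tI: "t = (\<lambda>i. (T ^^ i) v) ` I" using t(2) by (auto simp: I_def)
  have finI: "finite I" unfolding I_def using t(1) True by (rule finite_vimageI)
  define p where "p = (\<Sum>i\<in>I. monom (u ((T ^^ i) v)) i)"
  have cp: "coeff p k = (if k \<in> I then u ((T ^^ k) v) else 0)" for k
    using finI by (simp add: p_def coeff_sum)
  obtain i where i: "i \<in> I" "w = (T ^^ i) v" using t(4) tI by auto
  have "coeff p i \<noteq> 0" using i t(5) cp by auto
  then have "p \<noteq> 0" by auto
  moreover have "papp p T v = (\<Sum>i\<in>I. cscale (u ((T ^^ i) v)) ((T ^^ i) v))"
  proof -
    have "papp p T v = (\<Sum>k\<in>{..degree p}. cscale (coeff p k) ((T ^^ k) v))" by (simp add: papp_def)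
    also have "\<dots> = (\<Sum>k\<in>I \<union> {..degree p}. cscale (coeff p k) ((T ^^ k) v))"
      using finI by (intro sum.mono_neutral_left) (auto simp: coeff_eq_0)
    also have "\<dots> = (\<Sum>k\<in>I. cscale (coeff p k) ((T ^^ k) v))"
      using finI by (intro sum.mono_neutral_right) (auto simp: cp)
    finally show ?thesis by (simp add: cp)
  qed
  moreover have "\<dots> = (\<Sum>w\<in>t. cscale (u w) w)"
    unfolding tI by (subst sum.reindex) (use True in \<open>auto simp: inj_def inj_on_def\<close>)
  ultimately show ?thesis using t(3) by auto
qed

text \<open>An eigenvector in the quotient of \<open>W\<close> by \<open>U\<close>, without forming
  quotients. Among the nonzero \<open>p\<close> with p(T)w in \<open>U\<close> one of least degree
  is taken; it is not constant, and removing a linear factor leaves a vector outside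
  \<open>U\<close> that the factor maps into \<open>U\<close>.\<close>

lemma eigenvector_mod_subspace:
  fixes T :: "complex^'n^'m \<Rightarrow> complex^'n^'m"
  assumes T: "clin T" and W: "cmat.subspace W" "\<And>w. w \<in> W \<Longrightarrow> T w \<in> W"
    and U: "cmat.subspace U" and w: "w \<in> W" "w \<notin> U"
  shows "\<exists>v c. v \<in> W \<and> v \<notin> U \<and> T v - cscale c v \<in> U"
proof -
  define P where "P = (\<lambda>p. p \<noteq> 0 \<and> papp p T w \<in> U)"
  obtain p0 where "P p0" unfolding P_def
    using annihilating_poly_at[of T w] U cmat.subspace_0 by metis
  then obtain p where p: "P p" and min: "\<And>q. P q \<Longrightarrow> degree p \<le> degree q"
    using exists_least_iff[of "\<lambda>n. \<exists>p. P p \<and> degree p = n"] by (metis not_le)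
  have "degree p \<noteq> 0"
  proof
    assume "degree p = 0"
    then obtain a where a: "p = [:a:]" by (meson degree_eq_zeroE)
    with p have "a \<noteq> 0" "cscale a w \<in> U" by (auto simp: P_def papp_def)
    then have "cscale (inverse a) (cscale a w) \<in> U" using U cmat.subspace_scale by blast
    with \<open>a \<noteq> 0\<close> w show False by simp
  qed
  then obtain c where "poly p c = 0"
    using fundamental_theorem_of_algebra[of p] by (auto simp: constant_degree)
  then obtain q where q: "p = [:- c, 1:] * q" by (metis poly_eq_0_iff_dvd dvdE)
  then have "q \<noteq> 0" "degree q < degree p"
    using p by (auto simp: P_def degree_mult_eq simp del: mult_pCons_left)
  then have "papp q T w \<notin> U" using min[of q] by (auto simp: P_def)
  moreover have "papp q T w \<in> W" by (rule papp_in_subspace) (use T W w in auto)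
  moreover have "T (papp q T w) - cscale c (papp q T w) \<in> U"
    using p q T by (simp add: P_def papp_mult papp_linear_factor del: mult_pCons_left)
  ultimately show ?thesis by blast
qed

section \<open>Matrix algebra\<close>

lemma matrix_diff_ldistrib: "A ** (B - C) = A ** B - A ** (C :: complex^'n^'m)"
  by (simp add: vec_eq_iff matrix_matrix_mult_def right_diff_distrib sum_subtractf)
lemma matrix_diff_rdistrib: "(A - B) ** C = A ** C - B ** (C :: complex^'n^'m)"
  by (simp add: vec_eq_iff matrix_matrix_mult_def left_diff_distrib sum_subtractf)
lemma matrix_add_rdistrib: "(A + B) ** C = A ** C + B ** (C :: complex^'n^'m)"
  by (simp add: vec_eq_iff matrix_matrix_mult_def distrib_right sum.distrib)
lemma cscale_mult_left: "cscale c A ** B = cscale c (A ** B)"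
  by (simp add: vec_eq_iff matrix_matrix_mult_def sum_distrib_left mult.assoc)
lemma cscale_mult_right: "A ** cscale c B = cscale c (A ** B)"
  by (simp add: vec_eq_iff matrix_matrix_mult_def sum_distrib_left mult_ac)
lemma matrix_mult_0 [simp]: "A ** 0 = (0 :: complex^'n^'m)" "0 ** B = (0 :: complex^'n^'m)"
  by (simp_all add: vec_eq_iff matrix_matrix_mult_def)
lemma matrix_mult_minus: "A ** (- B) = - (A ** B)" "(- A) ** B = - (A ** (B :: complex^'n^'m))"
  by (simp_all add: vec_eq_iff matrix_matrix_mult_def sum_negf)

lemmas matrix_ring = matrix_add_ldistrib matrix_add_rdistrib matrix_diff_ldistrib matrix_diff_rdistrib
  cscale_mult_left cscale_mult_right matrix_mul_assoc matrix_mult_minus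
  cmat.scale_right_distrib cmat.scale_left_distrib cmat.scale_right_diff_distrib cmat.scale_left_diff_distrib

lemma clin_mult_left: "clin ((**) A)" and clin_mult_right: "clin (\<lambda>X. X ** A)"
  by (auto intro!: clinI simp: matrix_ring)

lemma lie_bracket_add: "lie_bracket (x + y) z = lie_bracket x z + lie_bracket y z"
    "lie_bracket x (y + z) = lie_bracket x y + lie_bracket x z"
  and lie_bracket_diff: "lie_bracket (x - y) z = lie_bracket x z - lie_bracket y z"
    "lie_bracket x (y - z) = lie_bracket x y - lie_bracket x z"
  and lie_bracket_scale: "lie_bracket (cscale c x) y = cscale c (lie_bracket x y)"
    "lie_bracket x (cscale c y) = cscale c (lie_bracket x y)"
  by (simp_all add: lie_bracket_def matrix_ring)

lemma lie_bracket_0 [simp]: "lie_bracket 0 x = 0" "lie_bracket x 0 = 0" "lie_bracket x x = 0"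
  by (simp_all add: lie_bracket_def)

lemma lie_bracket_anti: "lie_bracket x y = - lie_bracket y x"
  by (simp add: lie_bracket_def)

lemma lie_jacobi: "lie_bracket (lie_bracket x y) z = lie_bracket x (lie_bracket y z) - lie_bracket y (lie_bracket x z)"
  by (simp add: lie_bracket_def matrix_ring algebra_simps)

lemmas lie_bilinear = lie_bracket_add lie_bracket_diff lie_bracket_scale

lemma clin_lie_bracket: "clin (lie_bracket x)" "clin (\<lambda>y. lie_bracket y x)"
  by (auto intro!: clinI simp: lie_bilinear)

lemma trace_cscale: "trace (cscale c A) = c * trace A"
  by (simp add: trace_def sum_distrib_left)

lemma trace_0' [simp]: "trace (0 :: complex^'n^'n) = 0"
  by (simp add: trace_def)

lemma trace_lie_bracket_mult: "trace (lie_bracket u v ** w) = trace (u ** lie_bracket v w)"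
  by (simp add: lie_bracket_def matrix_ring trace_sub) (metis matrix_mul_assoc trace_mul_sym)

lemma lie_comm_base: "x \<in> H \<Longrightarrow> y \<in> K \<Longrightarrow> lie_bracket x y \<in> lie_comm H K"
  unfolding lie_comm_def by (rule cmat.span_base) blast

lemma lie_comm_subset:
  "cmat.subspace M \<Longrightarrow> (\<And>x y. x \<in> H \<Longrightarrow> y \<in> K \<Longrightarrow> lie_bracket x y \<in> M) \<Longrightarrow> lie_comm H K \<subseteq> M"
  unfolding lie_comm_def by (rule cmat.span_minimal) auto

lemma subspace_lie_comm: "cmat.subspace (lie_comm H K)"
  by (simp add: lie_comm_def)

lemma lie_comm_mono: "H \<subseteq> H' \<Longrightarrow> K \<subseteq> K' \<Longrightarrow> lie_comm H K \<subseteq> lie_comm H' K'"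
  by (rule lie_comm_subset[OF subspace_lie_comm]) (auto intro: lie_comm_base)

abbreviation derived :: "nat \<Rightarrow> (complex^'n^'n) set \<Rightarrow> (complex^'n^'n) set" where
  "derived k L \<equiv> ((\<lambda>I. lie_comm I I) ^^ k) L"

lemma derived_mono: "L \<subseteq> M \<Longrightarrow> derived k L \<subseteq> derived k M"
  by (induction k) (auto intro: lie_comm_mono[THEN subsetD])

lemma zero_in_derived: "0 \<in> L \<Longrightarrow> 0 \<in> derived k L"
  by (cases k) (auto simp: cmat.subspace_0 subspace_lie_comm)


lemma lie_solvable_derived:
  assumes "lie_solvable M" "derived k L \<subseteq> M" "0 \<in> L" shows "lie_solvable L"
proof -
  obtain j where "derived j M = {0}" using assms(1) by (auto simp: lie_solvable_def)
  then have "derived (j + k) L \<subseteq> {0}" using derived_mono[OF assms(2), of j] by (simp add: funpow_add)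
  with zero_in_derived[OF assms(3)] show ?thesis unfolding lie_solvable_def by blast
qed

lemma lie_solvable_subset: "lie_solvable M \<Longrightarrow> L \<subseteq> M \<Longrightarrow> 0 \<in> L \<Longrightarrow> lie_solvable L"
  using lie_solvable_derived[of M 0 L] by simp

lemma lie_subalgebraD: "lie_subalgebra H L \<Longrightarrow> cmat.subspace H" "lie_subalgebra H L \<Longrightarrow> H \<subseteq> L"
  "lie_subalgebra H L \<Longrightarrow> x \<in> H \<Longrightarrow> y \<in> H \<Longrightarrow> lie_bracket x y \<in> H"
  by (auto simp: lie_subalgebra_def)

lemma in_line_sum_iff: "x \<in> {b + cscale c y |b c. b \<in> B} \<longleftrightarrow> (\<exists>k. x - cscale k y \<in> B)"
proof
  assume "\<exists>k. x - cscale k y \<in> B"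
  then obtain k where "x - cscale k y \<in> B" by blast
  then show "x \<in> {b + cscale c y |b c. b \<in> B}"
    by (intro CollectI exI[of _ "x - cscale k y"] exI[of _ k]) simp
next
  assume "x \<in> {b + cscale c y |b c. b \<in> B}"
  then obtain b c where "b \<in> B" "x = b + cscale c y" by blast
  then show "\<exists>k. x - cscale k y \<in> B" by (intro exI[of _ c]) simp
qed

lemma subspace_insert_line:
  assumes "cmat.subspace B" shows "cmat.subspace {b + cscale c y |b c. b \<in> B}"
proof -
  have "cmat.span (insert y B) = {b + cscale c y |b c. b \<in> B}" (is "_ = ?R")
  proof -
    have "x \<in> cmat.span (insert y B) \<longleftrightarrow> x \<in> ?R" for x
    proof -
      have "x \<in> cmat.span (insert y B) \<longleftrightarrow> (\<exists>k. x - cscale k y \<in> B)"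
        using assms by (simp only: cmat.span_breakdown_eq cmat.span_eq_iff[THEN iffD2])
      also have "\<dots> \<longleftrightarrow> x \<in> ?R" by (simp only: in_line_sum_iff)
      finally show ?thesis .
    qed
    then show ?thesis by blast
  qed
  then show ?thesis by (metis cmat.subspace_span)
qed

text \<open>Supplies the ideal of codimension one on which the induction for Lie's theorem rests: a
  basis of \<open>C\<close> is extended to \<open>L\<close> and one new basis vector
  \<open>z\<close> is left out.\<close>

lemma hyperplane_between:
  fixes L :: "(complex^'n^'m) set"
  assumes "cmat.subspace C" "cmat.subspace L" "C \<subset> L"
  shows "\<exists>K z. cmat.subspace K \<and> C \<subseteq> K \<and> z \<in> L \<and> z \<notin> K \<and> L = {k + cscale c z |k c. k \<in> K}"
proof -
  obtain BC where BC: "BC \<subseteq> C" "cmat.independent BC" "C \<subseteq> cmat.span BC"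
    using cmat.maximal_independent_subset by blast
  have "BC \<subseteq> L" using BC assms by auto
  then obtain BL where BL: "BC \<subseteq> BL" "BL \<subseteq> L" "cmat.independent BL" "L \<subseteq> cmat.span BL"
    using cmat.maximal_independent_subset_extend[OF _ BC(2)] by metis
  have spL: "cmat.span BL = L" using BL assms cmat.span_minimal by blast
  have spC: "cmat.span BC = C" using BC assms cmat.span_minimal by blast
  obtain z where z: "z \<in> BL" "z \<notin> BC" using spL spC assms(3) BL(1) by (metis psubset_eq subsetI subset_antisym)
  let ?K = "cmat.span (BL - {z})"
  have "z \<notin> ?K" using BL(3) z cmat.dependent_def by blast
  moreover have "C \<subseteq> ?K" unfolding spC[symmetric] using BL(1) z by (intro cmat.span_mono) auto
  moreover have "L = {k + cscale c z |k c. k \<in> ?K}" (is "_ = ?R")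
  proof -
    have "x \<in> L \<longleftrightarrow> x \<in> ?R" for x
    proof -
      have "x \<in> L \<longleftrightarrow> x \<in> cmat.span (insert z (BL - {z}))" using z spL by (simp add: insert_absorb)
      also have "\<dots> \<longleftrightarrow> (\<exists>k. x - cscale k z \<in> ?K)" by (rule cmat.span_breakdown_eq)
      also have "\<dots> \<longleftrightarrow> x \<in> ?R" by (simp only: in_line_sum_iff)
      finally show ?thesis .
    qed
    then show ?thesis by blast
  qed
  moreover have "z \<in> L" using z BL by auto
  ultimately show ?thesis by (intro exI[of _ ?K] exI[of _ z]) auto
qed

section \<open>Lie's theorem\<close>

definition lie_rep :: "(complex^'n^'n) set \<Rightarrow> (complex^'n^'n \<Rightarrow> complex^'p^'q \<Rightarrow> complex^'p^'q) \<Rightarrow> bool" where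
  "lie_rep L \<rho> \<longleftrightarrow> (\<forall>k\<in>L. clin (\<rho> k)) \<and> (\<forall>k\<in>L. \<forall>l\<in>L. \<forall>v. \<rho> (k + l) v = \<rho> k v + \<rho> l v) \<and>
     (\<forall>k\<in>L. \<forall>c v. \<rho> (cscale c k) v = cscale c (\<rho> k v)) \<and>
     (\<forall>k\<in>L. \<forall>l\<in>L. \<forall>v. \<rho> (lie_bracket k l) v = \<rho> k (\<rho> l v) - \<rho> l (\<rho> k v))"

lemma lie_repD:
  assumes "lie_rep L \<rho>" "k \<in> L"
  shows "clin (\<rho> k)" "l \<in> L \<Longrightarrow> \<rho> (k + l) v = \<rho> k v + \<rho> l v"
    "\<rho> (cscale c k) v = cscale c (\<rho> k v)"
    "l \<in> L \<Longrightarrow> \<rho> (lie_bracket k l) v = \<rho> k (\<rho> l v) - \<rho> l (\<rho> k v)"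
  using assms by (auto simp: lie_rep_def)

lemma lie_rep_subset: "lie_rep L \<rho> \<Longrightarrow> K \<subseteq> L \<Longrightarrow> lie_rep K \<rho>"
  unfolding lie_rep_def by (meson subsetD)

lemma subspace_clin_preimage: "clin f \<Longrightarrow> cmat.subspace U \<Longrightarrow> cmat.subspace {x. f x \<in> U}"
  unfolding cmat.subspace_def using clin_0[of f] clin_add[of f] clin_scale[of f] by auto

lemma clin_minus_scale: "clin f \<Longrightarrow> clin (\<lambda>x. f x - cscale c x)"
  by (rule clinI) (simp_all add: clin_add[of f] clin_scale[of f] cmat.scale_right_distrib
      cmat.scale_right_diff_distrib mult.commute)

text \<open>Invariance of a weight under a larger algebra. Instead of a trace on the span of the
  vectors z^i w modulo \<open>U\<close>, the coefficient i \<kappa>([k,z]) is followed to the first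
  dependent vector, where it must vanish; characteristic zero then gives the claim.\<close>

lemma lie_weight_invariance:
  fixes \<rho> :: "complex^'n^'n \<Rightarrow> complex^'p^'q \<Rightarrow> complex^'p^'q"
  assumes rep: "lie_rep L \<rho>" and K: "K \<subseteq> L" and z: "z \<in> L"
    and ideal: "\<And>k. k \<in> K \<Longrightarrow> lie_bracket k z \<in> K"
    and U: "cmat.subspace U" "\<And>l u. l \<in> L \<Longrightarrow> u \<in> U \<Longrightarrow> \<rho> l u \<in> U"
    and w: "w \<notin> U" "\<And>k. k \<in> K \<Longrightarrow> \<rho> k w - cscale (\<kappa> k) w \<in> U"
    and k: "k \<in> K"
  shows "\<kappa> (lie_bracket k z) = 0"
proof -
  define x where "x i = (\<rho> z ^^ i) w" for i :: nat
  define S where "S i = cmat.span (U \<union> x ` {..<i})" for i :: nat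
  have x0: "x 0 = w" and xS: "x (Suc i) = \<rho> z (x i)" for i by (simp_all add: x_def)
  have subS: "cmat.subspace (S i)" for i by (simp add: S_def)
  have US: "u \<in> U \<Longrightarrow> u \<in> S i" for u i unfolding S_def by (rule cmat.span_base) auto
  have xin: "j < i \<Longrightarrow> x j \<in> S i" for i j unfolding S_def by (rule cmat.span_base) auto
  have S0: "S 0 = U" using U(1) by (simp add: S_def)
  have mono: "S i \<subseteq> S j" if "i \<le> j" for i j
    unfolding S_def by (rule cmat.span_mono) (use that in auto)
  have lin: "clin (\<rho> l)" if "l \<in> L" for l using lie_repD(1)[OF rep that] .
  have zS: "\<rho> z s \<in> S (Suc i)" if "s \<in> S i" for s i
  proof -
    have "S i \<subseteq> {s. \<rho> z s \<in> S (Suc i)}" unfolding S_def[of i]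
    proof (rule cmat.span_minimal)
      show "cmat.subspace {s. \<rho> z s \<in> S (Suc i)}"
        by (rule subspace_clin_preimage[OF lin[OF z] subS])
      show "U \<union> x ` {..<i} \<subseteq> {s. \<rho> z s \<in> S (Suc i)}"
        using U(2)[OF z] US xin by (auto simp flip: xS)
    qed
    then show ?thesis using that by auto
  qed
  \<comment> \<open>Moving \<open>k\<close> past \<open>i\<close> copies of \<open>z\<close> creates
    \<open>i\<close> brackets, each acting by the scalar \<kappa>([k,z]) up to lower terms. At
    \<open>i = 0\<close> the truncated index \<open>i - 1\<close> is harmless because the
    coefficient is 0.\<close>
  have A: "\<rho> k (x i) - cscale (\<kappa> k) (x i) - cscale (of_nat i * \<kappa> (lie_bracket k z)) (x (i - 1)) \<in> S (i - 1)"
    if "k \<in> K" for k i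
    using that
  proof (induction i arbitrary: k)
    case 0
    then show ?case using w(2) S0 x0 by simp
  next
    case (Suc i)
    define s where "s = \<rho> k (x i) - cscale (\<kappa> k) (x i) - cscale (of_nat i * \<kappa> (lie_bracket k z)) (x (i - 1))"
    define s' where "s' = \<rho> (lie_bracket k z) (x i) - cscale (\<kappa> (lie_bracket k z)) (x i)
       - cscale (of_nat i * \<kappa> (lie_bracket (lie_bracket k z) z)) (x (i - 1))"
    have s: "s \<in> S (i - 1)" "s' \<in> S (i - 1)"
      using Suc.IH[OF Suc.prems] Suc.IH[OF ideal[OF Suc.prems]] by (auto simp: s_def s'_def)
    have zx: "cscale (of_nat i * c) (\<rho> z (x (i - 1))) = cscale (of_nat i * c) (x i)" for c
      by (cases i) (simp_all add: xS)
    have kL: "k \<in> L" using Suc.prems K by auto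
    have "\<rho> k (x (Suc i)) = \<rho> z (\<rho> k (x i)) + \<rho> (lie_bracket k z) (x i)"
      using lie_repD(4)[OF rep kL z] by (simp add: xS)
    also have "\<rho> k (x i) = cscale (\<kappa> k) (x i) + cscale (of_nat i * \<kappa> (lie_bracket k z)) (x (i - 1)) + s"
      by (simp add: s_def)
    also have "\<rho> z \<dots> = cscale (\<kappa> k) (x (Suc i)) + cscale (of_nat i * \<kappa> (lie_bracket k z)) (x i) + \<rho> z s"
      by (simp only: clin_add[OF lin[OF z]] clin_scale[OF lin[OF z]] xS zx)
    also have "\<rho> (lie_bracket k z) (x i) = cscale (\<kappa> (lie_bracket k z)) (x i)
       + cscale (of_nat i * \<kappa> (lie_bracket (lie_bracket k z) z)) (x (i - 1)) + s'"
      by (simp add: s'_def)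
    finally have "\<rho> k (x (Suc i)) - cscale (\<kappa> k) (x (Suc i)) - cscale (of_nat (Suc i) * \<kappa> (lie_bracket k z)) (x i)
      = \<rho> z s + cscale (of_nat i * \<kappa> (lie_bracket (lie_bracket k z) z)) (x (i - 1)) + s'"
      by (simp add: algebra_simps cmat.scale_left_distrib)
    moreover have "\<rho> z s \<in> S i"
    proof (cases i)
      case 0
      then show ?thesis using s(1) S0 U(2)[OF z] by auto
    next
      case (Suc j)
      then show ?thesis using zS s(1) by auto
    qed
    moreover have "cscale (of_nat i * c) (x (i - 1)) \<in> S i" for c
      by (cases i) (use xin subS in \<open>auto simp: cmat.subspace_0 cmat.subspace_scale\<close>)
    moreover have "s' \<in> S i" using s(2) mono[of "i - 1" i] by auto
    ultimately show ?case using subS[of i] by (simp add: cmat.subspace_add)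
  qed
  have B: "\<rho> k s - cscale (\<kappa> k) s \<in> S (i - 1)" if "s \<in> S i" for s i
  proof -
    have kL: "k \<in> L" using k K by auto
    have "S i \<subseteq> {s. \<rho> k s - cscale (\<kappa> k) s \<in> S (i - 1)}" unfolding S_def[of i]
    proof (rule cmat.span_minimal)
      show "cmat.subspace {s. \<rho> k s - cscale (\<kappa> k) s \<in> S (i - 1)}"
        by (rule subspace_clin_preimage[OF clin_minus_scale[OF lin[OF kL]] subS])
      have "\<rho> k (x j) - cscale (\<kappa> k) (x j) \<in> S (i - 1)" if "j < i" for j
      proof -
        let ?c = "cscale (of_nat j * \<kappa> (lie_bracket k z)) (x (j - 1))"
        have "?c \<in> S (i - 1)"
          by (cases j) (use that xin[of "j - 1" "i - 1"] subS in \<open>auto simp: cmat.subspace_0 cmat.subspace_scale\<close>)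
        moreover have "\<rho> k (x j) - cscale (\<kappa> k) (x j) - ?c \<in> S (i - 1)"
          using A[OF k, of j] mono[of "j - 1" "i - 1"] that by (meson diff_le_mono less_imp_le subsetD)
        ultimately show ?thesis using cmat.subspace_add[OF subS] by fastforce
      qed
      moreover have "\<rho> k u - cscale (\<kappa> k) u \<in> U" if "u \<in> U" for u
        using U that kL by (auto intro: cmat.subspace_diff cmat.subspace_scale)
      ultimately show "U \<union> x ` {..<i} \<subseteq> {s. \<rho> k s - cscale (\<kappa> k) s \<in> S (i - 1)}"
        using US by auto
    qed
    then show ?thesis using that by auto
  qed
  \<comment> \<open>An annihilating polynomial expresses some \<open>x m\<close> through the earlier
    vectors, so the spans stop growing.\<close>
  have "\<exists>m. x m \<in> S m"
  proof -
    obtain p where p: "p \<noteq> 0" "papp p (\<rho> z) w = 0" using annihilating_poly_at by blast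
    define d where "d = degree p"
    have "(\<Sum>i\<le>d. cscale (coeff p i) (x i)) = 0" using p(2) by (simp add: papp_def d_def x_def)
    then have "cscale (coeff p d) (x d) = - (\<Sum>i<d. cscale (coeff p i) (x i))"
      by (simp add: lessThan_Suc_atMost[symmetric] add_eq_0_iff)
    also have "\<dots> \<in> S d"
      using xin subS by (intro cmat.subspace_neg cmat.subspace_sum cmat.subspace_scale) auto
    finally have "cscale (inverse (coeff p d)) (cscale (coeff p d) (x d)) \<in> S d"
      by (rule cmat.subspace_scale[OF subS])
    then show ?thesis using p(1) by (auto simp: d_def)
  qed
  \<comment> \<open>At the first such \<open>m\<close>, \<open>B\<close> puts the difference of
    \<open>k\<close> and its weight on \<open>x m\<close> into \<open>S (m - 1)\<close>. Comparison
    with \<open>A\<close> leaves a multiple of \<open>x (m - 1)\<close>, which lies outside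
    \<open>S (m - 1)\<close>.\<close>
  then obtain m where m: "x m \<in> S m" "\<And>j. j < m \<Longrightarrow> x j \<notin> S j"
    using exists_least_iff[of "\<lambda>m. x m \<in> S m"] by blast
  have "m \<noteq> 0" using m(1) w(1) S0 x0 by (cases m) auto
  have "cscale (of_nat m * \<kappa> (lie_bracket k z)) (x (m - 1)) \<in> S (m - 1)"
    using cmat.subspace_diff[OF subS B[OF m(1)] A[OF k, of m]] by simp
  then show ?thesis
  proof (rule contrapos_pp)
    assume "\<kappa> (lie_bracket k z) \<noteq> 0"
    then have c: "of_nat m * \<kappa> (lie_bracket k z) \<noteq> 0" (is "?c \<noteq> 0") using \<open>m \<noteq> 0\<close> by simp
    show "cscale ?c (x (m - 1)) \<notin> S (m - 1)"
    proof
      assume "cscale ?c (x (m - 1)) \<in> S (m - 1)"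
      then have "cscale (inverse ?c) (cscale ?c (x (m - 1))) \<in> S (m - 1)" by (rule cmat.subspace_scale[OF subS])
      then show False using m(2)[of "m - 1"] \<open>m \<noteq> 0\<close>
        by (simp only: cmat.scale_scale left_inverse[OF c] cmat.scale_one)
    qed
  qed
qed

text \<open>Lie's theorem for the quotient of two stable subspaces, \<open>V\<close> modulo
  \<open>U\<close>. This relative form yields both an invariant flag and, later, a vector by which a
  solvable subalgebra is enlarged by one dimension.\<close>

theorem lie_common_eigenvector:
  fixes L :: "(complex^'n^'n) set" and \<rho> :: "complex^'n^'n \<Rightarrow> complex^'p^'q \<Rightarrow> complex^'p^'q"
  assumes "lie_subalgebra L UNIV" "lie_solvable L" "lie_rep L \<rho>"
    and V: "cmat.subspace V" "\<And>l v. l \<in> L \<Longrightarrow> v \<in> V \<Longrightarrow> \<rho> l v \<in> V"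
    and U: "cmat.subspace U" "\<And>l u. l \<in> L \<Longrightarrow> u \<in> U \<Longrightarrow> \<rho> l u \<in> U"
    and "\<exists>v\<in>V. v \<notin> U"
  shows "\<exists>v \<kappa>. v \<in> V \<and> v \<notin> U \<and> (\<forall>l\<in>L. \<rho> l v - cscale (\<kappa> l) v \<in> U)"
  using assms(1,2,3) V(2) U(2)
proof (induction "cmat.dim L" arbitrary: L rule: less_induct)
  case less
  note L = lie_subalgebraD[OF less.prems(1)]
  note rep = less.prems(3)
  show ?case
  proof (cases "L = {0}")
    case True
    obtain v where "v \<in> V" "v \<notin> U" using assms(8) by blast
    moreover have "\<rho> 0 v = 0" using lie_repD(3)[OF rep, of 0 0 v] True by simp
    ultimately show ?thesis using True cmat.subspace_0[OF U(1)]
      by (intro exI[of _ v] exI[of _ "\<lambda>_. 0"]) auto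
  next
    case False
    have sub: "lie_comm L L \<subseteq> L" using L by (intro lie_comm_subset) auto
    have "lie_comm L L \<noteq> L"
    proof
      assume "lie_comm L L = L"
      then have "derived k L = L" for k by (induction k) auto
      then show False using less.prems(2) False by (auto simp: lie_solvable_def)
    qed
    with sub have "lie_comm L L \<subset> L" by simp
    \<comment> \<open>A hyperplane containing the derived algebra is automatically an ideal.\<close>
    from hyperplane_between[OF subspace_lie_comm L(1) this]
    obtain K z where K: "cmat.subspace K" "lie_comm L L \<subseteq> K" "z \<in> L" "z \<notin> K"
      and Lz: "L = {k + cscale c z |k c. k \<in> K}"
      by (elim exE conjE)
    have KL: "K \<subseteq> L"
    proof
      fix k assume "k \<in> K"
      then show "k \<in> L" unfolding Lz by (intro CollectI exI[of _ k] exI[of _ 0]) simp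
    qed
    have br: "lie_bracket a b \<in> K" if "a \<in> L" "b \<in> L" for a b
      using K(2) lie_comm_base[OF that] by auto
    have "cmat.dim K < cmat.dim L"
      using K L KL by (intro cmatf.dim_psubset) (auto simp: cmat.span_eq_iff[THEN iffD2])
    moreover have "lie_subalgebra K UNIV" using K(1) br KL by (auto simp: lie_subalgebra_def)
    moreover have "lie_solvable K"
      using lie_solvable_subset[OF less.prems(2) KL] K(1) cmat.subspace_0 by blast
    moreover have "lie_rep K \<rho>" using lie_rep_subset[OF rep KL] .
    ultimately have "\<exists>v \<kappa>. v \<in> V \<and> v \<notin> U \<and> (\<forall>l\<in>K. \<rho> l v - cscale (\<kappa> l) v \<in> U)"
      using less.prems(4,5) KL by (intro less.hyps) auto
    then obtain v0 \<kappa> where v0: "v0 \<in> V" "v0 \<notin> U" "\<And>k. k \<in> K \<Longrightarrow> \<rho> k v0 - cscale (\<kappa> k) v0 \<in> U"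
      by auto
    have \<kappa>0: "\<kappa> (lie_bracket k z) = 0" if "k \<in> K" for k
      by (rule lie_weight_invariance[OF rep KL K(3) _ U(1) less.prems(5) v0(2,3) that])
        (use br KL K(3) in auto)
    \<comment> \<open>The weight space of \<open>K\<close> modulo \<open>U\<close>. By
      \<open>\<kappa>0\<close> it is stable under \<open>z\<close>, and an eigenvector of
      \<open>z\<close> in it is one for all of \<open>L\<close>.\<close>
    define W where "W = {v \<in> V. \<forall>k\<in>K. \<rho> k v - cscale (\<kappa> k) v \<in> U}"
    have lin: "clin (\<rho> l)" if "l \<in> L" for l using lie_repD(1)[OF rep that] .
    have subW: "cmat.subspace W"
    proof -
      have "W = V \<inter> (\<Inter>k\<in>K. {v. \<rho> k v - cscale (\<kappa> k) v \<in> U})" by (auto simp: W_def)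
      moreover have "cmat.subspace {v. \<rho> k v - cscale (\<kappa> k) v \<in> U}" if "k \<in> K" for k
      proof -
        have "clin (\<rho> k)" using lin KL that by blast
        from subspace_clin_preimage[OF clin_minus_scale[OF this] U(1)] show ?thesis .
      qed
      ultimately show ?thesis by (simp only:) (intro cmat.subspace_inter V(1) cmat.subspace_Int)
    qed
    have zW: "\<rho> z v \<in> W" if "v \<in> W" for v
    proof -
      have "\<rho> k (\<rho> z v) - cscale (\<kappa> k) (\<rho> z v) \<in> U" if k: "k \<in> K" for k
      proof -
        let ?a = "\<rho> k v - cscale (\<kappa> k) v"
        have "?a \<in> U" using \<open>v \<in> W\<close> k by (auto simp: W_def)
        then have "\<rho> z ?a \<in> U" using less.prems(5) K(3) by blast
        moreover have "\<rho> (lie_bracket k z) v \<in> U"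
          using \<open>v \<in> W\<close> \<kappa>0[OF k] br[of k z] k KL K(3) by (auto simp: W_def dest!: bspec[of _ _ "lie_bracket k z"])
        moreover have "\<rho> k (\<rho> z v) = \<rho> z (\<rho> k v) + \<rho> (lie_bracket k z) v"
          using lie_repD(4)[OF rep _ K(3)] k KL by (simp add: subsetD)
        then have "\<rho> k (\<rho> z v) - cscale (\<kappa> k) (\<rho> z v) = \<rho> z ?a + \<rho> (lie_bracket k z) v"
          by (simp add: clin_diff[OF lin[OF K(3)]] clin_scale[OF lin[OF K(3)]])
        ultimately show ?thesis using cmat.subspace_add[OF U(1)] by simp
      qed
      then show ?thesis using that less.prems(4)[OF K(3)] by (auto simp: W_def)
    qed
    have "v0 \<in> W" using v0 by (auto simp: W_def)
    then obtain v c where v: "v \<in> W" "v \<notin> U" "\<rho> z v - cscale c v \<in> U"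
      using eigenvector_mod_subspace[OF lin[OF K(3)] subW zW U(1) _ v0(2)] by blast
    have "\<forall>l\<in>L. \<exists>a. \<rho> l v - cscale a v \<in> U"
    proof
      fix l assume "l \<in> L"
      then obtain k b where l: "l = k + cscale b z" "k \<in> K" using Lz by blast
      have "cscale b z \<in> L" using L(1) K(3) by (simp add: cmat.subspace_scale)
      then have "\<rho> l v = \<rho> k v + cscale b (\<rho> z v)"
        using lie_repD(2,3)[OF rep] l KL K(3) by (simp add: subsetD)
      then have "\<rho> l v - cscale (\<kappa> k + b * c) v = (\<rho> k v - cscale (\<kappa> k) v) + cscale b (\<rho> z v - cscale c v)"
        by (simp add: cmat.scale_left_distrib cmat.scale_right_diff_distrib algebra_simps)
      moreover have "\<dots> \<in> U" using v l(2) U(1) by (auto simp: W_def intro!: cmat.subspace_add cmat.subspace_scale)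
      ultimately show "\<exists>a. \<rho> l v - cscale a v \<in> U" by metis
    qed
    then obtain \<kappa>' where "\<forall>l\<in>L. \<rho> l v - cscale (\<kappa>' l) v \<in> U" by metis
    then show ?thesis using v by (auto simp: W_def)
  qed
qed

section \<open>Simultaneous triangularisation\<close>

definition mpow :: "complex^'n^'n \<Rightarrow> nat \<Rightarrow> complex^'n^'n" where
  "mpow u k = ((**) u ^^ k) (mat 1)"

definition mnilpotent :: "complex^'n^'n \<Rightarrow> bool" where
  "mnilpotent u \<longleftrightarrow> (\<exists>k. mpow u k = 0)"

lemma mpow_0 [simp]: "mpow u 0 = mat 1" and mpow_Suc: "mpow u (Suc k) = u ** mpow u k"
  by (simp_all add: mpow_def)

lemma mpow_add: "mpow u (i + j) = mpow u i ** mpow u j"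
  by (induction i) (simp_all add: mpow_Suc matrix_mul_assoc)

lemma mpow_Suc2: "mpow u (Suc k) = mpow u k ** u"
  using mpow_add[of u k 1] by (simp add: mpow_Suc)

lemma inj_munit: "inj (\<lambda>p. munit (fst p) (snd p) :: complex^'n^'m)"
proof (rule injI)
  fix p q :: "'m \<times> 'n" assume "munit (fst p) (snd p) = (munit (fst q) (snd q) :: complex^'n^'m)" (is "?m p = ?m q")
  then have "?m p $ fst p $ snd p = ?m q $ fst p $ snd p" by simp
  then show "p = q" by (simp split: if_splits add: prod_eq_iff)
qed

lemma dim_matrices: "cmat.dim (UNIV :: (complex^'n^'m) set) = CARD('m) * CARD('n)"
  unfolding cmatf.dim_UNIV card_image[OF inj_munit] by simp

text \<open>The flag grows by applying Lie's theorem to the whole space modulo the span reached so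
  far.\<close>

lemma lie_flag:
  fixes B :: "(complex^'n^'n) set"
  assumes "lie_subalgebra B UNIV" "lie_solvable B" "m \<le> CARD('n)"
  shows "\<exists>v :: nat \<Rightarrow> complex^1^'n. inj_on v {..<m} \<and> cmat.independent (v ` {..<m}) \<and>
     (\<forall>i<m. \<forall>b\<in>B. b ** v i \<in> cmat.span (v ` {..i}))"
  using assms(3)
proof (induction m)
  case (Suc m)
  then obtain v :: "nat \<Rightarrow> complex^1^'n" where v: "inj_on v {..<m}" "cmat.independent (v ` {..<m})"
    "\<And>i b. i < m \<Longrightarrow> b \<in> B \<Longrightarrow> b ** v i \<in> cmat.span (v ` {..i})" by auto
  let ?U = "cmat.span (v ` {..<m})"
  have "?U \<noteq> UNIV"
  proof
    assume "?U = UNIV"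
    then have "cmat.dim (UNIV :: (complex^1^'n) set) \<le> card (v ` {..<m})"
      by (intro cmat.dim_le_card) auto
    also have "\<dots> \<le> m" using card_image_le[of "{..<m}" v] by simp
    finally show False using Suc.prems by (simp add: dim_matrices del: cmatf.dim_UNIV)
  qed
  have rep: "lie_rep B (\<lambda>b v. b ** v :: complex^1^'n)"
    by (simp add: lie_rep_def clin_mult_left matrix_ring lie_bracket_def)
  have stable: "b ** u \<in> ?U" if "b \<in> B" "u \<in> ?U" for b u
  proof -
    have "?U \<subseteq> {u. b ** u \<in> ?U}"
    proof (rule cmat.span_minimal)
      show "cmat.subspace {u. b ** u \<in> ?U}"
        by (auto simp: cmat.subspace_def matrix_ring intro: cmat.span_add cmat.span_scale cmat.span_zero)
      show "v ` {..<m} \<subseteq> {u. b ** u \<in> ?U}"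
      proof clarify
        fix i assume "i < m"
        moreover have "cmat.span (v ` {..i}) \<subseteq> ?U" using \<open>i < m\<close> by (intro cmat.span_mono) auto
        ultimately show "b ** v i \<in> ?U" using v(3)[of i b] that by auto
      qed
    qed
    then show ?thesis using that by auto
  qed
  from \<open>?U \<noteq> UNIV\<close> have "\<exists>v\<in>UNIV. v \<notin> ?U" by auto
  then have "\<exists>w \<kappa>. w \<in> UNIV \<and> w \<notin> ?U \<and> (\<forall>b\<in>B. b ** w - cscale (\<kappa> b) w \<in> ?U)"
    by (intro lie_common_eigenvector[OF assms(1,2) rep cmat.subspace_UNIV _ cmat.subspace_span stable])
      simp_all
  then obtain w \<kappa> where w: "w \<notin> ?U" "\<And>b. b \<in> B \<Longrightarrow> b ** w - cscale (\<kappa> b) w \<in> ?U"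
    by auto
  define v' where "v' = v(m := w)"
  have im: "v' ` {..<i} = v ` {..<i}" if "i \<le> m" for i using that by (auto simp: v'_def)
  have im2: "v' ` {..<Suc m} = insert w (v ` {..<m})" using im[of m] by (auto simp: v'_def lessThan_Suc)
  have "inj_on v' {..<Suc m}"
  proof -
    have "w \<notin> v ` {..<m}" using w(1) cmat.span_base[of w "v ` {..<m}"] by auto
    moreover have "inj_on v' {..<m}" using v(1) by (simp add: v'_def inj_on_def)
    ultimately show ?thesis using im[of m] by (auto simp: lessThan_Suc v'_def)
  qed
  moreover have "cmat.independent (v' ` {..<Suc m})"
    unfolding im2 using w(1) v(2) by (simp add: cmat.independent_insertI)
  moreover have "b ** v' i \<in> cmat.span (v' ` {..i})" if "i < Suc m" "b \<in> B" for i b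
  proof (cases "i = m")
    case True
    have "v' ` {..i} = insert w (v ` {..<m})" using im2 True by (simp add: lessThan_Suc_atMost)
    moreover have "b ** w \<in> cmat.span (insert w (v ` {..<m}))"
      using w(2)[OF that(2)] by (auto simp: cmat.span_breakdown_eq)
    ultimately show ?thesis using True by (simp add: v'_def)
  next
    case False
    then have "v' i = v i" "v' ` {..i} = v ` {..i}" using that by (auto simp: v'_def)
    then show ?thesis using v(3) that False by auto
  qed
  ultimately show ?case by blast
qed (simp add: cmat.independent_empty)

text \<open>\<open>idx\<close> orders the index type. A nonzero entry of the k-th power must raise
  \<open>idx\<close> by at least \<open>k\<close>, which is impossible once \<open>k\<close> reaches
  \<open>n\<close>.\<close>

lemma upper_triangular_power_zero:
  fixes M :: "complex^'n^'n" and idx :: "'n \<Rightarrow> nat"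
  assumes "\<And>i j. idx j \<le> idx i \<Longrightarrow> M $ i $ j = 0" "\<And>i. idx i < n"
  shows "mpow M n = 0"
proof -
  have "mpow M k $ i $ j = 0" if "idx j < idx i + k" for k i j
    using that
  proof (induction k arbitrary: i j)
    case (Suc k)
    have "M $ i $ l * mpow M k $ l $ j = 0" for l
      using assms(1)[of l i] Suc.IH[of j l] Suc.prems by (cases "idx l \<le> idx i") auto
    then show ?case by (simp add: mpow_Suc matrix_matrix_mult_def sum.neutral)
  qed (auto simp: mat_def)
  then show ?thesis using assms(2) by (auto intro!: matrix_eqI simp: trans_less_add2)
qed

text \<open>\<open>\<T>\<close> is the algebra of matrices that are upper triangular in the flag
  basis, and \<open>\<kappa> k\<close> is the k-th diagonal entry in that basis. Later arguments see
  only these properties: the diagonal is multiplicative, its sum is the trace, and its vanishing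
  implies nilpotency.\<close>

lemma lie_triangularisation:
  fixes B :: "(complex^'n^'n) set"
  assumes "lie_subalgebra B UNIV" "lie_solvable B"
  obtains \<T> :: "(complex^'n^'n) set" and \<kappa> :: "'n \<Rightarrow> complex^'n^'n \<Rightarrow> complex" where
    "B \<subseteq> \<T>" "cmat.subspace \<T>" "mat 1 \<in> \<T>" "\<And>x y. x \<in> \<T> \<Longrightarrow> y \<in> \<T> \<Longrightarrow> x ** y \<in> \<T>"
    "\<And>k x y. x \<in> \<T> \<Longrightarrow> y \<in> \<T> \<Longrightarrow> \<kappa> k (x ** y) = \<kappa> k x * \<kappa> k y"
    "\<And>k x y. \<kappa> k (x + y) = \<kappa> k x + \<kappa> k y" "\<And>k c x. \<kappa> k (cscale c x) = c * \<kappa> k x"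
    "\<And>k. \<kappa> k (mat 1) = 1" "\<And>x. trace x = (\<Sum>k\<in>UNIV. \<kappa> k x)"
    "\<And>x. x \<in> \<T> \<Longrightarrow> (\<And>k. \<kappa> k x = 0) \<Longrightarrow> mnilpotent x"
proof -
  let ?n = "CARD('n)"
  obtain v :: "nat \<Rightarrow> complex^1^'n" where v: "inj_on v {..<?n}" "cmat.independent (v ` {..<?n})"
    "\<And>i b. i < ?n \<Longrightarrow> b \<in> B \<Longrightarrow> b ** v i \<in> cmat.span (v ` {..i})"
    using lie_flag[OF assms order_refl] by auto
  obtain idx :: "'n \<Rightarrow> nat" where idx: "bij_betw idx UNIV {..<?n}"
    using ex_bij_betw_finite_nat[of "UNIV :: 'n set"] by (auto simp: atLeast0LessThan)
  have idx_less: "idx i < ?n" for i using idx by (auto simp: bij_betw_def)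
  have idx_inj: "idx i = idx j \<longleftrightarrow> i = j" for i j using idx by (auto simp: bij_betw_def inj_def)
  \<comment> \<open>The columns of \<open>P\<close> are the flag vectors, so that \<open>C\<close>
    below is the passage to the flag basis.\<close>
  define P :: "complex^'n^'n" where "P = (\<chi> i j. v (idx j) $ i $ 1)"
  have spanU: "cmat.span (v ` {..<?n}) = UNIV"
  proof -
    have "(UNIV :: (complex^1^'n) set) \<subseteq> cmat.span (v ` {..<?n})"
      by (rule cmatf.card_ge_dim_independent) (use v in \<open>auto simp: dim_matrices card_image simp del: cmatf.dim_UNIV\<close>)
    then show ?thesis by auto
  qed
  have "surj (\<lambda>x. P *v x)"
  proof (rule surjI[of _ "\<lambda>x. SOME w. P *v w = x"])
    fix x :: "complex^'n"
    have "(\<chi> i j. x $ i) \<in> cmat.span (v ` {..<?n})" by (simp add: spanU)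
    then obtain u where u: "(\<chi> i j. x $ i) = (\<Sum>w\<in>v ` {..<?n}. cscale (u w) w)"
      by (auto simp: cmat.span_finite)
    also have "\<dots> = (\<Sum>j\<in>UNIV. cscale (u (v (idx j))) (v (idx j)))"
    proof -
      have "bij_betw (v \<circ> idx) UNIV (v ` {..<?n})"
        using idx v(1) by (intro bij_betw_trans[OF idx]) (simp add: bij_betw_def)
      then show ?thesis by (simp add: sum.reindex_bij_betw[symmetric, of "v \<circ> idx"])
    qed
    finally have "x $ i = (\<Sum>j\<in>UNIV. u (v (idx j)) * v (idx j) $ i $ 1)" for i
      by (auto simp: vec_eq_iff sum_component)
    then have "P *v (\<chi> j. u (v (idx j))) = x"
      by (simp add: vec_eq_iff matrix_vector_mult_def P_def mult.commute)
    then show "P *v (SOME w. P *v w = x) = x" by (rule someI)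
  qed
  then obtain Q where PQ: "P ** Q = mat 1" using matrix_right_invertible_surjective by blast
  then have QP: "Q ** P = mat 1" by (simp add: matrix_left_right_inverse)
  define C where "C m = Q ** m ** P" for m
  have Cmult: "C (x ** y) = C x ** C y" for x y
    by (simp add: C_def) (metis PQ matrix_mul_assoc matrix_mul_rid)
  have Cadd: "C (x + y) = C x + C y" and Cscale: "C (cscale c x) = cscale c (C x)" for x y c
    by (simp_all add: C_def matrix_ring)
  have C1: "C (mat 1) = mat 1" by (simp add: C_def QP)
  define \<T> where "\<T> = {m. \<forall>i j. idx j < idx i \<longrightarrow> C m $ i $ j = 0}"
  define X where "X k m = C m $ k $ k" for k m
  have diag: "C x $ k $ l * C y $ l $ j = (if l = k then C x $ k $ k * C y $ k $ k else 0)"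
    if "x \<in> \<T>" "y \<in> \<T>" "j = k" for x y k l j
  proof (cases "l = k")
    case False
    then have "idx l \<noteq> idx k" using idx_inj by auto
    then show ?thesis using that False by (cases "idx l < idx k") (auto simp: \<T>_def)
  qed (use that in auto)
  show thesis
  proof (rule that[of \<T> X])
    show "B \<subseteq> \<T>"
    proof
      fix b assume b: "b \<in> B"
      have "C b $ i $ j = 0" if "idx j < idx i" for i j
      proof -
        have Qv: "(Q ** v (idx l)) $ i $ 1 = (Q ** P) $ i $ l" for l
          by (simp add: matrix_matrix_mult_def P_def)
        have "cmat.span (v ` {..idx j}) \<subseteq> {w. (Q ** w) $ i $ 1 = 0}"
        proof (rule cmat.span_minimal)
          show "cmat.subspace {w. (Q ** w) $ i $ 1 = 0}" by (auto simp: cmat.subspace_def matrix_ring)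
          show "v ` {..idx j} \<subseteq> {w. (Q ** w) $ i $ 1 = 0}"
          proof clarify
            fix l assume l: "l \<le> idx j"
            then have "l \<in> {..<?n}" using idx_less[of j] by simp
            then obtain l' where "l = idx l'" using idx by (auto simp: bij_betw_def)
            moreover have "l' \<noteq> i" using that l \<open>l = idx l'\<close> by auto
            ultimately show "(Q ** v l) $ i $ 1 = 0" by (simp only: Qv QP) (simp add: mat_def)
          qed
        qed
        then have "(Q ** (b ** v (idx j))) $ i $ 1 = 0" using v(3)[OF idx_less b] by blast
        moreover have "(Q ** (b ** v (idx j))) $ i $ 1 = C b $ i $ j"
          by (simp add: C_def matrix_mul_assoc) (simp add: matrix_matrix_mult_def P_def)
        ultimately show ?thesis by simp
      qed
      then show "b \<in> \<T>" by (simp add: \<T>_def)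
    qed
    show "cmat.subspace \<T>" by (auto simp: cmat.subspace_def \<T>_def Cadd Cscale) (simp add: C_def)
    show "mat 1 \<in> \<T>" unfolding \<T>_def by (auto simp: C1) (auto simp: mat_def)
    show "x ** y \<in> \<T>" if "x \<in> \<T>" "y \<in> \<T>" for x y
    proof -
      have "C (x ** y) $ i $ j = 0" if ij: "idx j < idx i" for i j
      proof -
        have "C x $ i $ l * C y $ l $ j = 0" for l
          using \<open>x \<in> \<T>\<close> \<open>y \<in> \<T>\<close> ij by (cases "idx l < idx i") (auto simp: \<T>_def)
        then have "(C x ** C y) $ i $ j = 0" by (simp add: matrix_matrix_mult_def sum.neutral)
        then show ?thesis by (simp only: Cmult)
      qed
      then show ?thesis unfolding \<T>_def by simp
    qed
    show "X k (x ** y) = X k x * X k y" if "x \<in> \<T>" "y \<in> \<T>" for k x y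
    proof -
      have "(C x ** C y) $ k $ k = (\<Sum>l\<in>UNIV. if l = k then C x $ k $ k * C y $ k $ k else 0)"
        unfolding matrix_matrix_mult_def vec_lambda_beta by (rule sum.cong[OF refl diag[OF that refl]])
      then show ?thesis by (simp add: X_def Cmult)
    qed
    show "X k (x + y) = X k x + X k y" "X k (cscale c x) = c * X k x" "X k (mat 1) = 1" for k x y c
      by (simp_all add: X_def Cadd Cscale C1) (simp add: mat_def)
    show "trace x = (\<Sum>k\<in>UNIV. X k x)" for x
    proof -
      have "(\<Sum>k\<in>UNIV. X k x) = trace (Q ** (x ** P))" by (simp add: X_def trace_def C_def matrix_mul_assoc)
      also have "\<dots> = trace (x ** P ** Q)" by (rule trace_mul_sym)
      finally show ?thesis by (simp add: PQ flip: matrix_mul_assoc)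
    qed
    show "mnilpotent x" if x: "x \<in> \<T>" "\<And>k. X k x = 0" for x
    proof -
      have "mpow (C x) ?n = 0"
      proof (rule upper_triangular_power_zero[of idx, OF _ idx_less])
        fix i j assume "idx j \<le> idx i"
        then have "i = j \<or> idx j < idx i" using idx_inj[of i j] by linarith
        then show "C x $ i $ j = 0" using x by (auto simp: \<T>_def X_def)
      qed
      moreover have "mpow (C x) k = C (mpow x k)" for k
        by (induction k) (simp_all add: mpow_Suc C1 Cmult)
      ultimately have "P ** (Q ** mpow x ?n ** P) ** Q = 0" by (simp add: C_def)
      moreover have "P ** (Q ** mpow x ?n ** P) ** Q = P ** Q ** mpow x ?n ** (P ** Q)"
        by (simp only: matrix_mul_assoc)
      ultimately show ?thesis unfolding mnilpotent_def using PQ by auto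
    qed
  qed
qed

section \<open>Replicas of matrices\<close>

lemma matrix_mult_sum: "A ** sum g S = (\<Sum>a\<in>S. A ** (g a :: complex^'n^'n))"
  by (rule clin_sum[OF clin_mult_left])

lemma sum_mult_matrix: "sum g S ** A = (\<Sum>a\<in>S. g a ** (A :: complex^'n^'n))"
  using clin_sum[OF clin_mult_right[of A], of g S] by simp

section \<open>Polynomial congruences and polynomials in a matrix\<close>

lemma coprime_linear_powers:
  fixes \<nu> \<mu> :: complex
  assumes "\<nu> \<noteq> \<mu>" shows "coprime ([:- \<nu>, 1:] ^ i) ([:- \<mu>, 1:] ^ j)"
proof -
  have "coprime [:- \<nu>, 1:] [:- \<mu>, 1:]"
  proof (rule coprimeI)
    fix c assume "c dvd [:- \<nu>, 1:]" "c dvd [:- \<mu>, 1:]"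
    then have "c dvd [:- \<nu>, 1:] - [:- \<mu>, 1:]" by (rule dvd_diff)
    then have "c dvd [:\<mu> - \<nu>:]" by simp
    moreover have "is_unit [:\<mu> - \<nu>:]" using assms by (simp add: is_unit_const_poly_iff dvd_field_iff)
    ultimately show "is_unit c" using dvd_trans by blast
  qed
  then show ?thesis by simp
qed

lemma coprime_prod_linear_powers:
  fixes \<mu> :: complex
  assumes "finite \<Lambda>" "\<mu> \<notin> \<Lambda>"
  shows "coprime (\<Prod>\<nu>\<in>\<Lambda>. [:- \<nu>, 1:] ^ K) ([:- \<mu>, 1:] ^ K)"
  by (rule prod_coprime_left, rule coprime_linear_powers) (use assms in auto)

lemma prod_linear_powers_dvd:
  fixes q :: "complex poly"
  assumes "finite \<Lambda>" "\<And>\<nu>. \<nu> \<in> \<Lambda> \<Longrightarrow> [:- \<nu>, 1:] ^ K dvd q"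
  shows "(\<Prod>\<nu>\<in>\<Lambda>. [:- \<nu>, 1:] ^ K) dvd q"
  using assms
proof (induction rule: finite_induct)
  case (insert \<mu> \<Lambda>)
  have "coprime ([:- \<mu>, 1:] ^ K) (\<Prod>\<nu>\<in>\<Lambda>. [:- \<nu>, 1:] ^ K)"
    using coprime_prod_linear_powers[OF insert(1,2), of K] by (simp add: coprime_commute)
  moreover have "[:- \<mu>, 1:] ^ K dvd q" "(\<Prod>\<nu>\<in>\<Lambda>. [:- \<nu>, 1:] ^ K) dvd q"
    using insert by auto
  ultimately show ?case using insert(1,2) by (simp add: divides_mult)
qed simp

text \<open>The Chinese remainder theorem with constant residues and one exponent \<open>K\<close>
  for all points, which are added one at a time.\<close>

lemma complex_crt:
  fixes f :: "complex \<Rightarrow> complex"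
  assumes "finite \<Lambda>"
  shows "\<exists>h. \<forall>c\<in>\<Lambda>. [:- c, 1:] ^ K dvd h - [:f c:]"
  using assms
proof (induction rule: finite_induct)
  case (insert \<mu> \<Lambda>)
  then obtain h where h: "\<And>c. c \<in> \<Lambda> \<Longrightarrow> [:- c, 1:] ^ K dvd h - [:f c:]" by auto
  define A where "A = (\<Prod>\<nu>\<in>\<Lambda>. [:- \<nu>, 1:] ^ K)"
  define B where "B = [:- \<mu>, 1:] ^ K"
  have "coprime A B" unfolding A_def B_def by (rule coprime_prod_linear_powers[OF insert(1,2)])
  then obtain s t where st: "s * A + t * B = 1"
    using bezout_coefficients_fst_snd[of A B] by (metis coprime_iff_gcd_eq_1)
  \<comment> \<open>By Bezout \<open>s * A\<close> is 0 modulo the old factors and 1 modulo the new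
    one, so the correction changes only the residue at \<mu>.\<close>
  let ?h = "h + s * A * ([:f \<mu>:] - h)"
  have "[:- c, 1:] ^ K dvd ?h - [:f c:]" if "c \<in> \<Lambda>" for c
  proof -
    have "[:- c, 1:] ^ K dvd A" unfolding A_def using insert(1) that by (rule dvd_prodI)
    then have "[:- c, 1:] ^ K dvd (h - [:f c:]) + s * A * ([:f \<mu>:] - h)"
      using h[OF that] by (intro dvd_add) (auto intro: dvd_mult dvd_mult2)
    then show ?thesis by (simp add: algebra_simps)
  qed
  moreover have "?h - [:f \<mu>:] = B * (t * (h - [:f \<mu>:]))"
  proof -
    have "?h - [:f \<mu>:] = (1 - s * A) * (h - [:f \<mu>:])" by (simp add: algebra_simps)
    also have "1 - s * A = t * B" using st by (simp add: algebra_simps)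
    finally show ?thesis by (simp add: algebra_simps)
  qed
  then have "B dvd ?h - [:f \<mu>:]" by simp
  ultimately show ?case unfolding B_def by blast
qed simp

definition peval :: "complex^'n^'n \<Rightarrow> complex poly \<Rightarrow> complex^'n^'n" where
  "peval y p = papp p ((**) y) (mat 1)"

lemma papp_mult_left: "papp p ((**) y) v = peval y p ** v"
  unfolding peval_def
  by (induction p) (simp_all add: papp_pCons[OF clin_mult_left] matrix_ring)

lemma peval_pCons: "peval y (pCons a p) = cscale a (mat 1) + y ** peval y p"
  by (simp add: peval_def papp_pCons[OF clin_mult_left])

lemma peval_0 [simp]: "peval y 0 = 0" and peval_1 [simp]: "peval y 1 = mat 1"
  and peval_add: "peval y (p + q) = peval y p + peval y q"
  and peval_smult: "peval y (smult c p) = cscale c (peval y p)"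
  and peval_sum: "peval y (sum f S) = (\<Sum>a\<in>S. peval y (f a))"
  by (simp_all add: peval_def papp_add papp_smult papp_sum)

lemma peval_mult: "peval y (p * q) = peval y p ** peval y q"
proof -
  have "peval y (p * q) = papp p ((**) y) (papp q ((**) y) (mat 1))"
    by (simp only: peval_def papp_mult[OF clin_mult_left])
  then show ?thesis by (simp only: papp_mult_left matrix_mul_rid)
qed

lemma peval_diff: "peval y (p - q) = peval y p - peval y q"
  using peval_add[of y "p - q" q] by simp

lemma peval_const: "peval y [:c:] = cscale c (mat 1)"
  by (simp add: peval_pCons)

lemma peval_linear: "peval y [:- c, 1:] = y - cscale c (mat 1)"
  by (simp add: peval_pCons matrix_ring)

lemma peval_commute: "peval y p ** peval y q = peval y q ** peval y p"
  by (metis mult.commute peval_mult)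

lemma peval_X: "peval y [:0, 1:] = y"
  using peval_linear[of y 0] by simp

lemma peval_pow: "peval y (p ^ k) = mpow (peval y p) k"
  by (induction k) (simp_all add: peval_mult mpow_Suc)

text \<open>\<open>(L - R)\<^sup>k\<close> is a combination of the \<open>L\<^sup>i R\<^sup>j\<close> with \<open>i + j = k\<close>, for the commuting operators
  \<open>L\<close> (left multiplication by \<open>a\<close>) and \<open>R\<close> (right multiplication by \<open>b\<close>).\<close>

lemma left_minus_right_nilpotent:
  assumes "mpow a N ** m = 0" "m ** mpow b N = 0" "2 * N \<le> K"
  shows "((\<lambda>z. a ** z - z ** b) ^^ K) m = 0"
proof -
  let ?T = "\<lambda>z. a ** z - z ** b"
  define S where "S k = cmat.span {mpow a i ** m ** mpow b j |i j. i + j = k}" for k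
  have lin: "clin ?T" by (rule clinI) (simp_all add: matrix_ring)
  have base: "mpow a i ** m ** mpow b j \<in> S (i + j)" for i j
    unfolding S_def by (rule cmat.span_base) blast
  have step: "?T z \<in> S (Suc k)" if "z \<in> S k" for z k
  proof -
    have "S k \<subseteq> {z. ?T z \<in> S (Suc k)}" unfolding S_def[of k]
    proof (rule cmat.span_minimal)
      show "cmat.subspace {z. ?T z \<in> S (Suc k)}"
        by (rule subspace_clin_preimage[OF lin]) (simp add: S_def)
      show "{mpow a i ** m ** mpow b j |i j. i + j = k} \<subseteq> {z. ?T z \<in> S (Suc k)}"
      proof clarify
        fix i j assume k: "k = i + j"
        have "?T (mpow a i ** m ** mpow b j) = mpow a (Suc i) ** m ** mpow b j - mpow a i ** m ** mpow b (Suc j)"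
          by (simp add: mpow_Suc[of a] mpow_Suc2[of b] matrix_mul_assoc)
        also have "\<dots> \<in> S (Suc (i + j))"
          using base[of "Suc i" j] base[of i "Suc j"] by (simp add: S_def cmat.span_diff)
        finally show "?T (mpow a i ** m ** mpow b j) \<in> S (Suc (i + j))" .
      qed
    qed
    then show ?thesis using that by auto
  qed
  have "(?T ^^ k) m \<in> S k" for k
  proof (induction k)
    case 0
    have "mpow a 0 ** m ** mpow b 0 \<in> S 0" unfolding S_def by (rule cmat.span_base) blast
    then show ?case by simp
  qed (simp add: step)
  moreover have "S K \<subseteq> {0}" unfolding S_def
  proof (rule cmat.span_minimal)
    show "{mpow a i ** m ** mpow b j |i j. i + j = K} \<subseteq> {0}"
    proof clarify
      fix i j assume "K = i + j"
      with assms(3) have "N \<le> i \<or> N \<le> j" by linarith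
      then show "mpow a i ** m ** mpow b j = 0"
      proof
        assume "N \<le> i"
        then have "mpow a i ** m = mpow a (i - N) ** (mpow a N ** m)"
          using mpow_add[of a "i - N" N] by (simp add: matrix_mul_assoc)
        then show ?thesis using assms(1) by simp
      next
        assume "N \<le> j"
        then have "m ** mpow b j = (m ** mpow b N) ** mpow b (j - N)"
          using mpow_add[of b N "j - N"] by (simp add: matrix_mul_assoc)
        then show ?thesis using assms(2) by (simp flip: matrix_mul_assoc)
      qed
    qed
  qed simp
  ultimately show ?thesis by auto
qed

lemma mnilpotent_ad:
  assumes "mnilpotent u" obtains k where "\<And>m. (lie_bracket u ^^ k) m = 0"
proof -
  obtain N where "mpow u N = 0" using assms by (auto simp: mnilpotent_def)
  then have "(lie_bracket u ^^ (2 * N)) m = 0" for m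
    using left_minus_right_nilpotent[of u N m u "2 * N"] by (simp add: lie_bracket_def[abs_def])
  then show thesis using that by blast
qed

lemma ad_power_eigenvector: "lie_bracket x v = cscale c v \<Longrightarrow> (lie_bracket x ^^ k) v = cscale (c ^ k) v"
  by (induction k) (simp_all add: lie_bilinear mult.commute)

lemma mnilpotent_eigenvalue:
  assumes "mnilpotent x" "lie_bracket x v = cscale c v" "v \<noteq> 0" shows "c = 0"
proof -
  obtain k where "\<And>m. (lie_bracket x ^^ k) m = 0" using mnilpotent_ad[OF assms(1)] by blast
  then show ?thesis using ad_power_eigenvector[OF assms(2), of k] assms(3) by simp
qed

text \<open>The roots of an annihilating polynomial all receive the same exponent, one larger than
  its degree, so that a single exponent serves in the Chinese remainder theorem.\<close>

lemma matrix_spectrum: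
  fixes y :: "complex^'n^'n"
  obtains \<Lambda> N P where "finite \<Lambda>" "0 < N" "peval y P = 0" "P = (\<Prod>\<nu>\<in>\<Lambda>. [:- \<nu>, 1:] ^ N)"
proof -
  obtain p where p: "p \<noteq> 0" "peval y p = 0" unfolding peval_def using annihilating_poly_at by blast
  define \<Lambda> where "\<Lambda> = {z. poly p z = 0}"
  have fin: "finite \<Lambda>" unfolding \<Lambda>_def using p(1) by (rule poly_roots_finite)
  let ?N = "Suc (degree p)"
  have "(\<Prod>z\<in>\<Lambda>. [:- z, 1:] ^ order z p) dvd (\<Prod>z\<in>\<Lambda>. [:- z, 1:] ^ ?N)"
    by (rule prod_dvd_prod) (use order_degree[OF p(1)] in \<open>auto intro!: le_imp_power_dvd simp: le_Suc_eq simp del: power_Suc\<close>)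
  moreover have "p dvd (\<Prod>z\<in>\<Lambda>. [:- z, 1:] ^ order z p)"
    by (subst complex_poly_decompose[of p, symmetric]) (use p(1) in \<open>simp add: \<Lambda>_def smult_dvd_iff\<close>)
  ultimately obtain q where "(\<Prod>z\<in>\<Lambda>. [:- z, 1:] ^ ?N) = p * q" using dvd_trans by blast
  then have "peval y (\<Prod>z\<in>\<Lambda>. [:- z, 1:] ^ ?N) = 0" using p(2) by (simp add: peval_mult)
  then show thesis using that fin by blast
qed

text \<open>The matrix \<open>s\<close> is the semisimple part of \<open>y\<close> with conjugated
  eigenvalues, obtained as a polynomial in \<open>y\<close>: the device of Cartan's criterion.
  Conjugation turns the trace of \<open>y ** s\<close> into a sum of squared moduli, so that it
  vanishes only for nilpotent \<open>y\<close>. Moreover ad s is a polynomial in ad y without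
  constant term, so that inclusions [y,M] \<subseteq> N pass to \<open>s\<close>.\<close>

lemma matrix_replica:
  fixes y :: "complex^'n^'n"
  obtains s where
    "\<And>M N m. cmat.subspace M \<Longrightarrow> cmat.subspace N \<Longrightarrow> N \<subseteq> M \<Longrightarrow> (\<And>m. m \<in> M \<Longrightarrow> lie_bracket y m \<in> N) \<Longrightarrow>
        m \<in> M \<Longrightarrow> lie_bracket s m \<in> N"
    "\<And>k m. (lie_bracket y ^^ k) m = 0 \<Longrightarrow> lie_bracket s m = 0"
    "trace (y ** s) = 0 \<Longrightarrow> mnilpotent y"
proof -
  obtain \<Lambda> N P where sp: "finite \<Lambda>" "0 < N" "peval y P = 0" "P = (\<Prod>\<nu>\<in>\<Lambda>. [:- \<nu>, 1:] ^ N)"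
    by (rule matrix_spectrum)
  have zero: "peval y q = 0" if "\<And>\<nu>. \<nu> \<in> \<Lambda> \<Longrightarrow> [:- \<nu>, 1:] ^ N dvd q" for q
  proof -
    have "P dvd q" unfolding sp(4) using sp(1) that by (rule prod_linear_powers_dvd)
    then show ?thesis using sp(3) by (auto simp: peval_mult elim!: dvdE)
  qed
  obtain h where h: "\<And>c. c \<in> \<Lambda> \<Longrightarrow> [:- c, 1:] ^ N dvd h - [:cnj c:]"
    using complex_crt[OF sp(1), of N cnj] by blast
  \<comment> \<open>The polynomials \<open>e \<nu>\<close> evaluate to the projections
    \<open>E \<nu>\<close> onto the generalised eigenspaces of \<open>y\<close>.\<close>
  have "\<exists>e. \<forall>c\<in>\<Lambda>. [:- c, 1:] ^ N dvd e - [:if c = \<nu> then 1 else 0:]" for \<nu>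
    by (rule complex_crt[OF sp(1)])
  then obtain e where e: "\<And>\<nu> c. c \<in> \<Lambda> \<Longrightarrow> [:- c, 1:] ^ N dvd e \<nu> - [:if c = \<nu> then 1 else 0:]"
    by metis
  define s where "s = peval y h"
  define E where "E \<nu> = peval y (e \<nu>)" for \<nu>
  have e_dvd: "[:- c, 1:] ^ N dvd e \<nu>" if "c \<in> \<Lambda>" "c \<noteq> \<nu>" for c \<nu>
    using e[OF that(1), of \<nu>] that by simp
  have sumE: "(\<Sum>\<nu>\<in>\<Lambda>. E \<nu>) = mat 1"
  proof -
    have "peval y ((\<Sum>\<nu>\<in>\<Lambda>. e \<nu>) - 1) = 0"
    proof (rule zero)
      fix c assume c: "c \<in> \<Lambda>"
      have "(\<Sum>\<nu>\<in>\<Lambda>. e \<nu>) - 1 = (e c - 1) + (\<Sum>\<nu>\<in>\<Lambda> - {c}. e \<nu>)"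
        using c sp(1) by (simp add: sum.remove)
      moreover have "[:- c, 1:] ^ N dvd e c - 1" using e[OF c, of c] by (simp add: one_pCons)
      moreover have "[:- c, 1:] ^ N dvd (\<Sum>\<nu>\<in>\<Lambda> - {c}. e \<nu>)" using e_dvd c by (intro dvd_sum) auto
      ultimately show "[:- c, 1:] ^ N dvd (\<Sum>\<nu>\<in>\<Lambda>. e \<nu>) - 1" by (metis dvd_add)
    qed
    then show ?thesis by (simp add: peval_diff peval_sum E_def)
  qed
  have sE: "s ** E \<nu> = cscale (cnj \<nu>) (E \<nu>)" if l: "\<nu> \<in> \<Lambda>" for \<nu>
  proof -
    have "peval y ((h - [:cnj \<nu>:]) * e \<nu>) = 0"
      by (rule zero) (use h[OF l] e_dvd in \<open>metis dvd_mult dvd_mult2\<close>)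
    then show ?thesis by (simp add: peval_mult peval_diff peval_const s_def E_def matrix_ring)
  qed
  have NE: "mpow (y - cscale \<nu> (mat 1)) N ** E \<nu> = 0" if l: "\<nu> \<in> \<Lambda>" for \<nu>
  proof -
    have "peval y ([:- \<nu>, 1:] ^ N * e \<nu>) = 0"
      by (rule zero) (use e_dvd in \<open>metis dvd_mult dvd_triv_left\<close>)
    then show ?thesis by (simp add: peval_mult peval_pow peval_linear E_def del: mult_pCons_left)
  qed
  have comm: "E \<nu> ** mpow (y - cscale \<mu> (mat 1)) N = mpow (y - cscale \<mu> (mat 1)) N ** E \<nu>" for \<nu> \<mu>
    unfolding E_def peval_linear[symmetric] peval_pow[symmetric] by (rule peval_commute)
  have comms: "E \<nu> ** s = s ** E \<nu>" for \<nu> unfolding E_def s_def by (rule peval_commute)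
  define \<Delta> where "\<Delta> = (\<lambda>(\<nu>, \<mu>). \<nu> - \<mu>) ` (\<Lambda> \<times> \<Lambda>)"
  have fin\<Delta>: "finite \<Delta>" unfolding \<Delta>_def using sp(1) by simp
  \<comment> \<open>On the block between the generalised eigenspaces of \<nu> and \<mu>, ad y has
    the single eigenvalue \<nu> - \<mu> while ad s is the scalar \<open>cnj (\<nu> - \<mu>)\<close>.
    Interpolating conjugation on all differences gives ad s as g(ad y). Including 0, whose conjugate
    is 0, makes \<open>g\<close> divisible by a power of the variable.\<close>
  have key: "\<exists>g. [:0, 1:] ^ K dvd g \<and> (\<forall>m. lie_bracket s m = papp g (lie_bracket y) m)" if K: "2 * N \<le> K" for K
  proof -
    obtain g where g: "\<And>c. c \<in> insert 0 \<Delta> \<Longrightarrow> [:- c, 1:] ^ K dvd g - [:cnj c:]"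
      using complex_crt[of "insert 0 \<Delta>" K cnj] fin\<Delta> by blast
    have "lie_bracket s m = papp g (lie_bracket y) m" for m
    proof -
      have m: "m = (\<Sum>\<nu>\<in>\<Lambda>. \<Sum>\<mu>\<in>\<Lambda>. E \<nu> ** m ** E \<mu>)" for m
      proof -
        have "m = (\<Sum>\<nu>\<in>\<Lambda>. E \<nu>) ** m ** (\<Sum>\<mu>\<in>\<Lambda>. E \<mu>)" by (simp add: sumE)
        also have "\<dots> = (\<Sum>\<nu>\<in>\<Lambda>. \<Sum>\<mu>\<in>\<Lambda>. E \<nu> ** m ** E \<mu>)"
          by (simp only: sum_mult_matrix matrix_mult_sum) (rule sum.swap)
        finally show ?thesis .
      qed
      have one: "lie_bracket s (E \<nu> ** m ** E \<mu>) = papp g (lie_bracket y) (E \<nu> ** m ** E \<mu>)"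
        if lm: "\<nu> \<in> \<Lambda>" "\<mu> \<in> \<Lambda>" for \<nu> \<mu>
      proof -
        let ?m = "E \<nu> ** m ** E \<mu>" and ?c = "\<nu> - \<mu>"
        let ?a = "y - cscale \<nu> (mat 1)" and ?b = "y - cscale \<mu> (mat 1)"
        have "((\<lambda>z. ?a ** z - z ** ?b) ^^ K) ?m = 0"
        proof (rule left_minus_right_nilpotent[OF _ _ K])
          show "mpow ?a N ** ?m = 0" using NE[OF lm(1)] by (simp add: matrix_mul_assoc)
          show "?m ** mpow ?b N = 0"
            using NE[OF lm(2)] comm[of \<mu> \<mu>] by (simp flip: matrix_mul_assoc)
        qed
        moreover have "(\<lambda>z. ?a ** z - z ** ?b) = papp [:- ?c, 1:] (lie_bracket y)"
          by (rule ext) (simp only: papp_linear_factor[OF clin_lie_bracket(1)],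
            simp add: lie_bracket_def matrix_ring algebra_simps)
        ultimately have "papp ([:- ?c, 1:] ^ K) (lie_bracket y) ?m = 0"
          by (simp add: papp_pow[OF clin_lie_bracket(1)])
        moreover obtain q where "g - [:cnj ?c:] = [:- ?c, 1:] ^ K * q"
          using g[of ?c] lm by (auto simp: \<Delta>_def elim!: dvdE)
        then have "g = q * [:- ?c, 1:] ^ K + [:cnj ?c:]" by (simp add: algebra_simps)
        ultimately have "papp g (lie_bracket y) ?m = papp [:cnj ?c:] (lie_bracket y) ?m"
          by (simp only: papp_add papp_mult[OF clin_lie_bracket(1)]
              clin_0[OF clin_papp[OF clin_lie_bracket(1)]]) simp
        also have "\<dots> = cscale (cnj ?c) ?m" by (simp add: papp_def)
        also have "\<dots> = lie_bracket s ?m"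
        proof -
          have "s ** ?m = cscale (cnj \<nu>) ?m" using sE[OF lm(1)] by (simp add: matrix_ring)
          moreover have "?m ** s = cscale (cnj \<mu>) ?m"
            using sE[OF lm(2)] comms[of \<mu>] by (simp flip: matrix_mul_assoc add: cscale_mult_right)
          ultimately show ?thesis by (simp add: lie_bracket_def cmat.scale_left_diff_distrib)
        qed
        finally show ?thesis by simp
      qed
      show ?thesis
        by (subst (1 2) m) (simp add: clin_sum[OF clin_lie_bracket(1)]
            clin_sum[OF clin_papp[OF clin_lie_bracket(1)]] one cong: sum.cong)
    qed
    moreover have "[:0, 1:] ^ K dvd g" using g[of 0] by simp
    ultimately show ?thesis by blast
  qed
  show thesis
  proof (rule that[of s])
    fix M N' m
    assume M: "cmat.subspace M" "cmat.subspace N'" "N' \<subseteq> M" "\<And>m. m \<in> M \<Longrightarrow> lie_bracket y m \<in> N'" "m \<in> M"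
    obtain g where g: "[:0, 1:] ^ (2 * N) dvd g" "\<And>m. lie_bracket s m = papp g (lie_bracket y) m"
      using key[OF order_refl] by blast
    then obtain q where "g = [:0, 1:] * q"
      using sp(2) by (metis dvdE dvd_power dvd_trans mult_pos_pos zero_less_numeral)
    then have "g = [:- 0, 1:] * q" by simp
    then have "lie_bracket s m = lie_bracket y (papp q (lie_bracket y) m)"
      by (simp only: g(2) papp_mult[OF clin_lie_bracket(1)] papp_linear_factor[OF clin_lie_bracket(1)]) simp
    moreover have "papp q (lie_bracket y) m \<in> M"
      by (rule papp_in_subspace[OF clin_lie_bracket(1) M(1) _ M(5)]) (use M in auto)
    ultimately show "lie_bracket s m \<in> N'" using M(4) by simp
  next
    fix k m assume k: "(lie_bracket y ^^ k) m = 0"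
    obtain g where g: "[:0, 1:] ^ (2 * N + k) dvd g" "\<And>m. lie_bracket s m = papp g (lie_bracket y) m"
      using key[of "2 * N + k"] by auto
    then have "[:- 0, 1:] ^ k dvd g" by (metis dvd_trans le_add2 le_imp_power_dvd minus_zero)
    then obtain q where q: "g = q * [:- 0, 1:] ^ k" by (metis dvdE mult.commute)
    have "papp [:- 0, 1:] (lie_bracket y) = lie_bracket y"
      by (rule ext) (simp only: papp_linear_factor[OF clin_lie_bracket(1)], simp)
    then show "lie_bracket s m = 0"
      using k by (simp only: g(2) q papp_mult[OF clin_lie_bracket(1)] papp_pow[OF clin_lie_bracket(1)]
         clin_0[OF clin_papp[OF clin_lie_bracket(1)]])
  next
    assume tr: "trace (y ** s) = 0"
    \<comment> \<open>The polynomials in \<open>y\<close> form an abelian, hence solvable, algebra.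
      In triangular form the trace of \<open>y ** s\<close> is the sum of the squared moduli of the
      diagonal entries of \<open>y\<close>.\<close>
    let ?B = "range (peval y)"
    have br0: "lie_bracket a b = 0" if "a \<in> ?B" "b \<in> ?B" for a b
      using that by (auto simp: lie_bracket_def peval_commute)
    have subB: "cmat.subspace ?B"
    proof (rule cmat.subspaceI)
      show "0 \<in> ?B" using rangeI[of "peval y" 0] by simp
      show "a + b \<in> ?B" if ab: "a \<in> ?B" "b \<in> ?B" for a b
      proof -
        obtain p q where "a = peval y p" "b = peval y q" using ab by auto
        then have "a + b = peval y (p + q)" by (simp add: peval_add)
        then show ?thesis by simp
      qed
      show "cscale c a \<in> ?B" if a: "a \<in> ?B" for a c
      proof -
        obtain p where "a = peval y p" using a by auto
        then have "cscale c a = peval y (smult c p)" by (simp add: peval_smult)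
        then show ?thesis by simp
      qed
    qed
    have "lie_subalgebra ?B UNIV" unfolding lie_subalgebra_def using subB br0 cmat.subspace_0[OF subB] by simp
    moreover have "lie_comm ?B ?B \<subseteq> {0}" by (rule lie_comm_subset) (use br0 in auto)
    then have "derived 1 ?B = {0}" using cmat.subspace_0[OF subspace_lie_comm] by auto
    then have "lie_solvable ?B" unfolding lie_solvable_def by blast
    ultimately obtain \<T> \<kappa> where T: "?B \<subseteq> \<T>"
      "\<And>k x y. x \<in> \<T> \<Longrightarrow> y \<in> \<T> \<Longrightarrow> \<kappa> k (x ** y) = \<kappa> k x * (\<kappa> k y :: complex)"
      "\<And>k x y. \<kappa> k (x + y) = \<kappa> k x + \<kappa> k y" "\<And>k c x. \<kappa> k (cscale c x) = c * \<kappa> k x"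
      "\<And>k. \<kappa> k (mat 1) = 1" "\<And>x. trace x = (\<Sum>k\<in>(UNIV :: 'n set). \<kappa> k x)"
      "\<And>x. x \<in> \<T> \<Longrightarrow> (\<And>k. \<kappa> k x = 0) \<Longrightarrow> mnilpotent x"
      by (rule lie_triangularisation) blast
    have yB: "y \<in> ?B" using peval_X by (metis rangeI)
    have ev: "\<kappa> k (peval y p) = poly p (\<kappa> k y)" for k p
    proof (induction p)
      case 0
      show ?case using T(4)[of k 0 0] by simp
    next
      case (pCons a p)
      have "\<kappa> k (y ** peval y p) = \<kappa> k y * \<kappa> k (peval y p)" using T(1) yB by (intro T(2)) auto
      then show ?case using pCons by (simp add: peval_pCons T(3,4,5))
    qed
    have root: "\<kappa> k y \<in> \<Lambda>" for k
    proof -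
      have "poly P (\<kappa> k y) = 0" using ev[of k P] sp(3) ev[of k 0] by simp
      then show ?thesis using sp(1,4) by (auto simp: poly_prod)
    qed
    have "\<kappa> k s = cnj (\<kappa> k y)" for k
    proof -
      have "[:- \<kappa> k y, 1:] dvd h - [:cnj (\<kappa> k y):]"
        using h[OF root[of k]] sp(2) by (meson dvd_power dvd_trans)
      then show ?thesis by (simp add: s_def ev poly_eq_0_iff_dvd[symmetric])
    qed
    then have "\<kappa> k (y ** s) = \<kappa> k y * cnj (\<kappa> k y)" for k
      using T(1) yB by (subst T(2)) (auto simp: s_def)
    then have "\<kappa> k (y ** s) = of_real ((cmod (\<kappa> k y))\<^sup>2)" for k
      by (simp only: complex_norm_square)
    then have "of_real (\<Sum>k\<in>UNIV. (cmod (\<kappa> k y))\<^sup>2) = (0 :: complex)" using tr T(6) by simp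
    then have "(\<Sum>k\<in>UNIV. (cmod (\<kappa> k y))\<^sup>2) = 0" by (simp only: of_real_eq_0_iff)
    then have "\<kappa> k y = 0" for k by (subst (asm) sum_nonneg_eq_0_iff) auto
    then show "mnilpotent y" using T(1,7) yB by blast
  qed
qed

section \<open>The trace form\<close>

lemma subspace_lie_simple: "lie_simple L \<Longrightarrow> cmat.subspace L"
  by (simp add: lie_simple_def lie_subalgebra_def)

lemma lie_simple_bracket: "lie_simple L \<Longrightarrow> x \<in> L \<Longrightarrow> y \<in> L \<Longrightarrow> lie_bracket x y \<in> L"
  by (simp add: lie_simple_def lie_subalgebra_def)

lemma lie_ideal_trivial: "lie_simple L \<Longrightarrow> lie_ideal I L \<Longrightarrow> I \<noteq> {0} \<Longrightarrow> I = L"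
  by (auto simp: lie_simple_def)

lemma lie_simple_perfect:
  assumes "lie_simple L" shows "lie_comm L L = L"
proof (rule lie_ideal_trivial[OF assms])
  have sub: "lie_comm L L \<subseteq> L"
    by (rule lie_comm_subset) (use assms lie_simple_bracket subspace_lie_simple in auto)
  then show "lie_ideal (lie_comm L L) L"
    unfolding lie_ideal_def using lie_comm_base subspace_lie_comm by (metis subsetD)
  show "lie_comm L L \<noteq> {0}" using assms by (simp add: lie_simple_def)
qed

text \<open>Invariance of the trace form moves the bracket onto \<open>s\<close>, which may lie
  outside the algebra; this is how replicas are used.\<close>

lemma trace_comm_eq_0:
  assumes "y \<in> lie_comm L M" "\<And>u v. u \<in> L \<Longrightarrow> v \<in> M \<Longrightarrow> trace (u ** lie_bracket v s) = 0"
  shows "trace (y ** s) = 0"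
proof -
  have "lie_comm L M \<subseteq> {y. trace (y ** s) = 0}"
  proof (rule lie_comm_subset)
    show "cmat.subspace {y. trace (y ** s) = 0}"
      by (auto simp: cmat.subspace_def matrix_ring trace_add trace_cscale)
  qed (simp add: trace_lie_bracket_mult assms(2))
  then show ?thesis using assms(1) by auto
qed

text \<open>The replica of \<open>y\<close> commutes with \<open>L\<close>, because ad y is
  nilpotent there, so its trace against the derived algebra vanishes. This turns intrinsic
  nilpotency of an element into nilpotency of the matrix.\<close>

lemma ad_nilpotent_imp_mnilpotent:
  assumes "y \<in> lie_comm L L" "\<And>v. v \<in> L \<Longrightarrow> \<exists>k. (lie_bracket y ^^ k) v = 0"
  shows "mnilpotent y"
proof (rule matrix_replica[of y])
  fix s
  assume 1: "\<And>k m. (lie_bracket y ^^ k) m = 0 \<Longrightarrow> lie_bracket s m = 0"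
    and 2: "trace (y ** s) = 0 \<Longrightarrow> mnilpotent y"
  have "lie_bracket v s = 0" if "v \<in> L" for v
    using 1 assms(2)[OF that] lie_bracket_anti[of v s] by auto
  then show ?thesis by (intro 2 trace_comm_eq_0[OF assms(1)]) simp
qed

text \<open>Cartan's criterion. The radical of the form is an ideal. Were it all of
  \<open>L\<close>, the replica of \<open>x\<close>, which normalises \<open>L\<close>, would have
  trace zero against \<open>x\<close>, and \<open>x\<close> would be nilpotent.\<close>

lemma trace_form_nondegenerate:
  assumes L: "lie_simple L" and x: "x \<in> L" "\<not> mnilpotent x"
    and u: "u \<in> L" "\<And>v. v \<in> L \<Longrightarrow> trace (u ** v) = 0"
  shows "u = 0"
proof (rule ccontr)
  assume "u \<noteq> 0"
  let ?R = "{u \<in> L. \<forall>v\<in>L. trace (u ** v) = 0}"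
  have "lie_ideal ?R L"
    unfolding lie_ideal_def
  proof (intro conjI ballI)
    show "cmat.subspace ?R" using subspace_lie_simple[OF L]
      by (auto simp: cmat.subspace_def matrix_ring trace_add trace_cscale)
    fix w r assume w: "w \<in> L" "r \<in> ?R"
    have "trace (lie_bracket w r ** v) = 0" if "v \<in> L" for v
    proof -
      have "trace (lie_bracket w r ** v) = - trace (lie_bracket r w ** v)"
        using lie_bracket_anti[of w r] by (simp add: matrix_mult_minus trace_def sum_negf)
      then show ?thesis using w that lie_simple_bracket[OF L w(1) that] by (simp add: trace_lie_bracket_mult)
    qed
    then show "lie_bracket w r \<in> ?R" using w lie_simple_bracket[OF L] by auto
  qed auto
  moreover have "?R \<noteq> {0}" using \<open>u \<noteq> 0\<close> u by auto
  ultimately have R: "?R = L" by (rule lie_ideal_trivial[OF L])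
  show False
  proof (rule matrix_replica[of x])
    fix s
    assume 1: "\<And>M N m. cmat.subspace M \<Longrightarrow> cmat.subspace N \<Longrightarrow> N \<subseteq> M \<Longrightarrow>
        (\<And>m. m \<in> M \<Longrightarrow> lie_bracket x m \<in> N) \<Longrightarrow> m \<in> M \<Longrightarrow> lie_bracket s m \<in> N"
      and 2: "trace (x ** s) = 0 \<Longrightarrow> mnilpotent x"
    have sL: "lie_bracket s v \<in> L" if "v \<in> L" for v
      using 1[OF subspace_lie_simple[OF L] subspace_lie_simple[OF L] order_refl _ that] lie_simple_bracket[OF L x(1)]
      by simp
    have "trace (x ** s) = 0"
    proof (rule trace_comm_eq_0[of x L L])
      show "x \<in> lie_comm L L" using x lie_simple_perfect[OF L] by simp
      fix a b assume "a \<in> L" "b \<in> L"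
      have "lie_bracket b s = cscale (-1) (lie_bracket s b)" using lie_bracket_anti[of b s] by simp
      then have "lie_bracket b s \<in> L" using sL[OF \<open>b \<in> L\<close>] subspace_lie_simple[OF L] cmat.subspace_scale by metis
      then show "trace (a ** lie_bracket b s) = 0" using R \<open>a \<in> L\<close> by auto
    qed
    then show False using 2 x(2) by simp
  qed
qed

section \<open>Linear functionals and their representation by the trace form\<close>

lemma coordinate_functional:
  assumes "cmat.independent B" "b \<in> B"
  obtains l :: "complex^'n^'m \<Rightarrow> complex" where "\<And>u v. l (u + v) = l u + l v" "\<And>c u. l (cscale c u) = c * l u"
    "\<And>b'. b' \<in> B \<Longrightarrow> l b' = (if b' = b then 1 else 0)"
proof -
  define E where "E = cmat.extend_basis B"
  have E: "B \<subseteq> E" "cmat.independent E" "cmat.span E = UNIV"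
    using cmat.extend_basis_superset[OF assms(1)] cmat.independent_extend_basis[OF assms(1)]
      cmat.span_extend_basis[OF assms(1)] by (simp_all add: E_def)
  show thesis
  proof (rule that[of "\<lambda>v. cmat.representation E v b"])
    show "cmat.representation E (u + v) b = cmat.representation E u b + cmat.representation E v b" for u v
      using E by (simp add: cmat.representation_add)
    show "cmat.representation E (cscale c u) b = c * cmat.representation E u b" for c u
      using E by (simp add: cmat.representation_scale)
    fix b' assume "b' \<in> B"
    then have "b' \<in> E" using E(1) by auto
    then show "cmat.representation E b' b = (if b' = b then 1 else 0)"
      using E(2) by (auto simp: cmat.representation_basis)
  qed
qed

lemma separating_functional:
  assumes "cmat.subspace M" "e \<notin> M"
  obtains l :: "complex^'n^'m \<Rightarrow> complex" where "\<And>u v. l (u + v) = l u + l v" "\<And>c u. l (cscale c u) = c * l u"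
    "\<And>m. m \<in> M \<Longrightarrow> l m = 0" "l e = 1"
proof -
  obtain B where B: "B \<subseteq> M" "cmat.independent B" "M \<subseteq> cmat.span B"
    using cmat.maximal_independent_subset by blast
  have "cmat.span B = M" using B assms(1) cmat.span_minimal by blast
  then have ind: "cmat.independent (insert e B)" "e \<notin> B"
    using B assms(2) cmat.independent_insertI[of e B] by auto
  obtain l :: "complex^'n^'m \<Rightarrow> complex" where l: "\<And>u v. l (u + v) = l u + l v" "\<And>c u. l (cscale c u) = c * l u"
    "\<And>b'. b' \<in> insert e B \<Longrightarrow> l b' = (if b' = e then 1 else 0)"
    using coordinate_functional[OF ind(1), of e] by blast
  have "cmat.span B \<subseteq> {m. l m = 0}"
  proof (rule cmat.span_minimal)
    show "cmat.subspace {m. l m = 0}" using l(1,2) l(2)[of 0 0] by (auto simp: cmat.subspace_def)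
  qed (use l(3) ind(2) in auto)
  then have "l m = 0" if "m \<in> M" for m using that B(3) by auto
  then show thesis using that[of l] l by simp
qed

text \<open>The map \<open>f\<close> records the values of the form on a basis as coefficients in
  that basis. Nondegeneracy makes it an injective linear map of \<open>L\<close> into itself, hence
  onto, and a preimage of the coefficient vector of \<open>l\<close> represents \<open>l\<close> on
  \<open>L\<close>.\<close>

lemma trace_form_representation:
  fixes l :: "complex^'n^'n \<Rightarrow> complex"
  assumes L: "cmat.subspace L" "\<And>u. u \<in> L \<Longrightarrow> (\<And>v. v \<in> L \<Longrightarrow> trace (u ** v) = 0) \<Longrightarrow> u = 0"
    and l: "\<And>u v. l (u + v) = l u + l v" "\<And>c u. l (cscale c u) = c * l u"
  shows "\<exists>z\<in>L. \<forall>v\<in>L. l v = trace (z ** v)"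
proof -
  obtain B where B: "B \<subseteq> L" "cmat.independent B" "L \<subseteq> cmat.span B"
    using cmat.maximal_independent_subset by blast
  have finB: "finite B" using B(2) by (rule cmatf.finiteI_independent)
  have spB: "cmat.span B = L" using B L(1) cmat.span_minimal by blast
  define f where "f z = (\<Sum>b\<in>B. cscale (trace (z ** b)) b)" for z
  have lin: "clin f"
    by (rule clinI) (simp_all add: f_def matrix_ring trace_add trace_cscale sum.distrib cmat.scale_sum_right)
  have coef: "g b = h b" if "(\<Sum>b\<in>B. cscale (g b) b) = (\<Sum>b\<in>B. cscale (h b) b)" "b \<in> B" for g h b
  proof -
    have "(\<Sum>b\<in>B. cscale (g b - h b) b) = 0" using that(1) by (simp add: cmat.scale_left_diff_distrib sum_subtractf)
    from cmat.independentD[OF B(2) finB order_refl this that(2)] have "g b - h b = 0" .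
    then show ?thesis by simp
  qed
  have "inj_on f (cmat.span B)"
  proof (rule inj_onI)
    fix u v assume uv: "u \<in> cmat.span B" "v \<in> cmat.span B" "f u = f v"
    have "trace (u ** b) = trace (v ** b)" if "b \<in> B" for b
      using coef[OF _ that, of "\<lambda>b. trace (u ** b)" "\<lambda>b. trace (v ** b)"] uv(3) by (simp add: f_def)
    then have "B \<subseteq> {w. trace ((u - v) ** w) = 0}" by (auto simp: matrix_ring trace_sub)
    then have "cmat.span B \<subseteq> {w. trace ((u - v) ** w) = 0}"
      by (rule cmat.span_minimal) (auto simp: cmat.subspace_def matrix_ring trace_add trace_cscale trace_sub)
    then have "u - v = 0" using uv spB L by (intro L(2)) (auto intro: cmat.subspace_diff)
    then show "u = v" by simp
  qed
  then have ind: "cmat.independent (f ` B)" "card (f ` B) = card B"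
    using module_hom.independent_inj_on_image[OF _ B(2)] lin
    by (auto simp: module_hom_iff_linear card_image inj_on_subset[OF _ cmat.span_superset])
  have "f ` B \<subseteq> L" using B L(1) by (auto simp: f_def intro!: cmat.subspace_sum cmat.subspace_scale)
  then have "L \<subseteq> cmat.span (f ` B)"
    using ind B by (intro cmatf.card_ge_dim_independent) (simp_all add: cmat.basis_card_eq_dim)
  moreover have "(\<Sum>b\<in>B. cscale (l b) b) \<in> L" using B L(1) by (intro cmat.subspace_sum cmat.subspace_scale) auto
  moreover have "cmat.span (f ` B) = f ` L"
    using module_hom.span_image[of cscale cscale f B] lin spB by (simp add: module_hom_iff_linear)
  ultimately obtain z where z: "z \<in> L" "(\<Sum>b\<in>B. cscale (l b) b) = f z" by auto
  have "B \<subseteq> {v. l v = trace (z ** v)}" using coef[of l "\<lambda>b. trace (z ** b)"] z(2) by (auto simp: f_def)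
  then have "cmat.span B \<subseteq> {v. l v = trace (z ** v)}"
    using l l(2)[of 0 0] by (intro cmat.span_minimal) (auto simp: cmat.subspace_def matrix_ring trace_add trace_cscale)
  then show ?thesis using z(1) spB by blast
qed

text \<open>The line spanned by \<open>y\<close> is a solvable algebra. Its triangular form has
  multiplicative diagonal entries, so those of a nilpotent matrix are nilpotent numbers.\<close>

lemma trace_mnilpotent:
  assumes "mnilpotent (y :: complex^'n^'n)" shows "trace y = 0"
proof -
  let ?B = "range (\<lambda>c. cscale c y)"
  have subB: "cmat.subspace ?B"
    using cmat.span_singleton[of y] cmat.subspace_span[of "{y}"] by simp
  have br: "lie_bracket a b = 0" if "a \<in> ?B" "b \<in> ?B" for a b using that by (auto simp: lie_bilinear)
  have "lie_subalgebra ?B UNIV" unfolding lie_subalgebra_def using subB br cmat.subspace_0[OF subB] by simp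
  moreover have "lie_comm ?B ?B \<subseteq> {0}" by (rule lie_comm_subset) (use br in auto)
  then have "derived 1 ?B = {0}" using cmat.subspace_0[OF subspace_lie_comm] by auto
  then have "lie_solvable ?B" unfolding lie_solvable_def by blast
  ultimately obtain \<T> \<kappa> where T: "?B \<subseteq> \<T>" "mat 1 \<in> \<T>" "\<And>x y. x \<in> \<T> \<Longrightarrow> y \<in> \<T> \<Longrightarrow> x ** y \<in> \<T>"
    "\<And>k x y. x \<in> \<T> \<Longrightarrow> y \<in> \<T> \<Longrightarrow> \<kappa> k (x ** y) = \<kappa> k x * (\<kappa> k y :: complex)"
    "\<And>k c x. \<kappa> k (cscale c x) = c * \<kappa> k x" "\<And>k. \<kappa> k (mat 1) = 1"
    "\<And>x. trace x = (\<Sum>k\<in>(UNIV :: 'n set). \<kappa> k x)"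
    by (rule lie_triangularisation) blast
  have y: "y \<in> \<T>" using T(1) range_eqI[of y "\<lambda>c. cscale c y" 1] by auto
  have pw: "mpow y j \<in> \<T> \<and> \<kappa> k (mpow y j) = \<kappa> k y ^ j" for j k
    by (induction j) (simp_all add: mpow_Suc T y)
  obtain j where "mpow y j = 0" using assms by (auto simp: mnilpotent_def)
  then have "\<kappa> k y ^ j = 0" for k using pw[of j k] T(5)[of k 0 0] by simp
  then show ?thesis by (simp add: T(7))
qed

text \<open>Commuting factors let the powers of \<open>z ** e\<close> be separated, so the product
  inherits nilpotency from \<open>e\<close>.\<close>

lemma trace_commuting_nilpotent:
  assumes "mnilpotent e" "lie_bracket e z = 0" shows "trace (z ** e) = 0"
proof (rule trace_mnilpotent)
  have c: "e ** z = z ** e" using assms(2) by (simp add: lie_bracket_def)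
  have c2: "mpow z k ** e = e ** mpow z k" for k
    by (induction k) (simp_all add: mpow_Suc, metis c matrix_mul_assoc)
  have "mpow (z ** e) k = mpow z k ** mpow e k" for k
  proof (induction k)
    case (Suc k)
    have "mpow (z ** e) (Suc k) = z ** (e ** mpow z k) ** mpow e k" by (simp add: mpow_Suc Suc matrix_mul_assoc)
    also have "\<dots> = mpow z (Suc k) ** mpow e (Suc k)"
      by (simp only: c2[symmetric] mpow_Suc matrix_mul_assoc)
    finally show ?case .
  qed simp
  moreover obtain k where "mpow e k = 0" using assms(1) by (auto simp: mnilpotent_def)
  ultimately have "mpow (z ** e) k = 0" by simp
  then show "mnilpotent (z ** e)" by (auto simp: mnilpotent_def)
qed

text \<open>This \<open>h\<close> plays the part of half the neutral element of an sl2-triple: it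
  scales \<open>e\<close>. If \<open>e\<close> were outside [\<aa>,e], a functional vanishing there
  and equal to 1 at \<open>e\<close> would be represented by some \<open>z\<close>. Invariance gives
  [e,z] = 0, so \<open>z ** e\<close> is nilpotent and the value at \<open>e\<close>, its trace, is
  0.\<close>

lemma nilpotent_in_ad_image:
  assumes a: "lie_simple a" and x: "x \<in> a" "\<not> mnilpotent x" and e: "nilpotent_element a e"
  shows "\<exists>h\<in>a. lie_bracket h e = e"
proof (rule ccontr)
  assume neg: "\<not> ?thesis"
  have ea: "e \<in> a" using e lie_simple_perfect[OF a] by (simp add: nilpotent_element_def)
  have nil: "mnilpotent e"
    by (rule ad_nilpotent_imp_mnilpotent[of e a]) (use e in \<open>auto simp: nilpotent_element_def\<close>)
  let ?M = "(\<lambda>u. lie_bracket u e) ` a"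
  have subM: "cmat.subspace ?M"
    using module_hom.subspace_image[of cscale cscale "\<lambda>u. lie_bracket u e" a] clin_lie_bracket(2)[of e] subspace_lie_simple[OF a]
    by (simp add: module_hom_iff_linear)
  have "e \<notin> ?M" using neg by auto
  then obtain l where l: "\<And>u v. l (u + v) = l u + l v" "\<And>c u. l (cscale c u) = c * l u"
    "\<And>m. m \<in> ?M \<Longrightarrow> l m = 0" "l e = 1"
    using separating_functional[OF subM] by blast
  obtain z where z: "z \<in> a" "\<And>v. v \<in> a \<Longrightarrow> l v = trace (z ** v)"
    using trace_form_representation[OF subspace_lie_simple[OF a] trace_form_nondegenerate[OF a x], of l] l(1,2) by blast
  have "lie_bracket e z = 0"
  proof (rule trace_form_nondegenerate[OF a x])
    show "lie_bracket e z \<in> a" using lie_simple_bracket[OF a ea z(1)] .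
    fix u assume u: "u \<in> a"
    have "l (lie_bracket u e) = 0" by (rule l(3)) (use u in auto)
    then have "0 = trace (z ** lie_bracket u e)" using z(2)[OF lie_simple_bracket[OF a u ea]] by simp
    also have "\<dots> = trace (lie_bracket u e ** z)" by (rule trace_mul_sym)
    also have "\<dots> = trace (u ** lie_bracket e z)" by (rule trace_lie_bracket_mult)
    also have "\<dots> = trace (lie_bracket e z ** u)" by (rule trace_mul_sym)
    finally show "trace (lie_bracket e z ** u) = 0" by simp
  qed
  then have "trace (z ** e) = 0" using trace_commuting_nilpotent nil by blast
  then show False using z(2)[OF ea] l(4) by simp
qed

section \<open>Regular semisimple elements and Levi subalgebras\<close>

text \<open>Applying ad x - d removes the component of weight \<open>d\<close> and multiplies the
  others by nonzero scalars, so induction on the set of weights applies.\<close>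

lemma eigen_components_in_subspace:
  assumes "cmat.subspace M" "\<And>m. m \<in> M \<Longrightarrow> lie_bracket x m \<in> M" "finite \<Lambda>"
    "\<And>c. c \<in> \<Lambda> \<Longrightarrow> lie_bracket x (f c) = cscale c (f c)" "(\<Sum>c\<in>\<Lambda>. f c) \<in> M" "c \<in> \<Lambda>"
  shows "f c \<in> M"
  using assms(3-6)
proof (induction \<Lambda> arbitrary: f c rule: finite_induct)
  case (insert d \<Lambda>)
  let ?y = "\<Sum>c\<in>insert d \<Lambda>. f c"
  have "lie_bracket x ?y - cscale d ?y = (\<Sum>c\<in>\<Lambda>. cscale (c - d) (f c))"
  proof -
    have "lie_bracket x ?y = (\<Sum>c\<in>insert d \<Lambda>. cscale c (f c))"
      by (simp only: clin_sum[OF clin_lie_bracket(1)]) (rule sum.cong, use insert.prems in auto)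
    then show ?thesis using insert.hyps
      by (simp add: cmat.scale_sum_right cmat.scale_left_diff_distrib sum_subtractf cmat.scale_right_distrib)
  qed
  moreover have "lie_bracket x ?y - cscale d ?y \<in> M"
    using insert.prems(2) assms(1,2) by (intro cmat.subspace_diff cmat.subspace_scale) auto
  ultimately have "(\<Sum>c\<in>\<Lambda>. cscale (c - d) (f c)) \<in> M" by simp
  then have *: "cscale (c - d) (f c) \<in> M" if "c \<in> \<Lambda>" for c
    by (intro insert.IH[of "\<lambda>c. cscale (c - d) (f c)"]) (use insert.prems that in \<open>auto simp: lie_bilinear mult.commute\<close>)
  have in\<Lambda>: "f c \<in> M" if "c \<in> \<Lambda>" for c
  proof -
    have "c - d \<noteq> 0" using insert.hyps that by auto
    moreover have "cscale (inverse (c - d)) (cscale (c - d) (f c)) \<in> M"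
      using *[OF that] assms(1) by (rule cmat.subspace_scale[rotated])
    ultimately show ?thesis by simp
  qed
  have "f d = ?y - (\<Sum>c\<in>\<Lambda>. f c)" using insert.hyps by simp
  then have "f d \<in> M" using insert.prems(2) in\<Lambda> assms(1) by (metis cmat.subspace_diff cmat.subspace_sum)
  then show ?case using in\<Lambda> insert.prems(3) by auto
qed simp

lemma annihilating_poly:
  fixes T :: "complex^'n^'m \<Rightarrow> complex^'n^'m"
  assumes T: "clin T" shows "\<exists>p. p \<noteq> 0 \<and> (\<forall>v. papp p T v = 0)"
proof -
  have "\<forall>v. \<exists>p. p \<noteq> 0 \<and> papp p T v = 0" using annihilating_poly_at by blast
  then obtain P where P: "\<And>v. P v \<noteq> 0" "\<And>v. papp (P v) T v = 0" by metis
  let ?m = "\<lambda>q. munit (fst q) (snd q) :: complex^'n^'m"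
  define p where "p = (\<Prod>q\<in>UNIV. P (?m q))"
  have "papp p T (?m q) = 0" for q
  proof -
    have "p = (\<Prod>r\<in>UNIV - {q}. P (?m r)) * P (?m q)"
      unfolding p_def by (simp add: prod.remove[of UNIV q] mult.commute)
    then show ?thesis by (simp add: papp_mult[OF T] P clin_0[OF clin_papp[OF T]])
  qed
  then have "papp p T v = 0" for v
    by (subst munit_expansion) (simp add: clin_sum[OF clin_papp[OF T]] clin_scale[OF clin_papp[OF T]])
  moreover have "p \<noteq> 0" using P(1) by (simp add: p_def)
  ultimately show ?thesis by blast
qed

text \<open>The powers of \<open>u\<close> are eigenvectors of ad x with the multiples of
  \<open>c\<close> as eigenvalues, infinitely many unless some power vanishes.\<close>

lemma nonzero_weight_mnilpotent:
  assumes "lie_bracket x u = cscale c u" "c \<noteq> 0" shows "mnilpotent u"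
proof (rule ccontr)
  assume "\<not> ?thesis"
  then have nz: "mpow u k \<noteq> 0" for k by (auto simp: mnilpotent_def)
  have "lie_bracket x (mpow u k) = cscale (of_nat k * c) (mpow u k)" for k
  proof (induction k)
    case 0
    then show ?case by (simp add: lie_bracket_def)
  next
    case (Suc k)
    have "lie_bracket x (mpow u (Suc k)) = lie_bracket x u ** mpow u k + u ** lie_bracket x (mpow u k)"
      by (simp add: mpow_Suc lie_bracket_def matrix_ring)
    then show ?case by (simp add: Suc assms(1) matrix_ring mpow_Suc algebra_simps)
  qed
  moreover obtain p where p: "p \<noteq> 0" "\<And>v. papp p (lie_bracket x) v = 0"
    using annihilating_poly[OF clin_lie_bracket(1)] by blast
  ultimately have "cscale (poly p (of_nat k * c)) (mpow u k) = 0" for k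
    using papp_eigenvector[OF clin_lie_bracket(1), of x "mpow u k" "of_nat k * c" p] by simp
  then have "range (\<lambda>k. of_nat k * c) \<subseteq> {z. poly p z = 0}" using nz by auto
  moreover have "inj (\<lambda>k. of_nat k * c :: complex)" using assms(2) by (auto simp: inj_def)
  ultimately show False using poly_roots_finite[OF p(1)] finite_subset
    by (metis finite_imageD infinite_UNIV_nat)
qed

section \<open>Weight decomposition of a simple Lie algebra relative to a regular semisimple
  element\<close>

locale regular_simple =
  fixes \<gg> :: "(complex^'n^'n) set" and x :: "complex^'n^'n"
  assumes simple: "lie_simple \<gg>"
    and regular: "regular_semisimple_element \<gg> x"
begin

definition "H = lie_centralizer \<gg> x"
definition "U = {u \<in> \<gg>. \<exists>c. c \<noteq> 0 \<and> lie_bracket x u = cscale c u}"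

lemma sub\<gg>: "cmat.subspace \<gg>" and br\<gg>: "u \<in> \<gg> \<Longrightarrow> v \<in> \<gg> \<Longrightarrow> lie_bracket u v \<in> \<gg>"
  and perfect: "lie_comm \<gg> \<gg> = \<gg>" and \<gg>_nz: "\<gg> \<noteq> {0}"
  using subspace_lie_simple[OF simple] lie_simple_bracket[OF simple] lie_simple_perfect[OF simple] simple
  by (auto simp: lie_simple_def)

lemma x\<gg>: "x \<in> \<gg>"
  using regular by (simp add: regular_semisimple_element_def semisimple_element_def)

lemma H_iff: "y \<in> H \<longleftrightarrow> y \<in> \<gg> \<and> lie_bracket x y = 0"
  by (simp add: H_def lie_centralizer_def)

lemma subH: "cmat.subspace H"
  using sub\<gg> by (auto simp: cmat.subspace_def H_iff lie_bilinear)

lemma H_subalgebra: "lie_subalgebra H \<gg>" and H_nilpotent: "lie_nilpotent H"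
  using regular by (simp_all add: regular_semisimple_element_def cartan_subalgebra_def H_def)

text \<open>The decomposition takes place inside an arbitrary \<open>x\<close>-stable subspace
  \<open>M\<close>, because it is applied to a parabolic subalgebra and to its nilpotent ideals as
  well as to \<gg>.\<close>

lemma eigen_decomposition:
  assumes "cmat.subspace M" "M \<subseteq> \<gg>" "\<And>m. m \<in> M \<Longrightarrow> lie_bracket x m \<in> M" "y \<in> M"
  obtains y0 r where "y = y0 + r" "y0 \<in> M" "y0 \<in> H" "r \<in> cmat.span (M \<inter> U)"
proof -
  \<comment> \<open>\<open>f\<close> is indexed by all scalars and vanishes off
    \<open>\<Lambda>\<close>, so that two expansions can be added over the union of their supports
    and each weight still occurs once.\<close>
  define Q where "Q y \<longleftrightarrow> (\<exists>\<Lambda> f. finite \<Lambda> \<and> y = (\<Sum>c\<in>\<Lambda>. f c) \<and>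
      (\<forall>c. f c \<in> \<gg> \<and> lie_bracket x (f c) = cscale c (f c) \<and> (c \<notin> \<Lambda> \<longrightarrow> f c = 0)))" for y
  have "cmat.span {y \<in> \<gg>. \<exists>c. lie_bracket x y = cscale c y} \<subseteq> Collect Q"
  proof (rule cmat.span_minimal)
    show "cmat.subspace (Collect Q)"
    proof (rule cmat.subspaceI; clarsimp)
      show "Q 0" unfolding Q_def
        by (rule exI[of _ "{}"], rule exI[of _ "\<lambda>_. 0"]) (simp add: cmat.subspace_0[OF sub\<gg>])
      show "Q (u + v)" if "Q u" "Q v" for u v
      proof -
        from that obtain \<Lambda> f \<Lambda>' f' where f: "finite \<Lambda>" "u = (\<Sum>c\<in>\<Lambda>. f c)"
          "\<And>c. f c \<in> \<gg>" "\<And>c. lie_bracket x (f c) = cscale c (f c)" "\<And>c. c \<notin> \<Lambda> \<Longrightarrow> f c = 0"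
          and f': "finite \<Lambda>'" "v = (\<Sum>c\<in>\<Lambda>'. f' c)"
          "\<And>c. f' c \<in> \<gg>" "\<And>c. lie_bracket x (f' c) = cscale c (f' c)" "\<And>c. c \<notin> \<Lambda>' \<Longrightarrow> f' c = 0"
          unfolding Q_def by auto
        have "u = (\<Sum>c\<in>\<Lambda> \<union> \<Lambda>'. f c)" "v = (\<Sum>c\<in>\<Lambda> \<union> \<Lambda>'. f' c)"
          unfolding f(2) f'(2) by (rule sum.mono_neutral_left, use f f' in auto)+
        then show ?thesis unfolding Q_def using f f'
          by (intro exI[of _ "\<Lambda> \<union> \<Lambda>'"] exI[of _ "\<lambda>c. f c + f' c"])
            (auto simp: sum.distrib lie_bilinear cmat.scale_right_distrib cmat.subspace_add[OF sub\<gg>])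
      qed
      show "Q (cscale a u)" if "Q u" for a u
      proof -
        from that obtain \<Lambda> f where f: "finite \<Lambda>" "u = (\<Sum>c\<in>\<Lambda>. f c)"
          "\<And>c. f c \<in> \<gg>" "\<And>c. lie_bracket x (f c) = cscale c (f c)" "\<And>c. c \<notin> \<Lambda> \<Longrightarrow> f c = 0"
          unfolding Q_def by auto
        then show ?thesis unfolding Q_def
          by (intro exI[of _ \<Lambda>] exI[of _ "\<lambda>c. cscale a (f c)"])
            (auto simp: cmat.scale_sum_right lie_bilinear mult.commute cmat.subspace_scale[OF sub\<gg>])
      qed
    qed
    show "{y \<in> \<gg>. \<exists>c. lie_bracket x y = cscale c y} \<subseteq> Collect Q"
    proof clarify
      fix y c assume y: "y \<in> \<gg>" "lie_bracket x y = cscale c y"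
      show "Q y" unfolding Q_def
        by (rule exI[of _ "{c}"], rule exI[of _ "\<lambda>d. if d = c then y else 0"])
          (use y in \<open>auto simp: cmat.subspace_0[OF sub\<gg>]\<close>)
    qed
  qed
  moreover have "cmat.span {y \<in> \<gg>. \<exists>c. lie_bracket x y = cscale c y} = \<gg>"
    using regular by (simp add: regular_semisimple_element_def semisimple_element_def)
  ultimately have "Q y" using assms by auto
  then obtain \<Lambda> f where f: "finite \<Lambda>" "y = (\<Sum>c\<in>\<Lambda>. f c)"
    "\<And>c. f c \<in> \<gg>" "\<And>c. lie_bracket x (f c) = cscale c (f c)" "\<And>c. c \<notin> \<Lambda> \<Longrightarrow> f c = 0"
    unfolding Q_def by auto
  have fM: "f c \<in> M" for c
    using eigen_components_in_subspace[OF assms(1,3) f(1) f(4), of c] assms(1,4) f(2,5) cmat.subspace_0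
    by (cases "c \<in> \<Lambda>") auto
  have "y = f 0 + (\<Sum>c\<in>\<Lambda> - {0}. f c)"
    using f(1,2,5) by (cases "0 \<in> \<Lambda>") (simp_all add: sum.remove)
  moreover have "f 0 \<in> H" using f(3)[of 0] f(4)[of 0] by (simp add: H_iff)
  moreover have "(\<Sum>c\<in>\<Lambda> - {0}. f c) \<in> cmat.span (M \<inter> U)"
    by (intro cmat.span_sum cmat.span_base) (use fM f(3,4) in \<open>auto simp: U_def\<close>)
  ultimately show thesis using that[of "f 0"] fM by blast
qed

lemma decomposition\<gg>: assumes "y \<in> \<gg>" obtains y0 r where "y = y0 + r" "y0 \<in> H" "r \<in> cmat.span U"
  using eigen_decomposition[OF sub\<gg> order_refl br\<gg>[OF x\<gg>] assms] cmat.span_mono[of "\<gg> \<inter> U" U]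
  by (metis inf_le2 subsetD)

lemma \<gg>_not_H: "\<not> \<gg> \<subseteq> H"
proof
  assume "\<gg> \<subseteq> H"
  then have "H = \<gg>" by (auto simp: H_iff)
  moreover have "(lie_comm \<gg> ^^ k) \<gg> = \<gg>" for k by (induction k) (simp_all add: perfect)
  ultimately show False using H_nilpotent \<gg>_nz by (auto simp: lie_nilpotent_def)
qed

lemma U_mnilpotent: "u \<in> U \<Longrightarrow> mnilpotent u"
  using nonzero_weight_mnilpotent by (auto simp: U_def)

lemma ex_U: "\<exists>u\<in>U. u \<noteq> 0"
proof (rule ccontr)
  assume "\<not> ?thesis"
  then have "cmat.span U \<subseteq> {0}" by (intro cmat.span_minimal) auto
  moreover have "0 \<in> H" using subH cmat.subspace_0 by auto
  ultimately have "y \<in> H" if "y \<in> \<gg>" for y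
    using decomposition\<gg>[OF that] by (metis add.right_neutral singletonD subsetD)
  then show False using \<gg>_not_H by auto
qed

lemma x_not_nilpotent: "\<not> mnilpotent x"
proof
  assume x: "mnilpotent x"
  obtain u c where "u \<noteq> 0" "c \<noteq> 0" "lie_bracket x u = cscale c u" using ex_U by (auto simp: U_def)
  then show False using mnilpotent_eigenvalue[OF x] by blast
qed

lemmas nondegenerate = trace_form_nondegenerate[OF simple x\<gg> x_not_nilpotent]

text \<open>The subalgebra generated by \<open>U\<close> is stable under \<open>H\<close>, because
  \<open>H\<close> commutes with \<open>x\<close> and so preserves the eigenspaces of ad x. It is
  then stable under \<open>H\<close> + span \<open>U\<close>, which is \<gg>: a nonzero ideal, hence
  everything.\<close>

lemma generated_by_U:
  assumes "cmat.subspace S" "\<And>u v. u \<in> S \<Longrightarrow> v \<in> S \<Longrightarrow> lie_bracket u v \<in> S" "U \<subseteq> S"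
  shows "\<gg> \<subseteq> S"
proof -
  define F where "F = {S. lie_subalgebra S \<gg> \<and> U \<subseteq> S}"
  define S0 where "S0 = \<Inter>F"
  have \<gg>F: "\<gg> \<in> F" using sub\<gg> br\<gg> by (auto simp: F_def lie_subalgebra_def U_def)
  have S0: "cmat.subspace S0" "S0 \<subseteq> \<gg>" "U \<subseteq> S0" "\<And>u v. u \<in> S0 \<Longrightarrow> v \<in> S0 \<Longrightarrow> lie_bracket u v \<in> S0"
    using \<gg>F by (auto simp: S0_def F_def lie_subalgebra_def intro!: cmat.subspace_Inter)
  have min: "S0 \<subseteq> T" if "cmat.subspace T" "\<And>u v. u \<in> T \<Longrightarrow> v \<in> T \<Longrightarrow> lie_bracket u v \<in> T" "U \<subseteq> T" "T \<subseteq> \<gg>" for T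
    using that by (auto simp: S0_def F_def lie_subalgebra_def)
  have hS: "lie_bracket h s \<in> S0" if h: "h \<in> H" and s: "s \<in> S0" for h s
  proof -
    have "S0 \<subseteq> {s \<in> S0. lie_bracket h s \<in> S0}"
    proof (rule min)
      show "cmat.subspace {s \<in> S0. lie_bracket h s \<in> S0}"
        using S0(1) by (auto simp: cmat.subspace_def lie_bilinear)
      show "lie_bracket u v \<in> {s \<in> S0. lie_bracket h s \<in> S0}"
        if "u \<in> {s \<in> S0. lie_bracket h s \<in> S0}" "v \<in> {s \<in> S0. lie_bracket h s \<in> S0}" for u v
      proof -
        have "lie_bracket h (lie_bracket u v) = lie_bracket (lie_bracket h u) v + lie_bracket u (lie_bracket h v)"
          using lie_jacobi[of h u v] by simp
        moreover have "lie_bracket (lie_bracket h u) v \<in> S0" "lie_bracket u (lie_bracket h v) \<in> S0" "lie_bracket u v \<in> S0"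
          using that S0(4) by auto
        ultimately show ?thesis using cmat.subspace_add[OF S0(1)] by simp
      qed
      show "U \<subseteq> {s \<in> S0. lie_bracket h s \<in> S0}"
      proof clarify
        fix u assume u: "u \<in> U"
        then obtain c where c: "c \<noteq> 0" "lie_bracket x u = cscale c u" "u \<in> \<gg>" by (auto simp: U_def)
        have "lie_bracket x (lie_bracket h u) = cscale c (lie_bracket h u)"
          using h c lie_jacobi[of x h u] by (simp add: H_iff lie_bilinear)
        then have "lie_bracket h u \<in> U" using c h br\<gg> by (auto simp: U_def H_iff)
        then show "u \<in> S0 \<and> lie_bracket h u \<in> S0" using S0(3) u by auto
      qed
    qed (use S0 in auto)
    then show ?thesis using s by auto
  qed
  have "lie_bracket y s \<in> S0" if ys: "y \<in> \<gg>" "s \<in> S0" for y s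
  proof -
    obtain y0 r where y: "y = y0 + r" "y0 \<in> H" "r \<in> cmat.span U" by (rule decomposition\<gg>[OF ys(1)])
    have "r \<in> S0" using y(3) cmat.span_minimal[OF S0(3,1)] by auto
    then show ?thesis using y hS[OF y(2) ys(2)] S0(1,4) ys(2) by (simp add: lie_bilinear cmat.subspace_add)
  qed
  then have "lie_ideal S0 \<gg>" using S0 by (auto simp: lie_ideal_def)
  moreover have "S0 \<noteq> {0}" using ex_U S0(3) by auto
  ultimately have "S0 = \<gg>" by (rule lie_ideal_trivial[OF simple])
  moreover have "S0 \<subseteq> S \<inter> \<gg>"
    by (rule min) (use assms sub\<gg> br\<gg> in \<open>auto intro: cmat.subspace_inter simp: U_def\<close>)
  ultimately show ?thesis by auto
qed

text \<open>For \<open>u\<close> of weight \<open>c\<close>, invariance writes \<open>c\<close>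
  times the trace of \<open>h ** u\<close> as the trace of [h,x] against \<open>u\<close>, and [h,x]
  = 0.\<close>

lemma H_orthogonal: assumes "h \<in> H" "r \<in> cmat.span U" shows "trace (h ** r) = 0"
proof -
  have "cmat.span U \<subseteq> {r. trace (h ** r) = 0}"
  proof (rule cmat.span_minimal)
    show "cmat.subspace {r. trace (h ** r) = 0}" by (auto simp: cmat.subspace_def matrix_ring trace_add trace_cscale)
    show "U \<subseteq> {r. trace (h ** r) = 0}"
    proof clarify
      fix u assume "u \<in> U"
      then obtain c where c: "c \<noteq> 0" "lie_bracket x u = cscale c u" by (auto simp: U_def)
      have "lie_bracket h x = 0" using assms(1) lie_bracket_anti[of h x] by (simp add: H_iff)
      then have "trace (h ** lie_bracket x u) = 0" using trace_lie_bracket_mult[of h x u] by simp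
      then show "trace (h ** u) = 0" using c by (simp add: matrix_ring trace_cscale)
    qed
  qed
  then show ?thesis using assms(2) by auto
qed

lemma H_nondegenerate: assumes "y \<in> H" "\<And>h. h \<in> H \<Longrightarrow> trace (y ** h) = 0" shows "y = 0"
proof (rule nondegenerate)
  show "y \<in> \<gg>" using assms(1) by (simp add: H_iff)
  fix v assume "v \<in> \<gg>"
  then obtain y0 r where "v = y0 + r" "y0 \<in> H" "r \<in> cmat.span U" by (rule decomposition\<gg>)
  then show "trace (y ** v) = 0" using assms H_orthogonal by (simp add: matrix_ring trace_add)
qed

text \<open>\<open>H\<close> is nilpotent, hence solvable and simultaneously triangular. A nilpotent
  \<open>y\<close> has zero diagonal there, so it is orthogonal to \<open>H\<close>, on which the
  form is nondegenerate.\<close>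

lemma H_mnilpotent: assumes "y \<in> H" "mnilpotent y" shows "y = 0"
proof (rule H_nondegenerate[OF assms(1)])
  fix h assume h: "h \<in> H"
  have sub: "lie_subalgebra H UNIV" using H_subalgebra by (simp add: lie_subalgebra_def)
  obtain k where k: "(lie_comm H ^^ k) H = {0}" using H_nilpotent by (auto simp: lie_nilpotent_def)
  have dH: "derived j H \<subseteq> H" for j
  proof (induction j)
    case (Suc j)
    have "lie_comm H H \<subseteq> H"
      by (rule lie_comm_subset[OF subH]) (use H_subalgebra in \<open>simp add: lie_subalgebra_def\<close>)
    then show ?case using lie_comm_mono[OF Suc Suc] by simp
  qed simp
  have "derived j H \<subseteq> (lie_comm H ^^ j) H" for j
  proof (induction j)
    case (Suc j)
    show ?case using lie_comm_mono[OF dH Suc] by simp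
  qed simp
  then have "derived k H = {0}" using k zero_in_derived[of H k] cmat.subspace_0[OF subH] by auto
  then have "lie_solvable H" by (auto simp: lie_solvable_def)
  then obtain \<T> \<kappa> where T: "H \<subseteq> \<T>" "mat 1 \<in> \<T>" "\<And>x y. x \<in> \<T> \<Longrightarrow> y \<in> \<T> \<Longrightarrow> x ** y \<in> \<T>"
    "\<And>k x y. x \<in> \<T> \<Longrightarrow> y \<in> \<T> \<Longrightarrow> \<kappa> k (x ** y) = \<kappa> k x * (\<kappa> k y :: complex)"
    "\<And>k c x. \<kappa> k (cscale c x) = c * \<kappa> k x" "\<And>k. \<kappa> k (mat 1) = 1"
    "\<And>x. trace x = (\<Sum>k\<in>(UNIV :: 'n set). \<kappa> k x)"
    by (rule lie_triangularisation[OF sub]) blast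
  have y: "y \<in> \<T>" and h': "h \<in> \<T>" using T(1) assms(1) h by auto
  have pw: "mpow y j \<in> \<T> \<and> \<kappa> k (mpow y j) = \<kappa> k y ^ j" for j k
    by (induction j) (simp_all add: mpow_Suc T y)
  obtain j where "mpow y j = 0" using assms by (auto simp: mnilpotent_def)
  then have "\<kappa> k y ^ j = 0" for k using pw[of j k] T(5)[of k 0 0] by simp
  then show "trace (y ** h) = 0" by (simp add: T(4,7) y h')
qed

end

section \<open>Borel subalgebras and the codimension of U + \<aa>\<close>

lemma lie_rep_bracket: "lie_rep L lie_bracket"
  by (simp add: lie_rep_def clin_lie_bracket lie_bilinear lie_jacobi)

text \<open>In triangular form the diagonal of a commutator is zero.\<close>

lemma trace_bracket_solvable:
  assumes "lie_subalgebra B UNIV" "lie_solvable B" "a \<in> B" "b \<in> B" "c \<in> B"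
  shows "trace (a ** lie_bracket b c) = 0"
proof -
  obtain \<T> \<kappa> where T: "B \<subseteq> \<T>" "cmat.subspace \<T>" "\<And>x y. x \<in> \<T> \<Longrightarrow> y \<in> \<T> \<Longrightarrow> x ** y \<in> \<T>"
    "\<And>k x y. x \<in> \<T> \<Longrightarrow> y \<in> \<T> \<Longrightarrow> \<kappa> k (x ** y) = \<kappa> k x * (\<kappa> k y :: complex)"
    "\<And>k x y. \<kappa> k (x + y) = \<kappa> k x + \<kappa> k y" "\<And>k c x. \<kappa> k (cscale c x) = c * \<kappa> k x"
    "\<And>x. trace x = (\<Sum>k\<in>(UNIV :: 'a set). \<kappa> k x)"
    by (rule lie_triangularisation[OF assms(1,2)]) blast
  have m: "a \<in> \<T>" "b \<in> \<T>" "c \<in> \<T>" using T(1) assms by auto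
  have eq: "lie_bracket b c = b ** c + cscale (-1) (c ** b)" by (simp add: lie_bracket_def)
  have "\<kappa> k (lie_bracket b c) = 0" for k unfolding eq by (simp only: T(4-6) m) simp
  moreover have "lie_bracket b c \<in> \<T>" unfolding lie_bracket_def using m T(2,3) by (intro cmat.subspace_diff)
  ultimately show ?thesis by (simp add: T(4,7) m)
qed

lemma trace_minus: "trace (- A) = - trace (A :: complex^'n^'n)"
  by (simp add: trace_def sum_negf)

context regular_simple
begin

text \<open>Otherwise Lie's theorem yields a vector \<open>y0\<close>, orthogonal to
  \<open>B\<close> and outside it, such that \<open>B\<close> and \<open>y0\<close> span a
  subalgebra \<open>S\<close>. The trilinear form trace(u [v,w]) vanishes on \<open>S\<close>, so
  [S,S] consists of nilpotent matrices and \<open>S\<close> turns out solvable, against the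
  maximality of \<open>B\<close>.\<close>

lemma borel_orthogonal_subset:
  assumes B: "borel_subalgebra B \<gg>" and y: "y \<in> \<gg>" "\<And>b. b \<in> B \<Longrightarrow> trace (y ** b) = 0"
  shows "y \<in> B"
proof (rule ccontr)
  assume "y \<notin> B"
  have subB: "cmat.subspace B" "B \<subseteq> \<gg>" and brB: "\<And>a b. a \<in> B \<Longrightarrow> b \<in> B \<Longrightarrow> lie_bracket a b \<in> B"
    and solB: "lie_solvable B"
    using B by (auto simp: borel_subalgebra_def lie_subalgebra_def)
  have algB: "lie_subalgebra B UNIV" using subB brB by (auto simp: lie_subalgebra_def)
  define Bp where "Bp = {y \<in> \<gg>. \<forall>b\<in>B. trace (y ** b) = 0}"
  have subBp: "cmat.subspace Bp"
    using sub\<gg> by (auto simp: cmat.subspace_def Bp_def matrix_ring trace_add trace_cscale)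
  have brBp: "lie_bracket b y \<in> Bp" if by_in: "b \<in> B" "y \<in> Bp" for b y
  proof -
    have "trace (lie_bracket b y ** b') = 0" if "b' \<in> B" for b'
    proof -
      have "trace (lie_bracket b y ** b') = - trace (lie_bracket y b ** b')"
        using lie_bracket_anti[of b y] by (simp add: matrix_mult_minus trace_minus)
      then show ?thesis using by_in that brB by (simp add: trace_lie_bracket_mult Bp_def)
    qed
    then show ?thesis using by_in subB br\<gg> by (auto simp: Bp_def)
  qed
  define V where "V = {u + w |u w. u \<in> B \<and> w \<in> Bp}"
  have "cmat.subspace V" unfolding V_def by (rule cmat.subspace_sums[OF subB(1) subBp])
  moreover have "lie_bracket b v \<in> V" if "b \<in> B" "v \<in> V" for b v
    using that brB brBp unfolding V_def by (fastforce simp: lie_bilinear)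
  moreover have "y \<in> V" using y cmat.subspace_0[OF subB(1)] unfolding V_def Bp_def
    by (intro CollectI exI[of _ 0] exI[of _ y]) auto
  ultimately obtain y1 \<kappa> where y1: "y1 \<in> V" "y1 \<notin> B" "\<And>b. b \<in> B \<Longrightarrow> lie_bracket b y1 - cscale (\<kappa> b) y1 \<in> B"
    using lie_common_eigenvector[OF algB solB lie_rep_bracket, of V B] subB(1) brB \<open>y \<notin> B\<close> by metis
  \<comment> \<open>The eigenvector is moved into the orthogonal complement by subtracting its part
    in \<open>B\<close>, which does not change its weights modulo \<open>B\<close>.\<close>
  then obtain b0 y0 where by0: "y1 = b0 + y0" "b0 \<in> B" "y0 \<in> Bp" by (auto simp: V_def)
  have y0B: "y0 \<notin> B" using y1(2) by0 cmat.subspace_add[OF subB(1)] by auto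
  have wt: "lie_bracket b y0 - cscale (\<kappa> b) y0 \<in> B" if b: "b \<in> B" for b
  proof -
    have "lie_bracket b y0 - cscale (\<kappa> b) y0 =
        (lie_bracket b y1 - cscale (\<kappa> b) y1) - (lie_bracket b b0 - cscale (\<kappa> b) b0)"
      by (simp add: by0(1) lie_bilinear cmat.scale_right_distrib)
    moreover have "\<dots> \<in> B"
      by (intro cmat.subspace_diff[OF subB(1)] cmat.subspace_scale[OF subB(1)] y1(3) brB b by0(2))
    ultimately show ?thesis by simp
  qed
  define S where "S = {b + cscale c y0 |b c. b \<in> B}"
  have subS: "cmat.subspace S" unfolding S_def by (rule subspace_insert_line[OF subB(1)])
  have S\<gg>: "S \<subseteq> \<gg>" using subB by0(3) sub\<gg>
    by (auto simp: S_def Bp_def intro!: cmat.subspace_add[OF sub\<gg>] cmat.subspace_scale[OF sub\<gg>])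
  have BS: "B \<subseteq> S" unfolding S_def by (rule subsetI, rule CollectI, rule exI, rule exI[of _ 0]) simp
  have "cscale 1 y0 \<in> S" unfolding S_def
    by (rule CollectI, rule exI[of _ 0], rule exI[of _ 1]) (simp add: cmat.subspace_0[OF subB(1)])
  then have y0S: "y0 \<in> S" by simp
  have by0S: "lie_bracket b y0 \<in> S" if "b \<in> B" for b
    unfolding S_def in_line_sum_iff using wt[OF that] by blast
  have brS: "lie_bracket u v \<in> S" if uv: "u \<in> S" "v \<in> S" for u v
  proof -
    obtain b c b' c' where u: "u = b + cscale c y0" "b \<in> B" and v: "v = b' + cscale c' y0" "b' \<in> B"
      using uv by (auto simp: S_def)
    have "lie_bracket u v = lie_bracket b b' + cscale c' (lie_bracket b y0) - cscale c (lie_bracket b' y0)"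
      unfolding u v using lie_bracket_anti[of y0 b'] by (simp add: lie_bilinear)
    moreover have "\<dots> \<in> S"
      by (intro cmat.subspace_diff[OF subS] cmat.subspace_add[OF subS] cmat.subspace_scale[OF subS] by0S u(2) v(2)
          subsetD[OF BS] brB)
    ultimately show ?thesis by simp
  qed
  have y0orth: "trace (y0 ** b) = 0" "trace (b ** y0) = 0" if "b \<in> B" for b
    using by0(3) that trace_mul_sym[of b y0] by (auto simp: Bp_def)
  \<comment> \<open>Expanded over \<open>B\<close> and \<open>y0\<close>: the terms within
    \<open>B\<close> vanish by triangularity, those with one \<open>y0\<close> by orthogonality,
    those with more by invariance.\<close>
  have tri: "trace (u ** lie_bracket v w) = 0" if uvw: "u \<in> S" "v \<in> S" "w \<in> S" for u v w
  proof -
    have t1: "trace (y0 ** lie_bracket b b') = 0" if "b \<in> B" "b' \<in> B" for b b'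
      using y0orth brB that by simp
    have t2: "trace (b ** lie_bracket y0 b') = 0" "trace (b ** lie_bracket b' y0) = 0" if "b \<in> B" "b' \<in> B" for b b'
    proof -
      have "trace (b ** lie_bracket b' y0) = trace (lie_bracket b b' ** y0)"
        by (simp add: trace_lie_bracket_mult)
      then show "trace (b ** lie_bracket b' y0) = 0" using y0orth brB that by simp
      then show "trace (b ** lie_bracket y0 b') = 0"
        using lie_bracket_anti[of y0 b'] by (simp add: matrix_mult_minus trace_minus)
    qed
    have t3: "trace (y0 ** lie_bracket y0 b) = 0" "trace (y0 ** lie_bracket b y0) = 0" for b
    proof -
      show "trace (y0 ** lie_bracket y0 b) = 0" using trace_lie_bracket_mult[of y0 y0 b] by simp
      then show "trace (y0 ** lie_bracket b y0) = 0"
        using lie_bracket_anti[of b y0] by (simp add: matrix_mult_minus trace_minus)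
    qed
    have t0: "trace (b ** lie_bracket b' b'') = 0" if "b \<in> B" "b' \<in> B" "b'' \<in> B" for b b' b''
      using trace_bracket_solvable[OF algB solB that] .
    obtain b c b' c' b'' c'' where e: "u = b + cscale c y0" "b \<in> B" "v = b' + cscale c' y0" "b' \<in> B"
      "w = b'' + cscale c'' y0" "b'' \<in> B" using uvw by (auto simp: S_def)
    show ?thesis unfolding e(1,3,5) using e(2,4,6)
      by (simp add: lie_bilinear matrix_ring trace_add trace_cscale t0 t1 t2 t3)
  qed
  define N where "N = lie_comm S S"
  have subN: "cmat.subspace N" by (simp add: N_def subspace_lie_comm)
  have NS: "N \<subseteq> S" unfolding N_def by (rule lie_comm_subset[OF subS]) (rule brS)
  have nilN: "mnilpotent v" if v: "v \<in> N" for v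
  proof (rule matrix_replica[of v])
    fix s
    assume 1: "\<And>M N m. cmat.subspace M \<Longrightarrow> cmat.subspace N \<Longrightarrow> N \<subseteq> M \<Longrightarrow>
        (\<And>m. m \<in> M \<Longrightarrow> lie_bracket v m \<in> N) \<Longrightarrow> m \<in> M \<Longrightarrow> lie_bracket s m \<in> N"
      and 2: "trace (v ** s) = 0 \<Longrightarrow> mnilpotent v"
    have vS: "v \<in> S" using v NS by auto
    have sN: "lie_bracket s m \<in> N" if "m \<in> S" for m
      by (rule 1[OF subS subN NS _ that]) (use vS in \<open>auto simp: N_def intro: lie_comm_base\<close>)
    have z: "trace (u ** m) = 0" if um: "u \<in> S" "m \<in> N" for u m
    proof -
      have "N \<subseteq> {m. trace (u ** m) = 0}" unfolding N_def
        by (rule lie_comm_subset) (use tri[OF um(1)] in \<open>auto simp: cmat.subspace_def matrix_ring trace_add trace_cscale\<close>)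
      then show ?thesis using um(2) by auto
    qed
    have "trace (v ** s) = 0"
    proof (rule trace_comm_eq_0[of v S S])
      show "v \<in> lie_comm S S" using v by (simp add: N_def)
      fix a b assume "a \<in> S" "b \<in> S"
      then have "trace (a ** lie_bracket s b) = 0" by (intro z sN)
      then show "trace (a ** lie_bracket b s) = 0"
        using lie_bracket_anti[of b s] by (simp add: matrix_mult_minus trace_minus)
    qed
    then show "mnilpotent v" by (rule 2)
  qed
  \<comment> \<open>\<open>n\<close> is a nilpotent matrix, so the scalar by which it acts on
    \<open>y0\<close> modulo \<open>B\<close> is zero.\<close>
  have \<kappa>0: "lie_bracket n y0 \<in> B" if n: "n \<in> N" "n \<in> B" for n
  proof -
    have ad: "(lie_bracket n ^^ k) y0 - cscale (\<kappa> n ^ k) y0 \<in> B" for k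
    proof (induction k)
      case 0
      then show ?case by (simp add: cmat.subspace_0[OF subB(1)])
    next
      case (Suc k)
      have "(lie_bracket n ^^ Suc k) y0 - cscale (\<kappa> n ^ Suc k) y0 =
         lie_bracket n ((lie_bracket n ^^ k) y0 - cscale (\<kappa> n ^ k) y0) + cscale (\<kappa> n ^ k) (lie_bracket n y0 - cscale (\<kappa> n) y0)"
        by (simp add: lie_bilinear cmat.scale_right_diff_distrib mult.commute)
      moreover have "\<dots> \<in> B"
        by (intro cmat.subspace_add[OF subB(1)] cmat.subspace_scale[OF subB(1)] brB n wt Suc)
      ultimately show ?case by simp
    qed
    obtain k where k: "\<And>m. (lie_bracket n ^^ k) m = 0" using mnilpotent_ad[OF nilN[OF n(1)]] by blast
    have "cscale (- (\<kappa> n ^ k)) y0 \<in> B" using ad[of k] by (simp add: k)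
    have "\<kappa> n = 0"
    proof (rule ccontr)
      assume "\<kappa> n \<noteq> 0"
      then have nz: "- (\<kappa> n ^ k) \<noteq> 0" by simp
      have "cscale (inverse (- (\<kappa> n ^ k))) (cscale (- (\<kappa> n ^ k)) y0) \<in> B"
        by (rule cmat.subspace_scale[OF subB(1)]) fact
      then show False using y0B by (simp only: cmat.scale_scale left_inverse[OF nz] cmat.scale_one)
    qed
    then show ?thesis using wt[OF n(2)] by simp
  qed
  \<comment> \<open>\<open>N\<close> meets \<open>B\<close> in codimension at most one, so in a
    bracket of two elements of \<open>N\<close> one factor may be taken in \<open>B\<close>.\<close>
  have "lie_comm N N \<subseteq> B"
  proof (rule lie_comm_subset[OF subB(1)])
    fix n1 n2 assume n: "n1 \<in> N" "n2 \<in> N"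
    obtain b1 c1 where n1: "n1 = b1 + cscale c1 y0" "b1 \<in> B" using n NS by (auto simp: S_def)
    obtain b2 c2 where n2: "n2 = b2 + cscale c2 y0" "b2 \<in> B" using n NS by (auto simp: S_def)
    have line: "lie_bracket m n' \<in> B" if m: "m \<in> N" "m \<in> S" and n': "n' \<in> N" "n' \<in> B" for m n'
    proof -
      obtain b c where m': "m = b + cscale c y0" "b \<in> B" using m by (auto simp: S_def)
      have "lie_bracket m n' = lie_bracket b n' - cscale c (lie_bracket n' y0)"
        unfolding m' using lie_bracket_anti[of y0 n'] by (simp add: lie_bilinear)
      also have "\<dots> \<in> B"
        by (intro cmat.subspace_diff[OF subB(1)] cmat.subspace_scale[OF subB(1)] brB m' n' \<kappa>0)
      finally show ?thesis .
    qed
    show "lie_bracket n1 n2 \<in> B"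
    proof (cases "c1 = 0")
      case True
      then have "lie_bracket n2 n1 \<in> B" using n n1 NS by (intro line) auto
      then have "- lie_bracket n2 n1 \<in> B" by (rule cmat.subspace_neg[OF subB(1)])
      then show ?thesis using lie_bracket_anti[of n1 n2] by simp
    next
      case False
      let ?n = "n2 - cscale (c2 / c1) n1"
      have e: "?n = b2 - cscale (c2 / c1) b1" using False by (simp add: n1 n2 cmat.scale_right_distrib)
      have "?n \<in> B"
        unfolding e by (intro cmat.subspace_diff[OF subB(1)] cmat.subspace_scale[OF subB(1)] n1 n2)
      moreover have "?n \<in> N" using n cmat.subspace_diff[OF subN] cmat.subspace_scale[OF subN] by simp
      ultimately have "lie_bracket n1 ?n \<in> B" using n NS by (intro line) auto
      then show ?thesis by (simp add: lie_bilinear)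
    qed
  qed
  then have "derived 2 S \<subseteq> B" by (simp add: numeral_2_eq_2 N_def)
  then have "lie_solvable S" using lie_solvable_derived[OF solB] cmat.subspace_0[OF subS] by blast
  moreover have "lie_subalgebra S \<gg>" using subS S\<gg> brS by (auto simp: lie_subalgebra_def)
  ultimately have "S = B" using B BS by (auto simp: borel_subalgebra_def)
  then show False using y0S y0B by simp
qed

lemma ad_power_trace:
  "trace ((lie_bracket y ^^ j) u ** p) = (-1) ^ j * trace (u ** (lie_bracket y ^^ j) p)"
proof (induction j arbitrary: u)
  case (Suc j)
  have "trace ((lie_bracket y ^^ Suc j) u ** p) = trace ((lie_bracket y ^^ j) (lie_bracket y u) ** p)"
    by (simp add: funpow_swap1)
  also have "\<dots> = (-1) ^ j * trace (lie_bracket y u ** (lie_bracket y ^^ j) p)" by (rule Suc)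
  also have "trace (lie_bracket y u ** (lie_bracket y ^^ j) p) = - trace (lie_bracket u y ** (lie_bracket y ^^ j) p)"
    using lie_bracket_anti[of y u] by (simp add: matrix_mult_minus trace_minus)
  finally show ?case by (simp add: trace_lie_bracket_mult)
qed simp

text \<open>The point is that the whole centralizer \<open>H\<close> lies in \<open>\<ll>\<close>,
  while at first only \<open>x\<close> does; the proof passes through the parabolic subalgebra and
  its nilradical. Then \<gg>, being \<open>H\<close> + span \<open>U\<close>, is spanned by
  \<open>U\<close>, the derived algebra and the line of the centre.\<close>

theorem levi_codimension:
  assumes levi: "levi_subalgebra \<ll> \<gg>" and dim: "cmat.dim (lie_center \<ll>) = 1"
    and a: "\<aa> = lie_comm \<ll> \<ll>" and xa: "x \<in> \<aa>"
  obtains z where "\<And>y. y \<in> \<gg> \<Longrightarrow> \<exists>r\<in>cmat.span U. \<exists>v\<in>\<aa>. \<exists>c. y = r + v + cscale c z"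
proof -
  have l: "lie_subalgebra \<ll> \<gg>" "lie_reductive \<ll>" using levi by (auto simp: levi_subalgebra_def)
  obtain P where P: "parabolic_subalgebra P \<gg>" "direct_sum_decomp P \<ll> (lie_nilradical P)"
    using levi by (auto simp: levi_subalgebra_def)
  obtain B where B: "borel_subalgebra B \<gg>" "B \<subseteq> P" using P(1) by (auto simp: parabolic_subalgebra_def)
  have subl: "cmat.subspace \<ll>" and brl: "\<And>u v. u \<in> \<ll> \<Longrightarrow> v \<in> \<ll> \<Longrightarrow> lie_bracket u v \<in> \<ll>"
    using l(1) by (auto simp: lie_subalgebra_def)
  have subP: "cmat.subspace P" "P \<subseteq> \<gg>" and brP: "\<And>u v. u \<in> P \<Longrightarrow> v \<in> P \<Longrightarrow> lie_bracket u v \<in> P"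
    using P(1) by (auto simp: parabolic_subalgebra_def lie_subalgebra_def)
  have subB: "cmat.subspace B" "B \<subseteq> \<gg>" and brB: "\<And>u v. u \<in> B \<Longrightarrow> v \<in> B \<Longrightarrow> lie_bracket u v \<in> B"
    and solB: "lie_solvable B"
    using B(1) by (auto simp: borel_subalgebra_def lie_subalgebra_def)
  define n where "n = lie_nilradical P"
  have subn: "cmat.subspace n" by (simp add: n_def lie_nilradical_def)
  have al: "\<aa> \<subseteq> \<ll>" unfolding a by (rule lie_comm_subset[OF subl]) (rule brl)
  have P_eq: "P = {u + w |u w. u \<in> \<ll> \<and> w \<in> n}" and ln: "\<ll> \<inter> n = {0}"
    using P(2) by (auto simp: direct_sum_decomp_def n_def)
  have lP: "\<ll> \<subseteq> P"
  proof
    fix u assume "u \<in> \<ll>"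
    then show "u \<in> P" unfolding P_eq using cmat.subspace_0[OF subn] by (intro CollectI exI[of _ u] exI[of _ 0]) simp
  qed
  have xl: "x \<in> \<ll>" and xP: "x \<in> P" using xa al lP by auto
  have orthP: "y \<in> B" if y: "y \<in> \<gg>" "\<And>p. p \<in> P \<Longrightarrow> trace (y ** p) = 0" for y
    using borel_orthogonal_subset[OF B(1) y(1)] y(2) B(2) by auto
  \<comment> \<open>By nondegeneracy the replica of \<open>y\<close> acts on \<gg> as some
    \<open>z\<close> in \<gg>. Since \<open>z\<close> normalises \<open>B\<close>, maximality puts
    \<open>z\<close> into \<open>B\<close> and so into \<open>P\<close>, to which \<open>y\<close>
    is orthogonal; hence \<open>y\<close> is nilpotent.\<close>
  have M: "y = 0" if y: "y \<in> H" "\<And>p. p \<in> P \<Longrightarrow> trace (y ** p) = 0" for y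
  proof (rule H_mnilpotent[OF y(1)], rule matrix_replica[of y])
    fix s
    assume 1: "\<And>M N m. cmat.subspace M \<Longrightarrow> cmat.subspace N \<Longrightarrow> N \<subseteq> M \<Longrightarrow>
        (\<And>m. m \<in> M \<Longrightarrow> lie_bracket y m \<in> N) \<Longrightarrow> m \<in> M \<Longrightarrow> lie_bracket s m \<in> N"
      and 2: "trace (y ** s) = 0 \<Longrightarrow> mnilpotent y"
    have y\<gg>: "y \<in> \<gg>" using y(1) by (simp add: H_iff)
    have yB: "y \<in> B" by (rule orthP[OF y\<gg> y(2)])
    obtain z where z: "z \<in> \<gg>" "\<And>v. v \<in> \<gg> \<Longrightarrow> trace (s ** v) = trace (z ** v)"
      using trace_form_representation[OF sub\<gg> nondegenerate, of "\<lambda>v. trace (s ** v)"]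
      by (auto simp: matrix_ring trace_add trace_cscale)
    have s\<gg>: "lie_bracket s u \<in> \<gg>" if "u \<in> \<gg>" for u
      by (rule 1[OF sub\<gg> sub\<gg> order_refl br\<gg>[OF y\<gg>] that])
    have sB: "lie_bracket s b \<in> B" if "b \<in> B" for b
      by (rule 1[OF subB(1) subB(1) order_refl brB[OF yB] that])
    have sz: "lie_bracket s u = lie_bracket z u" if u: "u \<in> \<gg>" for u
    proof -
      have "lie_bracket s u - lie_bracket z u = 0"
      proof (rule nondegenerate)
        show "lie_bracket s u - lie_bracket z u \<in> \<gg>"
          using s\<gg> br\<gg> z(1) u cmat.subspace_diff[OF sub\<gg>] by auto
        fix v assume "v \<in> \<gg>"
        then show "trace ((lie_bracket s u - lie_bracket z u) ** v) = 0"
          using z(2)[OF br\<gg>[OF u]] by (simp add: matrix_diff_rdistrib trace_sub trace_lie_bracket_mult)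
      qed
      then show ?thesis by simp
    qed
    have zB: "lie_bracket z b \<in> B" if "b \<in> B" for b using sz[of b] sB[OF that] that subB(2) by auto
    define S where "S = {b + cscale c z |b c. b \<in> B}"
    have subS: "cmat.subspace S" unfolding S_def by (rule subspace_insert_line[OF subB(1)])
    have BS: "B \<subseteq> S" unfolding S_def by (rule subsetI, rule CollectI, rule exI, rule exI[of _ 0]) simp
    have SS: "lie_bracket u v \<in> B" if uv: "u \<in> S" "v \<in> S" for u v
    proof -
      obtain b c b' c' where u: "u = b + cscale c z" "b \<in> B" and v: "v = b' + cscale c' z" "b' \<in> B"
        using uv by (auto simp: S_def)
      have "lie_bracket u v = lie_bracket b b' + cscale c (lie_bracket z b') - cscale c' (lie_bracket z b)"
        unfolding u v using lie_bracket_anti[of b z] by (simp add: lie_bilinear)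
      also have "\<dots> \<in> B"
        by (intro cmat.subspace_diff[OF subB(1)] cmat.subspace_add[OF subB(1)] cmat.subspace_scale[OF subB(1)] brB zB u v)
      finally show ?thesis .
    qed
    have "derived 1 S \<subseteq> B" using lie_comm_subset[OF subB(1), of S S] SS by simp
    then have "lie_solvable S" using lie_solvable_derived[OF solB] cmat.subspace_0[OF subS] by blast
    moreover have "S \<subseteq> \<gg>" using subB z(1)
      by (auto simp: S_def intro!: cmat.subspace_add[OF sub\<gg>] cmat.subspace_scale[OF sub\<gg>])
    then have "lie_subalgebra S \<gg>" using subS SS BS by (auto simp: lie_subalgebra_def)
    ultimately have "S = B" using B(1) BS by (auto simp: borel_subalgebra_def)
    moreover have "cscale 1 z \<in> S" unfolding S_def
      by (rule CollectI, rule exI[of _ 0], rule exI[of _ 1]) (simp add: cmat.subspace_0[OF subB(1)])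
    ultimately have "z \<in> P" using B(2) by auto
    have "trace (y ** s) = trace (z ** y)" using z(2)[OF y\<gg>] trace_mul_sym[of y s] by simp
    also have "\<dots> = 0" using y(2)[OF \<open>z \<in> P\<close>] trace_mul_sym[of z y] by simp
    finally show "mnilpotent y" by (rule 2)
  qed
  \<comment> \<open>A power of ad y kills \<open>P\<close>, so it maps \<gg> into the orthogonal
    complement of \<open>P\<close>, which lies in \<open>B\<close> and so in \<open>P\<close>;
    applying the power twice gives zero on \<gg>.\<close>
  have nilI: "y = 0" if I: "lie_ideal I P" "lie_nilpotent I" and y: "y \<in> I" "y \<in> H" for I y
  proof (rule H_mnilpotent[OF y(2)], rule ad_nilpotent_imp_mnilpotent[of y \<gg>])
    show "y \<in> lie_comm \<gg> \<gg>" using y(2) by (simp add: perfect H_iff)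
    obtain k where k: "(lie_comm I ^^ k) I = {0}" using I(2) by (auto simp: lie_nilpotent_def)
    have adP: "(lie_bracket y ^^ Suc j) p \<in> (lie_comm I ^^ j) I" if p: "p \<in> P" for j p
    proof (induction j)
      case 0
      have "lie_bracket p y \<in> I" using I(1) p y(1) by (auto simp: lie_ideal_def)
      then have "- lie_bracket p y \<in> I" using I(1) by (auto simp: lie_ideal_def intro: cmat.subspace_neg)
      then show ?case using lie_bracket_anti[of y p] by simp
    next
      case (Suc j)
      show ?case using lie_comm_base[OF y(1) Suc] by simp
    qed
    have adP0: "(lie_bracket y ^^ Suc k) p = 0" if "p \<in> P" for p using adP[OF that, of k] k by simp
    show "\<exists>m. (lie_bracket y ^^ m) u = 0" if u: "u \<in> \<gg>" for u
    proof -
      let ?w = "(lie_bracket y ^^ Suc k) u"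
      have y\<gg>: "y \<in> \<gg>" using y(2) by (simp add: H_iff)
      have "(lie_bracket y ^^ j) u \<in> \<gg>" for j by (induction j) (use u br\<gg> y\<gg> in auto)
      moreover have "trace (?w ** p) = 0" if "p \<in> P" for p
        by (simp only: ad_power_trace adP0[OF that]) simp
      ultimately have "?w \<in> P" using orthP B(2) by blast
      then have "(lie_bracket y ^^ (Suc k + Suc k)) u = 0" by (simp only: funpow_add o_apply adP0)
      then show ?thesis by blast
    qed
  qed
  have nU: "n \<subseteq> cmat.span U"
    unfolding n_def lie_nilradical_def
  proof (rule cmat.span_minimal)
    show "\<Union>{I. lie_ideal I P \<and> lie_nilpotent I} \<subseteq> cmat.span U"
    proof (rule Union_least)
      fix I assume "I \<in> {I. lie_ideal I P \<and> lie_nilpotent I}"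
      then have I: "lie_ideal I P" "lie_nilpotent I" by auto
      have "cmat.subspace I" "I \<subseteq> \<gg>" and xI: "\<And>m. m \<in> I \<Longrightarrow> lie_bracket x m \<in> I"
        using I(1) subP xP by (auto simp: lie_ideal_def)
      then show "I \<subseteq> cmat.span U"
      proof (intro subsetI)
        fix y assume "y \<in> I"
        obtain y0 r where d: "y = y0 + r" "y0 \<in> I" "y0 \<in> H" "r \<in> cmat.span (I \<inter> U)"
          by (rule eigen_decomposition[OF \<open>cmat.subspace I\<close> \<open>I \<subseteq> \<gg>\<close> xI \<open>y \<in> I\<close>])
        then have "y = r" using nilI[OF I] by simp
        then show "y \<in> cmat.span U" using d(4) cmat.span_mono[of "I \<inter> U" U] by auto
      qed
    qed
  qed simp
  have HnU: "y = 0" if "y \<in> H" "y \<in> cmat.span U" for y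
    by (rule H_nondegenerate[OF that(1)]) (use H_orthogonal[OF _ that(2)] trace_mul_sym[of y] in metis)
  have xn: "lie_bracket x v \<in> n" if v: "v \<in> n" for v
  proof -
    have "n \<subseteq> {v. lie_bracket x v \<in> n}" unfolding n_def lie_nilradical_def
    proof (rule cmat.span_minimal)
      show "cmat.subspace {v. lie_bracket x v \<in> cmat.span (\<Union>{I. lie_ideal I P \<and> lie_nilpotent I})}"
        by (rule subspace_clin_preimage[OF clin_lie_bracket(1)]) simp
      show "\<Union>{I. lie_ideal I P \<and> lie_nilpotent I} \<subseteq> {v. lie_bracket x v \<in> cmat.span (\<Union>{I. lie_ideal I P \<and> lie_nilpotent I})}"
      proof (clarsimp)
        fix v I assume I: "v \<in> I" "lie_ideal I P" "lie_nilpotent I"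
        then have "lie_bracket x v \<in> I" using xP by (auto simp: lie_ideal_def)
        then show "lie_bracket x v \<in> cmat.span (\<Union>{I. lie_ideal I P \<and> lie_nilpotent I})"
          by (intro cmat.span_base) (use I in auto)
      qed
    qed
    then show ?thesis using v by auto
  qed
  \<comment> \<open>The bracket of \<open>x\<close> with the nilradical part of \<open>p\<close>
    lies in both summands, so that part commutes with \<open>x\<close>; lying in the span of
    \<open>U\<close>, it is 0.\<close>
  have PHl: "p \<in> \<ll>" if p: "p \<in> P" "p \<in> H" for p
  proof -
    obtain u v where uv: "p = u + v" "u \<in> \<ll>" "v \<in> n" using p(1) by (auto simp: P_eq)
    have z: "lie_bracket x u + lie_bracket x v = 0" using p(2) uv(1) by (simp add: H_iff lie_bilinear)
    then have "lie_bracket x v = - lie_bracket x u" by (simp add: add_eq_0_iff)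
    then have "lie_bracket x v \<in> \<ll>" using cmat.subspace_neg[OF subl brl[OF xl uv(2)]] by simp
    then have "lie_bracket x v = 0" using xn[OF uv(3)] ln by blast
    moreover have "v \<in> \<gg>" using uv(3) nU cmat.span_minimal[OF _ sub\<gg>, of U] by (auto simp: U_def)
    ultimately have "v = 0" using HnU nU uv(3) by (auto simp: H_iff)
    then show ?thesis using uv by simp
  qed
  \<comment> \<open>If \<open>h\<close> were outside \<open>P\<close>, a functional vanishing on P
    \<inter> H but not at \<open>h\<close> would be represented by an element of \<open>H\<close>
    orthogonal to \<open>P\<close>, which is 0 by \<open>M\<close>.\<close>
  have HP: "h \<in> P" if h: "h \<in> H" for h
  proof (rule ccontr)
    assume "h \<notin> P"
    have "cmat.subspace (P \<inter> H)" using subP(1) subH by (rule cmat.subspace_inter)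
    moreover have "h \<notin> P \<inter> H" using \<open>h \<notin> P\<close> by simp
    ultimately obtain f where f: "\<And>u v. f (u + v) = f u + f v" "\<And>c u. f (cscale c u) = c * f u"
      "\<And>m. m \<in> P \<inter> H \<Longrightarrow> f m = 0" "f h = 1"
      using separating_functional by blast
    obtain z where z: "z \<in> H" "\<And>v. v \<in> H \<Longrightarrow> f v = trace (z ** v)"
      using trace_form_representation[OF subH H_nondegenerate f(1,2)] by blast
    have "z = 0"
    proof (rule M[OF z(1)])
      fix p assume "p \<in> P"
      obtain p0 r where d: "p = p0 + r" "p0 \<in> P" "p0 \<in> H" "r \<in> cmat.span (P \<inter> U)"
        by (rule eigen_decomposition[OF subP brP[OF xP] \<open>p \<in> P\<close>])
      have "r \<in> cmat.span U" using d(4) cmat.span_mono[of "P \<inter> U" U] by auto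
      then show "trace (z ** p) = 0"
        using H_orthogonal[OF z(1)] z(2)[OF d(3)] f(3)[of p0] d by (simp add: matrix_ring trace_add)
    qed
    then show False using z(2)[OF h] f(4) by simp
  qed
  have "lie_ideal \<aa> \<ll>" unfolding a lie_ideal_def
    using al subspace_lie_comm by (auto simp: a intro: lie_comm_base)
  then obtain J where J: "lie_ideal J \<ll>" "direct_sum_decomp \<ll> \<aa> J"
    using l(2) by (auto simp: lie_reductive_def)
  \<comment> \<open>An ideal complementary to the derived algebra is central, since its brackets lie
    in both summands.\<close>
  have "J \<subseteq> lie_center \<ll>"
  proof
    fix j assume j: "j \<in> J"
    then have jl: "j \<in> \<ll>" using J(1) by (auto simp: lie_ideal_def)
    have "lie_bracket j v = 0" if v: "v \<in> \<ll>" for v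
    proof -
      have "lie_bracket v j \<in> J" using J(1) j v by (auto simp: lie_ideal_def)
      moreover have "lie_bracket v j \<in> \<aa>" unfolding a using v jl by (rule lie_comm_base)
      ultimately have "lie_bracket v j = 0" using J(2) by (auto simp: direct_sum_decomp_def)
      then show ?thesis using lie_bracket_anti[of j v] by simp
    qed
    then show "j \<in> lie_center \<ll>" using jl by (simp add: lie_center_def)
  qed
  moreover obtain Z where Z: "Z \<subseteq> lie_center \<ll>" "cmat.independent Z" "lie_center \<ll> \<subseteq> cmat.span Z" "card Z = 1"
    using cmat.basis_exists[of "lie_center \<ll>"] dim by auto
  moreover obtain z where "Z = {z}" using Z(4) card_1_singletonE by blast
  ultimately have Jz: "J \<subseteq> range (\<lambda>c. cscale c z)" by (auto simp: cmat.span_singleton)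
  show thesis
  proof (rule that[of z])
    fix y assume "y \<in> \<gg>"
    then obtain y0 r where y: "y = y0 + r" "y0 \<in> H" "r \<in> cmat.span U" by (rule decomposition\<gg>)
    have "y0 \<in> \<ll>" using PHl HP y(2) by simp
    then obtain v j where vj: "y0 = v + j" "v \<in> \<aa>" "j \<in> J" using J(2) by (auto simp: direct_sum_decomp_def)
    then obtain c where "j = cscale c z" using Jz by auto
    then have "y = r + v + cscale c z" using y(1) vj(1) by simp
    then show "\<exists>r\<in>cmat.span U. \<exists>v\<in>\<aa>. \<exists>c. y = r + v + cscale c z" using y(3) vj(2) by blast
  qed
qed

end

section \<open>Polynomial functions\<close>

lemma polyfun_sum: "(\<And>a. a \<in> A \<Longrightarrow> f a \<in> polyfun C) \<Longrightarrow> (\<lambda>x. \<Sum>a\<in>A. f a x) \<in> polyfun C"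
  by (induction A rule: infinite_finite_induct) (auto intro: polyfun.intros)

lemma polyfun_prod: "(\<And>a. a \<in> A \<Longrightarrow> f a \<in> polyfun C) \<Longrightarrow> (\<lambda>x. \<Prod>a\<in>A. f a x) \<in> polyfun C"
  by (induction A rule: infinite_finite_induct) (auto intro: polyfun.intros)

lemma polyfun_power: "f \<in> polyfun C \<Longrightarrow> (\<lambda>x. f x ^ n) \<in> polyfun C"
  by (induction n) (auto intro: polyfun.intros)

lemma polyfun_scale: "f \<in> polyfun C \<Longrightarrow> (\<lambda>x. a * f x) \<in> polyfun C"
  by (intro polyfun.mult polyfun.const)

lemma polyfun_uminus: "f \<in> polyfun C \<Longrightarrow> (\<lambda>x. - f x) \<in> polyfun C"
  using polyfun_scale[of f C "-1"] by simp

lemma polyfun_diff: "f \<in> polyfun C \<Longrightarrow> g \<in> polyfun C \<Longrightarrow> (\<lambda>x. f x - g x) \<in> polyfun C"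
  using polyfun.add[OF _ polyfun_uminus, of f C g] by simp

lemma polyfun_compose:
  assumes "f \<in> polyfun C" "\<And>c. c \<in> C \<Longrightarrow> (\<lambda>x. c (m x)) \<in> polyfun C'"
  shows "(\<lambda>x. f (m x)) \<in> polyfun C'"
  using assms(1) by induction (auto intro: assms(2) polyfun.intros)

lemma polyfun_mono: "f \<in> polyfun C \<Longrightarrow> C \<subseteq> C' \<Longrightarrow> f \<in> polyfun C'"
  using polyfun_compose[of f C "\<lambda>x. x" C'] by (auto intro: polyfun.coord)

lemma polyfun_cong: "f \<in> polyfun C \<Longrightarrow> (\<And>c. c \<in> C \<Longrightarrow> c x = c y) \<Longrightarrow> f x = f y"
  by (induction rule: polyfun.induct) auto

lemma polyfun_on_polynomial_curve:
  assumes "f \<in> polyfun C" "\<And>c. c \<in> C \<Longrightarrow> \<exists>p. \<forall>s. c (\<gamma> s) = poly p s"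
  shows "\<exists>p. \<forall>s. f (\<gamma> s) = poly p s"
  using assms(1)
proof induction
  case (const a)
  show ?case by (rule exI[of _ "[:a:]"]) simp
next
  case (add f g)
  then show ?case by (metis poly_add)
next
  case (mult f g)
  then show ?case by (metis poly_mult)
qed (use assms(2) in auto)

section \<open>Functions as a complex vector space, filtered by degree\<close>

definition fscale :: "complex \<Rightarrow> ('x \<Rightarrow> complex) \<Rightarrow> 'x \<Rightarrow> complex" where
  "fscale a f = (\<lambda>x. a * f x)"

interpretation fs: vector_space "fscale :: complex \<Rightarrow> ('x \<Rightarrow> complex) \<Rightarrow> 'x \<Rightarrow> complex"
  by standard (simp_all add: fscale_def fun_eq_iff algebra_simps)

lemma fscale_apply [simp]: "fscale a f x = a * f x"
  by (simp add: fscale_def)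

lemma fun_sum_apply: "(sum f A) x = (\<Sum>a\<in>A. f a (x :: 'x) :: complex)"
  by (induction A rule: infinite_finite_induct) auto

lemma polyfun_plus: "f \<in> polyfun C \<Longrightarrow> g \<in> polyfun C \<Longrightarrow> f + g \<in> polyfun C"
  by (simp add: plus_fun_def polyfun.add)

lemma polyfun_fscale: "f \<in> polyfun C \<Longrightarrow> fscale a f \<in> polyfun C"
  by (simp add: fscale_def polyfun_scale)

lemma polyfun_zero: "0 \<in> polyfun C"
  by (simp add: zero_fun_def polyfun.const)

lemma subspace_polyfun: "fs.subspace (polyfun C)"
  by (auto simp: fs.subspace_def polyfun_zero polyfun_plus polyfun_fscale)

primrec monomials :: "('a \<Rightarrow> complex) set \<Rightarrow> nat \<Rightarrow> ('a \<Rightarrow> complex) set" where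
  "monomials C 0 = {\<lambda>_. 1}"
| "monomials C (Suc n) = monomials C n \<union> {\<lambda>x. c x * b x |c b. c \<in> C \<and> b \<in> monomials C n}"

text \<open>Polynomials occur only as functions, so this bounds the degree of some polynomial
  expression; the coordinates in \<open>C\<close> may satisfy relations. For finite \<open>C\<close>
  the space is finite-dimensional.\<close>

definition poly_deg :: "('a \<Rightarrow> complex) set \<Rightarrow> nat \<Rightarrow> ('a \<Rightarrow> complex) set" where
  "poly_deg C n = fs.span (monomials C n)"

lemma finite_monomials: "finite C \<Longrightarrow> finite (monomials C n)"
proof (induction n)
  case (Suc n)
  have "{\<lambda>x. c x * b x |c b. c \<in> C \<and> b \<in> monomials C n} = (\<lambda>(c, b) x. c x * b x) ` (C \<times> monomials C n)"
    by auto
  then show ?case using Suc by simp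
qed simp

lemma subspace_poly_deg: "fs.subspace (poly_deg C n)"
  by (simp add: poly_deg_def)

lemma poly_deg_add: "f \<in> poly_deg C n \<Longrightarrow> g \<in> poly_deg C n \<Longrightarrow> (\<lambda>x. f x + g x) \<in> poly_deg C n"
  using fs.subspace_add[OF subspace_poly_deg, of f C n g] by (simp add: plus_fun_def)

lemma poly_deg_scale: "f \<in> poly_deg C n \<Longrightarrow> (\<lambda>x. a * f x) \<in> poly_deg C n"
  using fs.subspace_scale[OF subspace_poly_deg, of f C n a] by (simp add: fscale_def)

lemma poly_deg_sum: "(\<And>a. a \<in> A \<Longrightarrow> f a \<in> poly_deg C n) \<Longrightarrow> (\<lambda>x. \<Sum>a\<in>A. f a x) \<in> poly_deg C n"
  by (induction A rule: infinite_finite_induct)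
    (auto intro: poly_deg_add simp: fs.subspace_0[OF subspace_poly_deg, unfolded zero_fun_def])

lemma monomials_mono: "m \<le> n \<Longrightarrow> monomials C m \<subseteq> monomials C n"
  by (rule lift_Suc_mono_le[of "monomials C"]) auto

lemma poly_deg_mono: "m \<le> n \<Longrightarrow> poly_deg C m \<subseteq> poly_deg C n"
  unfolding poly_deg_def by (intro fs.span_mono monomials_mono)

lemma poly_deg_const: "(\<lambda>_. a) \<in> poly_deg C n"
proof -
  have "(\<lambda>_. 1) \<in> poly_deg C 0" unfolding poly_deg_def by (intro fs.span_base) simp
  from poly_deg_scale[OF this, of a] show ?thesis using poly_deg_mono[of 0 n C] by auto
qed

lemma poly_deg_0: "f \<in> poly_deg C 0 \<Longrightarrow> \<exists>a. f = (\<lambda>_. a)"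
  by (auto simp: poly_deg_def fs.span_singleton fscale_def)

lemma poly_deg_subset:
  assumes "fs.subspace W" "\<And>b. b \<in> monomials C n \<Longrightarrow> b \<in> W" shows "poly_deg C n \<subseteq> W"
  unfolding poly_deg_def using assms by (intro fs.span_minimal) auto

lemma poly_deg_coord_mult:
  assumes "c \<in> C" "f \<in> poly_deg C n" shows "(\<lambda>x. c x * f x) \<in> poly_deg C (Suc n)"
proof -
  have "poly_deg C n \<subseteq> {f. (\<lambda>x. c x * f x) \<in> poly_deg C (Suc n)}"
  proof (rule poly_deg_subset)
    show "fs.subspace {f. (\<lambda>x. c x * f x) \<in> poly_deg C (Suc n)}"
      by (auto simp: fs.subspace_def distrib_left poly_deg_const poly_deg_add
          mult.left_commute[of "c _"] poly_deg_scale)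
    fix b assume "b \<in> monomials C n"
    then have "(\<lambda>x. c x * b x) \<in> monomials C (Suc n)" using assms(1) by auto
    then show "b \<in> {f. (\<lambda>x. c x * f x) \<in> poly_deg C (Suc n)}" by (auto simp: poly_deg_def intro: fs.span_base)
  qed
  then show ?thesis using assms(2) by auto
qed

lemma poly_deg_coord: "c \<in> C \<Longrightarrow> c \<in> poly_deg C (Suc n)"
  using poly_deg_coord_mult[OF _ poly_deg_const[of 1 C n]] by simp

lemma poly_deg_mult:
  assumes "f \<in> poly_deg C m" "g \<in> poly_deg C n" shows "(\<lambda>x. f x * g x) \<in> poly_deg C (m + n)"
proof -
  have sub: "fs.subspace {f. (\<lambda>x. f x * g x) \<in> poly_deg C k}" for k
    by (auto simp: fs.subspace_def distrib_right poly_deg_const poly_deg_add mult.assoc poly_deg_scale)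
  have "(\<lambda>x. b x * g x) \<in> poly_deg C (m + n)" if "b \<in> monomials C m" for b
    using that
  proof (induction m arbitrary: b)
    case 0
    then show ?case using assms(2) by simp
  next
    case (Suc m)
    show ?case
    proof (cases "b \<in> monomials C m")
      case True
      then show ?thesis using Suc.IH poly_deg_mono[of "m + n" "Suc m + n" C] by auto
    next
      case False
      then obtain c b' where "c \<in> C" "b' \<in> monomials C m" "b = (\<lambda>x. c x * b' x)" using Suc.prems by auto
      then show ?thesis using poly_deg_coord_mult[OF _ Suc.IH] by (simp add: mult.assoc)
    qed
  qed
  then have "poly_deg C m \<subseteq> {f. (\<lambda>x. f x * g x) \<in> poly_deg C (m + n)}"
    by (intro poly_deg_subset[OF sub]) auto
  then show ?thesis using assms(1) by auto
qed

lemma poly_deg_imp_polyfun: "f \<in> poly_deg C n \<Longrightarrow> f \<in> polyfun C"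
proof -
  have "b \<in> polyfun C" if "b \<in> monomials C n" for b
    using that by (induction n arbitrary: b) (auto intro: polyfun.intros)
  then have "poly_deg C n \<subseteq> polyfun C" by (rule poly_deg_subset[OF subspace_polyfun])
  then show "f \<in> poly_deg C n \<Longrightarrow> f \<in> polyfun C" by auto
qed

lemma polyfun_imp_poly_deg: "f \<in> polyfun C \<Longrightarrow> \<exists>n. f \<in> poly_deg C n"
proof (induction rule: polyfun.induct)
  case (add f g)
  then obtain m n where "f \<in> poly_deg C m" "g \<in> poly_deg C n" by auto
  then have "f \<in> poly_deg C (max m n)" "g \<in> poly_deg C (max m n)"
    using poly_deg_mono[of m "max m n" C] poly_deg_mono[of n "max m n" C] by auto
  then show ?case using poly_deg_add by blast
qed (auto intro: poly_deg_coord poly_deg_const poly_deg_mult)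

section \<open>Point derivations\<close>

text \<open>A tangent vector at \<open>x\<close>, seen as a derivation over evaluation at
  \<open>x\<close>. The sum and product rules are imposed on polynomial functions only.\<close>

definition point_derivation :: "('a \<Rightarrow> complex) set \<Rightarrow> 'a \<Rightarrow> (('a \<Rightarrow> complex) \<Rightarrow> complex) \<Rightarrow> bool" where
  "point_derivation C x L \<longleftrightarrow> (\<forall>a. L (\<lambda>_. a) = 0) \<and>
     (\<forall>f\<in>polyfun C. \<forall>g\<in>polyfun C. L (\<lambda>y. f y + g y) = L f + L g \<and> L (\<lambda>y. f y * g y) = f x * L g + g x * L f)"

lemma point_derivationD:
  assumes "point_derivation C x L"
  shows "L (\<lambda>_. a) = 0"
    "f \<in> polyfun C \<Longrightarrow> g \<in> polyfun C \<Longrightarrow> L (\<lambda>y. f y + g y) = L f + L g"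
    "f \<in> polyfun C \<Longrightarrow> g \<in> polyfun C \<Longrightarrow> L (\<lambda>y. f y * g y) = f x * L g + g x * L f"
  using assms by (auto simp: point_derivation_def)

lemma point_derivation_unique:
  assumes "point_derivation C x L" "point_derivation C x L'" "\<And>c. c \<in> C \<Longrightarrow> L c = L' c" "f \<in> polyfun C"
  shows "L f = L' f"
  using assms(4)
  by induction (simp_all add: assms(3) point_derivationD[OF assms(1)] point_derivationD[OF assms(2)])

lemma point_derivation_scale:
  "point_derivation C x L \<Longrightarrow> f \<in> polyfun C \<Longrightarrow> L (\<lambda>y. a * f y) = a * L f"
  using point_derivationD(3)[of C x L "\<lambda>_. a" f] by (simp add: polyfun.const point_derivationD(1)[of C x L])

lemma point_derivation_sum:
  assumes "point_derivation C x L" "\<And>a. a \<in> A \<Longrightarrow> f a \<in> polyfun C"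
  shows "L (\<lambda>y. \<Sum>a\<in>A. f a y) = (\<Sum>a\<in>A. L (f a))"
  using assms(2) by (induction A rule: infinite_finite_induct)
    (simp_all add: point_derivationD[OF assms(1)] polyfun_sum)

lemma point_derivation_prod:
  assumes "point_derivation C x L" "finite A" "\<And>a. a \<in> A \<Longrightarrow> f a \<in> polyfun C"
  shows "L (\<lambda>y. \<Prod>a\<in>A. f a y) = (\<Sum>a\<in>A. L (f a) * (\<Prod>b\<in>A - {a}. f b x))"
  using assms(2,3)
proof (induction A rule: finite_induct)
  case (insert a A)
  have "(\<Prod>b\<in>insert a A - {c}. f b x) = f a x * (\<Prod>b\<in>A - {c}. f b x)" if "c \<in> A" for c
  proof -
    have "insert a A - {c} = insert a (A - {c})" using insert.hyps that by auto
    then show ?thesis using insert.hyps by simp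
  qed
  moreover have "insert a A - {a} = A" using insert.hyps by auto
  ultimately show ?case using insert
    by (simp add: point_derivationD[OF assms(1)] polyfun_prod sum_distrib_left algebra_simps)
qed (simp add: point_derivationD[OF assms(1)])

lemma point_derivation_pullback:
  assumes "point_derivation C x L" "\<And>c. c \<in> C' \<Longrightarrow> (\<lambda>x. c (m x)) \<in> polyfun C"
  shows "point_derivation C' (m x) (\<lambda>f. L (\<lambda>x. f (m x)))"
proof -
  have "(\<lambda>x. f (m x)) \<in> polyfun C" if "f \<in> polyfun C'" for f
    using that assms(2) by (rule polyfun_compose)
  then show ?thesis
    unfolding point_derivation_def by (simp add: point_derivationD[OF assms(1)])
qed

lemma point_derivation_lincomb:
  assumes "\<And>a. a \<in> A \<Longrightarrow> point_derivation C x (L a)"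
  shows "point_derivation C x (\<lambda>f. \<Sum>a\<in>A. r a * L a f)"
  unfolding point_derivation_def
proof (intro conjI ballI allI)
  show "(\<Sum>b\<in>A. r b * L b (\<lambda>_. a)) = 0" for a
    by (rule sum.neutral) (simp add: point_derivationD(1)[OF assms])
  fix f g assume fg: "f \<in> polyfun C" "g \<in> polyfun C"
  show "(\<Sum>a\<in>A. r a * L a (\<lambda>y. f y + g y)) = (\<Sum>a\<in>A. r a * L a f) + (\<Sum>a\<in>A. r a * L a g)"
    unfolding sum.distrib[symmetric]
    by (rule sum.cong) (simp_all add: point_derivationD(2)[OF assms] fg algebra_simps)
  show "(\<Sum>a\<in>A. r a * L a (\<lambda>y. f y * g y)) = f x * (\<Sum>a\<in>A. r a * L a g) + g x * (\<Sum>a\<in>A. r a * L a f)"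
    unfolding sum.distrib[symmetric] sum_distrib_left
    by (rule sum.cong) (simp_all add: point_derivationD(3)[OF assms] fg algebra_simps)
qed

section \<open>Partial derivatives of polynomial functions\<close>

definition vars :: "'i set \<Rightarrow> (('i \<Rightarrow> complex) \<Rightarrow> complex) set" where
  "vars I = (\<lambda>i z. z i) ` I"

lemma vars_coord: "i \<in> I \<Longrightarrow> (\<lambda>z. z i) \<in> vars I"
  by (auto simp: vars_def)

lemma polyfun_vars_cong: "f \<in> polyfun (vars I) \<Longrightarrow> (\<And>i. i \<in> I \<Longrightarrow> x i = y i) \<Longrightarrow> f x = f y"
  by (erule polyfun_cong) (auto simp: vars_def)

lemma polyfun_vars_compose:
  "f \<in> polyfun (vars I) \<Longrightarrow> (\<And>i. i \<in> I \<Longrightarrow> h i \<in> polyfun C) \<Longrightarrow> (\<lambda>x. f (\<lambda>i. h i x)) \<in> polyfun C"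
  by (rule polyfun_compose[of f "vars I" "\<lambda>x i. h i x"]) (auto simp: vars_def)

lemma vars_mono: "I \<subseteq> J \<Longrightarrow> vars I \<subseteq> vars J"
  by (auto simp: vars_def)

definition pd :: "'i \<Rightarrow> (('i \<Rightarrow> complex) \<Rightarrow> complex) \<Rightarrow> ('i \<Rightarrow> complex) \<Rightarrow> complex" where
  "pd i f z = deriv (\<lambda>t. f (z(i := t))) (z i)"

lemma pd_eqI: "((\<lambda>t. f (z(i := t))) has_field_derivative d) (at (z i)) \<Longrightarrow> pd i f z = d"
  unfolding pd_def by (rule DERIV_imp_deriv)

lemma polyfun_var_derivative:
  "f \<in> polyfun (vars I) \<Longrightarrow> ((\<lambda>t. f (z(i := t))) has_field_derivative pd i f z) (at (z i))"
proof -
  assume "f \<in> polyfun (vars I)"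
  then have "\<exists>d. ((\<lambda>t. f (z(i := t))) has_field_derivative d) (at (z i))"
  proof induction
    case (coord c)
    then obtain j where c: "c = (\<lambda>z. z j)" by (auto simp: vars_def)
    show ?case by (cases "i = j") (auto simp: c intro: DERIV_ident DERIV_const)
  next
    case (const a)
    show ?case using DERIV_const by blast
  next
    case (add f g)
    then show ?case using DERIV_add by blast
  next
    case (mult f g)
    then show ?case using DERIV_mult by blast
  qed
  then show ?thesis using pd_eqI by metis
qed

lemma pd_var: "pd i (\<lambda>z. z j) z = (if i = j then 1 else 0)"
  by (rule pd_eqI) (auto intro!: derivative_eq_intros)

lemma pd_const: "pd i (\<lambda>_. a) z = 0"
  by (rule pd_eqI) simp

lemma point_derivation_pd: "point_derivation (vars I) z (\<lambda>f. pd i f z)"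
  unfolding point_derivation_def
proof (intro conjI allI ballI)
  show "pd i (\<lambda>_. a) z = 0" for a by (rule pd_eqI) simp
  fix f g assume fg: "f \<in> polyfun (vars I)" "g \<in> polyfun (vars I)"
  show "pd i (\<lambda>y. f y + g y) z = pd i f z + pd i g z"
    by (rule pd_eqI, rule DERIV_add[OF polyfun_var_derivative[OF fg(1)] polyfun_var_derivative[OF fg(2)]])
  show "pd i (\<lambda>y. f y * g y) z = f z * pd i g z + g z * pd i f z"
    by (rule pd_eqI, rule DERIV_cong[OF DERIV_mult[OF polyfun_var_derivative[OF fg(1)] polyfun_var_derivative[OF fg(2)]]])
       (simp add: algebra_simps)
qed

text \<open>The second clause covers the truncated subtraction at \<open>n = 0\<close>, so that a
  derivative of a relation of minimal degree really has smaller degree or vanishes.\<close>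

lemma pd_poly_deg:
  "f \<in> poly_deg (vars I) n \<Longrightarrow> pd i f \<in> poly_deg (vars I) (n - 1) \<and> (n = 0 \<longrightarrow> pd i f = (\<lambda>_. 0))"
proof -
  note pdD = point_derivationD[OF point_derivation_pd[of I]]
  let ?W = "\<lambda>n. {f \<in> polyfun (vars I). pd i f \<in> poly_deg (vars I) (n - 1) \<and> (n = 0 \<longrightarrow> pd i f = (\<lambda>_. 0))}"
  have sub: "fs.subspace (?W n)" for n
  proof -
    have "pd i (0 :: ('a \<Rightarrow> complex) \<Rightarrow> complex) = (\<lambda>_. 0)"
      by (auto simp: zero_fun_def pd_const)
    moreover have "pd i (f + g) = (\<lambda>z. pd i f z + pd i g z)" if "f \<in> polyfun (vars I)" "g \<in> polyfun (vars I)" for f g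
      using pdD(2)[OF that] by (auto simp: plus_fun_def)
    moreover have "pd i (fscale a f) = (\<lambda>z. a * pd i f z)" if "f \<in> polyfun (vars I)" for a f
      using point_derivation_scale[OF point_derivation_pd that] by (auto simp: fscale_def)
    ultimately show ?thesis
      unfolding fs.subspace_def
      by (auto simp: polyfun_zero polyfun_plus polyfun_fscale poly_deg_const poly_deg_add poly_deg_scale)
  qed
  have "b \<in> ?W n" if "b \<in> monomials (vars I) n" for b n
    using that
  proof (induction n arbitrary: b)
    case 0
    have "pd i (\<lambda>_. 1) = (\<lambda>_. 0)" by (rule ext) (rule pd_const)
    with 0 show ?case by (simp add: polyfun.const poly_deg_const)
  next
    case (Suc n)
    show ?case
    proof (cases "b \<in> monomials (vars I) n")
      case True
      then show ?thesis using Suc.IH[OF True] poly_deg_mono[of "n - 1" n "vars I"] by auto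
    next
      case False
      then obtain c b' where cb: "c \<in> vars I" "b' \<in> monomials (vars I) n" "b = (\<lambda>x. c x * b' x)"
        using Suc.prems by auto
      then obtain j where j: "c = (\<lambda>z. z j)" by (auto simp: vars_def)
      have b': "b' \<in> poly_deg (vars I) n" using cb(2) by (auto simp: poly_deg_def intro: fs.span_base)
      have b'p: "b' \<in> polyfun (vars I)" using b' by (rule poly_deg_imp_polyfun)
      have cp: "c \<in> polyfun (vars I)" using cb(1) by (rule polyfun.coord)
      have eq: "pd i b = (\<lambda>z. c z * pd i b' z + (if i = j then 1 else 0) * b' z)"
        unfolding cb(3) using pdD(3)[OF cp b'p] by (auto simp: j pd_var)
      have "(\<lambda>z. c z * pd i b' z) \<in> poly_deg (vars I) n"
      proof (cases n)
        case 0
        then show ?thesis using Suc.IH[OF cb(2)] by (auto simp: poly_deg_const)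
      next
        case (Suc m)
        then show ?thesis using \<open>b' \<in> monomials (vars I) n\<close> Suc.IH[OF cb(2)] poly_deg_coord_mult[OF cb(1)] by auto
      qed
      then have "pd i b \<in> poly_deg (vars I) n" unfolding eq by (intro poly_deg_add poly_deg_scale b')
      moreover have "b \<in> polyfun (vars I)" unfolding cb(3) by (intro polyfun.mult cp b'p)
      ultimately show ?thesis by simp
    qed
  qed
  then show "f \<in> poly_deg (vars I) n \<Longrightarrow> ?thesis"
    using poly_deg_subset[OF sub, of "vars I" n n] by auto
qed

lemma pd_polyfun: "f \<in> polyfun (vars I) \<Longrightarrow> pd i f \<in> polyfun (vars I)"
  using polyfun_imp_poly_deg pd_poly_deg poly_deg_imp_polyfun by metis

text \<open>Both sides are derivations in \<open>f\<close> at the same point and agree on the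
  variables.\<close>

lemma polyfun_chain_rule:
  assumes "finite I" "f \<in> polyfun (vars I)" "point_derivation C x L" "\<And>i. i \<in> I \<Longrightarrow> h i \<in> polyfun C"
  shows "L (\<lambda>x. f (\<lambda>i. h i x)) = (\<Sum>i\<in>I. L (h i) * pd i f (\<lambda>i. h i x))"
proof (rule point_derivation_unique[OF _ _ _ assms(2)])
  show "point_derivation (vars I) (\<lambda>i. h i x) (\<lambda>f. L (\<lambda>x. f (\<lambda>i. h i x)))"
    by (rule point_derivation_pullback[OF assms(3)]) (auto simp: vars_def assms(4))
  show "point_derivation (vars I) (\<lambda>i. h i x) (\<lambda>f. \<Sum>i\<in>I. L (h i) * pd i f (\<lambda>i. h i x))"
    by (rule point_derivation_lincomb) (rule point_derivation_pd)
  fix c assume "c \<in> vars I"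
  then obtain j where j: "j \<in> I" "c = (\<lambda>z. z j)" by (auto simp: vars_def)
  then show "L (\<lambda>x. c (\<lambda>i. h i x)) = (\<Sum>i\<in>I. L (h i) * pd i c (\<lambda>i. h i x))"
    using assms(1) by (simp add: pd_var if_distrib sum.delta cong: if_cong)
qed

lemma polyfun_curve_derivative:
  assumes "finite I" "f \<in> polyfun (vars I)" "\<And>i. i \<in> I \<Longrightarrow> ((\<lambda>t. \<gamma> t i) has_field_derivative d i) (at t0)"
  shows "((\<lambda>t. f (\<gamma> t)) has_field_derivative (\<Sum>i\<in>I. d i * pd i f (\<gamma> t0))) (at t0)"
  using assms(2)
proof induction
  case (coord c)
  then obtain j where j: "j \<in> I" "c = (\<lambda>z. z j)" by (auto simp: vars_def)
  then show ?case using assms(1,3) by (simp add: pd_var if_distrib sum.delta cong: if_cong)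
next
  case (const a)
  show ?case by (simp add: pd_const)
next
  case (add f g)
  show ?case
    by (rule DERIV_cong[OF DERIV_add[OF add.IH]])
      (simp add: point_derivationD(2)[OF point_derivation_pd add.hyps] algebra_simps sum.distrib)
next
  case (mult f g)
  show ?case
    by (rule DERIV_cong[OF DERIV_mult[OF mult.IH]])
      (simp add: point_derivationD(3)[OF point_derivation_pd mult.hyps] sum_distrib_left sum.distrib algebra_simps)
qed

section \<open>Noetherian rings of functions\<close>

text \<open>The ascending chain condition in the form in which it is used: in every sequence some
  member lies in the ideal generated by its predecessors.\<close>

definition seq_noetherian :: "('a \<Rightarrow> complex) set \<Rightarrow> bool" where
  "seq_noetherian R \<longleftrightarrow> (\<forall>a :: nat \<Rightarrow> 'a \<Rightarrow> complex. (\<forall>n. a n \<in> R) \<longrightarrow>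
     (\<exists>n r. (\<forall>i<n. r i \<in> R) \<and> a n = (\<lambda>x. \<Sum>i<n. r i x * a i x)))"

lemma seq_noetherian_constants: "seq_noetherian (polyfun {})"
  unfolding seq_noetherian_def
proof (intro allI impI)
  fix a :: "nat \<Rightarrow> 'a \<Rightarrow> complex"
  assume a: "\<forall>n. a n \<in> polyfun {}"
  have "\<exists>c. f = (\<lambda>_. c)" if "f \<in> polyfun {}" for f :: "'a \<Rightarrow> complex"
    using that by induction auto
  then have "\<forall>n. \<exists>c. a n = (\<lambda>_. c)" using a by simp
  then obtain c where c: "\<And>n. a n = (\<lambda>_. c n)" by metis
  show "\<exists>n r. (\<forall>i<n. r i \<in> polyfun {}) \<and> a n = (\<lambda>x. \<Sum>i<n. r i x * a i x)"
  proof (cases "c 0 = 0")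
    case True
    then show ?thesis using c by (intro exI[of _ 0]) auto
  next
    case False
    then show ?thesis using c
      by (intro exI[of _ 1] exI[of _ "\<lambda>_ _. c 1 / c 0"]) (auto intro: polyfun.const)
  qed
qed

text \<open>The strict bound leaves only the zero function at \<open>d = 0\<close>. The function
  \<open>c\<close> may be algebraic over \<open>R\<close>, so coefficients are not unique and only
  the existence of such an expression counts.\<close>

definition deg_less :: "('a \<Rightarrow> complex) set \<Rightarrow> ('a \<Rightarrow> complex) \<Rightarrow> nat \<Rightarrow> ('a \<Rightarrow> complex) set" where
  "deg_less R c d = {f. \<exists>q. (\<forall>i. q i \<in> R) \<and> f = (\<lambda>x. \<Sum>i<d. q i x * c x ^ i)}"

lemma deg_lessI: "(\<And>i. q i \<in> R) \<Longrightarrow> f = (\<lambda>x. \<Sum>i<d. q i x * c x ^ i) \<Longrightarrow> f \<in> deg_less R c d"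
  unfolding deg_less_def by auto

context
  fixes C :: "('a \<Rightarrow> complex) set" and c :: "'a \<Rightarrow> complex"
begin

private abbreviation "R \<equiv> polyfun C"
private abbreviation "S \<equiv> polyfun (insert c C)"
private abbreviation "D \<equiv> deg_less R c"

lemma deg_less_mono: "f \<in> D d \<Longrightarrow> d \<le> e \<Longrightarrow> f \<in> D e"
proof -
  assume f: "f \<in> D d" and de: "d \<le> e"
  obtain q where q: "\<And>i. q i \<in> R" "f = (\<lambda>x. \<Sum>i<d. q i x * c x ^ i)" using f by (auto simp: deg_less_def)
  show "f \<in> D e"
  proof (rule deg_lessI[of "\<lambda>i. if i < d then q i else (\<lambda>_. 0)"])
    have "(\<Sum>i<d. q i x * c x ^ i) = (\<Sum>i<e. (if i < d then q i else (\<lambda>_. 0)) x * c x ^ i)" for x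
      by (rule sum.mono_neutral_cong_left) (use de in auto)
    then show "f = (\<lambda>x. \<Sum>i<e. (if i < d then q i else (\<lambda>_. 0)) x * c x ^ i)" using q(2) by auto
  qed (use q in \<open>auto intro: polyfun.const\<close>)
qed

lemma deg_less_add: "f \<in> D d \<Longrightarrow> g \<in> D d \<Longrightarrow> (\<lambda>x. f x + g x) \<in> D d"
proof -
  assume f: "f \<in> D d" and g: "g \<in> D d"
  obtain q where q: "\<And>i. q i \<in> R" "f = (\<lambda>x. \<Sum>i<d. q i x * c x ^ i)" using f by (auto simp: deg_less_def)
  obtain p where p: "\<And>i. p i \<in> R" "g = (\<lambda>x. \<Sum>i<d. p i x * c x ^ i)" using g by (auto simp: deg_less_def)
  show ?thesis
    by (rule deg_lessI[of "\<lambda>i x. q i x + p i x"])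
      (use p q in \<open>auto intro: polyfun.add simp: sum.distrib algebra_simps\<close>)
qed

lemma deg_less_mult: "r \<in> R \<Longrightarrow> f \<in> D d \<Longrightarrow> (\<lambda>x. r x * f x) \<in> D d"
proof -
  assume r: "r \<in> R" and f: "f \<in> D d"
  obtain q where q: "\<And>i. q i \<in> R" "f = (\<lambda>x. \<Sum>i<d. q i x * c x ^ i)" using f by (auto simp: deg_less_def)
  show ?thesis
    by (rule deg_lessI[of "\<lambda>i x. r x * q i x"])
      (use r q in \<open>auto intro: polyfun.mult simp: sum_distrib_left mult.assoc\<close>)
qed

lemma deg_less_shift: "f \<in> D d \<Longrightarrow> (\<lambda>x. c x ^ k * f x) \<in> D (d + k)"
proof (induction k)
  case (Suc k)
  then obtain q where q: "\<And>i. q i \<in> R" "(\<lambda>x. c x ^ k * f x) = (\<lambda>x. \<Sum>i<d + k. q i x * c x ^ i)"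
    by (auto simp: deg_less_def)
  show ?case
  proof (rule deg_lessI[of "\<lambda>i. case i of 0 \<Rightarrow> (\<lambda>_. 0) | Suc j \<Rightarrow> q j"])
    have "c x ^ Suc k * f x = c x * (\<Sum>i<d + k. q i x * c x ^ i)" for x
      using fun_cong[OF q(2), of x] by (simp add: mult.assoc)
    moreover have "(\<Sum>i<d + Suc k. (case i of 0 \<Rightarrow> (\<lambda>_. 0) | Suc j \<Rightarrow> q j) x * c x ^ i) =
        c x * (\<Sum>i<d + k. q i x * c x ^ i)" for x
      by (simp only: add_Suc_right sum.lessThan_Suc_shift) (simp add: sum_distrib_left mult_ac)
    ultimately show "(\<lambda>x. c x ^ Suc k * f x) = (\<lambda>x. \<Sum>i<d + Suc k. (case i of 0 \<Rightarrow> (\<lambda>_. 0) | Suc j \<Rightarrow> q j) x * c x ^ i)"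
      by auto
  qed (use q in \<open>auto intro: polyfun.const split: nat.split\<close>)
qed simp

lemma deg_less_zero: "(\<lambda>_. 0) \<in> D d"
  by (rule deg_lessI[of "\<lambda>_ _. 0"]) (auto intro: polyfun.const)

lemma deg_less_sum: "(\<And>i. i \<in> I \<Longrightarrow> f i \<in> D d) \<Longrightarrow> (\<lambda>x. \<Sum>i\<in>I. f i x) \<in> D d"
  by (induction I rule: infinite_finite_induct) (auto intro: deg_less_zero deg_less_add)

lemma deg_less_const_coeff: "r \<in> R \<Longrightarrow> r \<in> D 1"
  by (rule deg_lessI[of "\<lambda>_. r"]) auto

lemma polyfun_insert_deg_less: "f \<in> S \<Longrightarrow> \<exists>d. f \<in> D d"
proof (induction rule: polyfun.induct)
  case (coord f)
  show ?case
  proof (cases "f = c")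
    case True
    have "(\<lambda>_. 1) \<in> D 1" by (intro deg_less_const_coeff polyfun.const)
    from deg_less_shift[OF this, of 1] show ?thesis using True by auto
  next
    case False
    then show ?thesis using coord deg_less_const_coeff polyfun.coord by blast
  qed
next
  case (const a)
  then show ?case using deg_less_const_coeff polyfun.const by blast
next
  case (add f g)
  then obtain d e where "f \<in> D d" "g \<in> D e" by auto
  then have "f \<in> D (max d e)" "g \<in> D (max d e)" using deg_less_mono by auto
  then show ?case using deg_less_add by blast
next
  case (mult f g)
  then obtain d e where f: "f \<in> D d" and g: "g \<in> D e" by auto
  obtain q where q: "\<And>i. q i \<in> R" "f = (\<lambda>x. \<Sum>i<d. q i x * c x ^ i)" using f by (auto simp: deg_less_def)
  have "(\<lambda>x. \<Sum>i<d. q i x * (c x ^ i * g x)) \<in> D (e + d)"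
    by (intro deg_less_sum deg_less_mult q deg_less_mono[OF deg_less_shift[OF g]]) auto
  then show ?case using q(2) by (auto simp: sum_distrib_right mult.assoc)
qed

definition ideal_of :: "(nat \<Rightarrow> 'a \<Rightarrow> complex) \<Rightarrow> nat \<Rightarrow> ('a \<Rightarrow> complex) set" where
  "ideal_of b N = {g. \<exists>r. (\<forall>i<N. r i \<in> S) \<and> g = (\<lambda>x. \<Sum>i<N. r i x * b i x)}"

lemma ideal_of_0: "(\<lambda>_. 0) \<in> ideal_of b N"
  unfolding ideal_of_def by (intro CollectI exI[of _ "\<lambda>_ _. 0"]) (auto intro: polyfun.const)

lemma ideal_of_add: "f \<in> ideal_of b N \<Longrightarrow> g \<in> ideal_of b N \<Longrightarrow> (\<lambda>x. f x + g x) \<in> ideal_of b N"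
proof -
  assume "f \<in> ideal_of b N" "g \<in> ideal_of b N"
  then obtain r s where "\<forall>i<N. r i \<in> S" "f = (\<lambda>x. \<Sum>i<N. r i x * b i x)"
    "\<forall>i<N. s i \<in> S" "g = (\<lambda>x. \<Sum>i<N. s i x * b i x)" by (auto simp: ideal_of_def)
  then show ?thesis unfolding ideal_of_def
    by (intro CollectI exI[of _ "\<lambda>i x. r i x + s i x"]) (auto intro: polyfun.add simp: sum.distrib algebra_simps)
qed

lemma ideal_of_mult: "s \<in> S \<Longrightarrow> f \<in> ideal_of b N \<Longrightarrow> (\<lambda>x. s x * f x) \<in> ideal_of b N"
proof -
  assume s: "s \<in> S" and "f \<in> ideal_of b N"
  then obtain r where "\<forall>i<N. r i \<in> S" "f = (\<lambda>x. \<Sum>i<N. r i x * b i x)" by (auto simp: ideal_of_def)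
  then show ?thesis unfolding ideal_of_def
    by (intro CollectI exI[of _ "\<lambda>i x. s x * r i x"]) (auto intro: polyfun.mult s simp: sum_distrib_left mult.assoc)
qed

lemma ideal_of_sum: "(\<And>i. i \<in> I \<Longrightarrow> f i \<in> ideal_of b N) \<Longrightarrow> (\<lambda>x. \<Sum>i\<in>I. f i x) \<in> ideal_of b N"
  by (induction I rule: infinite_finite_induct) (auto intro: ideal_of_0 ideal_of_add)

lemma ideal_of_mono: "f \<in> ideal_of b M \<Longrightarrow> M \<le> N \<Longrightarrow> f \<in> ideal_of b N"
proof -
  assume f: "f \<in> ideal_of b M" and MN: "M \<le> N"
  then obtain r where r: "\<forall>i<M. r i \<in> S" "f = (\<lambda>x. \<Sum>i<M. r i x * b i x)" by (auto simp: ideal_of_def)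
  have "(\<Sum>i<M. r i x * b i x) = (\<Sum>i<N. (if i < M then r i else (\<lambda>_. 0)) x * b i x)" for x
    by (rule sum.mono_neutral_cong_left) (use MN in auto)
  then show ?thesis using r unfolding ideal_of_def
    by (intro CollectI exI[of _ "\<lambda>i. if i < M then r i else (\<lambda>_. 0)"]) (auto intro: polyfun.const)
qed

lemma ideal_of_base: "i < N \<Longrightarrow> b i \<in> ideal_of b N"
proof -
  assume i: "i < N"
  have "(\<Sum>j<N. (if j = i then 1 else 0) * b j x) = (\<Sum>j<N. if j = i then b i x else 0)" for x
    by (rule sum.cong) auto
  then have "b i = (\<lambda>x. \<Sum>j<N. (if j = i then 1 else 0) * b j x)" using i by auto
  then show ?thesis unfolding ideal_of_def
    by (intro CollectI exI[of _ "\<lambda>j x. if j = i then 1 else 0"]) (auto intro: polyfun.const)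
qed

lemma ideal_of_subset: "(\<And>i. i < n \<Longrightarrow> f i \<in> ideal_of b N) \<Longrightarrow> ideal_of f n \<subseteq> ideal_of b N"
  unfolding ideal_of_def[of f] by (auto intro!: ideal_of_sum ideal_of_mult)

lemma ideal_of_cong: "(\<And>i. i < n \<Longrightarrow> f i = g i) \<Longrightarrow> ideal_of f n = ideal_of g n"
  unfolding ideal_of_def by (intro Collect_cong ex_cong1 conj_cong refl) (auto intro!: sum.cong)

text \<open>Hilbert's basis theorem. From a sequence violating the condition one picks
  \<open>f n\<close> of least degree outside the ideal of its predecessors; a relation among the
  leading coefficients then produces an element of smaller degree that is still outside.\<close>

lemma seq_noetherian_insert:
  assumes "seq_noetherian R" shows "seq_noetherian S"
  unfolding seq_noetherian_def
proof (intro allI impI, rule ccontr)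
  fix b :: "nat \<Rightarrow> 'a \<Rightarrow> complex"
  assume b: "\<forall>n. b n \<in> S" and "\<not> (\<exists>n r. (\<forall>i<n. r i \<in> S) \<and> b n = (\<lambda>x. \<Sum>i<n. r i x * b i x))"
  then have bad: "b n \<notin> ideal_of b n" for n by (auto simp: ideal_of_def)
  define I where "I = (\<Union>N. ideal_of b N)"
  have I_add: "(\<lambda>x. f x + g x) \<in> I" if fg: "f \<in> I" "g \<in> I" for f g
  proof -
    obtain M N where "f \<in> ideal_of b M" "g \<in> ideal_of b N" using fg by (auto simp: I_def)
    then have "f \<in> ideal_of b (max M N)" "g \<in> ideal_of b (max M N)" using ideal_of_mono by auto
    from ideal_of_add[OF this] show ?thesis unfolding I_def by (rule UN_I[OF UNIV_I])
  qed
  have I_mult: "(\<lambda>x. s x * f x) \<in> I" if "s \<in> S" "f \<in> I" for s f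
  proof -
    obtain N where "f \<in> ideal_of b N" using \<open>f \<in> I\<close> by (auto simp: I_def)
    from ideal_of_mult[OF that(1) this] show ?thesis unfolding I_def by (rule UN_I[OF UNIV_I])
  qed
  have I_0: "(\<lambda>_. 0) \<in> I" using ideal_of_0 by (auto simp: I_def)
  have I_sum: "(\<lambda>x. \<Sum>i\<in>J. f i x) \<in> I" if "\<And>i. i \<in> J \<Longrightarrow> f i \<in> I" for J :: "nat set" and f
    using that by (induction J rule: infinite_finite_induct) (auto intro: I_0 I_add)
  have IS: "f \<in> S" if "f \<in> I" for f
    using that b by (auto simp: I_def ideal_of_def intro!: polyfun_sum polyfun.mult)
  have nonempty: "\<exists>g\<in>I. g \<notin> ideal_of f n" if "\<And>i. i < n \<Longrightarrow> f i \<in> I" for f n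
  proof -
    have "\<exists>N. \<forall>i<n. f i \<in> ideal_of b N" using that
    proof (induction n)
      case (Suc n)
      then obtain N where N: "\<forall>i<n. f i \<in> ideal_of b N" by auto
      obtain M where "f n \<in> ideal_of b M" using Suc.prems by (auto simp: I_def)
      then have "\<forall>i<Suc n. f i \<in> ideal_of b (max M N)"
        using N ideal_of_mono[of _ b N "max M N"] ideal_of_mono[of _ b M "max M N"] by (auto simp: less_Suc_eq)
      then show ?case by blast
    qed simp
    then obtain N where "\<forall>i<n. f i \<in> ideal_of b N" by blast
    then have "ideal_of f n \<subseteq> ideal_of b N" by (intro ideal_of_subset) auto
    moreover have "b N \<in> I" using ideal_of_base[of N "Suc N" b] by (auto simp: I_def)
    ultimately show ?thesis using bad by blast
  qed
  \<comment> \<open>The condition on \<open>f n\<close> involves only the earlier values, as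
    \<open>ideal_of_cong\<close> shows, so the choice can be made by recursion.\<close>
  define Q where "Q f n g \<longleftrightarrow> g \<in> I \<and> g \<notin> ideal_of f n \<and>
      (\<exists>d. g \<in> D d \<and> (\<forall>h\<in>I. h \<notin> ideal_of f n \<longrightarrow> (\<forall>d'<d. h \<notin> D d')))" for f n g
  have "\<exists>f. \<forall>n. Q f n (f n)"
  proof (rule dependent_wellorder_choice)
    fix r and f g :: "nat \<Rightarrow> 'a \<Rightarrow> complex" and n :: nat assume "\<And>m. m < n \<Longrightarrow> f m = g m"
    then have "ideal_of f n = ideal_of g n" by (rule ideal_of_cong)
    then show "Q f n r = Q g n r" by (simp add: Q_def)
  next
    fix n :: nat and f :: "nat \<Rightarrow> 'a \<Rightarrow> complex" assume "\<And>m. m < n \<Longrightarrow> Q f m (f m)"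
    then obtain g0 where g0: "g0 \<in> I" "g0 \<notin> ideal_of f n" using nonempty[of n f] by (auto simp: Q_def)
    obtain d0 where "g0 \<in> D d0" using polyfun_insert_deg_less[OF IS[OF g0(1)]] by blast
    with g0 have "\<exists>d. \<exists>g\<in>I. g \<notin> ideal_of f n \<and> g \<in> D d" by blast
    then obtain d g where "g \<in> I" "g \<notin> ideal_of f n" "g \<in> D d"
      "\<forall>d'<d. \<not> (\<exists>g\<in>I. g \<notin> ideal_of f n \<and> g \<in> D d')"
      using exists_least_iff[of "\<lambda>d. \<exists>g\<in>I. g \<notin> ideal_of f n \<and> g \<in> D d"] by blast
    then show "\<exists>g. Q f n g" unfolding Q_def by blast
  qed
  then obtain f where f: "\<And>n. Q f n (f n)" by blast
  have "\<forall>n. \<exists>d. f n \<in> D d \<and> (\<forall>h\<in>I. h \<notin> ideal_of f n \<longrightarrow> (\<forall>d'<d. h \<notin> D d'))"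
    using f by (auto simp: Q_def)
  then obtain d where d: "\<And>n. f n \<in> D (d n)" "\<And>n h d'. h \<in> I \<Longrightarrow> h \<notin> ideal_of f n \<Longrightarrow> d' < d n \<Longrightarrow> h \<notin> D d'"
    by metis
  have fI: "f n \<in> I" and fbad: "f n \<notin> ideal_of f n" for n using f by (auto simp: Q_def)
  have "\<forall>n. \<exists>q. (\<forall>i. q i \<in> R) \<and> f n = (\<lambda>x. \<Sum>i<d n. q i x * c x ^ i)"
    using d(1) by (auto simp: deg_less_def)
  then obtain q where q: "\<And>n i. q n i \<in> R" "\<And>n. f n = (\<lambda>x. \<Sum>i<d n. q n i x * c x ^ i)" by metis
  have dpos: "d n \<noteq> 0" for n
  proof
    assume "d n = 0"
    then have "f n = (\<lambda>_. 0)" using q(2)[of n] by simp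
    then show False using fbad[of n] ideal_of_0 by simp
  qed
  have dmono: "d i \<le> d n" if "i \<le> n" for i n
  proof (rule ccontr)
    assume "\<not> d i \<le> d n"
    moreover have "f n \<notin> ideal_of f i" using fbad[of n] ideal_of_mono that by blast
    ultimately show False using d(2)[OF fI, of n i "d n"] d(1)[of n] by auto
  qed
  define lead where "lead n = q n (d n - 1)" for n
  define low where "low n = (\<lambda>x. \<Sum>i<d n - 1. q n i x * c x ^ i)" for n
  have low: "low n \<in> D (d n - 1)" for n unfolding low_def by (rule deg_lessI[OF q(1) refl])
  have split: "f n x = low n x + lead n x * c x ^ (d n - 1)" for n x
    using dpos[of n] by (cases "d n") (simp_all add: q(2) low_def lead_def)
  have "\<forall>n. lead n \<in> R" using q(1) by (simp add: lead_def)
  then have "\<exists>n r. (\<forall>i<n. r i \<in> R) \<and> lead n = (\<lambda>x. \<Sum>i<n. r i x * lead i x)"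
    using assms by (simp add: seq_noetherian_def)
  then obtain n r where r: "\<And>i. i < n \<Longrightarrow> r i \<in> R" "lead n = (\<lambda>x. \<Sum>i<n. r i x * lead i x)"
    by (elim exE conjE) blast
  \<comment> \<open>The combination cancels the leading coefficient of \<open>f n\<close>; the
    exponents \<open>d n - d i\<close> are genuine differences since the least degrees
    increase.\<close>
  define g where "g = (\<lambda>x. f n x + (\<Sum>i<n. (- r i x * c x ^ (d n - d i)) * f i x))"
  have rS: "(\<lambda>x. - r i x * c x ^ (d n - d i)) \<in> S" if "i < n" for i
    by (intro polyfun.mult polyfun_uminus polyfun_power polyfun.coord insertI1 polyfun_mono[OF r(1)[OF that]]) auto
  have gI: "g \<in> I" unfolding g_def by (intro I_add fI I_sum I_mult rS) auto
  have gbad: "g \<notin> ideal_of f n"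
  proof
    assume "g \<in> ideal_of f n"
    moreover have "(\<lambda>x. (-1) * (\<Sum>i<n. (- r i x * c x ^ (d n - d i)) * f i x)) \<in> ideal_of f n"
      by (intro ideal_of_mult polyfun.const ideal_of_sum rS ideal_of_base) auto
    ultimately have "(\<lambda>x. g x + (-1) * (\<Sum>i<n. (- r i x * c x ^ (d n - d i)) * f i x)) \<in> ideal_of f n"
      by (rule ideal_of_add)
    then show False using fbad[of n] by (simp add: g_def)
  qed
  have "g = (\<lambda>x. low n x + (\<Sum>i<n. - r i x * (c x ^ (d n - d i) * low i x)))"
  proof
    fix x
    have "c x ^ (d n - d i) * f i x = c x ^ (d n - d i) * low i x + lead i x * c x ^ (d n - 1)" if "i < n" for i
    proof -
      have "(d n - d i) + (d i - 1) = d n - 1" using dmono[of i n] dpos[of i] that by simp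
      then have "c x ^ (d n - d i) * c x ^ (d i - 1) = c x ^ (d n - 1)" by (metis power_add)
      then show ?thesis unfolding split by (simp add: algebra_simps)
    qed
    note shifted = this
    have "(- r i x * c x ^ (d n - d i)) * f i x =
        - r i x * (c x ^ (d n - d i) * low i x) - (r i x * lead i x) * c x ^ (d n - 1)" if "i < n" for i
    proof -
      have "(- r i x * c x ^ (d n - d i)) * f i x = - r i x * (c x ^ (d n - d i) * f i x)" by simp
      also have "\<dots> = - r i x * (c x ^ (d n - d i) * low i x + lead i x * c x ^ (d n - 1))"
        by (simp only: shifted[OF that])
      finally show ?thesis by (simp add: algebra_simps)
    qed
    then have "(\<Sum>i<n. (- r i x * c x ^ (d n - d i)) * f i x) =
        (\<Sum>i<n. - r i x * (c x ^ (d n - d i) * low i x) - (r i x * lead i x) * c x ^ (d n - 1))"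
      by (intro sum.cong refl) simp
    also have "\<dots> = (\<Sum>i<n. - r i x * (c x ^ (d n - d i) * low i x)) - lead n x * c x ^ (d n - 1)"
      by (simp add: sum_subtractf r(2) sum_distrib_right)
    finally show "g x = low n x + (\<Sum>i<n. - r i x * (c x ^ (d n - d i) * low i x))"
      by (simp add: g_def split[of n])
  qed
  also have "\<dots> \<in> D (d n - 1)"
  proof (intro deg_less_add low deg_less_sum deg_less_mult[of "\<lambda>x. - r _ x"] polyfun_uminus r(1))
    fix i assume "i \<in> {..<n}"
    then show "i < n" "(\<lambda>x. c x ^ (d n - d i) * low i x) \<in> D (d n - 1)"
      using deg_less_mono[OF deg_less_shift[OF low[of i], of "d n - d i"], of "d n - 1"] dmono[of i n] dpos[of i] by auto
  qed
  finally show False using d(2)[OF gI gbad, of "d n - 1"] dpos[of n] by auto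
qed

end

theorem seq_noetherian_polyfun: "finite C \<Longrightarrow> seq_noetherian (polyfun C)"
  by (induction rule: finite_induct) (simp_all add: seq_noetherian_constants seq_noetherian_insert)

section \<open>Irreducible components\<close>

definition irreducible_on :: "('a \<Rightarrow> complex) set \<Rightarrow> 'a set \<Rightarrow> bool" where
  "irreducible_on C X \<longleftrightarrow> (\<forall>f\<in>polyfun C. \<forall>g\<in>polyfun C. (\<forall>x\<in>X. f x * g x = 0) \<longrightarrow>
     (\<forall>x\<in>X. f x = 0) \<or> (\<forall>x\<in>X. g x = 0))"

definition closed_in_set :: "('a \<Rightarrow> complex) set \<Rightarrow> 'a set \<Rightarrow> 'a set \<Rightarrow> bool" where
  "closed_in_set C X Z \<longleftrightarrow> (\<exists>F\<subseteq>polyfun C. Z = {x \<in> X. \<forall>f\<in>F. f x = 0})"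

lemma irreducible_onD:
  "irreducible_on C X \<Longrightarrow> f \<in> polyfun C \<Longrightarrow> g \<in> polyfun C \<Longrightarrow> (\<And>x. x \<in> X \<Longrightarrow> f x * g x = 0) \<Longrightarrow>
    (\<forall>x\<in>X. f x = 0) \<or> (\<forall>x\<in>X. g x = 0)"
  by (simp add: irreducible_on_def)

text \<open>Termination of the splitting into components. Witnesses for an infinite strict growth of
  the ideals would form a sequence in which no member lies in the ideal of its predecessors, since
  these vanish on a set where it does not.\<close>

lemma wf_vanishing_ideal:
  assumes "finite C"
  shows "wf {(Y, X). Y \<subseteq> X \<and> vanishing_ideal C X \<subset> vanishing_ideal C Y}"
proof (rule ccontr)
  assume "\<not> ?thesis"
  then obtain X where "\<forall>n. (X (Suc n), X n) \<in> {(Y, X). Y \<subseteq> X \<and> vanishing_ideal C X \<subset> vanishing_ideal C Y}"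
    unfolding wf_iff_no_infinite_down_chain by blast
  then have X: "\<And>n. X (Suc n) \<subseteq> X n" "\<And>n. vanishing_ideal C (X n) \<subset> vanishing_ideal C (X (Suc n))"
    by auto
  have "\<forall>n. \<exists>f. f \<in> vanishing_ideal C (X (Suc n)) \<and> f \<notin> vanishing_ideal C (X n)" using X(2) by blast
  then obtain f where f: "\<And>n. f n \<in> vanishing_ideal C (X (Suc n))" "\<And>n. f n \<notin> vanishing_ideal C (X n)" by metis
  have fp: "f n \<in> polyfun C" for n using f(1) by (auto simp: vanishing_ideal_def)
  then have "\<exists>n r. (\<forall>i<n. r i \<in> polyfun C) \<and> f n = (\<lambda>x. \<Sum>i<n. r i x * f i x)"
    using seq_noetherian_polyfun[OF assms] by (auto simp: seq_noetherian_def)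
  then obtain n r where n: "f n = (\<lambda>x. \<Sum>i<n. r i x * f i x)" by (elim exE conjE)
  have "f i x = 0" if "i < n" "x \<in> X n" for i x
  proof -
    have "X n \<subseteq> X (Suc i)" by (rule lift_Suc_antimono_le[of X]) (use X(1) that in auto)
    then show ?thesis using f(1)[of i] that by (auto simp: vanishing_ideal_def)
  qed
  note zero = this
  have "f n x = 0" if "x \<in> X n" for x
  proof -
    have "f n x = (\<Sum>i<n. r i x * f i x)" by (rule fun_cong[OF n])
    also have "\<dots> = 0" by (rule sum.neutral) (use zero that in simp)
    finally show ?thesis .
  qed
  then show False using f(2)[of n] fp by (auto simp: vanishing_ideal_def)
qed

lemma irreducible_decomposition:
  assumes "finite C"
  shows "\<exists>\<Z>. finite \<Z> \<and> \<Union>\<Z> = X \<and> (\<forall>Z\<in>\<Z>. irreducible_on C Z \<and> closed_in_set C X Z)"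
proof (induction X rule: wf_induct_rule[OF wf_vanishing_ideal[OF assms]])
  case (1 X)
  show ?case
  proof (cases "irreducible_on C X")
    case True
    moreover have "closed_in_set C X X" unfolding closed_in_set_def by (intro exI[of _ "{}"]) auto
    ultimately show ?thesis by (intro exI[of _ "{X}"]) auto
  next
    case False
    then obtain f g where fg: "f \<in> polyfun C" "g \<in> polyfun C" "\<forall>x\<in>X. f x * g x = 0" "\<exists>x\<in>X. f x \<noteq> 0" "\<exists>x\<in>X. g x \<noteq> 0"
      unfolding irreducible_on_def by blast
    have sub: "\<exists>\<Z>. finite \<Z> \<and> \<Union>\<Z> = {x \<in> X. h x = 0} \<and> (\<forall>Z\<in>\<Z>. irreducible_on C Z \<and> closed_in_set C X Z)"
      if h: "h \<in> polyfun C" "\<exists>x\<in>X. h x \<noteq> 0" for h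
    proof -
      let ?Y = "{x \<in> X. h x = 0}"
      have "h \<in> vanishing_ideal C ?Y" "h \<notin> vanishing_ideal C X" using h by (auto simp: vanishing_ideal_def)
      moreover have "vanishing_ideal C X \<subseteq> vanishing_ideal C ?Y" by (auto simp: vanishing_ideal_def)
      ultimately have "(?Y, X) \<in> {(Y, X). Y \<subseteq> X \<and> vanishing_ideal C X \<subset> vanishing_ideal C Y}" by blast
      from 1[OF this] obtain \<Z> where Z: "finite \<Z>" "\<Union>\<Z> = ?Y" "\<forall>Z\<in>\<Z>. irreducible_on C Z \<and> closed_in_set C ?Y Z"
        by (elim exE conjE)
      have "closed_in_set C X Z" if "Z \<in> \<Z>" for Z
      proof -
        have "closed_in_set C ?Y Z" using Z(3) \<open>Z \<in> \<Z>\<close> by blast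
        then obtain F where "F \<subseteq> polyfun C" "Z = {x \<in> ?Y. \<forall>f\<in>F. f x = 0}"
          unfolding closed_in_set_def by (elim exE conjE)
        then show ?thesis using h(1) unfolding closed_in_set_def by (intro exI[of _ "insert h F"]) auto
      qed
      with Z show ?thesis by (intro exI[of _ \<Z>]) auto
    qed
    obtain \<Z>1 where Z1: "finite \<Z>1" "\<Union>\<Z>1 = {x \<in> X. f x = 0}" "\<forall>Z\<in>\<Z>1. irreducible_on C Z \<and> closed_in_set C X Z"
      using sub[OF fg(1,4)] by (elim exE conjE)
    obtain \<Z>2 where Z2: "finite \<Z>2" "\<Union>\<Z>2 = {x \<in> X. g x = 0}" "\<forall>Z\<in>\<Z>2. irreducible_on C Z \<and> closed_in_set C X Z"
      using sub[OF fg(2,5)] by (elim exE conjE)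
    have "\<Union>(\<Z>1 \<union> \<Z>2) = X" unfolding Union_Un_distrib Z1(2) Z2(2) using fg(3) by auto
    then show ?thesis using Z1(1,3) Z2(1,3) by (intro exI[of _ "\<Z>1 \<union> \<Z>2"]) auto
  qed
qed

lemma irreducible_on_prod:
  assumes "irreducible_on C Y" "Y \<noteq> {}" "finite J" "\<And>j. j \<in> J \<Longrightarrow> f j \<in> polyfun C" "\<forall>x\<in>Y. (\<Prod>j\<in>J. f j x) = 0"
  shows "\<exists>j\<in>J. \<forall>x\<in>Y. f j x = 0"
  using assms(3-5)
proof (induction rule: finite_induct)
  case empty
  then show ?case using assms(2) by auto
next
  case (insert j J)
  have "\<forall>x\<in>Y. f j x * (\<Prod>j\<in>J. f j x) = 0" using insert by auto
  moreover have "f j \<in> polyfun C" "(\<lambda>x. \<Prod>j\<in>J. f j x) \<in> polyfun C"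
    using insert.prems(1) by (auto intro: polyfun_prod)
  ultimately have "(\<forall>x\<in>Y. f j x = 0) \<or> (\<forall>x\<in>Y. (\<Prod>j\<in>J. f j x) = 0)"
    by (intro irreducible_onD[OF assms(1)]) auto
  then show ?case using insert by auto
qed

text \<open>Otherwise each member of the cover has an equation that does not vanish on
  \<open>Y\<close>, and the product of these equations contradicts irreducibility.\<close>

lemma irreducible_on_subset_component:
  assumes "irreducible_on C Y" "Y \<noteq> {}" "finite \<Z>" "Y \<subseteq> \<Union>\<Z>" "\<Union>\<Z> \<subseteq> X" "\<And>Z. Z \<in> \<Z> \<Longrightarrow> closed_in_set C X Z"
  shows "\<exists>Z\<in>\<Z>. Y \<subseteq> Z"
proof (rule ccontr)
  assume neg: "\<not> ?thesis"
  have "\<exists>f\<in>polyfun C. (\<forall>x\<in>Z. f x = 0) \<and> (\<exists>x\<in>Y. f x \<noteq> 0)" if Z: "Z \<in> \<Z>" for Z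
  proof -
    obtain F where F: "F \<subseteq> polyfun C" "Z = {x \<in> X. \<forall>f\<in>F. f x = 0}" using assms(6)[OF Z] by (auto simp: closed_in_set_def)
    obtain y where "y \<in> Y" "y \<notin> Z" using neg Z by blast
    then obtain f where "f \<in> F" "f y \<noteq> 0" using F assms(4,5) by blast
    then show ?thesis using F \<open>y \<in> Y\<close> by blast
  qed
  then obtain f where f: "\<And>Z. Z \<in> \<Z> \<Longrightarrow> f Z \<in> polyfun C" "\<And>Z x. Z \<in> \<Z> \<Longrightarrow> x \<in> Z \<Longrightarrow> f Z x = 0"
    "\<And>Z. Z \<in> \<Z> \<Longrightarrow> \<exists>x\<in>Y. f Z x \<noteq> 0" by metis
  have "\<forall>x\<in>Y. (\<Prod>Z\<in>\<Z>. f Z x) = 0"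
  proof
    fix x assume "x \<in> Y"
    then obtain Z where "Z \<in> \<Z>" "x \<in> Z" using assms(4) by blast
    then show "(\<Prod>Z\<in>\<Z>. f Z x) = 0" using f(2) assms(3) by (intro prod_zero) auto
  qed
  then have "\<exists>Z\<in>\<Z>. \<forall>x\<in>Y. f Z x = 0" by (intro irreducible_on_prod[OF assms(1-3)] f(1))
  then show False using f(3) by blast
qed

section \<open>Irreducibility of connected algebraic groups\<close>

lemma finite_mat_coords: "finite (mat_coords :: (complex^'n^'n \<Rightarrow> complex) set)"
proof -
  have "mat_coords \<subseteq> range (\<lambda>p (X :: complex^'n^'n). X $ fst p $ snd p)"
  proof
    fix c :: "complex^'n^'n \<Rightarrow> complex" assume "c \<in> mat_coords"
    then obtain i j where "c = (\<lambda>X. X $ i $ j)" by (auto simp: mat_coords_def)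
    then show "c \<in> range (\<lambda>p (X :: complex^'n^'n). X $ fst p $ snd p)" by (intro image_eqI[of _ _ "(i, j)"]) auto
  qed
  then show ?thesis by (rule finite_subset) simp
qed

lemma matrix_inv_works: "invertible A \<Longrightarrow> A ** matrix_inv A = mat 1 \<and> matrix_inv A ** A = mat 1"
  unfolding matrix_inv_def invertible_def by (rule someI_ex)

lemma entry_polyfun: "(\<lambda>X. X $ i $ j) \<in> polyfun mat_coords"
  by (rule polyfun.coord) (unfold mat_coords_def, blast)

lemma polyfun_mat_compose:
  assumes "f \<in> polyfun mat_coords" "\<And>i j. (\<lambda>x. m x $ i $ j) \<in> polyfun C"
  shows "(\<lambda>x. f (m x)) \<in> polyfun C"
  by (rule polyfun_compose[OF assms(1)]) (auto simp: mat_coords_def assms(2))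

lemma matrix_mult_entries:
  assumes "\<And>i j. (\<lambda>x. m x $ i $ j) \<in> polyfun C" "\<And>i j. (\<lambda>x. k x $ i $ j) \<in> polyfun C"
  shows "(\<lambda>x. (m x ** k x) $ i $ j) \<in> polyfun C"
  by (simp add: matrix_matrix_mult_def) (intro polyfun_sum polyfun.mult assms)

lemma polyfun_left_translate: "f \<in> polyfun mat_coords \<Longrightarrow> (\<lambda>x. f (h ** x)) \<in> polyfun mat_coords"
  by (rule polyfun_mat_compose[where m = "\<lambda>x. h ** x"], assumption,
      rule matrix_mult_entries[where m = "\<lambda>_. h" and k = "\<lambda>x. x"], rule polyfun.const, rule entry_polyfun)

text \<open>In an irredundant decomposition some point lies on one component only. Translations
  carry it to every other point, so the components are disjoint closed sets, and connectedness
  leaves a single one.\<close>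

theorem connected_algebraic_group_irreducible:
  fixes A :: "(complex^'n^'n) set"
  assumes A: "algebraic_group A" and conn: "connectedin mat_zariski A"
  shows "irreducible_on mat_coords A"
proof -
  let ?C = "mat_coords :: (complex^'n^'n \<Rightarrow> complex) set"
  have inv: "invertible a" if "a \<in> A" for a
    using A that by (auto simp: algebraic_group_def closedin_def)
  have mult: "a ** b \<in> A" and minv: "matrix_inv a \<in> A" if "a \<in> A" "b \<in> A" for a b
    using A that by (auto simp: algebraic_group_def)
  define cover where "cover \<Z> \<longleftrightarrow> finite \<Z> \<and> \<Union>\<Z> = A \<and> (\<forall>Z\<in>\<Z>. irreducible_on ?C Z \<and> closed_in_set ?C A Z)" for \<Z>
  obtain \<Z>0 where "cover \<Z>0" using irreducible_decomposition[OF finite_mat_coords, of A] by (auto simp: cover_def)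
  then obtain \<Z> where Z: "cover \<Z>" and min: "\<And>\<Y>. cover \<Y> \<Longrightarrow> card \<Z> \<le> card \<Y>"
    using exists_least_iff[of "\<lambda>n. \<exists>\<Z>. cover \<Z> \<and> card \<Z> = n"] by (metis not_le)
  have fin: "finite \<Z>" and un: "\<Union>\<Z> = A" and irr: "\<And>Z. Z \<in> \<Z> \<Longrightarrow> irreducible_on ?C Z"
    and cl: "\<And>Z. Z \<in> \<Z> \<Longrightarrow> closed_in_set ?C A Z" using Z by (auto simp: cover_def)
  have irredundant: "\<not> Z \<subseteq> \<Union>(\<Z> - {Z})" if "Z \<in> \<Z>" for Z
  proof
    assume "Z \<subseteq> \<Union>(\<Z> - {Z})"
    then have "\<Union>(\<Z> - {Z}) = A" using un that by blast
    then have "cover (\<Z> - {Z})" using fin irr cl by (auto simp: cover_def)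
    then show False using min[of "\<Z> - {Z}"] card_Diff1_less[OF fin that] by simp
  qed
  have contained: "Z = W" if "Z \<in> \<Z>" "W \<in> \<Z>" "Z \<subseteq> W" for Z W
    using irredundant[OF that(1)] that by blast
  have translate: "irreducible_on ?C ((**) h ` Z)" if "irreducible_on ?C Z" for h Z
    unfolding irreducible_on_def
  proof (intro ballI impI)
    fix f g assume fg: "f \<in> polyfun ?C" "g \<in> polyfun ?C" "\<forall>x\<in>(**) h ` Z. f x * g x = 0"
    have "(\<forall>x\<in>Z. f (h ** x) = 0) \<or> (\<forall>x\<in>Z. g (h ** x) = 0)"
      by (rule irreducible_onD[OF that polyfun_left_translate[OF fg(1)] polyfun_left_translate[OF fg(2)]])
        (use fg(3) in auto)
    then show "(\<forall>x\<in>(**) h ` Z. f x = 0) \<or> (\<forall>x\<in>(**) h ` Z. g x = 0)" by auto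
  qed
  have trans_in: "\<exists>W\<in>\<Z>. (**) h ` Z \<subseteq> W" if "Z \<in> \<Z>" "h \<in> A" for Z h
  proof (rule irreducible_on_subset_component[OF translate[OF irr[OF that(1)]] _ fin _ _ cl])
    show "(**) h ` Z \<noteq> {}" using irredundant[OF that(1)] by auto
    show "(**) h ` Z \<subseteq> \<Union>\<Z>" using mult[OF that(2)] un that(1) by auto
  qed (use un in auto)
  have "mat 1 \<in> A" using A by (simp add: algebraic_group_def)
  then obtain Z1 where Z1: "Z1 \<in> \<Z>" using un by auto
  obtain a where a: "a \<in> Z1" "a \<notin> \<Union>(\<Z> - {Z1})" using irredundant[OF Z1] by blast
  have aA: "a \<in> A" using a Z1 un by auto
  \<comment> \<open>The translation taking \<open>b\<close> to \<open>a\<close> carries every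
    component through \<open>b\<close> into the only one through \<open>a\<close>; going back, all
    of them lie in one component.\<close>
  have disj: "Z = Z'" if "Z \<in> \<Z>" "Z' \<in> \<Z>" "b \<in> Z" "b \<in> Z'" for Z Z' b
  proof -
    have bA: "b \<in> A" using that un by auto
    let ?h = "a ** matrix_inv b" and ?h' = "b ** matrix_inv a"
    have hA: "?h \<in> A" "?h' \<in> A" using mult minv aA bA by auto
    have hb: "?h ** b = a"
    proof -
      have "?h ** b = a ** (matrix_inv b ** b)" by (simp only: matrix_mul_assoc)
      then show ?thesis using matrix_inv_works[OF inv[OF bA]] by simp
    qed
    have hh: "?h' ** (?h ** y) = y" for y
    proof -
      have "?h' ** (?h ** y) = b ** (matrix_inv a ** a) ** matrix_inv b ** y" by (simp only: matrix_mul_assoc)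
      then show ?thesis using matrix_inv_works[OF inv[OF bA]] matrix_inv_works[OF inv[OF aA]] by simp
    qed
    have toZ1: "(**) ?h ` W \<subseteq> Z1" if W: "W \<in> \<Z>" "b \<in> W" for W
    proof -
      obtain V where V: "V \<in> \<Z>" "(**) ?h ` W \<subseteq> V" using trans_in[OF W(1) hA(1)] by blast
      then have "a \<in> V" using W(2) hb by force
      then show ?thesis using V a(2) by blast
    qed
    obtain V where V: "V \<in> \<Z>" "(**) ?h' ` Z1 \<subseteq> V" using trans_in[OF Z1 hA(2)] by blast
    have "W \<subseteq> V" if W: "W \<in> \<Z>" "b \<in> W" for W
    proof
      fix y assume "y \<in> W"
      then have "?h ** y \<in> Z1" using toZ1[OF W] by auto
      then have "?h' ** (?h ** y) \<in> V" using V(2) by blast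
      then show "y \<in> V" by (simp only: hh)
    qed
    then show ?thesis using contained that V(1) by metis
  qed
  have "A \<subseteq> Z1"
  proof (rule ccontr)
    assume "\<not> A \<subseteq> Z1"
    have "\<exists>E. closedin mat_zariski E \<and> E \<inter> A = Z" if Z: "Z \<in> \<Z>" for Z
    proof -
      obtain F where F: "F \<subseteq> polyfun ?C" "Z = {x \<in> A. \<forall>f\<in>F. f x = 0}"
        using cl[OF Z] by (auto simp: closed_in_set_def)
      have "closedin mat_zariski {x. \<forall>f\<in>F. f x = 0}" unfolding closedin_zariski_iff using F(1) by blast
      moreover have "{x. \<forall>f\<in>F. f x = 0} \<inter> A = Z" by (auto simp: F(2))
      ultimately show ?thesis by blast
    qed
    then obtain E where E: "\<And>Z. Z \<in> \<Z> \<Longrightarrow> closedin mat_zariski (E Z)" "\<And>Z. Z \<in> \<Z> \<Longrightarrow> E Z \<inter> A = Z" by metis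
    define E2 where "E2 = \<Union>(E ` (\<Z> - {Z1}))"
    have E2A: "E2 \<inter> A = \<Union>(\<Z> - {Z1})" using E(2) by (auto simp: E2_def)
    have "closedin mat_zariski E2" unfolding E2_def using fin E(1) by (intro closedin_Union) auto
    moreover have "A \<subseteq> E Z1 \<union> E2" using un E2A E(2)[OF Z1] by blast
    moreover have "E Z1 \<inter> E2 \<inter> A = {}"
    proof -
      have "E Z1 \<inter> E2 \<inter> A = Z1 \<inter> \<Union>(\<Z> - {Z1})" using E2A E(2)[OF Z1] by blast
      also have "\<dots> = {}" using disj[OF Z1] by blast
      finally show ?thesis .
    qed
    moreover have "E Z1 \<inter> A \<noteq> {}" using E(2)[OF Z1] a(1) by blast
    moreover have "E2 \<inter> A \<noteq> {}" using \<open>\<not> A \<subseteq> Z1\<close> un E2A by blast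
    ultimately have "\<exists>E1 E2. closedin mat_zariski E1 \<and> closedin mat_zariski E2 \<and> A \<subseteq> E1 \<union> E2 \<and>
        E1 \<inter> E2 \<inter> A = {} \<and> E1 \<inter> A \<noteq> {} \<and> E2 \<inter> A \<noteq> {}"
      using E(1)[OF Z1] by (intro exI[of _ "E Z1"] exI[of _ E2]) simp
    then show False using conn by (simp only: connectedin_closedin) simp
  qed
  then have "A = Z1" using un Z1 by auto
  then show ?thesis using irr[OF Z1] by simp
qed

section \<open>Derivations of the coordinate ring of an irreducible set\<close>

text \<open>A derivation D of a ring of functions amounts to the ring homomorphism f \<mapsto> f +
  D(f) eps into functions with values in the dual numbers.\<close>

datatype dual = Dual (dre: complex) (deps: complex)

lemma dual_eqI: "dre x = dre y \<Longrightarrow> deps x = deps y \<Longrightarrow> x = y"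
  by (rule dual.expand) simp

lemma dual_eq_iff: "x = y \<longleftrightarrow> dre x = dre y \<and> deps x = deps y"
  using dual_eqI by auto

instantiation dual :: comm_ring_1
begin

definition "0 = Dual 0 0"
definition "1 = Dual 1 0"
definition "x + y = Dual (dre x + dre y) (deps x + deps y)"
definition "- x = Dual (- dre x) (- deps x)"
definition "x - y = Dual (dre x - dre y) (deps x - deps y)"
definition "x * y = Dual (dre x * dre y) (dre x * deps y + deps x * dre y)"

instance
  by standard (simp_all add: dual_eq_iff zero_dual_def one_dual_def plus_dual_def uminus_dual_def
      minus_dual_def times_dual_def algebra_simps)

end

lemma dual_ring_simps [simp]:
  "dre 0 = 0" "deps 0 = 0" "dre 1 = 1" "deps 1 = 0"
  "dre (x + y) = dre x + dre y" "deps (x + y) = deps x + deps y"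
  "dre (- x) = - dre x" "deps (- x) = - deps x"
  "dre (x - y) = dre x - dre y" "deps (x - y) = deps x - deps y"
  "dre (x * y) = dre x * dre y" "deps (x * y) = dre x * deps y + deps x * dre y"
  by (simp_all add: zero_dual_def one_dual_def plus_dual_def uminus_dual_def minus_dual_def times_dual_def)

lemma dre_sum: "dre (sum f A) = (\<Sum>a\<in>A. dre (f a))" and deps_sum: "deps (sum f A) = (\<Sum>a\<in>A. deps (f a))"
  by (induction A rule: infinite_finite_induct) simp_all

lemma dre_power [simp]: "dre (x ^ n) = dre x ^ n"
  by (induction n) simp_all

lemma deps_power: "deps (x ^ n) = of_nat n * dre x ^ (n - 1) * deps x"
proof (induction n)
  case (Suc n)
  then show ?case by (cases n) (simp_all add: algebra_simps)
qed simp

text \<open>A derivation of a ring of functions on \<open>X\<close> is encoded by its graph: a ring of functions with values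
  in the dual numbers in which the real part determines the infinitesimal part on \<open>X\<close>.\<close>

definition derivation_graph :: "('a \<Rightarrow> complex) set \<Rightarrow> 'a set \<Rightarrow> ('a \<Rightarrow> dual) set \<Rightarrow> bool" where
  "derivation_graph C X S \<longleftrightarrow>
     (\<forall>a. (\<lambda>_. Dual a 0) \<in> S) \<and> (\<forall>f\<in>S. \<forall>g\<in>S. (\<lambda>x. f x + g x) \<in> S \<and> (\<lambda>x. f x * g x) \<in> S) \<and>
     (\<forall>f\<in>S. (\<lambda>x. dre (f x)) \<in> polyfun C \<and> (\<lambda>x. deps (f x)) \<in> polyfun C) \<and>
     (\<forall>f\<in>S. (\<forall>x\<in>X. dre (f x) = 0) \<longrightarrow> (\<forall>x\<in>X. f x = 0))"

lemma derivation_graphD: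
  assumes "derivation_graph C X S"
  shows "(\<lambda>_. Dual a 0) \<in> S" "f \<in> S \<Longrightarrow> g \<in> S \<Longrightarrow> (\<lambda>x. f x + g x) \<in> S" "f \<in> S \<Longrightarrow> g \<in> S \<Longrightarrow> (\<lambda>x. f x * g x) \<in> S"
    "f \<in> S \<Longrightarrow> (\<lambda>x. dre (f x)) \<in> polyfun C" "f \<in> S \<Longrightarrow> (\<lambda>x. deps (f x)) \<in> polyfun C"
    "f \<in> S \<Longrightarrow> (\<And>x. x \<in> X \<Longrightarrow> dre (f x) = 0) \<Longrightarrow> x \<in> X \<Longrightarrow> f x = 0"
  using assms by (auto simp: derivation_graph_def)

definition adjoin :: "('a \<Rightarrow> dual) set \<Rightarrow> ('a \<Rightarrow> dual) \<Rightarrow> ('a \<Rightarrow> dual) set" where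
  "adjoin S w = {f. \<exists>q e. (\<forall>i. q i \<in> S) \<and> f = (\<lambda>x. \<Sum>i<e. q i x * w x ^ i)}"

lemma adjoinI: "(\<And>i. q i \<in> S) \<Longrightarrow> f = (\<lambda>x. \<Sum>i<e. q i x * w x ^ i) \<Longrightarrow> f \<in> adjoin S w"
  unfolding adjoin_def by auto

definition dual_subring :: "('a \<Rightarrow> complex) set \<Rightarrow> ('a \<Rightarrow> dual) set \<Rightarrow> bool" where
  "dual_subring C S \<longleftrightarrow>
     (\<forall>a. (\<lambda>_. Dual a 0) \<in> S) \<and> (\<forall>f\<in>S. \<forall>g\<in>S. (\<lambda>x. f x + g x) \<in> S \<and> (\<lambda>x. f x * g x) \<in> S) \<and>
     (\<forall>f\<in>S. (\<lambda>x. dre (f x)) \<in> polyfun C \<and> (\<lambda>x. deps (f x)) \<in> polyfun C)"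

lemma dual_subringD:
  assumes "dual_subring C S"
  shows "(\<lambda>_. Dual a 0) \<in> S" "f \<in> S \<Longrightarrow> g \<in> S \<Longrightarrow> (\<lambda>x. f x + g x) \<in> S" "f \<in> S \<Longrightarrow> g \<in> S \<Longrightarrow> (\<lambda>x. f x * g x) \<in> S"
    "f \<in> S \<Longrightarrow> (\<lambda>x. dre (f x)) \<in> polyfun C" "f \<in> S \<Longrightarrow> (\<lambda>x. deps (f x)) \<in> polyfun C"
  using assms by (auto simp: dual_subring_def)

lemma dual_subring_zero: "dual_subring C S \<Longrightarrow> (\<lambda>_. 0) \<in> S"
  using dual_subringD(1)[of C S 0] by (simp add: zero_dual_def)

lemma derivation_graph_iff:
  "derivation_graph C X S \<longleftrightarrow> dual_subring C S \<and> (\<forall>f\<in>S. (\<forall>x\<in>X. dre (f x) = 0) \<longrightarrow> (\<forall>x\<in>X. f x = 0))"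
  unfolding derivation_graph_def dual_subring_def by (simp only: conj_assoc)

lemma polyfun_dual_power:
  assumes "(\<lambda>x. dre (w x)) \<in> polyfun C" "(\<lambda>x. deps (w x)) \<in> polyfun C"
  shows "(\<lambda>x. dre (w x ^ n)) \<in> polyfun C" "(\<lambda>x. deps (w x ^ n)) \<in> polyfun C"
  using assms by (auto simp: deps_power intro!: polyfun.mult polyfun_power polyfun.const)

lemma dual_subring_adjoin:
  assumes S: "dual_subring C S" and w: "(\<lambda>x. dre (w x)) \<in> polyfun C" "(\<lambda>x. deps (w x)) \<in> polyfun C"
  shows "dual_subring C (adjoin S w)" "S \<subseteq> adjoin S w" "w \<in> adjoin S w"
proof -
  note SD = dual_subringD[OF S] and S0 = dual_subring_zero[OF S]
  show sub: "S \<subseteq> adjoin S w"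
  proof
    fix f assume "f \<in> S"
    then show "f \<in> adjoin S w" by (intro adjoinI[where q = "\<lambda>_. f" and e = 1]) auto
  qed
  have one: "(\<lambda>_. 1) \<in> S" using SD(1)[of 1] by (simp add: one_dual_def)
  have add: "(\<lambda>x. f x + g x) \<in> adjoin S w" if fg: "f \<in> adjoin S w" "g \<in> adjoin S w" for f g
  proof -
    obtain q e where q: "\<And>i. q i \<in> S" "f = (\<lambda>x. \<Sum>i<e. q i x * w x ^ i)" using fg by (auto simp: adjoin_def)
    obtain p d where p: "\<And>i. p i \<in> S" "g = (\<lambda>x. \<Sum>i<d. p i x * w x ^ i)" using fg by (auto simp: adjoin_def)
    let ?c = "\<lambda>i x. (if i < e then q i x else 0) + (if i < d then p i x else 0)"
    show ?thesis
    proof (rule adjoinI[of ?c])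
      show "?c i \<in> S" for i using q(1) p(1) S0 SD(2) by (cases "i < e"; cases "i < d") auto
      have "(\<Sum>i<e. q i x * w x ^ i) = (\<Sum>i<max e d. (if i < e then q i x else 0) * w x ^ i)" for x
        by (rule sum.mono_neutral_cong_left) auto
      moreover have "(\<Sum>i<d. p i x * w x ^ i) = (\<Sum>i<max e d. (if i < d then p i x else 0) * w x ^ i)" for x
        by (rule sum.mono_neutral_cong_left) auto
      ultimately show "(\<lambda>x. f x + g x) = (\<lambda>x. \<Sum>i<max e d. ?c i x * w x ^ i)"
        by (simp add: q(2) p(2) distrib_right sum.distrib)
    qed
  qed
  have zero: "(\<lambda>_. 0) \<in> adjoin S w" using S0 sub by auto
  have sum: "(\<lambda>x. \<Sum>i\<in>I. f i x) \<in> adjoin S w" if "\<And>i. i \<in> I \<Longrightarrow> f i \<in> adjoin S w" for I :: "nat set" and f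
    using that by (induction I rule: infinite_finite_induct) (auto intro: zero add)
  have mon: "(\<lambda>x. r x * w x ^ k) \<in> adjoin S w" if "r \<in> S" for r k
  proof (rule adjoinI[of "\<lambda>i x. if i = k then r x else 0"])
    show "(\<lambda>x. if i = k then r x else 0) \<in> S" for i using that S0 by (cases "i = k") auto
    have "(\<Sum>i<Suc k. (if i = k then r x else 0) * w x ^ i) = (\<Sum>i<Suc k. if i = k then r x * w x ^ k else 0)" for x
      by (rule sum.cong) auto
    then show "(\<lambda>x. r x * w x ^ k) = (\<lambda>x. \<Sum>i<Suc k. (if i = k then r x else 0) * w x ^ i)" by simp
  qed
  show "w \<in> adjoin S w" using mon[OF one, of 1] by simp
  have mult: "(\<lambda>x. f x * g x) \<in> adjoin S w" if fg: "f \<in> adjoin S w" "g \<in> adjoin S w" for f g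
  proof -
    obtain q e where q: "\<And>i. q i \<in> S" "f = (\<lambda>x. \<Sum>i<e. q i x * w x ^ i)" using fg by (auto simp: adjoin_def)
    obtain p d where p: "\<And>i. p i \<in> S" "g = (\<lambda>x. \<Sum>i<d. p i x * w x ^ i)" using fg by (auto simp: adjoin_def)
    have "(\<lambda>x. \<Sum>i<e. \<Sum>j<d. (q i x * p j x) * w x ^ (i + j)) \<in> adjoin S w"
      by (intro sum mon SD(3) q(1) p(1))
    moreover have "f x * g x = (\<Sum>i<e. \<Sum>j<d. (q i x * p j x) * w x ^ (i + j))" for x
      unfolding q(2) p(2) sum_product by (intro sum.cong refl) (simp add: power_add mult_ac)
    ultimately show ?thesis by simp
  qed
  have poly: "(\<lambda>x. dre (f x)) \<in> polyfun C \<and> (\<lambda>x. deps (f x)) \<in> polyfun C" if f: "f \<in> adjoin S w" for f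
  proof -
    obtain q e where q: "\<And>i. q i \<in> S" "f = (\<lambda>x. \<Sum>i<e. q i x * w x ^ i)" using f by (auto simp: adjoin_def)
    show ?thesis unfolding q(2) dre_sum deps_sum dual_ring_simps
      by (intro conjI polyfun_sum polyfun.add polyfun.mult polyfun_dual_power w SD(4,5) q(1))
  qed
  show "dual_subring C (adjoin S w)"
    unfolding dual_subring_def using sub SD(1) add mult poly by blast
qed

text \<open>A derivation multiplied by a function is again a derivation; this clears the denominator
  that appears when a derivation is extended to an algebraic element.\<close>

definition rescale :: "complex \<Rightarrow> dual \<Rightarrow> dual" where
  "rescale t a = Dual (dre a) (t * deps a)"

lemma rescale_simps [simp]: "dre (rescale t a) = dre a" "deps (rescale t a) = t * deps a"
  by (simp_all add: rescale_def)

lemma rescale_ring: "rescale t (a + b) = rescale t a + rescale t b" "rescale t (a * b) = rescale t a * rescale t b"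
  "rescale t (Dual c 0) = Dual c 0"
  by (simp_all add: dual_eq_iff algebra_simps)

lemma derivation_graph_rescale:
  assumes S: "derivation_graph C X S" and t: "t \<in> polyfun C"
  shows "derivation_graph C X ((\<lambda>f x. rescale (t x) (f x)) ` S)"
  unfolding derivation_graph_def
proof (intro conjI allI ballI impI)
  note SD = derivation_graphD[OF S]
  let ?r = "\<lambda>f x. rescale (t x) (f x)"
  show "(\<lambda>_. Dual a 0) \<in> ?r ` S" for a
    by (rule image_eqI[OF _ SD(1)[of a]]) (simp add: rescale_ring)
  fix f assume "f \<in> ?r ` S"
  then obtain f' where f: "f = ?r f'" "f' \<in> S" by auto
  show "(\<lambda>x. dre (f x)) \<in> polyfun C" "(\<lambda>x. deps (f x)) \<in> polyfun C"
    using SD(4,5)[OF f(2)] t by (auto simp: f(1) intro: polyfun.mult)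
  show "f x = 0" if "\<forall>x\<in>X. dre (f x) = 0" "x \<in> X" for x
    using SD(6)[OF f(2)] that by (simp add: f(1) dual_eq_iff)
  fix g assume "g \<in> ?r ` S"
  then obtain g' where g: "g = ?r g'" "g' \<in> S" by auto
  show "(\<lambda>x. f x + g x) \<in> ?r ` S"
    by (rule image_eqI[OF _ SD(2)[OF f(2) g(2)]]) (simp add: f(1) g(1) rescale_ring)
  show "(\<lambda>x. f x * g x) \<in> ?r ` S"
    by (rule image_eqI[OF _ SD(3)[OF f(2) g(2)]]) (simp add: f(1) g(1) rescale_ring)
qed

text \<open>If \<open>w\<close> satisfies no relation over \<open>S\<close>, an element of the
  extension with vanishing real part has coefficients with vanishing real part, so any infinitesimal
  part of \<open>w\<close> is admissible.\<close>

lemma derivation_graph_adjoin_transcendental: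
  assumes S: "derivation_graph C X S" and w: "(\<lambda>x. dre (w x)) \<in> polyfun C" "(\<lambda>x. deps (w x)) \<in> polyfun C"
    and tr: "\<And>q e i x. (\<And>i. q i \<in> S) \<Longrightarrow> (\<And>x. x \<in> X \<Longrightarrow> (\<Sum>i<e. dre (q i x) * dre (w x) ^ i) = 0) \<Longrightarrow>
        i < e \<Longrightarrow> x \<in> X \<Longrightarrow> dre (q i x) = 0"
  shows "derivation_graph C X (adjoin S w)"
  unfolding derivation_graph_iff
proof (intro conjI ballI impI)
  show "dual_subring C (adjoin S w)" using S w by (intro dual_subring_adjoin(1)) (simp_all add: derivation_graph_iff)
  fix f x assume f: "f \<in> adjoin S w" "\<forall>x\<in>X. dre (f x) = 0" "x \<in> X"
  then obtain q e where q: "\<And>i. q i \<in> S" "f = (\<lambda>x. \<Sum>i<e. q i x * w x ^ i)" by (auto simp: adjoin_def)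
  have "dre (q i y) = 0" if "i < e" "y \<in> X" for i y
    by (rule tr[OF q(1) _ that]) (use f(2) in \<open>simp add: q(2) dre_sum\<close>)
  then have "q i x = 0" if "i < e" for i using derivation_graphD(6)[OF S q(1)] that f(3) by blast
  then show "f x = 0" by (simp add: q(2))
qed

text \<open>Adjoining \<open>c\<close> with a minimal relation \<open>Q(c) = 0\<close>: after multiplying the derivation by \<open>Q'(c)\<close>,
  the derivative of \<open>c\<close> is forced to be minus the coefficientwise derivative of \<open>Q\<close> evaluated at \<open>c\<close>.\<close>

lemma derivation_graph_adjoin_algebraic:
  assumes irr: "irreducible_on C X" and S: "derivation_graph C X S" and c: "c \<in> polyfun C"
    and q: "\<And>i. q i \<in> S" "\<And>x. x \<in> X \<Longrightarrow> (\<Sum>i<Suc d. dre (q i x) * c x ^ i) = 0" "\<exists>x\<in>X. dre (q d x) \<noteq> 0"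
    and min: "\<And>p i x. (\<And>i. p i \<in> S) \<Longrightarrow> (\<And>x. x \<in> X \<Longrightarrow> (\<Sum>i<d. dre (p i x) * c x ^ i) = 0) \<Longrightarrow>
        i < d \<Longrightarrow> x \<in> X \<Longrightarrow> dre (p i x) = 0"
  shows "\<exists>t w. t \<in> polyfun C \<and> (\<exists>x\<in>X. t x \<noteq> 0) \<and> (\<forall>x. dre (w x) = c x) \<and>
     derivation_graph C X (adjoin ((\<lambda>f x. rescale (t x) (f x)) ` S) w)"
proof -
  note SD = derivation_graphD[OF S]
  define t where "t x = (\<Sum>i<Suc d. of_nat i * dre (q i x) * c x ^ (i - 1))" for x
  define w where "w x = Dual (c x) (- (\<Sum>i<Suc d. deps (q i x) * c x ^ i))" for x
  let ?r = "\<lambda>f x. rescale (t x) (f x)"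
  have qp: "(\<lambda>x. dre (q i x)) \<in> polyfun C" "(\<lambda>x. deps (q i x)) \<in> polyfun C" for i
    using SD(4,5) q(1) by auto
  have tp: "t \<in> polyfun C" unfolding t_def by (intro polyfun_sum polyfun.mult polyfun.const polyfun_power qp c)
  have wp: "(\<lambda>x. dre (w x)) \<in> polyfun C" "(\<lambda>x. deps (w x)) \<in> polyfun C"
    by (simp add: w_def c, simp only: w_def dual.sel)
       (intro polyfun_sum polyfun.mult polyfun_uminus polyfun_power qp c)
  have wre [simp]: "dre (w x) = c x" for x by (simp add: w_def)
  have tS: "derivation_graph C X (?r ` S)" by (rule derivation_graph_rescale[OF S tp])
  have dpos: "d \<noteq> 0" using q(2,3) by (intro notI) auto
  \<comment> \<open>If \<open>t\<close> vanished on \<open>X\<close>, it would be a relation of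
    smaller degree whose leading coefficient is \<open>d\<close> times that of the minimal
    one.\<close>
  have tnz: "\<exists>x\<in>X. t x \<noteq> 0"
  proof (rule ccontr)
    assume notz: "\<not> ?thesis"
    let ?p = "\<lambda>i x. Dual (of_nat (Suc i)) 0 * q (Suc i) x"
    have pS: "?p i \<in> S" for i by (intro SD(3) SD(1) q(1))
    have "(\<Sum>i<d. dre (?p i x) * c x ^ i) = t x" for x
      unfolding t_def sum.lessThan_Suc_shift by simp
    then have "dre (?p (d - 1) x) = 0" if "x \<in> X" for x
      using notz dpos by (intro min[OF pS _ _ that]) auto
    then have "dre (q d x) = 0" if "x \<in> X" for x using dpos that by auto
    then show False using q(3) by auto
  qed
  define Qh where "Qh x = (\<Sum>i<Suc d. ?r (q i) x * w x ^ i)" for x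
  have Qh0: "Qh x = 0" if x: "x \<in> X" for x
  proof (rule dual_eqI)
    show "dre (Qh x) = dre 0" using q(2)[OF x] by (simp add: Qh_def dre_sum)
    have "deps (Qh x) = (\<Sum>i<Suc d. (of_nat i * dre (q i x) * c x ^ (i - 1)) * deps (w x) + t x * (deps (q i x) * c x ^ i))"
      unfolding Qh_def deps_sum by (rule sum.cong) (simp_all add: deps_power algebra_simps)
    also have "\<dots> = t x * deps (w x) + t x * (\<Sum>i<Suc d. deps (q i x) * c x ^ i)"
      by (simp only: sum.distrib sum_distrib_left[symmetric] sum_distrib_right[symmetric] t_def)
    also have "deps (w x) = - (\<Sum>i<Suc d. deps (q i x) * c x ^ i)" by (simp only: w_def dual.sel)
    finally show "deps (Qh x) = deps 0" by (simp only: dual_ring_simps mult_minus_right left_minus)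
  qed
  have main: "f x = 0"
    if "\<And>i. p i \<in> ?r ` S" "f = (\<lambda>x. \<Sum>i<e. p i x * w x ^ i)" "\<And>x. x \<in> X \<Longrightarrow> dre (f x) = 0" "x \<in> X" for e p f x
    using that
  proof (induction e arbitrary: p f x)
    case 0
    then show ?case by simp
  next
    case (Suc e)
    note p = Suc.prems(1)
    have "\<forall>i. \<exists>p'. p' \<in> S \<and> p i = ?r p'" using p by blast
    then obtain p' where p': "\<And>i. p' i \<in> S" "\<And>i. p i = ?r (p' i)" by metis
    have rel: "(\<Sum>i<Suc e. dre (p' i x) * c x ^ i) = 0" if "x \<in> X" for x
      using Suc.prems(3)[OF that] unfolding Suc.prems(2) dre_sum by (simp add: p'(2))
    show ?case
    proof (cases "Suc e \<le> d")
      case True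
      have "dre (p' i y) = 0" if i: "i < Suc e" and y: "y \<in> X" for i y
      proof -
        let ?p = "\<lambda>i. if i < Suc e then p' i else (\<lambda>_. 0)"
        have "(\<Sum>i<d. dre (?p i x) * c x ^ i) = (\<Sum>i<Suc e. dre (p' i x) * c x ^ i)" for x
          by (rule sum.mono_neutral_cong_right) (use True in auto)
        moreover have "?p i \<in> S" for i using p'(1) SD(1)[of 0] by (auto simp: zero_dual_def)
        ultimately have "dre (?p i y) = 0" using i y True rel by (intro min[of ?p]) auto
        then show ?thesis using i by simp
      qed
      then have "p' i x = 0" if "i < Suc e" for i
        using SD(6)[OF p'(1)] that Suc.prems(4) by blast
      then have "p i x = 0" if "i < Suc e" for i using that by (simp add: p'(2) dual_eq_iff)
      then show ?thesis unfolding Suc.prems(2) by (intro sum.neutral) auto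
    next
      case False
      then have de: "d \<le> e" by simp
      let ?qd = "?r (q d)"
      \<comment> \<open>Pseudo-division by the relation: after multiplication by its leading
        coefficient the top term cancels. On \<open>X\<close> the value only acquires the factor
        \<open>q d\<close>, which irreducibility allows to cancel.\<close>
      define p2 where "p2 i x = ?qd x * p i x + (if e - d \<le> i then Dual (-1) 0 * p e x * ?r (q (i - (e - d))) x else 0)" for i x
      have qS: "?r (q i) \<in> ?r ` S" for i using q(1) by blast
      note rD = derivation_graphD[OF tS]
      have p2S: "p2 i \<in> ?r ` S" for i
      proof (cases "e - d \<le> i")
        case True
        have "(\<lambda>x. ?qd x * p i x + Dual (-1) 0 * p e x * ?r (q (i - (e - d))) x) \<in> ?r ` S"
          by (intro rD(2) rD(3) rD(1) qS p)
        then show ?thesis using True by (simp add: p2_def[abs_def])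
      next
        case False
        have "(\<lambda>x. ?qd x * p i x) \<in> ?r ` S" by (intro rD(3) qS p)
        then show ?thesis using False by (simp add: p2_def[abs_def])
      qed
      define f2 where "f2 x = (\<Sum>i<e. p2 i x * w x ^ i)" for x
      have m1: "Dual (-1) 0 * z = - z" for z by (simp add: dual_eq_iff)
      have f2: "f2 x = ?qd x * f x - p e x * w x ^ (e - d) * Qh x" for x
      proof -
        have "(\<Sum>i<Suc e. (if e - d \<le> i then ?r (q (i - (e - d))) x else 0) * w x ^ i) = w x ^ (e - d) * Qh x"
        proof -
          have "(\<Sum>i<Suc e. (if e - d \<le> i then ?r (q (i - (e - d))) x else 0) * w x ^ i) =
             (\<Sum>i\<in>{e - d..<Suc e}. ?r (q (i - (e - d))) x * w x ^ i)"
            by (rule sum.mono_neutral_cong_right) auto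
          also have "\<dots> = (\<Sum>i\<in>{0 + (e - d)..<Suc d + (e - d)}. ?r (q (i - (e - d))) x * w x ^ i)"
            using de by simp
          also have "\<dots> = (\<Sum>i\<in>{0..<Suc d}. ?r (q i) x * w x ^ (i + (e - d)))"
            by (subst sum.shift_bounds_nat_ivl) simp
          also have "\<dots> = w x ^ (e - d) * Qh x"
            unfolding Qh_def sum_distrib_left atLeast0LessThan by (rule sum.cong) (simp_all add: power_add mult_ac)
          finally show ?thesis .
        qed
        moreover have "p2 e x = 0" using de by (simp only: p2_def m1) (simp add: mult.commute)
        then have "f2 x = (\<Sum>i<Suc e. p2 i x * w x ^ i)" by (simp add: f2_def)
        moreover have "(\<Sum>i<Suc e. p2 i x * w x ^ i) =
            (\<Sum>i<Suc e. ?qd x * (p i x * w x ^ i) - p e x * ((if e - d \<le> i then ?r (q (i - (e - d))) x else 0) * w x ^ i))"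
          by (rule sum.cong) (simp_all add: p2_def m1 algebra_simps)
        moreover have "\<dots> = ?qd x * (\<Sum>i<Suc e. p i x * w x ^ i) -
            p e x * (\<Sum>i<Suc e. (if e - d \<le> i then ?r (q (i - (e - d))) x else 0) * w x ^ i)"
          by (simp only: sum_subtractf sum_distrib_left)
        ultimately show ?thesis unfolding Suc.prems(2) by (simp only: mult.assoc)
      qed
      have f2X: "f2 y = ?qd y * f y" if "y \<in> X" for y using f2[of y] Qh0[OF that] by simp
      have f2z: "f2 y = 0" if "y \<in> X" for y
        by (rule Suc.IH[OF p2S _ _ that]) (use f2X Suc.prems(3) in \<open>auto simp: f2_def\<close>)
      have "dre (q d y) * deps (f y) = 0" if "y \<in> X" for y
        using f2X[OF that] f2z[OF that] Suc.prems(3)[OF that] by (simp add: dual_eq_iff)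
      moreover have "(\<lambda>y. deps (f y)) \<in> polyfun C"
      proof -
        have "f \<in> adjoin (?r ` S) w" by (rule adjoinI[OF p Suc.prems(2)])
        moreover have "dual_subring C (?r ` S)" using tS by (simp add: derivation_graph_iff)
        ultimately show ?thesis using dual_subringD(5) dual_subring_adjoin(1)[OF _ wp] by blast
      qed
      ultimately have "(\<forall>y\<in>X. dre (q d y) = 0) \<or> (\<forall>y\<in>X. deps (f y) = 0)"
        by (intro irreducible_onD[OF irr] qp) auto
      then show ?thesis using q(3) Suc.prems(3,4) by (auto simp: dual_eq_iff)
    qed
  qed
  have "derivation_graph C X (adjoin (?r ` S) w)"
    unfolding derivation_graph_iff
  proof (intro conjI ballI impI)
    show "dual_subring C (adjoin (?r ` S) w)" using tS by (intro dual_subring_adjoin(1) wp) (simp add: derivation_graph_iff)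
    fix f x assume f: "f \<in> adjoin (?r ` S) w" "\<forall>x\<in>X. dre (f x) = 0" "x \<in> X"
    then obtain p e where "\<And>i. p i \<in> ?r ` S" "f = (\<lambda>x. \<Sum>i<e. p i x * w x ^ i)" by (auto simp: adjoin_def)
    then show "f x = 0" using main f(2,3) by blast
  qed
  then show ?thesis using tp tnz wre by blast
qed

lemma derivation_graph_constants: "derivation_graph C X (range (\<lambda>a _. Dual a 0))" if "X \<noteq> {}"
  unfolding derivation_graph_def
proof (intro conjI allI ballI impI)
  fix f assume "f \<in> range (\<lambda>a (_ :: 'a). Dual a 0)"
  then obtain a where f: "f = (\<lambda>_. Dual a 0)" by auto
  show "(\<lambda>x. dre (f x)) \<in> polyfun C" "(\<lambda>x. deps (f x)) \<in> polyfun C" by (simp_all add: f polyfun.const)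
  show "f x = 0" if "\<forall>x\<in>X. dre (f x) = 0" "x \<in> X" for x using that by (auto simp: f dual_eq_iff)
  fix g assume "g \<in> range (\<lambda>a (_ :: 'a). Dual a 0)"
  then obtain b where g: "g = (\<lambda>_. Dual b 0)" by auto
  show "(\<lambda>x. f x + g x) \<in> range (\<lambda>a _. Dual a 0)"
    by (rule range_eqI[of _ _ "a + b"]) (simp add: f g dual_eq_iff fun_eq_iff)
  show "(\<lambda>x. f x * g x) \<in> range (\<lambda>a _. Dual a 0)"
    by (rule range_eqI[of _ _ "a * b"]) (simp add: f g dual_eq_iff fun_eq_iff)
qed auto

text \<open>The real part of \<open>F\<close> is kept, and its infinitesimal part is at most
  multiplied by the function \<open>t\<close>; irreducibility keeps it nonzero on
  \<open>X\<close>.\<close>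

lemma derivation_graph_extend_coord:
  assumes irr: "irreducible_on C X" and S: "derivation_graph C X S" and c: "c \<in> polyfun C"
    and F: "F \<in> S" "\<exists>x\<in>X. deps (F x) \<noteq> 0"
    and old: "\<And>b. b \<in> B \<Longrightarrow> \<exists>f\<in>S. \<forall>x. dre (f x) = b x"
  shows "\<exists>S' F'. derivation_graph C X S' \<and> F' \<in> S' \<and> (\<forall>x. dre (F' x) = dre (F x)) \<and> (\<exists>x\<in>X. deps (F' x) \<noteq> 0) \<and>
    (\<forall>b\<in>insert c B. \<exists>f\<in>S'. \<forall>x. dre (f x) = b x)"
proof -
  let ?rel = "\<lambda>d. \<exists>q. (\<forall>i. q i \<in> S) \<and> (\<forall>x\<in>X. (\<Sum>i<Suc d. dre (q i x) * c x ^ i) = 0) \<and> (\<exists>x\<in>X. dre (q d x) \<noteq> 0)"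
  have coeffs: "dre (p i x) = 0"
    if norel: "\<And>d'. d' < e \<Longrightarrow> \<not> ?rel d'" and p: "\<And>i. p i \<in> S" "\<And>x. x \<in> X \<Longrightarrow> (\<Sum>i<e. dre (p i x) * c x ^ i) = 0"
      and ix: "i < e" "x \<in> X" for e p i x
    using norel p(2) ix
  proof (induction e arbitrary: i x)
    case (Suc e)
    have top: "dre (p e y) = 0" if "y \<in> X" for y
      using Suc.prems(1)[of e] Suc.prems(2) p(1) that by blast
    then have "(\<Sum>i<e. dre (p i y) * c y ^ i) = 0" if "y \<in> X" for y
      using Suc.prems(2)[OF that] that by simp
    then have "dre (p i x) = 0" if "i < e" using Suc.IH[of i x] Suc.prems(1,4) that by simp
    then show ?case using top Suc.prems(3,4) less_Suc_eq by blast
  qed simp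
  show ?thesis
  proof (cases "\<exists>d. ?rel d")
    case False
    define w where "w x = Dual (c x) 0" for x
    have wp: "(\<lambda>x. dre (w x)) \<in> polyfun C" "(\<lambda>x. deps (w x)) \<in> polyfun C"
      by (simp_all add: w_def c polyfun.const)
    have "derivation_graph C X (adjoin S w)"
    proof (rule derivation_graph_adjoin_transcendental[OF S wp])
      fix q e i x
      assume q: "\<And>i. q i \<in> S" "\<And>x. x \<in> X \<Longrightarrow> (\<Sum>i<e. dre (q i x) * dre (w x) ^ i) = 0" "i < e" "x \<in> X"
      have norel: "\<not> ?rel d'" for d' using False by simp
      show "dre (q i x) = 0"
        by (rule coeffs[OF norel q(1) _ q(3,4)]) (use q(2) in \<open>simp add: w_def\<close>)
    qed
    moreover have sub: "S \<subseteq> adjoin S w" and w_in: "w \<in> adjoin S w"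
      using S by (simp_all only: derivation_graph_iff dual_subring_adjoin(2,3)[OF _ wp])
    moreover have "\<exists>f\<in>adjoin S w. \<forall>x. dre (f x) = c x"
      by (rule bexI[OF _ w_in]) (simp add: w_def)
    moreover have "\<exists>f\<in>adjoin S w. \<forall>x. dre (f x) = b x" if "b \<in> B" for b
      using old[OF that] sub by blast
    ultimately show ?thesis using F by (intro exI[of _ "adjoin S w"] exI[of _ F]) auto
  next
    case True
    then obtain d where d: "?rel d" "\<And>d'. d' < d \<Longrightarrow> \<not> ?rel d'"
      using exists_least_iff[of ?rel] by blast
    then obtain q where q: "\<And>i. q i \<in> S" "\<And>x. x \<in> X \<Longrightarrow> (\<Sum>i<Suc d. dre (q i x) * c x ^ i) = 0" "\<exists>x\<in>X. dre (q d x) \<noteq> 0"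
      by blast
    obtain t w where tw: "t \<in> polyfun C" "\<exists>x\<in>X. t x \<noteq> 0" "\<And>x. dre (w x) = c x"
       "derivation_graph C X (adjoin ((\<lambda>f x. rescale (t x) (f x)) ` S) w)"
    proof -
      have min: "dre (p i x) = 0" if "\<And>i. p i \<in> S" "\<And>x. x \<in> X \<Longrightarrow> (\<Sum>i<d. dre (p i x) * c x ^ i) = 0"
        "i < d" "x \<in> X" for p i x
        by (rule coeffs[OF d(2) that(1) that(2) that(3,4)])
      have "\<exists>t w. t \<in> polyfun C \<and> (\<exists>x\<in>X. t x \<noteq> 0) \<and> (\<forall>x. dre (w x) = c x) \<and>
         derivation_graph C X (adjoin ((\<lambda>f x. rescale (t x) (f x)) ` S) w)"
      proof (rule derivation_graph_adjoin_algebraic[where q = q and d = d])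
        show "dre (p i x) = 0" if "\<And>i. p i \<in> S" "\<And>x. x \<in> X \<Longrightarrow> (\<Sum>i<d. dre (p i x) * c x ^ i) = 0"
          "i < d" "x \<in> X" for p i x
          using min[of p i x] that by simp
      qed (rule irr, rule S, rule c, rule q(1), erule q(2), rule q(3))
      then show thesis by (elim exE conjE) (rule that, simp_all)
    qed
    let ?S = "(\<lambda>f x. rescale (t x) (f x)) ` S"
    have w_in: "w \<in> adjoin ?S w"
    proof (rule adjoinI[where q = "\<lambda>i. if i = 1 then (\<lambda>_. Dual 1 0) else (\<lambda>_. Dual 0 0)" and e = 2])
      have "(\<lambda>_. Dual a 0) \<in> ?S" for a
        by (rule image_eqI[OF _ derivation_graphD(1)[OF S, of a]]) (simp add: rescale_ring)
      then show "(if i = 1 then (\<lambda>_. Dual 1 0) else (\<lambda>_. Dual 0 0)) \<in> ?S" for i :: nat by simp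
    qed (simp add: numeral_2_eq_2 flip: zero_dual_def one_dual_def)
    have sub: "?S \<subseteq> adjoin ?S w"
    proof
      fix f assume "f \<in> ?S"
      then show "f \<in> adjoin ?S w" by (intro adjoinI[where q = "\<lambda>_. f" and e = 1]) auto
    qed
    have "\<exists>x\<in>X. t x * deps (F x) \<noteq> 0"
      using irreducible_onD[OF irr tw(1) derivation_graphD(5)[OF S F(1)]] tw(2) F(2) by auto
    moreover have "\<exists>f\<in>adjoin ?S w. \<forall>x. dre (f x) = b x" if b: "b \<in> insert c B" for b
    proof (cases "b = c")
      case True
      then show ?thesis using tw(3) w_in by (intro bexI[of _ w]) auto
    next
      case False
      then obtain f where f: "f \<in> S" "\<forall>x. dre (f x) = b x" using old b by blast
      have "(\<lambda>x. rescale (t x) (f x)) \<in> adjoin ?S w" using sub f(1) by blast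
      then show ?thesis by (rule bexI[rotated]) (simp add: f(2))
    qed
    moreover have "(\<lambda>x. rescale (t x) (F x)) \<in> adjoin ?S w" using sub F(1) by blast
    ultimately show ?thesis using tw(4)
      by (intro exI[of _ "adjoin ?S w"] exI[of _ "\<lambda>x. rescale (t x) (F x)"]) simp
  qed
qed

text \<open>On the ring generated by \<open>F\<close> alone the derivation d/dF exists, because a
  nonconstant function on an irreducible set is transcendental over the constants. It is extended
  coordinate by coordinate and evaluated at a point where the derivative of \<open>F\<close>
  survives. The purpose is to prove functions on a group constant.\<close>

theorem irreducible_nonconstant_derivation:
  assumes C: "finite C" and irr: "irreducible_on C X" and F: "F \<in> polyfun C"
    and nonconst: "x1 \<in> X" "x2 \<in> X" "F x1 \<noteq> F x2"
  obtains x L where "x \<in> X" "point_derivation C x L" "\<And>f. f \<in> polyfun C \<Longrightarrow> (\<And>y. y \<in> X \<Longrightarrow> f y = 0) \<Longrightarrow> L f = 0"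
    "L F \<noteq> 0"
proof -
  let ?S0 = "range (\<lambda>a (_ :: 'a). Dual a 0)" and ?w0 = "\<lambda>x. Dual (F x) 1"
  have S0: "derivation_graph C X ?S0" by (rule derivation_graph_constants) (use nonconst(1) in auto)
  have w0: "(\<lambda>x. dre (?w0 x)) \<in> polyfun C" "(\<lambda>x. deps (?w0 x)) \<in> polyfun C" by (simp_all add: F polyfun.const)
  have S1: "derivation_graph C X (adjoin ?S0 ?w0)"
  proof (rule derivation_graph_adjoin_transcendental[OF S0 w0])
    fix q :: "nat \<Rightarrow> 'a \<Rightarrow> dual" and e i x
    assume q: "\<And>i. q i \<in> ?S0" "\<And>x. x \<in> X \<Longrightarrow> (\<Sum>i<e. dre (q i x) * dre (?w0 x) ^ i) = 0" "i < e" "x \<in> X"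
    have "\<forall>i. \<exists>a. q i = (\<lambda>_. Dual a 0)" using q(1) by blast
    then obtain a where a: "\<And>i. q i = (\<lambda>_. Dual (a i) 0)" by metis
    define p where "p = (\<Sum>i<e. monom (a i) i)"
    have poly0: "poly p (F x) = 0" if "x \<in> X" for x
      using q(2)[OF that] by (simp add: p_def poly_sum poly_monom a)
    have "p = 0"
    proof (rule ccontr)
      assume "p \<noteq> 0"
      then have fin: "finite {z. poly p z = 0}" by (rule poly_roots_finite)
      have "\<forall>x\<in>X. (\<Prod>z\<in>{z. poly p z = 0}. F x - z) = 0"
        using poly0 fin by (auto simp: prod_zero_iff)
      then have "\<exists>z\<in>{z. poly p z = 0}. \<forall>x\<in>X. F x - z = 0"
        by (intro irreducible_on_prod[OF irr _ fin]) (use nonconst(1) F in \<open>auto intro: polyfun_diff polyfun.const\<close>)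
      then show False using nonconst by auto
    qed
    moreover have "coeff p i = a i" using q(3) by (simp add: p_def coeff_sum)
    ultimately show "dre (q i x) = 0" by (simp add: a)
  qed
  have F1: "?w0 \<in> adjoin ?S0 ?w0" using S0 dual_subring_adjoin(3)[OF _ w0] by (simp add: derivation_graph_iff)
  have "\<exists>S F'. derivation_graph C X S \<and> F' \<in> S \<and> (\<forall>x. dre (F' x) = F x) \<and> (\<exists>x\<in>X. deps (F' x) \<noteq> 0) \<and>
      (\<forall>b\<in>B. \<exists>f\<in>S. \<forall>x. dre (f x) = b x)" if "B \<subseteq> C" "finite B" for B
    using that(2,1)
  proof (induction rule: finite_induct)
    case empty
    then show ?case using S1 F1 nonconst(1) by (intro exI[of _ "adjoin ?S0 ?w0"] exI[of _ ?w0]) auto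
  next
    case (insert c B)
    have "B \<subseteq> C" using insert.prems by simp
    from insert.IH[OF this] obtain S F' where "derivation_graph C X S \<and> F' \<in> S \<and> (\<forall>x. dre (F' x) = F x) \<and>
      (\<exists>x\<in>X. deps (F' x) \<noteq> 0) \<and> (\<forall>b\<in>B. \<exists>f\<in>S. \<forall>x. dre (f x) = b x)" by (elim exE)
    then have S: "derivation_graph C X S" "F' \<in> S" "\<And>x. dre (F' x) = F x" "\<exists>x\<in>X. deps (F' x) \<noteq> 0"
      "\<And>b. b \<in> B \<Longrightarrow> \<exists>f\<in>S. \<forall>x. dre (f x) = b x" by simp_all
    have "c \<in> polyfun C" using insert.prems by (auto intro: polyfun.coord)
    from derivation_graph_extend_coord[OF irr S(1) this S(2,4,5)] show ?case using S(3) by simp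
  qed
  from this[OF order_refl C] obtain S F' where "derivation_graph C X S \<and> F' \<in> S \<and> (\<forall>x. dre (F' x) = F x) \<and>
      (\<exists>x\<in>X. deps (F' x) \<noteq> 0) \<and> (\<forall>b\<in>C. \<exists>f\<in>S. \<forall>x. dre (f x) = b x)" by (elim exE)
  then have S: "derivation_graph C X S" "F' \<in> S" "\<And>x. dre (F' x) = F x"
    "\<exists>x\<in>X. deps (F' x) \<noteq> 0" "\<And>b. b \<in> C \<Longrightarrow> \<exists>f\<in>S. \<forall>x. dre (f x) = b x" by simp_all
  note SD = derivation_graphD[OF S(1)]
  obtain x0 where x0: "x0 \<in> X" "deps (F' x0) \<noteq> 0" using S(4) by blast
  have lift: "\<exists>f'\<in>S. \<forall>x. dre (f' x) = f x" if "f \<in> polyfun C" for f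
    using that
  proof induction
    case (const a)
    show ?case by (rule bexI[OF _ SD(1)[of a]]) simp
  next
    case (add f g)
    then obtain f' g' where "f' \<in> S" "\<forall>x. dre (f' x) = f x" "g' \<in> S" "\<forall>x. dre (g' x) = g x" by blast
    then show ?case by (intro bexI[OF _ SD(2)[of f' g']]) auto
  next
    case (mult f g)
    then obtain f' g' where "f' \<in> S" "\<forall>x. dre (f' x) = f x" "g' \<in> S" "\<forall>x. dre (g' x) = g x" by blast
    then show ?case by (intro bexI[OF _ SD(3)[of f' g']]) auto
  qed (use S(5) in auto)
  have uniq: "deps (f x) = deps (g x)" if fg: "f \<in> S" "g \<in> S" "\<And>y. y \<in> X \<Longrightarrow> dre (f y) = dre (g y)" "x \<in> X" for f g x
  proof -
    have "(\<lambda>x. f x + Dual (-1) 0 * g x) \<in> S" by (intro SD(2) SD(3) SD(1) fg)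
    then have "f x + Dual (-1) 0 * g x = 0" by (rule SD(6)[OF _ _ fg(4)]) (use fg(3) in simp)
    then show ?thesis by (simp add: dual_eq_iff)
  qed
  define l where "l f = (SOME f'. f' \<in> S \<and> (\<forall>x. dre (f' x) = f x))" for f
  have l: "l f \<in> S" "dre (l f x) = f x" if "f \<in> polyfun C" for f x
    using someI_ex[of "\<lambda>f'. f' \<in> S \<and> (\<forall>x. dre (f' x) = f x)"] lift[OF that] unfolding l_def by (auto simp: Bex_def)
  define L where "L f = deps (l f x0)" for f
  have Leq: "L f = deps (f' x0)" if "f \<in> polyfun C" "f' \<in> S" "\<And>y. dre (f' y) = f y" for f f'
    unfolding L_def by (rule uniq[OF l(1)[OF that(1)] that(2) _ x0(1)]) (simp add: l(2)[OF that(1)] that(3))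
  show thesis
  proof (rule that[OF x0(1)])
    show "point_derivation C x0 L" unfolding point_derivation_def
    proof (intro conjI allI ballI)
      show "L (\<lambda>_. a) = 0" for a using Leq[OF polyfun.const SD(1)[of a]] by simp
      fix f g assume fg: "f \<in> polyfun C" "g \<in> polyfun C"
      show "L (\<lambda>y. f y + g y) = L f + L g"
        using Leq[OF polyfun.add[OF fg] SD(2)[OF l(1)[OF fg(1)] l(1)[OF fg(2)]]] l(2) fg by (simp add: L_def)
      show "L (\<lambda>y. f y * g y) = f x0 * L g + g x0 * L f"
        using Leq[OF polyfun.mult[OF fg] SD(3)[OF l(1)[OF fg(1)] l(1)[OF fg(2)]]] l(2) fg by (simp add: L_def)
    qed
    show "L f = 0" if "f \<in> polyfun C" "\<And>y. y \<in> X \<Longrightarrow> f y = 0" for f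
      using SD(6)[OF l(1)[OF that(1)] _ x0(1)] l(2)[OF that(1)] that(2) by (simp add: L_def dual_eq_iff)
    show "L F \<noteq> 0" using Leq[OF F S(2,3)] x0(2) by simp
  qed
qed

section \<open>Directional derivatives on matrix spaces\<close>

definition of_entries :: "('n \<times> 'n \<Rightarrow> complex) \<Rightarrow> complex^'n^'n" where
  "of_entries z = (\<chi> i j. z (i, j))"

definition entries :: "complex^'n^'n \<Rightarrow> 'n \<times> 'n \<Rightarrow> complex" where
  "entries X = (\<lambda>p. X $ fst p $ snd p)"

lemma of_entries_entries [simp]: "of_entries (entries X) = X"
  by (simp add: of_entries_def entries_def vec_eq_iff)

lemma of_entries_nth [simp]: "of_entries z $ i $ j = z (i, j)"
  by (simp add: of_entries_def)

lemma mat_coordsE: "c \<in> mat_coords \<Longrightarrow> (\<And>i j. c = (\<lambda>X. X $ i $ j) \<Longrightarrow> P) \<Longrightarrow> P"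
  by (auto simp: mat_coords_def)

lemma mat_coordsI: "(\<lambda>X. X $ i $ j) \<in> mat_coords"
  unfolding mat_coords_def by blast

lemma poly_deg_compose:
  assumes "f \<in> poly_deg C n" "\<And>c. c \<in> C \<Longrightarrow> (\<lambda>x. c (m x)) \<in> C'"
  shows "(\<lambda>x. f (m x)) \<in> poly_deg C' n"
proof -
  have "(\<lambda>x. b (m x)) \<in> poly_deg C' n" if "b \<in> monomials C n" for b
    using that
  proof (induction n arbitrary: b)
    case 0
    then show ?case by (simp add: poly_deg_const)
  next
    case (Suc n)
    show ?case
    proof (cases "b \<in> monomials C n")
      case True
      then show ?thesis using Suc.IH poly_deg_mono[of n "Suc n" C'] by auto
    next
      case False
      then obtain c b' where "c \<in> C" "b' \<in> monomials C n" "b = (\<lambda>x. c x * b' x)" using Suc.prems by auto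
      then show ?thesis using poly_deg_coord_mult[OF assms(2) Suc.IH, of c b'] by simp
    qed
  qed
  moreover have "fs.subspace {f. (\<lambda>x. f (m x)) \<in> poly_deg C' n}"
    by (auto simp: fs.subspace_def poly_deg_const poly_deg_add poly_deg_scale)
  ultimately have "poly_deg C n \<subseteq> {f. (\<lambda>x. f (m x)) \<in> poly_deg C' n}"
    by (intro poly_deg_subset) auto
  then show ?thesis using assms(1) by auto
qed

lemma coord_of_entries: "c \<in> mat_coords \<Longrightarrow> (\<lambda>z. c (of_entries z)) \<in> vars UNIV"
  by (elim mat_coordsE) (simp add: vars_coord)

lemma coord_entries: "c \<in> vars UNIV \<Longrightarrow> (\<lambda>X. c (entries X)) \<in> mat_coords"
  by (auto simp: vars_def entries_def mat_coordsI)

lemma polyfun_of_entries: "f \<in> polyfun mat_coords \<Longrightarrow> (\<lambda>z. f (of_entries z)) \<in> polyfun (vars UNIV)"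
  by (rule polyfun_compose[where m = of_entries]) (auto intro: polyfun.coord coord_of_entries)

definition dd :: "(complex^'n^'n \<Rightarrow> complex) \<Rightarrow> complex^'n^'n \<Rightarrow> complex^'n^'n \<Rightarrow> complex" where
  "dd f y v = (\<Sum>p\<in>UNIV. v $ fst p $ snd p * pd p (\<lambda>z. f (of_entries z)) (entries y))"

lemma dd_add_direction: "dd f y (v + w) = dd f y v + dd f y w"
  and dd_scale_direction: "dd f y (cscale c v) = c * dd f y v"
  and dd_zero_direction [simp]: "dd f y 0 = 0"
  by (simp_all add: dd_def algebra_simps sum.distrib sum_distrib_left)

lemma point_derivation_dd: "point_derivation mat_coords y (\<lambda>f. dd f y v)"
  unfolding dd_def
proof (rule point_derivation_lincomb)
  fix p
  have "point_derivation mat_coords (of_entries (entries y)) (\<lambda>f. pd p (\<lambda>z. f (of_entries z)) (entries y))"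
    by (rule point_derivation_pullback[OF point_derivation_pd[of UNIV]]) (rule polyfun.coord, rule coord_of_entries)
  then show "point_derivation mat_coords y (\<lambda>f. pd p (\<lambda>z. f (of_entries z)) (entries y))" by simp
qed

lemma dd_entry: "dd (\<lambda>X. X $ i $ j) y v = v $ i $ j"
proof -
  have "dd (\<lambda>X. X $ i $ j) y v = (\<Sum>p\<in>UNIV. if p = (i, j) then v $ i $ j else 0)"
    unfolding dd_def by (rule sum.cong) (auto simp: pd_var)
  then show ?thesis by simp
qed

lemma dd_curve:
  assumes "f \<in> polyfun mat_coords" "\<And>i j. ((\<lambda>t. \<gamma> t $ i $ j) has_field_derivative V $ i $ j) (at t0)"
  shows "((\<lambda>t. f (\<gamma> t)) has_field_derivative dd f (\<gamma> t0) V) (at t0)"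
proof -
  have "((\<lambda>t. f (of_entries (entries (\<gamma> t)))) has_field_derivative
      (\<Sum>p\<in>UNIV. V $ fst p $ snd p * pd p (\<lambda>z. f (of_entries z)) (entries (\<gamma> t0)))) (at t0)"
    by (rule polyfun_curve_derivative[OF finite_class.finite_UNIV polyfun_of_entries[OF assms(1)], where \<gamma> = "\<lambda>t. entries (\<gamma> t)"])
      (simp add: entries_def assms(2))
  then show ?thesis by (simp add: dd_def)
qed

lemma dd_line:
  assumes "f \<in> polyfun mat_coords"
  shows "((\<lambda>t. f (y + cscale t v)) has_field_derivative dd f y v) (at 0)"
proof -
  have "((\<lambda>t. f (y + cscale t v)) has_field_derivative dd f (y + cscale 0 v) v) (at 0)"
    by (rule dd_curve[OF assms]) (auto intro!: derivative_eq_intros)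
  then show ?thesis by simp
qed

lemma point_derivation_matrix_chain:
  assumes "point_derivation C x L" "f \<in> polyfun mat_coords" "\<And>i j. (\<lambda>x. m x $ i $ j) \<in> polyfun C"
  shows "L (\<lambda>x. f (m x)) = dd f (m x) (\<chi> i j. L (\<lambda>x. m x $ i $ j))"
proof -
  have eq: "of_entries (\<lambda>p. m x $ fst p $ snd p) = m x" for x by (simp add: vec_eq_iff)
  have "L (\<lambda>x. f (of_entries (\<lambda>p. m x $ fst p $ snd p))) =
      (\<Sum>p\<in>UNIV. L (\<lambda>x. m x $ fst p $ snd p) * pd p (\<lambda>z. f (of_entries z)) (\<lambda>p. m x $ fst p $ snd p))"
    by (rule polyfun_chain_rule[OF finite_class.finite_UNIV polyfun_of_entries[OF assms(2)] assms(1),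
          where h = "\<lambda>p x. m x $ fst p $ snd p"]) (rule assms(3))
  then show ?thesis by (simp add: eq dd_def entries_def)
qed

lemma linear_poly_deg: "(\<lambda>x. \<Sum>a\<in>A. r a * c a x) \<in> poly_deg C (Suc n)" if "\<And>a. a \<in> A \<Longrightarrow> c a \<in> C"
  using that by (intro poly_deg_sum poly_deg_scale poly_deg_coord)

text \<open>A vector field with coefficients of degree at most one does not raise the degree, so
  that polynomials of bounded degree form a finite-dimensional space on which the adjoint vector
  fields act.\<close>

lemma dd_poly_deg:
  assumes f: "f \<in> poly_deg mat_coords n" and V: "\<And>i j. (\<lambda>y. V y $ i $ j) \<in> poly_deg mat_coords 1"
  shows "(\<lambda>y. dd f y (V y)) \<in> poly_deg mat_coords n"
  unfolding dd_def
proof (rule poly_deg_sum)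
  fix p
  let ?g = "\<lambda>z. f (of_entries z)"
  have g: "?g \<in> poly_deg (vars UNIV) n" by (rule poly_deg_compose[OF f coord_of_entries])
  then have pd: "pd p ?g \<in> poly_deg (vars UNIV) (n - 1)" "n = 0 \<Longrightarrow> pd p ?g = (\<lambda>_. 0)"
    using pd_poly_deg[OF g, of p] by auto
  show "(\<lambda>y. V y $ fst p $ snd p * pd p ?g (entries y)) \<in> poly_deg mat_coords n"
  proof (cases n)
    case 0
    then show ?thesis using pd(2) by (simp add: poly_deg_const)
  next
    case (Suc m)
    have "(\<lambda>y. pd p ?g (entries y)) \<in> poly_deg mat_coords (n - 1)"
      by (rule poly_deg_compose[OF pd(1) coord_entries])
    from poly_deg_mult[OF V this] show ?thesis using Suc by simp
  qed
qed

section \<open>The vector fields of the adjoint action\<close>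

definition ad_deriv :: "complex^'n^'n \<Rightarrow> (complex^'n^'n \<Rightarrow> complex) \<Rightarrow> complex^'n^'n \<Rightarrow> complex" where
  "ad_deriv u f y = dd f y (lie_bracket u y)"

lemma lie_bracket_entry_poly_deg: "(\<lambda>y. lie_bracket u y $ i $ j) \<in> poly_deg mat_coords (Suc n)"
proof -
  have eq: "(\<lambda>y. lie_bracket u y $ i $ j) =
      (\<lambda>y. (\<Sum>k\<in>UNIV. u $ i $ k * y $ k $ j) + (\<Sum>k\<in>UNIV. (- u $ k $ j) * y $ i $ k))"
    by (simp add: lie_bracket_def matrix_matrix_mult_def sum_negf fun_eq_iff mult.commute)
  show ?thesis unfolding eq by (intro poly_deg_add linear_poly_deg mat_coordsI)
qed

lemma ad_deriv_poly_deg: "f \<in> poly_deg mat_coords n \<Longrightarrow> ad_deriv u f \<in> poly_deg mat_coords n"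
  unfolding ad_deriv_def[abs_def] using dd_poly_deg[of f n "lie_bracket u"] lie_bracket_entry_poly_deg[of u _ _ 0]
  by (simp add: numeral_1_eq_Suc_0)

lemma ad_deriv_polyfun: "f \<in> polyfun mat_coords \<Longrightarrow> ad_deriv u f \<in> polyfun mat_coords"
  using polyfun_imp_poly_deg ad_deriv_poly_deg poly_deg_imp_polyfun by metis

lemma point_derivation_ad_deriv: "point_derivation mat_coords y (\<lambda>f. ad_deriv u f y)"
  unfolding ad_deriv_def by (rule point_derivation_dd)

lemmas ad_derivD = point_derivationD[OF point_derivation_ad_deriv]

lemma ad_deriv_mult:
  "f \<in> polyfun mat_coords \<Longrightarrow> g \<in> polyfun mat_coords \<Longrightarrow>
    ad_deriv u (\<lambda>y. f y * g y) = (\<lambda>y. f y * ad_deriv u g y + g y * ad_deriv u f y)"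
  by (rule ext) (rule ad_derivD(3))

lemma ad_deriv_plus:
  "f \<in> polyfun mat_coords \<Longrightarrow> g \<in> polyfun mat_coords \<Longrightarrow>
    ad_deriv u (\<lambda>y. f y + g y) = (\<lambda>y. ad_deriv u f y + ad_deriv u g y)"
  by (rule ext) (rule ad_derivD(2))

lemma ad_deriv_add_left: "ad_deriv (u + v) f y = ad_deriv u f y + ad_deriv v f y"
  and ad_deriv_scale_left: "ad_deriv (cscale c u) f y = c * ad_deriv u f y"
  by (simp_all add: ad_deriv_def lie_bilinear dd_add_direction dd_scale_direction)

lemma ad_deriv_entry: "ad_deriv u (\<lambda>X. X $ i $ j) = (\<lambda>y. lie_bracket u y $ i $ j)"
  by (simp add: ad_deriv_def dd_entry fun_eq_iff)

lemma ad_deriv_const: "ad_deriv u (\<lambda>_. a) = (\<lambda>_. 0)"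
  by (rule ext) (rule ad_derivD(1))

text \<open>The second-order parts cancel, so both sides are derivations and may be compared on
  matrix entries, where the identity is Jacobi's. Acting on functions reverses the bracket, whence
  the order of \<open>u\<close> and \<open>v\<close>.\<close>

lemma ad_deriv_commutator:
  assumes f: "f \<in> polyfun mat_coords"
  shows "ad_deriv (lie_bracket u v) f y = ad_deriv v (ad_deriv u f) y - ad_deriv u (ad_deriv v f) y"
proof (rule point_derivation_unique[OF point_derivation_ad_deriv _ _ f])
  show "point_derivation mat_coords y (\<lambda>f. ad_deriv v (ad_deriv u f) y - ad_deriv u (ad_deriv v f) y)"
    unfolding point_derivation_def
  proof (intro conjI ballI allI)
    show "ad_deriv v (ad_deriv u (\<lambda>_. a)) y - ad_deriv u (ad_deriv v (\<lambda>_. a)) y = 0" for a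
      by (simp add: ad_deriv_const)
    fix f g :: "complex^'a^'a \<Rightarrow> complex" assume fg: "f \<in> polyfun mat_coords" "g \<in> polyfun mat_coords"
    note p = fg ad_deriv_polyfun[OF fg(1)] ad_deriv_polyfun[OF fg(2)]
    show "ad_deriv v (ad_deriv u (\<lambda>y. f y + g y)) y - ad_deriv u (ad_deriv v (\<lambda>y. f y + g y)) y =
        ad_deriv v (ad_deriv u f) y - ad_deriv u (ad_deriv v f) y + (ad_deriv v (ad_deriv u g) y - ad_deriv u (ad_deriv v g) y)"
      by (simp add: ad_deriv_plus p)
    show "ad_deriv v (ad_deriv u (\<lambda>y. f y * g y)) y - ad_deriv u (ad_deriv v (\<lambda>y. f y * g y)) y =
        f y * (ad_deriv v (ad_deriv u g) y - ad_deriv u (ad_deriv v g) y) +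
        g y * (ad_deriv v (ad_deriv u f) y - ad_deriv u (ad_deriv v f) y)"
      by (simp add: ad_deriv_mult ad_deriv_plus p polyfun.mult algebra_simps)
  qed
  fix c :: "complex^'a^'a \<Rightarrow> complex" assume "c \<in> mat_coords"
  then obtain i j where c: "c = (\<lambda>X. X $ i $ j)" by (rule mat_coordsE)
  have lin: "ad_deriv w (\<lambda>y. lie_bracket w' y $ i $ j) y = lie_bracket w' (lie_bracket w y) $ i $ j" for w w'
  proof -
    have pol: "(\<lambda>y. lie_bracket w' y $ i $ j) \<in> polyfun mat_coords"
      using lie_bracket_entry_poly_deg poly_deg_imp_polyfun by blast
    have "((\<lambda>t. lie_bracket w' (y + cscale t (lie_bracket w y)) $ i $ j) has_field_derivative
        lie_bracket w' (lie_bracket w y) $ i $ j) (at 0)"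
      unfolding lie_bilinear by (auto intro!: derivative_eq_intros)
    from DERIV_unique[OF dd_line[OF pol] this] show ?thesis unfolding ad_deriv_def .
  qed
  show "ad_deriv (lie_bracket u v) c y = ad_deriv v (ad_deriv u c) y - ad_deriv u (ad_deriv v c) y"
    unfolding c ad_deriv_entry lin by (simp add: lie_jacobi)
qed

text \<open>The vector field of \<open>u\<close> is tangent to the closure of \<open>Y\<close>;
  equivalently it maps the ideal of \<open>Y\<close> into itself.\<close>

definition ad_stable :: "(complex^'n^'n) set \<Rightarrow> complex^'n^'n \<Rightarrow> bool" where
  "ad_stable Y u \<longleftrightarrow> (\<forall>f \<in> vanishing_ideal mat_coords Y. \<forall>y\<in>Y. ad_deriv u f y = 0)"

lemma ad_stableD: "ad_stable Y u \<Longrightarrow> f \<in> vanishing_ideal mat_coords Y \<Longrightarrow> ad_deriv u f \<in> vanishing_ideal mat_coords Y"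
  by (auto simp: ad_stable_def vanishing_ideal_def ad_deriv_polyfun)

lemma subspace_ad_stable: "cmat.subspace {u. ad_stable Y u}"
  by (auto simp: cmat.subspace_def ad_stable_def ad_deriv_add_left ad_deriv_scale_left) (simp add: ad_deriv_def)

lemma ad_stable_bracket: "ad_stable Y u \<Longrightarrow> ad_stable Y v \<Longrightarrow> ad_stable Y (lie_bracket u v)"
  unfolding ad_stable_def
proof (intro ballI)
  fix f y assume st: "\<forall>f\<in>vanishing_ideal mat_coords Y. \<forall>y\<in>Y. ad_deriv u f y = 0"
    "\<forall>f\<in>vanishing_ideal mat_coords Y. \<forall>y\<in>Y. ad_deriv v f y = 0"
    and f: "f \<in> vanishing_ideal mat_coords Y" and y: "y \<in> Y"
  have "ad_deriv u f \<in> vanishing_ideal mat_coords Y" "ad_deriv v f \<in> vanishing_ideal mat_coords Y"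
    using st f by (auto simp: vanishing_ideal_def ad_deriv_polyfun)
  then show "ad_deriv (lie_bracket u v) f y = 0"
    using st y f ad_deriv_commutator[of f u v y] by (auto simp: vanishing_ideal_def)
qed

section \<open>Triangular systems of functions\<close>

text \<open>The matrix of the values \<open>w i (z j)\<close> is unitriangular. This certifies
  linear independence and later gives a determinant equal to 1.\<close>

definition triangular_system :: "nat \<Rightarrow> (nat \<Rightarrow> 'a \<Rightarrow> complex) \<Rightarrow> (nat \<Rightarrow> 'a) \<Rightarrow> bool" where
  "triangular_system m w z \<longleftrightarrow> (\<forall>i<m. w i (z i) = 1) \<and> (\<forall>i<m. \<forall>j<i. w i (z j) = 0)"

lemma triangular_system_unique:
  assumes "triangular_system m w z" "\<And>x. (\<Sum>i<m. a i * w i x) = (\<Sum>i<m. b i * w i x)" "i < m"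
  shows "a i = b i"
  using assms(3)
proof (induction i rule: less_induct)
  case (less i)
  have "(\<Sum>l<m. (a l - b l) * w l (z i)) = (\<Sum>l<m. if l = i then a i - b i else 0)"
  proof (rule sum.cong)
    fix l assume l: "l \<in> {..<m}"
    show "(a l - b l) * w l (z i) = (if l = i then a i - b i else 0)"
    proof (cases l i rule: linorder_cases)
      case less
      then show ?thesis using less.IH[of l] l by simp
    next
      case equal
      then show ?thesis using assms(1) l by (simp add: triangular_system_def)
    next
      case greater
      then show ?thesis using assms(1) l by (simp add: triangular_system_def)
    qed
  qed simp
  moreover have "(\<Sum>l<m. (a l - b l) * w l (z i)) = 0"
    using assms(2)[of "z i"] by (simp add: left_diff_distrib sum_subtractf)
  ultimately show ?case using less.prems by simp
qed

lemma triangular_system_bound: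
  assumes tri: "triangular_system m w z" and B: "finite B" "\<And>i. i < m \<Longrightarrow> w i \<in> fs.span B"
  shows "m \<le> card B"
proof -
  have inj: "inj_on w {..<m}"
  proof (rule inj_onI)
    fix i j assume ij: "i \<in> {..<m}" "j \<in> {..<m}" "w i = w j"
    have "w j (z i) \<noteq> w i (z i)" if "i < j" "j < m" for i j
      using tri that by (simp add: triangular_system_def)
    then show "i = j" using ij by (metis lessThan_iff linorder_neqE_nat)
  qed
  have "fs.independent (w ` {..<m})"
  proof (rule fs.independent_if_scalars_zero)
    fix f x assume s: "(\<Sum>x\<in>w ` {..<m}. fscale (f x) x) = 0" and x: "x \<in> w ` {..<m}"
    then obtain i where i: "i < m" "x = w i" by auto
    have "(\<Sum>i<m. f (w i) * w i y) = (\<Sum>i<m. 0 * w i y)" for y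
    proof -
      have "(\<Sum>i<m. f (w i) * w i y) = (\<Sum>x\<in>w ` {..<m}. fscale (f x) x) y"
        by (simp add: fun_sum_apply sum.reindex[OF inj])
      then show ?thesis using s by simp
    qed
    from triangular_system_unique[OF tri this i(1)] show "f x = 0" using i by simp
  qed simp
  then have "card (w ` {..<m}) \<le> card B"
    using fs.independent_span_bound[OF B(1), of "w ` {..<m}"] B(2) by auto
  then show ?thesis using inj by (simp add: card_image)
qed

text \<open>A system of maximal length spans \<open>W\<close>: once \<open>f\<close> is interpolated
  at the points, the remainder vanishes at all of them and, if nonzero, would extend the system. The
  first point is prescribed.\<close>

lemma triangular_system_exists:
  assumes W: "fs.subspace W" "W \<subseteq> fs.span B" "finite B" and f0: "f0 \<in> W" "f0 z0 \<noteq> 0"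
  obtains m w z where "triangular_system m w z" "0 < m" "z 0 = z0" "\<And>i. i < m \<Longrightarrow> w i \<in> W"
    "\<And>f. f \<in> W \<Longrightarrow> \<exists>a. \<forall>x. f x = (\<Sum>i<m. a i * w i x)"
proof -
  define P where "P m \<longleftrightarrow> (\<exists>w z. triangular_system m w z \<and> 0 < m \<and> z 0 = z0 \<and> (\<forall>i<m. w i \<in> W))" for m
  have "P 1" unfolding P_def
    by (rule exI[of _ "\<lambda>_. fscale (inverse (f0 z0)) f0"], rule exI[of _ "\<lambda>_. z0"])
      (use W f0 in \<open>auto simp: triangular_system_def fs.subspace_scale\<close>)
  moreover have "m \<le> card B" if "P m" for m
    using that W triangular_system_bound[of m _ _ B] unfolding P_def by (meson subsetD)
  ultimately obtain m where m: "P m" "\<And>k. P k \<Longrightarrow> k \<le> m" by (metis Greatest_le_nat GreatestI_nat)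
  then obtain w z where wz: "triangular_system m w z" "0 < m" "z 0 = z0" "\<And>i. i < m \<Longrightarrow> w i \<in> W"
    unfolding P_def by blast
  have "\<exists>a. \<forall>x. f x = (\<Sum>i<m. a i * w i x)" if f: "f \<in> W" for f
  proof -
    have "\<exists>a. \<forall>j<k. f (z j) - (\<Sum>i<k. a i * w i (z j)) = 0" if "k \<le> m" for k
      using that
    proof (induction k)
      case (Suc k)
      then obtain a where a: "\<forall>j<k. f (z j) - (\<Sum>i<k. a i * w i (z j)) = 0" by auto
      let ?a = "a(k := f (z k) - (\<Sum>i<k. a i * w i (z k)))"
      have s: "(\<Sum>i<k. ?a i * w i x) = (\<Sum>i<k. a i * w i x)" for x by (rule sum.cong) auto
      have "f (z j) - (\<Sum>i<Suc k. ?a i * w i (z j)) = 0" if j: "j < Suc k" for j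
      proof (cases "j = k")
        case True
        then show ?thesis using wz(1) Suc.prems by (simp add: s triangular_system_def del: fun_upd_apply) simp
      next
        case False
        then have jk: "j < k" using j by simp
        then have "w k (z j) = 0" using wz(1) Suc.prems by (simp add: triangular_system_def)
        then show ?thesis using a jk by (simp add: s del: fun_upd_apply)
      qed
      then show ?case by blast
    qed auto
    then obtain a where a: "\<forall>j<m. f (z j) - (\<Sum>i<m. a i * w i (z j)) = 0" by blast
    define r where "r = f - (\<Sum>i<m. fscale (a i) (w i))"
    have rW: "r \<in> W" unfolding r_def
      using wz(4) f W(1) by (intro fs.subspace_diff fs.subspace_sum fs.subspace_scale) auto
    have rx: "r x = f x - (\<Sum>i<m. a i * w i x)" for x by (simp add: r_def fun_sum_apply)
    have "r x = 0" for x
    proof (rule ccontr)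
      assume nz: "r x \<noteq> 0"
      let ?w = "w(m := fscale (inverse (r x)) r)" and ?z = "z(m := x)"
      have "triangular_system (Suc m) ?w ?z"
        using wz(1) nz a by (auto simp: triangular_system_def less_Suc_eq rx)
      moreover have "?w i \<in> W" if "i < Suc m" for i
        using that wz(4) rW W(1) by (auto simp: less_Suc_eq fs.subspace_scale)
      ultimately have "P (Suc m)" unfolding P_def using wz(2,3) by (intro exI[of _ ?w] exI[of _ ?z]) auto
      then show False using m(2) by fastforce
    qed
    then have "\<forall>x. f x = (\<Sum>i<m. a i * w i x)" by (simp add: rx)
    then show ?thesis by blast
  qed
  then show thesis using that wz by blast
qed

section \<open>Determinants indexed by natural numbers\<close>

text \<open>The size is a dimension found inside a proof, so the Leibniz formula is indexed by
  numbers instead of a finite type.\<close>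

definition ndet :: "nat \<Rightarrow> (nat \<Rightarrow> nat \<Rightarrow> complex) \<Rightarrow> complex" where
  "ndet m M = (\<Sum>p | p permutes {..<m}. of_int (sign p) * (\<Prod>i<m. M i (p i)))"

lemma ndet_column_zero:
  assumes "j < m" "\<And>i. i < m \<Longrightarrow> M i j = 0" shows "ndet m M = 0"
  unfolding ndet_def
proof (rule sum.neutral, clarify)
  fix p assume p: "p permutes {..<m}"
  then obtain i where "i < m" "p i = j" using permutes_image[OF p] assms(1) by (metis image_iff lessThan_iff)
  then show "of_int (sign p) * (\<Prod>i<m. M i (p i)) = 0" using assms(2) by auto
qed

lemma ndet_triangular:
  assumes "\<And>i. i < m \<Longrightarrow> M i i = 1" "\<And>i j. i < m \<Longrightarrow> j < i \<Longrightarrow> M i j = 0" shows "ndet m M = 1"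
proof -
  have "(\<Sum>p | p permutes {..<m}. of_int (sign p) * (\<Prod>i<m. M i (p i))) =
      (\<Sum>p | p permutes {..<m}. if p = id then 1 else 0 :: complex)"
  proof (rule sum.cong)
    fix p assume "p \<in> {p. p permutes {..<m}}"
    then have p: "p permutes {..<m}" by simp
    show "of_int (sign p) * (\<Prod>i<m. M i (p i)) = (if p = id then 1 else 0)"
    proof (cases "p = id")
      case False
      then obtain i where "i < m" "p i < i" using permutes_natset_ge[OF p] by (meson lessThan_iff not_le)
      then have "\<exists>i<m. M i (p i) = 0" using assms(2) by auto
      then show ?thesis using False by auto
    qed (simp add: assms(1))
  qed simp
  also have "\<dots> = 1" by (simp add: finite_permutations permutes_id)
  finally show ?thesis by (simp add: ndet_def)
qed

lemma ndet_equal_rows: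
  assumes "i < m" "k < m" "i \<noteq> k" "M i = M k" shows "ndet m M = 0"
proof -
  let ?t = "Transposition.transpose i k"
  have t: "?t permutes {..<m}" using assms by (intro permutes_swap_id) auto
  have "ndet m M = (\<Sum>p | p permutes {..<m}. of_int (sign (p \<circ> ?t)) * (\<Prod>l<m. M l ((p \<circ> ?t) l)))"
    unfolding ndet_def
    by (rule sum.reindex_bij_witness[of _ "\<lambda>p. p \<circ> ?t" "\<lambda>p. p \<circ> ?t"])
      (auto intro: permutes_compose[OF t] simp: comp_assoc)
  also have "\<dots> = (\<Sum>p | p permutes {..<m}. - (of_int (sign p) * (\<Prod>l<m. M l (p l))))"
  proof (rule sum.cong)
    fix p assume "p \<in> {p. p permutes {..<m}}"
    then have p: "p permutes {..<m}" by simp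
    have "sign (p \<circ> ?t) = - sign p"
      using assms(3) permutes_imp_permutation[OF _ p] permutes_imp_permutation[OF _ t]
      by (simp add: sign_compose sign_swap_id)
    moreover have "(\<Prod>l<m. M l ((p \<circ> ?t) l)) = (\<Prod>l<m. M (?t l) (p (?t l)))"
    proof (rule prod.cong)
      fix l
      have "M (?t l) = M l"
        using assms(4)[symmetric] unfolding Transposition.transpose_def by (cases "l = i") (simp, cases "l = k", simp_all)
      then show "M l ((p \<circ> ?t) l) = M (?t l) (p (?t l))" by simp
    qed simp
    moreover have "\<dots> = (\<Prod>l<m. M l (p l))"
      using prod.permute[OF t, of "\<lambda>l. M l (p l)"] by (simp add: comp_def)
    ultimately show "of_int (sign (p \<circ> ?t)) * (\<Prod>l<m. M l ((p \<circ> ?t) l)) = - (of_int (sign p) * (\<Prod>l<m. M l (p l)))"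
      by simp
  qed simp
  also have "\<dots> = - ndet m M" by (simp add: ndet_def sum_negf)
  finally show ?thesis by simp
qed

text \<open>Liouville's formula: replacing row \<open>i\<close> by row \<open>k\<close> makes the
  determinant 0 unless k = i, so only the trace of the coefficient matrix remains.\<close>

lemma ndet_derivative:
  assumes L: "point_derivation C x L" and M: "\<And>i j. i < m \<Longrightarrow> j < m \<Longrightarrow> M i j \<in> polyfun C"
    and rows: "\<And>i j. i < m \<Longrightarrow> j < m \<Longrightarrow> L (M i j) = (\<Sum>k<m. c k i * M k j x)"
  shows "L (\<lambda>x. ndet m (\<lambda>i j. M i j x)) = (\<Sum>i<m. c i i) * ndet m (\<lambda>i j. M i j x)"
proof -
  let ?N = "\<lambda>i j. M i j x"
  have pin: "p i < m" if "p permutes {..<m}" "i < m" for p i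
    using permutes_in_image[OF that(1), of i] that(2) by simp
  have pp: "(\<lambda>x. \<Prod>i<m. M i (p i) x) \<in> polyfun C" if p: "p permutes {..<m}" for p
    by (rule polyfun_prod, rule M) (use pin[OF p] in auto)
  have "L (\<lambda>x. ndet m (\<lambda>i j. M i j x)) = (\<Sum>p | p permutes {..<m}. L (\<lambda>x. of_int (sign p) * (\<Prod>i<m. M i (p i) x)))"
    unfolding ndet_def
  proof (rule point_derivation_sum[OF L, where f = "\<lambda>p x. of_int (sign p) * (\<Prod>i<m. M i (p i) x)"])
    fix p assume "p \<in> {p. p permutes {..<m}}"
    then show "(\<lambda>x. of_int (sign p) * (\<Prod>i<m. M i (p i) x)) \<in> polyfun C" by (intro polyfun_scale pp) simp
  qed
  also have "\<dots> = (\<Sum>p | p permutes {..<m}. of_int (sign p) *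
      (\<Sum>i<m. (\<Sum>k<m. c k i * ?N k (p i)) * (\<Prod>l\<in>{..<m} - {i}. ?N l (p l))))"
  proof (rule sum.cong)
    fix p assume "p \<in> {p. p permutes {..<m}}"
    then have p: "p permutes {..<m}" by simp
    have "L (\<lambda>x. of_int (sign p) * (\<Prod>i<m. M i (p i) x)) = of_int (sign p) * L (\<lambda>x. \<Prod>i<m. M i (p i) x)"
      by (rule point_derivation_scale[OF L pp[OF p]])
    also have "L (\<lambda>x. \<Prod>i<m. M i (p i) x) = (\<Sum>i<m. L (M i (p i)) * (\<Prod>l\<in>{..<m} - {i}. M l (p l) x))"
      by (rule point_derivation_prod[OF L, where f = "\<lambda>i. M i (p i)"]) (auto intro: M simp: pin[OF p])
    also have "\<dots> = (\<Sum>i<m. (\<Sum>k<m. c k i * ?N k (p i)) * (\<Prod>l\<in>{..<m} - {i}. ?N l (p l)))"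
      by (rule sum.cong) (simp_all add: rows pin[OF p])
    finally show "L (\<lambda>x. of_int (sign p) * (\<Prod>i<m. M i (p i) x)) = of_int (sign p) *
      (\<Sum>i<m. (\<Sum>k<m. c k i * ?N k (p i)) * (\<Prod>l\<in>{..<m} - {i}. ?N l (p l)))" .
  qed simp
  also have "\<dots> = (\<Sum>p | p permutes {..<m}. \<Sum>i<m. \<Sum>k<m. c k i * (of_int (sign p) * (?N k (p i) * (\<Prod>l\<in>{..<m} - {i}. ?N l (p l)))))"
  proof (rule sum.cong[OF refl])
    fix p
    have "of_int (sign p) * ((\<Sum>k<m. c k i * ?N k (p i)) * r) = (\<Sum>k<m. c k i * (of_int (sign p) * (?N k (p i) * r)))" for i r
      unfolding sum_distrib_right sum_distrib_left by (rule sum.cong) (simp_all only: mult.assoc mult.left_commute)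
    then show "of_int (sign p) * (\<Sum>i<m. (\<Sum>k<m. c k i * ?N k (p i)) * (\<Prod>l\<in>{..<m} - {i}. ?N l (p l))) =
      (\<Sum>i<m. \<Sum>k<m. c k i * (of_int (sign p) * (?N k (p i) * (\<Prod>l\<in>{..<m} - {i}. ?N l (p l)))))"
      by (simp only: sum_distrib_left)
  qed
  also have "\<dots> = (\<Sum>i<m. \<Sum>k<m. \<Sum>p | p permutes {..<m}. c k i * (of_int (sign p) * (?N k (p i) * (\<Prod>l\<in>{..<m} - {i}. ?N l (p l)))))"
    by (subst sum.swap, rule sum.cong[OF refl], rule sum.swap)
  also have "\<dots> = (\<Sum>i<m. \<Sum>k<m. c k i * ndet m (?N(i := ?N k)))"
  proof (rule sum.cong[OF refl], rule sum.cong[OF refl])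
    fix i k assume i: "i \<in> {..<m}"
    have "(\<Prod>l<m. (?N(i := ?N k)) l (p l)) = ?N k (p i) * (\<Prod>l\<in>{..<m} - {i}. ?N l (p l))" for p
      using i by (subst prod.remove[of _ i]) auto
    then show "(\<Sum>p | p permutes {..<m}. c k i * (of_int (sign p) * (?N k (p i) * (\<Prod>l\<in>{..<m} - {i}. ?N l (p l))))) =
        c k i * ndet m (?N(i := ?N k))"
      unfolding ndet_def sum_distrib_left by simp
  qed
  also have "\<dots> = (\<Sum>i<m. \<Sum>k<m. if k = i then c i i * ndet m ?N else 0)"
  proof (rule sum.cong[OF refl], rule sum.cong[OF refl])
    fix i k assume ik: "i \<in> {..<m}" "k \<in> {..<m}"
    show "c k i * ndet m (?N(i := ?N k)) = (if k = i then c i i * ndet m ?N else 0)"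
    proof (cases "k = i")
      case True
      then show ?thesis by (simp add: fun_upd_idem)
    next
      case False
      then have "ndet m (?N(i := ?N k)) = 0" using ik by (intro ndet_equal_rows[of i m k]) auto
      then show ?thesis using False by simp
    qed
  qed
  also have "\<dots> = (\<Sum>i<m. c i i) * ndet m ?N" by (simp add: sum_distrib_right)
  finally show ?thesis .
qed

section \<open>From the Lie algebra to the group\<close>

lemma det_polyfun:
  assumes "\<And>i j. (\<lambda>x. M x $ i $ j) \<in> polyfun C" shows "(\<lambda>x. det (M x)) \<in> polyfun C"
  unfolding det_def by (intro polyfun_sum polyfun.mult polyfun.const polyfun_prod assms)

lemma matrix_inv_cramer:
  fixes g :: "complex^'n^'n"
  assumes "invertible g"
  shows "det g * matrix_inv g $ k $ l = det (\<chi> i j. if j = k then (if i = l then 1 else 0) else g $ i $ j)"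
proof -
  have "det g \<noteq> 0" using assms invertible_det_nz by blast
  have "g *v (\<chi> i. matrix_inv g $ i $ l) = (\<chi> i. if i = l then 1 else 0)"
  proof -
    have "(g *v (\<chi> i. matrix_inv g $ i $ l)) $ i = (g ** matrix_inv g) $ i $ l" for i
      by (simp add: matrix_vector_mult_def matrix_matrix_mult_def)
    then show ?thesis using matrix_inv_works[OF assms] by (simp add: vec_eq_iff mat_def)
  qed
  then have "(\<chi> i. matrix_inv g $ i $ l) =
      (\<chi> k. det (\<chi> i j. if j = k then (\<chi> i. if i = l then 1 else 0) $ i else g $ i $ j) / det g)"
    using cramer[OF \<open>det g \<noteq> 0\<close>, of "\<chi> i. matrix_inv g $ i $ l" "\<chi> i. if i = l then 1 else 0"] by (simp only:)
  then have "matrix_inv g $ k $ l = det (\<chi> i j. if j = k then (if i = l then 1 else 0) else g $ i $ j) / det g"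
    by (simp add: vec_eq_iff cong: if_cong)
  then show ?thesis using \<open>det g \<noteq> 0\<close> by simp
qed

definition pair_coords :: "((complex^'n^'n) \<times> (complex^'n^'n) \<Rightarrow> complex) set" where
  "pair_coords = (\<lambda>f q. f (fst q)) ` mat_coords \<union> (\<lambda>f q. f (snd q)) ` mat_coords"

text \<open>Pairing \<open>g\<close> with its inverse makes conjugation by \<open>g\<close>
  polynomial in the coordinates.\<close>

definition group_pairs :: "(complex^'n^'n) set \<Rightarrow> ((complex^'n^'n) \<times> (complex^'n^'n)) set" where
  "group_pairs A = (\<lambda>g. (g, matrix_inv g)) ` A"

lemma finite_pair_coords: "finite pair_coords"
  by (simp add: pair_coords_def finite_mat_coords)

lemma fst_entry_polyfun: "(\<lambda>q. fst q $ i $ j) \<in> polyfun pair_coords"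
  by (rule polyfun.coord) (unfold pair_coords_def, rule UnI1, rule image_eqI[OF _ mat_coordsI], simp)

lemma snd_entry_polyfun: "(\<lambda>q. snd q $ i $ j) \<in> polyfun pair_coords"
  by (rule polyfun.coord) (unfold pair_coords_def, rule UnI2, rule image_eqI[OF _ mat_coordsI], simp)

lemma clear_denominators:
  assumes "f \<in> polyfun (pair_coords :: ((complex^'n^'n) \<times> (complex^'n^'n) \<Rightarrow> complex) set)"
  shows "\<exists>m. \<exists>F\<in>polyfun mat_coords. \<forall>g. invertible g \<longrightarrow> det g ^ m * f (g, matrix_inv g) = F g"
  using assms
proof induction
  case (coord c)
  then consider i j where "c = (\<lambda>q. fst q $ i $ j)" | i j where "c = (\<lambda>q. snd q $ i $ j)"
    unfolding pair_coords_def by (auto elim!: mat_coordsE)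
  then show ?case
  proof cases
    case 1
    then show ?thesis by (intro exI[of _ 0] bexI[OF _ entry_polyfun[of i j]]) auto
  next
    case 2
    let ?F = "\<lambda>g :: complex^'n^'n. det (\<chi> i' j'. if j' = i then (if i' = j then 1 else 0) else g $ i' $ j')"
    have "?F \<in> polyfun mat_coords"
    proof (rule det_polyfun)
      fix i' j'
      show "(\<lambda>g :: complex^'n^'n. (\<chi> i' j'. if j' = i then (if i' = j then 1 else 0) else g $ i' $ j') $ i' $ j') \<in> polyfun mat_coords"
        by (cases "j' = i") (simp_all add: polyfun.const entry_polyfun)
    qed
    then show ?thesis using 2 by (intro exI[of _ 1] bexI[of _ ?F]) (auto simp: matrix_inv_cramer)
  qed
next
  case (const a)
  show ?case by (intro exI[of _ 0] bexI[OF _ polyfun.const[of a]]) auto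
next
  case (add f f')
  then obtain m F m' F' where "F \<in> polyfun mat_coords" "\<And>g. invertible g \<Longrightarrow> det g ^ m * f (g, matrix_inv g) = F g"
    "F' \<in> polyfun mat_coords" "\<And>g. invertible g \<Longrightarrow> det g ^ m' * f' (g, matrix_inv g) = F' g" by blast
  note * = this
  have "(\<lambda>g. det g ^ m' * F g + det g ^ m * F' g) \<in> polyfun mat_coords"
    by (intro polyfun.add polyfun.mult polyfun_power det_polyfun entry_polyfun *)
  then show ?case
    by (intro exI[of _ "m + m'"], rule bexI[rotated]) (simp add: *(2,4)[symmetric] power_add algebra_simps)
next
  case (mult f f')
  then obtain m F m' F' where "F \<in> polyfun mat_coords" "\<And>g. invertible g \<Longrightarrow> det g ^ m * f (g, matrix_inv g) = F g"
    "F' \<in> polyfun mat_coords" "\<And>g. invertible g \<Longrightarrow> det g ^ m' * f' (g, matrix_inv g) = F' g" by blast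
  note * = this
  have "(\<lambda>g. F g * F' g) \<in> polyfun mat_coords" by (intro polyfun.mult *)
  then show ?case
    by (intro exI[of _ "m + m'"], rule bexI[rotated]) (simp add: *(2,4)[symmetric] power_add algebra_simps)
qed

lemma irreducible_group_pairs:
  assumes irr: "irreducible_on mat_coords A" and inv: "\<And>g. g \<in> A \<Longrightarrow> invertible g"
  shows "irreducible_on pair_coords (group_pairs A)"
  unfolding irreducible_on_def
proof (intro ballI impI)
  fix f f' assume f: "f \<in> polyfun pair_coords" and f': "f' \<in> polyfun pair_coords"
    and z: "\<forall>x\<in>group_pairs A. f x * f' x = 0"
  obtain m F where F: "F \<in> polyfun mat_coords" "\<And>g. invertible g \<Longrightarrow> det g ^ m * f (g, matrix_inv g) = F g"
    using clear_denominators[OF f] by blast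
  obtain m' F' where F': "F' \<in> polyfun mat_coords" "\<And>g. invertible g \<Longrightarrow> det g ^ m' * f' (g, matrix_inv g) = F' g"
    using clear_denominators[OF f'] by blast
  have nz: "det g \<noteq> 0" if "g \<in> A" for g using inv[OF that] invertible_det_nz by blast
  have "(\<forall>g\<in>A. F g = 0) \<or> (\<forall>g\<in>A. F' g = 0)"
  proof (rule irreducible_onD[OF irr F(1) F'(1)])
    fix g assume g: "g \<in> A"
    then have "f (g, matrix_inv g) * f' (g, matrix_inv g) = 0" using z by (auto simp: group_pairs_def)
    then show "F g * F' g = 0" using F(2)[OF inv[OF g]] F'(2)[OF inv[OF g]] by auto
  qed
  moreover have "f (g, matrix_inv g) = 0" if "g \<in> A" "F g = 0" for g
    using F(2)[OF inv[OF that(1)]] that nz by simp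
  moreover have "f' (g, matrix_inv g) = 0" if "g \<in> A" "F' g = 0" for g
    using F'(2)[OF inv[OF that(1)]] that nz by simp
  ultimately show "(\<forall>x\<in>group_pairs A. f x = 0) \<or> (\<forall>x\<in>group_pairs A. f' x = 0)"
    by (auto simp: group_pairs_def)
qed

lemma algebraic_groupD:
  assumes "algebraic_group A"
  shows "mat 1 \<in> A" "g \<in> A \<Longrightarrow> h \<in> A \<Longrightarrow> g ** h \<in> A" "g \<in> A \<Longrightarrow> matrix_inv g \<in> A" "g \<in> A \<Longrightarrow> invertible g"
  using assms by (auto simp: algebraic_group_def closedin_def)

lemma algebraic_group_closed:
  assumes "algebraic_group A" "invertible g" "\<And>f. f \<in> vanishing_ideal mat_coords A \<Longrightarrow> f g = 0"
  shows "g \<in> A"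
proof -
  obtain T where T: "closedin mat_zariski T" "A = T \<inter> {g. invertible g}"
    using assms(1) by (auto simp: algebraic_group_def closedin_subtopology)
  then obtain F where F: "F \<subseteq> polyfun mat_coords" "T = {x. \<forall>f\<in>F. f x = 0}" unfolding closedin_zariski_iff by blast
  have "F \<subseteq> vanishing_ideal mat_coords A" using F T(2) by (auto simp: vanishing_ideal_def)
  then show ?thesis using assms(2,3) F(2) T(2) by auto
qed

lemma lie_algebra_iff: "u \<in> lie_algebra A \<longleftrightarrow> (\<forall>f\<in>vanishing_ideal mat_coords A. dd f (mat 1) u = 0)"
proof -
  have "((\<lambda>t. f (mat 1 + cscale t u)) has_field_derivative 0) (at 0) \<longleftrightarrow> dd f (mat 1) u = 0"
    if "f \<in> vanishing_ideal mat_coords A" for f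
    using dd_line[of f "mat 1" u] that DERIV_unique by (fastforce simp: vanishing_ideal_def)
  then show ?thesis by (simp add: lie_algebra_def)
qed

lemma matrix_inv_unique: "g ** h = mat 1 \<Longrightarrow> h ** g = mat 1 \<Longrightarrow> matrix_inv g = (h :: complex^'n^'n)"
proof -
  assume gh: "g ** h = mat 1" "h ** g = mat 1"
  then have "invertible g" by (auto simp: invertible_def)
  then have "matrix_inv g ** g = mat 1" using matrix_inv_works by blast
  then have "matrix_inv g ** (g ** h) = h" by (simp add: matrix_mul_assoc)
  then show ?thesis using gh by simp
qed

text \<open>The polynomials of degree at most \<open>N\<close> that vanish on \<open>Y\<close> form
  a finite-dimensional representation of the Lie algebra, of trace zero because the Lie algebra is
  perfect. The determinant of its basis evaluated at conjugates of fixed points is therefore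
  constant on the irreducible group. If the claim fails, the points can be chosen so that the
  determinant is 1 at \<open>g1\<close>, yet 0 at the identity, where one column is evaluated at
  \<open>p\<close> in \<open>Y\<close>.\<close>

theorem ad_stable_imp_group_stable:
  fixes A Y :: "(complex^'n^'n) set"
  assumes A: "algebraic_group A" and irr: "irreducible_on mat_coords A"
    and perfect: "lie_comm (lie_algebra A) (lie_algebra A) = lie_algebra A"
    and stable: "\<And>u. u \<in> lie_algebra A \<Longrightarrow> ad_stable Y u"
    and f: "f \<in> vanishing_ideal mat_coords Y" and g1: "g1 \<in> A" and p: "p \<in> Y"
  shows "f (g1 ** p ** matrix_inv g1) = 0"
proof (rule ccontr)
  note AD = algebraic_groupD[OF A]
  define h1 where "h1 = matrix_inv g1"
  have gh1: "g1 ** h1 = mat 1" "h1 ** g1 = mat 1" using matrix_inv_works[OF AD(4)[OF g1]] by (auto simp: h1_def)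
  assume "f (g1 ** p ** matrix_inv g1) \<noteq> 0"
  then have nz: "f (g1 ** p ** h1) \<noteq> 0" by (simp add: h1_def)
  have "f \<in> polyfun mat_coords" using f by (simp add: vanishing_ideal_def)
  then obtain N where N: "f \<in> poly_deg mat_coords N" using polyfun_imp_poly_deg by blast
  define W where "W = {f \<in> poly_deg mat_coords N. \<forall>y\<in>Y. f y = 0}"
  have W: "fs.subspace W" "W \<subseteq> fs.span (monomials mat_coords N)"
    using subspace_poly_deg[of mat_coords N] by (auto simp: W_def fs.subspace_def poly_deg_def)
  have fW: "f \<in> W" using f N by (auto simp: W_def vanishing_ideal_def)
  obtain m w y where tri: "triangular_system m w y" "0 < m" "y 0 = g1 ** p ** h1" "\<And>i. i < m \<Longrightarrow> w i \<in> W"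
    "\<And>f. f \<in> W \<Longrightarrow> \<exists>a. \<forall>x. f x = (\<Sum>i<m. a i * w i x)"
    by (rule triangular_system_exists[OF W finite_monomials[OF finite_mat_coords, of N] fW nz], rule that)
  have wp: "w i \<in> polyfun mat_coords" if "i < m" for i
    using tri(4)[OF that] by (auto simp: W_def intro: poly_deg_imp_polyfun)
  have wI: "w i \<in> vanishing_ideal mat_coords Y" if "i < m" for i
    using wp[OF that] tri(4)[OF that] by (auto simp: W_def vanishing_ideal_def)
  have dW: "ad_deriv u (w l) \<in> W" if "u \<in> lie_algebra A" "l < m" for u l
    using ad_stableD[OF stable[OF that(1)] wI[OF that(2)]] tri(4)[OF that(2)] ad_deriv_poly_deg
    by (auto simp: W_def vanishing_ideal_def)
  have "\<exists>a. \<forall>x. ad_deriv u (w l) x = (\<Sum>i<m. a i * w i x)" if "u \<in> lie_algebra A" "l < m" for u l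
    using tri(5) dW[OF that] by blast
  then obtain c where c: "\<And>u l x. u \<in> lie_algebra A \<Longrightarrow> l < m \<Longrightarrow> ad_deriv u (w l) x = (\<Sum>i<m. c u l i * w i x)"
    by metis
  have subA: "cmat.subspace (lie_algebra A)" and brA: "\<And>u v. u \<in> lie_algebra A \<Longrightarrow> v \<in> lie_algebra A \<Longrightarrow> lie_bracket u v \<in> lie_algebra A"
    using perfect subspace_lie_comm lie_comm_base by (metis, metis)
  \<comment> \<open>The trace of \<open>u\<close> on \<open>W\<close> in the basis
    \<open>w\<close>.\<close>
  define \<tau> where "\<tau> u = (\<Sum>l<m. c u l l)" for u
  have c_add: "c (u + v) l i = c u l i + c v l i" if "u \<in> lie_algebra A" "v \<in> lie_algebra A" "l < m" "i < m" for u v l i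
  proof -
    have "(\<Sum>i<m. c (u + v) l i * w i x) = (\<Sum>i<m. (c u l i + c v l i) * w i x)" for x
      using c[OF cmat.subspace_add[OF subA that(1,2)] that(3)] c[OF that(1,3)] c[OF that(2,3)]
      by (simp add: ad_deriv_add_left distrib_right sum.distrib)
    from triangular_system_unique[OF tri(1) this that(4)] show ?thesis .
  qed
  have c_scale: "c (cscale a u) l i = a * c u l i" if "u \<in> lie_algebra A" "l < m" "i < m" for a u l i
  proof -
    have "(\<Sum>i<m. c (cscale a u) l i * w i x) = (\<Sum>i<m. (a * c u l i) * w i x)" for x
      using c[OF cmat.subspace_scale[OF subA that(1)] that(2)] c[OF that(1,2)]
      by (simp add: ad_deriv_scale_left sum_distrib_left mult.assoc)
    from triangular_system_unique[OF tri(1) this that(3)] show ?thesis .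
  qed
  have dd2: "ad_deriv v (ad_deriv u (w l)) x = (\<Sum>i<m. (\<Sum>k<m. c u l k * c v k i) * w i x)"
    if "u \<in> lie_algebra A" "v \<in> lie_algebra A" "l < m" for u v l x
  proof -
    have "ad_deriv u (w l) = (\<lambda>x. \<Sum>k<m. c u l k * w k x)" using c[OF that(1,3)] by (rule ext)
    then have "ad_deriv v (ad_deriv u (w l)) x = (\<Sum>k<m. ad_deriv v (\<lambda>x. c u l k * w k x) x)"
      by (simp only:) (rule point_derivation_sum[OF point_derivation_ad_deriv], rule polyfun_scale, rule wp, simp)
    also have "\<dots> = (\<Sum>k<m. c u l k * (\<Sum>i<m. c v k i * w i x))"
      by (rule sum.cong) (simp_all add: point_derivation_scale[OF point_derivation_ad_deriv wp] c[OF that(2)])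
    also have "\<dots> = (\<Sum>k<m. \<Sum>i<m. c u l k * c v k i * w i x)"
      by (simp add: sum_distrib_left mult.assoc)
    also have "\<dots> = (\<Sum>i<m. (\<Sum>k<m. c u l k * c v k i) * w i x)"
      by (subst sum.swap) (simp add: sum_distrib_right)
    finally show ?thesis .
  qed
  have \<tau>_bracket: "\<tau> (lie_bracket u v) = 0" if uv: "u \<in> lie_algebra A" "v \<in> lie_algebra A" for u v
  proof -
    have "c (lie_bracket u v) l i = (\<Sum>k<m. c u l k * c v k i) - (\<Sum>k<m. c v l k * c u k i)"
      if li: "l < m" "i < m" for l i
    proof -
      have "(\<Sum>i<m. c (lie_bracket u v) l i * w i x) =
          (\<Sum>i<m. ((\<Sum>k<m. c u l k * c v k i) - (\<Sum>k<m. c v l k * c u k i)) * w i x)" for x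
        using c[OF brA[OF uv] li(1)] ad_deriv_commutator[OF wp[OF li(1)]] dd2[OF uv li(1)] dd2[OF uv(2,1) li(1)]
        by (simp add: left_diff_distrib sum_subtractf)
      from triangular_system_unique[OF tri(1) this li(2)] show ?thesis .
    qed
    then have "\<tau> (lie_bracket u v) = (\<Sum>l<m. \<Sum>k<m. c u l k * c v k l) - (\<Sum>l<m. \<Sum>k<m. c v l k * c u k l)"
      by (simp add: \<tau>_def sum_subtractf)
    also have "(\<Sum>l<m. \<Sum>k<m. c v l k * c u k l) = (\<Sum>l<m. \<Sum>k<m. c u l k * c v k l)"
      by (subst sum.swap) (simp add: mult.commute)
    finally show ?thesis by simp
  qed
  have \<tau>0: "\<tau> u = 0" if "u \<in> lie_algebra A" for u
  proof -
    have "lie_comm (lie_algebra A) (lie_algebra A) \<subseteq> {u \<in> lie_algebra A. \<tau> u = 0}"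
    proof (rule lie_comm_subset)
      have "\<tau> (u + v) = \<tau> u + \<tau> v" if "u \<in> lie_algebra A" "v \<in> lie_algebra A" for u v
        using that by (simp add: \<tau>_def c_add sum.distrib)
      moreover have "\<tau> (cscale a u) = a * \<tau> u" if "u \<in> lie_algebra A" for a u
        using that by (simp add: \<tau>_def c_scale sum_distrib_left)
      moreover have "\<tau> 0 = 0" using calculation(2)[OF cmat.subspace_0[OF subA], of 0] by simp
      ultimately show "cmat.subspace {u \<in> lie_algebra A. \<tau> u = 0}"
        using subA by (auto simp: cmat.subspace_def)
    qed (use \<tau>_bracket brA in auto)
    then show ?thesis using that perfect by auto
  qed
  \<comment> \<open>Conjugating the points back by \<open>g1\<close> makes the matrix unitriangular
    at \<open>g1\<close>, and turns the first point into \<open>p\<close>.\<close>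
  define z where "z j = h1 ** y j ** g1" for j
  have zy: "g1 ** z j ** h1 = y j" for j
  proof -
    have "g1 ** z j ** h1 = (g1 ** h1) ** y j ** (g1 ** h1)" by (simp only: z_def matrix_mul_assoc)
    then show ?thesis by (simp add: gh1)
  qed
  have z0: "z 0 = p"
  proof -
    have "z 0 = (h1 ** g1) ** p ** (h1 ** g1)" by (simp only: z_def tri(3) matrix_mul_assoc)
    then show ?thesis by (simp add: gh1)
  qed
  define M where "M i j q = w i (fst q ** z j ** snd q)" for i j q
  have conj_poly: "(\<lambda>q. (fst q ** M0 ** snd q) $ a $ b) \<in> polyfun pair_coords" for M0 a b
    by (rule matrix_mult_entries[where m = "\<lambda>q. fst q ** M0" and k = snd],
        rule matrix_mult_entries[where m = fst and k = "\<lambda>_. M0"], rule fst_entry_polyfun, rule polyfun.const, rule snd_entry_polyfun)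
  have Mp: "M i j \<in> polyfun pair_coords" if "i < m" for i j
    unfolding M_def by (rule polyfun_mat_compose[where m = "\<lambda>q. fst q ** z j ** snd q", OF wp[OF that] conj_poly])
  define \<Phi> where "\<Phi> q = ndet m (\<lambda>i j. M i j q)" for q
  have \<Phi>p: "\<Phi> \<in> polyfun pair_coords"
    unfolding \<Phi>_def ndet_def
    by (rule polyfun_sum, rule polyfun_scale, rule polyfun_prod, rule Mp) simp
  have one: "(mat 1, mat 1) \<in> group_pairs A"
    using AD(1) matrix_inv_unique[of "mat 1 :: complex^'n^'n" "mat 1"] unfolding group_pairs_def by (intro image_eqI[of _ _ "mat 1"]) auto
  have \<Phi>1: "\<Phi> (mat 1, mat 1) = 0"
    unfolding \<Phi>_def by (rule ndet_column_zero[OF tri(2)]) (use wI p in \<open>simp add: M_def z0 vanishing_ideal_def\<close>)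
  have "\<Phi> (g1, h1) = 1"
    unfolding \<Phi>_def by (rule ndet_triangular) (use tri(1) in \<open>simp_all add: M_def zy triangular_system_def\<close>)
  then have ne: "\<Phi> (mat 1, mat 1) \<noteq> \<Phi> (g1, h1)" using \<Phi>1 by simp
  have "(g1, h1) \<in> group_pairs A" using g1 by (auto simp: group_pairs_def h1_def)
  then obtain q L where q: "q \<in> group_pairs A" and L: "point_derivation pair_coords q L"
    and LI: "\<And>f. f \<in> polyfun pair_coords \<Longrightarrow> (\<And>y. y \<in> group_pairs A \<Longrightarrow> f y = 0) \<Longrightarrow> L f = 0" and L\<Phi>: "L \<Phi> \<noteq> 0"
    using irreducible_nonconstant_derivation[OF finite_pair_coords irreducible_group_pairs[OF irr AD(4)] \<Phi>p one _ ne] by blast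
  obtain g where g: "g \<in> A" "q = (g, matrix_inv g)" using q by (auto simp: group_pairs_def)
  define h where "h = matrix_inv g"
  have gh: "g ** h = mat 1" "h ** g = mat 1" using matrix_inv_works[OF AD(4)[OF g(1)]] by (auto simp: h_def)
  have q': "fst q = g" "snd q = h" using g by (auto simp: h_def)
  define v1 where "v1 = (\<chi> i j. L (\<lambda>q. fst q $ i $ j))"
  define v2 where "v2 = (\<chi> i j. L (\<lambda>q. snd q $ i $ j))"
  have Lprod: "L (\<lambda>q. (a q ** b q) $ i $ j) = ((\<chi> i j. L (\<lambda>q. a q $ i $ j)) ** b q + a q ** (\<chi> i j. L (\<lambda>q. b q $ i $ j))) $ i $ j"
    if ab: "\<And>i j. (\<lambda>q. a q $ i $ j) \<in> polyfun pair_coords" "\<And>i j. (\<lambda>q. b q $ i $ j) \<in> polyfun pair_coords" for a b i j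
  proof -
    have "L (\<lambda>q. (a q ** b q) $ i $ j) = L (\<lambda>q. \<Sum>k\<in>UNIV. a q $ i $ k * b q $ k $ j)" by (simp add: matrix_matrix_mult_def)
    also have "\<dots> = (\<Sum>k\<in>UNIV. L (\<lambda>q. a q $ i $ k * b q $ k $ j))"
      by (rule point_derivation_sum[OF L]) (intro polyfun.mult ab)
    also have "\<dots> = (\<Sum>k\<in>UNIV. a q $ i $ k * L (\<lambda>q. b q $ k $ j) + b q $ k $ j * L (\<lambda>q. a q $ i $ k))"
      by (rule sum.cong) (simp_all add: point_derivationD(3)[OF L ab(1) ab(2)])
    finally show ?thesis by (simp add: matrix_matrix_mult_def sum.distrib mult.commute add.commute)
  qed
  have Lconst: "(\<chi> i j. L (\<lambda>q. M0 $ i $ j)) = 0" for M0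
    by (simp add: point_derivationD(1)[OF L] vec_eq_iff)
  have rel: "v1 ** h + g ** v2 = 0"
  proof (rule matrix_eqI)
    fix i j
    have "L (\<lambda>q. (fst q ** snd q) $ i $ j + (- mat 1 $ i $ j)) = 0"
    proof (rule LI)
      show "(\<lambda>q. (fst q ** snd q) $ i $ j + (- mat 1 $ i $ j)) \<in> polyfun pair_coords"
        by (rule polyfun.add[OF matrix_mult_entries[OF fst_entry_polyfun snd_entry_polyfun] polyfun.const])
      fix y assume "y \<in> group_pairs A"
      then show "(fst y ** snd y) $ i $ j + (- mat 1 $ i $ j) = 0"
        using matrix_inv_works[OF AD(4)] by (auto simp: group_pairs_def)
    qed
    then have "L (\<lambda>q. (fst q ** snd q) $ i $ j) = 0"
      using point_derivationD(2)[OF L matrix_mult_entries[OF fst_entry_polyfun snd_entry_polyfun] polyfun.const, of i j "- mat 1 $ i $ j"]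
        point_derivationD(1)[OF L] by simp
    then show "(v1 ** h + g ** v2) $ i $ j = 0 $ i $ j"
      using Lprod[OF fst_entry_polyfun snd_entry_polyfun, of i j] by (simp add: v1_def v2_def q')
  qed
  \<comment> \<open>The tangent vector at \<open>g\<close> translated to the identity. The relation
    between \<open>v1\<close> and \<open>v2\<close> is the derivative of the identity saying that
    the two members of a pair are inverse.\<close>
  define u where "u = v1 ** h"
  have v1: "v1 = u ** g"
  proof -
    have "u ** g = v1 ** (h ** g)" by (simp only: u_def matrix_mul_assoc)
    then show ?thesis by (simp add: gh)
  qed
  have v2: "v2 = - (h ** u)"
  proof -
    have "h ** (v1 ** h + g ** v2) = h ** u + (h ** g) ** v2" by (simp add: matrix_add_ldistrib u_def matrix_mul_assoc)
    then have "h ** u + v2 = 0" by (simp add: rel gh)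
    then show ?thesis by (simp add: eq_neg_iff_add_eq_0 add.commute)
  qed
  have uA: "u \<in> lie_algebra A"
    unfolding lie_algebra_iff
  proof
    fix f assume f: "f \<in> vanishing_ideal mat_coords A"
    then have fp: "f \<in> polyfun mat_coords" by (auto simp: vanishing_ideal_def)
    have ent: "(\<lambda>q. (fst q ** h) $ i $ j) \<in> polyfun pair_coords" for i j
      by (rule matrix_mult_entries[where m = fst and k = "\<lambda>_. h"], rule fst_entry_polyfun, rule polyfun.const)
    have "L (\<lambda>q. f (fst q ** h)) = 0"
    proof (rule LI)
      show "(\<lambda>q. f (fst q ** h)) \<in> polyfun pair_coords"
        by (rule polyfun_mat_compose[where m = "\<lambda>q. fst q ** h", OF fp ent])
      fix y assume "y \<in> group_pairs A"
      then have "fst y ** h \<in> A" using AD(2,3) g(1) by (auto simp: group_pairs_def h_def)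
      then show "f (fst y ** h) = 0" using f by (auto simp: vanishing_ideal_def)
    qed
    moreover have "L (\<lambda>q. f (fst q ** h)) = dd f (fst q ** h) (\<chi> i j. L (\<lambda>q. (fst q ** h) $ i $ j))"
      by (rule point_derivation_matrix_chain[where m = "\<lambda>q. fst q ** h", OF L fp ent])
    moreover have "(\<chi> i j. L (\<lambda>q. (fst q ** h) $ i $ j)) = u"
      by (simp add: vec_eq_iff Lprod[OF fst_entry_polyfun, of "\<lambda>_. h"] polyfun.const Lconst u_def v1_def)
    ultimately show "dd f (mat 1) u = 0" by (simp add: q' gh)
  qed
  have LM: "L (M i j) = (\<Sum>k<m. c u i k * M k j q)" if "i < m" for i j
  proof -
    let ?y = "g ** z j ** h"
    have "L (M i j) = dd (w i) (fst q ** z j ** snd q) (\<chi> a b. L (\<lambda>q. (fst q ** z j ** snd q) $ a $ b))"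
      unfolding M_def by (rule point_derivation_matrix_chain[where m = "\<lambda>q. fst q ** z j ** snd q", OF L wp[OF that] conj_poly])
    also have "(\<chi> a b. L (\<lambda>q. (fst q ** z j ** snd q) $ a $ b)) = lie_bracket u ?y"
    proof (rule matrix_eqI)
      fix a b
      have e1: "(\<lambda>q. (fst q ** z j) $ i $ k) \<in> polyfun pair_coords" for i k
        by (rule matrix_mult_entries[where m = fst and k = "\<lambda>_. z j"], rule fst_entry_polyfun, rule polyfun.const)
      have "(\<chi> a b. L (\<lambda>q. (fst q ** z j) $ a $ b)) = v1 ** z j"
        by (simp add: vec_eq_iff Lprod[OF fst_entry_polyfun, of "\<lambda>_. z j"] polyfun.const Lconst v1_def)
      then have "L (\<lambda>q. (fst q ** z j ** snd q) $ a $ b) = (v1 ** z j ** h + g ** z j ** v2) $ a $ b"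
        using Lprod[OF e1 snd_entry_polyfun, of a b] by (simp add: q' v2_def)
      moreover have "v1 ** z j ** h + g ** z j ** v2 = lie_bracket u ?y"
        by (simp add: v1 v2 lie_bracket_def matrix_mult_minus matrix_mul_assoc)
      ultimately show "(\<chi> a b. L (\<lambda>q. (fst q ** z j ** snd q) $ a $ b)) $ a $ b = lie_bracket u ?y $ a $ b" by simp
    qed
    also have "dd (w i) (fst q ** z j ** snd q) (lie_bracket u ?y) = ad_deriv u (w i) ?y" by (simp add: ad_deriv_def q')
    also have "\<dots> = (\<Sum>k<m. c u i k * M k j q)" using c[OF uA that] by (simp add: M_def q')
    finally show ?thesis .
  qed
  have "L \<Phi> = (\<Sum>i<m. c u i i) * ndet m (\<lambda>i j. M i j q)"
    unfolding \<Phi>_def by (rule ndet_derivative[OF L, where c = "\<lambda>k i. c u i k"]) (use Mp LM in auto)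
  also have "\<dots> = 0" using \<tau>0[OF uA] by (simp add: \<tau>_def)
  finally show False using L\<Phi> by simp
qed

section \<open>Exponentials of nilpotent matrices\<close>

definition mderiv :: "(complex \<Rightarrow> complex^'n^'m) \<Rightarrow> complex^'n^'m \<Rightarrow> complex \<Rightarrow> bool" where
  "mderiv \<gamma> V t \<longleftrightarrow> (\<forall>i j. ((\<lambda>t. \<gamma> t $ i $ j) has_field_derivative V $ i $ j) (at t))"

lemma mderiv_const: "mderiv (\<lambda>_. M) 0 t"
  by (simp add: mderiv_def)

lemma mderiv_unique: "mderiv \<gamma> V t \<Longrightarrow> mderiv \<gamma> W t \<Longrightarrow> V = W"
proof (rule matrix_eqI)
  fix i j assume "mderiv \<gamma> V t" "mderiv \<gamma> W t"
  then have "((\<lambda>t. \<gamma> t $ i $ j) has_field_derivative V $ i $ j) (at t)"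
    "((\<lambda>t. \<gamma> t $ i $ j) has_field_derivative W $ i $ j) (at t)" by (simp_all add: mderiv_def)
  then show "V $ i $ j = W $ i $ j" by (rule DERIV_unique)
qed

lemma mderiv_line: "mderiv (\<lambda>t. y + cscale t v) v t0"
  by (auto simp: mderiv_def intro!: derivative_eq_intros)

lemma mderiv_mult:
  fixes \<gamma> \<delta> :: "complex \<Rightarrow> complex^'n^'n"
  assumes "mderiv \<gamma> V t" "mderiv \<delta> W t"
  shows "mderiv (\<lambda>t. \<gamma> t ** \<delta> t) (V ** \<delta> t + \<gamma> t ** W) t"
  unfolding mderiv_def
proof (intro allI)
  fix i j
  have "((\<lambda>t. \<Sum>k\<in>UNIV. \<gamma> t $ i $ k * \<delta> t $ k $ j) has_field_derivative
      (\<Sum>k\<in>UNIV. V $ i $ k * \<delta> t $ k $ j + W $ k $ j * \<gamma> t $ i $ k)) (at t)"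
    by (rule DERIV_sum, rule DERIV_mult) (use assms in \<open>auto simp: mderiv_def\<close>)
  then show "((\<lambda>t. (\<gamma> t ** \<delta> t) $ i $ j) has_field_derivative (V ** \<delta> t + \<gamma> t ** W) $ i $ j) (at t)"
    by (simp add: matrix_matrix_mult_def sum.distrib mult.commute)
qed

lemma dd_mderiv: "f \<in> polyfun mat_coords \<Longrightarrow> mderiv \<gamma> V t \<Longrightarrow> ((\<lambda>t. f (\<gamma> t)) has_field_derivative dd f (\<gamma> t) V) (at t)"
  by (rule dd_curve) (simp_all add: mderiv_def)

lemma mderiv_0_imp_const: "(\<And>t. mderiv \<gamma> 0 t) \<Longrightarrow> \<gamma> s = \<gamma> t"
proof (rule matrix_eqI)
  fix i j assume "\<And>t. mderiv \<gamma> 0 t"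
  then have "\<exists>c. \<forall>t\<in>UNIV. \<gamma> t $ i $ j = c"
    by (intro has_field_derivative_zero_constant) (simp_all add: mderiv_def)
  then show "\<gamma> s $ i $ j = \<gamma> t $ i $ j" by auto
qed

text \<open>The exponential series cut off at the nilpotency index, so that the entries are
  polynomials in \<open>s\<close> by construction.\<close>

definition nexp :: "complex^'n^'n \<Rightarrow> complex \<Rightarrow> complex^'n^'n" where
  "nexp u s = (\<Sum>k<(LEAST k. mpow u k = 0). cscale (s ^ k / fact k) (mpow u k))"

lemma nexp_entry: "nexp u s $ i $ j = (\<Sum>k<(LEAST k. mpow u k = 0). s ^ k / fact k * mpow u k $ i $ j)"
  by (simp add: nexp_def sum_component)

lemma mat_1_nonzero: "mat 1 \<noteq> (0 :: complex^'n^'n)"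
proof
  fix i :: 'n assume "mat 1 = (0 :: complex^'n^'n)"
  then have "mat 1 $ i $ i = (0 :: complex^'n^'n) $ i $ i" by simp
  then show False by (simp add: mat_def)
qed

lemma nilpotency_index:
  assumes "mnilpotent (u :: complex^'n^'n)"
  obtains m where "(LEAST k. mpow u k = 0) = Suc m" "mpow u (Suc m) = 0"
proof -
  have z: "mpow u (LEAST k. mpow u k = 0) = 0" using assms unfolding mnilpotent_def by (rule LeastI_ex)
  show thesis using that z mat_1_nonzero by (cases "LEAST k. mpow u k = 0") auto
qed

lemma nexp_0:
  assumes "mnilpotent u" shows "nexp u 0 = mat 1"
proof -
  obtain m where "(LEAST k. mpow u k = 0) = Suc m" using nilpotency_index[OF assms] .
  then have "nexp u 0 = cscale 1 (mat 1) + (\<Sum>k<m. cscale 0 (mpow u (Suc k)))"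
    unfolding nexp_def by (simp del: sum.lessThan_Suc add: sum.lessThan_Suc_shift)
  then show ?thesis by simp
qed

lemma nexp_zero: "nexp 0 s = mat 1"
proof -
  have e: "(LEAST k. mpow (0 :: complex^'a^'a) k = 0) = 1"
  proof (rule Least_equality)
    fix k assume "mpow (0 :: complex^'a^'a) k = 0"
    then show "1 \<le> k" by (cases k) (simp_all add: mat_1_nonzero)
  qed (simp add: mpow_Suc matrix_mult_0)
  show ?thesis by (simp add: nexp_def e)
qed

lemma nexp_commute: "u ** nexp u s = nexp u s ** u"
  by (simp add: nexp_def matrix_mult_sum sum_mult_matrix cscale_mult_left cscale_mult_right mpow_Suc[symmetric] mpow_Suc2)

lemma nexp_mderiv:
  assumes "mnilpotent u" shows "mderiv (nexp u) (u ** nexp u s) s"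
  unfolding mderiv_def
proof (intro allI)
  fix i j
  obtain m where m: "(LEAST k. mpow u k = 0) = Suc m" "mpow u (Suc m) = 0" using nilpotency_index[OF assms] .
  have "((\<lambda>s. \<Sum>k<m. s ^ Suc k / fact (Suc k) * mpow u (Suc k) $ i $ j) has_field_derivative
      (\<Sum>k<m. s ^ k / fact k * mpow u (Suc k) $ i $ j)) (at s)"
  proof (rule DERIV_sum)
    fix k
    have "((\<lambda>s. s ^ Suc k / fact (Suc k) * mpow u (Suc k) $ i $ j) has_field_derivative
        (of_nat (Suc k) * s ^ k) / fact (Suc k) * mpow u (Suc k) $ i $ j) (at s)"
      using DERIV_power[where n = "Suc k", OF DERIV_ident, of s UNIV] by (intro DERIV_cmult_right DERIV_cdivide) simp
    moreover have "(of_nat (Suc k) * s ^ k) / fact (Suc k) = s ^ k / fact k"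
      by (simp add: fact_Suc del: of_nat_Suc)
    ultimately show "((\<lambda>s. s ^ Suc k / fact (Suc k) * mpow u (Suc k) $ i $ j) has_field_derivative
        s ^ k / fact k * mpow u (Suc k) $ i $ j) (at s)" by simp
  qed
  then have "((\<lambda>s. mat 1 $ i $ j + (\<Sum>k<m. s ^ Suc k / fact (Suc k) * mpow u (Suc k) $ i $ j)) has_field_derivative
      0 + (\<Sum>k<m. s ^ k / fact k * mpow u (Suc k) $ i $ j)) (at s)"
    by (intro DERIV_add DERIV_const)
  moreover have "nexp u s $ i $ j = mat 1 $ i $ j + (\<Sum>k<m. s ^ Suc k / fact (Suc k) * mpow u (Suc k) $ i $ j)" for s
    unfolding nexp_entry m(1) by (subst sum.lessThan_Suc_shift) simp
  moreover have "(u ** nexp u s) $ i $ j = 0 + (\<Sum>k<m. s ^ k / fact k * mpow u (Suc k) $ i $ j)"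
  proof -
    have "u ** nexp u s = (\<Sum>k<Suc m. cscale (s ^ k / fact k) (mpow u (Suc k)))"
      unfolding nexp_def m(1) matrix_mult_sum cscale_mult_right mpow_Suc ..
    also have "\<dots> = (\<Sum>k<m. cscale (s ^ k / fact k) (mpow u (Suc k)))" using m(2) by simp
    finally show ?thesis by (simp add: sum_component)
  qed
  ultimately show "((\<lambda>s. nexp u s $ i $ j) has_field_derivative (u ** nexp u s) $ i $ j) (at s)" by simp
qed

lemma nexp_minus_mderiv:
  assumes "mnilpotent u" shows "mderiv (\<lambda>s. nexp u (- s)) (- (u ** nexp u (- s))) s"
  unfolding mderiv_def
proof (intro allI)
  fix i j
  have "((\<lambda>s. nexp u s $ i $ j) has_field_derivative (u ** nexp u (- s)) $ i $ j) (at (- s))"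
    using nexp_mderiv[OF assms] by (simp add: mderiv_def)
  moreover have "((\<lambda>s :: complex. - s) has_field_derivative -1) (at s)" by (auto intro!: derivative_eq_intros)
  ultimately show "((\<lambda>s. nexp u (- s) $ i $ j) has_field_derivative (- (u ** nexp u (- s))) $ i $ j) (at s)"
    using DERIV_chain2 by fastforce
qed

lemma nexp_inverse:
  assumes "mnilpotent u" shows "nexp u s ** nexp u (- s) = mat 1"
proof -
  have "mderiv (\<lambda>s. nexp u s ** nexp u (- s)) 0 t" for t
  proof -
    have "u ** nexp u t ** nexp u (- t) + nexp u t ** - (u ** nexp u (- t)) = 0"
      by (simp add: nexp_commute[of u t, symmetric] matrix_mult_minus matrix_mul_assoc)
    then show ?thesis using mderiv_mult[OF nexp_mderiv[OF assms] nexp_minus_mderiv[OF assms], of t] by simp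
  qed
  from mderiv_0_imp_const[OF this, of s 0] show ?thesis by (simp add: nexp_0[OF assms])
qed

lemma nexp_inverse': "mnilpotent u \<Longrightarrow> nexp u (- s) ** nexp u s = mat 1"
  using nexp_inverse[of u "- s"] by simp

lemma nexp_polyfun: "\<sigma> \<in> polyfun C \<Longrightarrow> (\<lambda>x. nexp u (\<sigma> x) $ i $ j) \<in> polyfun C"
  unfolding nexp_entry divide_inverse by (intro polyfun_sum polyfun.mult polyfun_power polyfun.const)

lemma polyfun_identity: "f \<in> polyfun {\<lambda>s. s} \<Longrightarrow> \<exists>p. \<forall>s. f s = poly p s"
  by (rule polyfun_on_polynomial_curve[where \<gamma> = "\<lambda>s. s"]) (auto intro: exI[of _ "[:0, 1:]"])

lemma curve_polynomial:
  "f \<in> polyfun mat_coords \<Longrightarrow> (\<And>i j. (\<lambda>s. \<gamma> s $ i $ j) \<in> polyfun {\<lambda>s. s}) \<Longrightarrow> \<exists>p. \<forall>s. f (\<gamma> s) = poly p s"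
  by (rule polyfun_identity) (rule polyfun_mat_compose)

lemma polyfun_id: "(\<lambda>s. s) \<in> polyfun {\<lambda>s. s}"
  by (rule polyfun.coord) simp

text \<open>For \<open>f\<close> in the ideal of \<open>G\<close> the polynomial f(exp(s u))
  vanishes at s = 0, and its derivative is of the same kind, with the left-invariant derivative of
  \<open>f\<close> in place of \<open>f\<close>. Induction on the degree makes it zero.\<close>

lemma nexp_vanishing:
  assumes G: "algebraic_group G" and u: "u \<in> lie_algebra G" "mnilpotent u"
    and f: "f \<in> vanishing_ideal mat_coords G"
  shows "f (nexp u s) = 0"
proof -
  let ?D = "\<lambda>f g. dd f g (g ** u)"
  have DI: "?D f \<in> vanishing_ideal mat_coords G" if f: "f \<in> vanishing_ideal mat_coords G" for f
  proof -
    have fp: "f \<in> polyfun mat_coords" using f by (simp add: vanishing_ideal_def)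
    obtain n where n: "f \<in> poly_deg mat_coords n" using polyfun_imp_poly_deg[OF fp] by blast
    have ent: "(\<lambda>y. (y ** u) $ i $ j) \<in> poly_deg mat_coords 1" for i j
    proof -
      have "(\<lambda>y. (y ** u) $ i $ j) = (\<lambda>y. \<Sum>k\<in>UNIV. u $ k $ j * y $ i $ k)"
        by (simp add: matrix_matrix_mult_def mult.commute)
      then show ?thesis using linear_poly_deg[of UNIV "\<lambda>k y. y $ i $ k" mat_coords "\<lambda>k. u $ k $ j" 0, OF mat_coordsI] by simp
    qed
    have "?D f \<in> polyfun mat_coords" using dd_poly_deg[OF n ent] poly_deg_imp_polyfun by blast
    moreover have "?D f g = 0" if g: "g \<in> G" for g
    proof -
      let ?h = "\<lambda>x. f (g ** x)"
      have h: "?h \<in> vanishing_ideal mat_coords G"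
        using f polyfun_left_translate[OF fp, of g] algebraic_groupD(2)[OF G g] by (simp add: vanishing_ideal_def)
      then have "dd ?h (mat 1) u = 0" using u(1) by (simp add: lie_algebra_iff)
      then have "((\<lambda>t. f (g ** (mat 1 + cscale t u))) has_field_derivative 0) (at 0)"
        using dd_line[of ?h "mat 1" u] h by (simp add: vanishing_ideal_def)
      then have "((\<lambda>t. f (g + cscale t (g ** u))) has_field_derivative 0) (at 0)"
        by (simp add: matrix_add_ldistrib cscale_mult_right)
      with dd_line[OF fp, of g "g ** u"] show ?thesis by (rule DERIV_unique)
    qed
    ultimately show ?thesis by (simp add: vanishing_ideal_def)
  qed
  have curve: "\<exists>p. \<forall>s. f (nexp u s) = poly p s" if "f \<in> vanishing_ideal mat_coords G" for f
    by (rule curve_polynomial) (use that nexp_polyfun[OF polyfun_id] in \<open>auto simp: vanishing_ideal_def\<close>)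
  have "p = 0" if "f \<in> vanishing_ideal mat_coords G" "\<And>s. f (nexp u s) = poly p s" for f p
    using that
  proof (induction "degree p" arbitrary: f p rule: less_induct)
    case less
    have fp: "f \<in> polyfun mat_coords" using less.prems by (simp add: vanishing_ideal_def)
    have "((\<lambda>s. f (nexp u s)) has_field_derivative ?D f (nexp u s)) (at s)" for s
      using dd_mderiv[OF fp nexp_mderiv[OF u(2)], of s] by (simp add: nexp_commute)
    then have "((\<lambda>s. poly p s) has_field_derivative ?D f (nexp u s)) (at s)" for s
      by (simp add: less.prems(2))
    then have D: "?D f (nexp u s) = poly (pderiv p) s" for s using poly_DERIV DERIV_unique by blast
    have "pderiv p = 0 \<or> degree p \<noteq> 0" by (auto simp: pderiv_eq_0_iff)
    then have "pderiv p = 0"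
      using less.hyps[OF _ DI[OF less.prems(1)] D] by (auto simp: degree_pderiv)
    then obtain a where a: "p = [:a:]" using pderiv_eq_0_iff degree_eq_zeroE by blast
    have "f (mat 1) = 0" using less.prems(1) algebraic_groupD(1)[OF G] by (simp add: vanishing_ideal_def)
    then have "poly p 0 = 0" using less.prems(2)[of 0] by (simp add: nexp_0[OF u(2)])
    then show ?case using a by simp
  qed
  then show ?thesis using curve[OF f] f by fastforce
qed

lemma nexp_in_group:
  assumes "algebraic_group G" "u \<in> lie_algebra G" "mnilpotent u"
  shows "nexp u s \<in> G" "matrix_inv (nexp u s) = nexp u (- s)"
proof -
  have "invertible (nexp u s)" using nexp_inverse[OF assms(3)] nexp_inverse'[OF assms(3)] by (auto simp: invertible_def)
  then show "nexp u s \<in> G" using nexp_vanishing[OF assms] by (intro algebraic_group_closed[OF assms(1)])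
  show "matrix_inv (nexp u s) = nexp u (- s)"
    by (rule matrix_inv_unique[OF nexp_inverse[OF assms(3)] nexp_inverse'[OF assms(3)]])
qed

section \<open>Conjugation by one-parameter unipotent groups\<close>

definition nconj :: "complex^'n^'n \<Rightarrow> complex \<Rightarrow> complex^'n^'n \<Rightarrow> complex^'n^'n" where
  "nconj u s y = nexp u s ** y ** nexp u (- s)"

lemma nconj_0: "mnilpotent u \<Longrightarrow> nconj u 0 y = y"
  by (simp add: nconj_def nexp_0)

lemma nconj_zero_left [simp]: "nconj 0 s y = y"
  by (simp add: nconj_def nexp_zero)

lemma nconj_add: "nconj u s (y + w) = nconj u s y + nconj u s w"
  and nconj_scale: "nconj u s (cscale c y) = cscale c (nconj u s y)"
  and nconj_zero [simp]: "nconj u s 0 = 0"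
  by (simp_all add: nconj_def matrix_ring matrix_mult_0)

lemma nconj_inverse: "mnilpotent u \<Longrightarrow> nconj u (- s) (nconj u s y) = y"
proof -
  assume u: "mnilpotent u"
  have "nconj u (- s) (nconj u s y) = (nexp u (- s) ** nexp u s) ** y ** (nexp u (- s) ** nexp u s)"
    by (simp add: nconj_def matrix_mul_assoc)
  then show ?thesis by (simp add: nexp_inverse'[OF u])
qed

lemma nconj_polyfun:
  assumes "\<sigma> \<in> polyfun C" "\<And>i j. (\<lambda>x. m x $ i $ j) \<in> polyfun C"
  shows "(\<lambda>x. nconj u (\<sigma> x) (m x) $ i $ j) \<in> polyfun C"
  unfolding nconj_def
  by (rule matrix_mult_entries[where m = "\<lambda>x. nexp u (\<sigma> x) ** m x" and k = "\<lambda>x. nexp u (- \<sigma> x)"],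
      rule matrix_mult_entries[where m = "\<lambda>x. nexp u (\<sigma> x)" and k = m],
      rule nexp_polyfun[OF assms(1)], rule assms(2), rule nexp_polyfun[OF polyfun_uminus[OF assms(1)]])

lemma nconj_mderiv:
  assumes "mnilpotent u" shows "mderiv (\<lambda>s. nconj u s (y + cscale s a)) (lie_bracket u y + a) 0"
proof -
  from mderiv_mult[OF mderiv_mult[OF nexp_mderiv[OF assms, of 0] mderiv_line[of y a 0]] nexp_minus_mderiv[OF assms, of 0]]
  show ?thesis by (simp add: nconj_def[abs_def] nexp_0[OF assms] lie_bracket_def matrix_mult_minus algebra_simps)
qed

lemma nconj_stable_imp_ad_stable:
  assumes u: "mnilpotent u" and stable: "\<And>f y s. f \<in> vanishing_ideal mat_coords Y \<Longrightarrow> y \<in> Y \<Longrightarrow> f (nconj u s y) = 0"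
  shows "ad_stable Y u"
  unfolding ad_stable_def ad_deriv_def
proof (intro ballI)
  fix f y assume f: "f \<in> vanishing_ideal mat_coords Y" and y: "y \<in> Y"
  have "mderiv (\<lambda>s. nconj u s y) (lie_bracket u y) 0" using nconj_mderiv[OF u, of y 0] by simp
  then have "((\<lambda>s. f (nconj u s y)) has_field_derivative dd f (nconj u 0 y) (lie_bracket u y)) (at 0)"
    using f by (intro dd_mderiv) (auto simp: vanishing_ideal_def)
  then have "((\<lambda>s. 0) has_field_derivative dd f y (lie_bracket u y)) (at 0)"
    by (simp add: stable[OF f y] nconj_0[OF u])
  from DERIV_unique[OF this DERIV_const] show "dd f y (lie_bracket u y) = 0" .
qed

lemma adjoint_orbit_stable:
  assumes A: "algebraic_group A" and g: "g \<in> A" and y: "y \<in> adjoint_orbit A e"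
  shows "g ** y ** matrix_inv g \<in> adjoint_orbit A e"
proof -
  obtain a where a: "a \<in> A" "y = a ** e ** matrix_inv a" using y by (auto simp: adjoint_orbit_def)
  note inv = matrix_inv_works[OF algebraic_groupD(4)[OF A g]] matrix_inv_works[OF algebraic_groupD(4)[OF A a(1)]]
  have "matrix_inv (g ** a) = matrix_inv a ** matrix_inv g"
  proof (rule matrix_inv_unique)
    have "g ** a ** (matrix_inv a ** matrix_inv g) = g ** (a ** matrix_inv a) ** matrix_inv g" by (simp add: matrix_mul_assoc)
    then show "g ** a ** (matrix_inv a ** matrix_inv g) = mat 1" using inv by simp
    have "matrix_inv a ** matrix_inv g ** (g ** a) = matrix_inv a ** (matrix_inv g ** g) ** a" by (simp add: matrix_mul_assoc)
    then show "matrix_inv a ** matrix_inv g ** (g ** a) = mat 1" using inv by simp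
  qed
  then have "g ** y ** matrix_inv g = (g ** a) ** e ** matrix_inv (g ** a)" by (simp add: a(2) matrix_mul_assoc)
  then show ?thesis using algebraic_groupD(2)[OF A g a(1)] by (auto simp: adjoint_orbit_def)
qed

lemma orbit_ad_stable:
  fixes A :: "(complex^'n^'n) set"
  assumes A: "algebraic_group A" and u: "u \<in> lie_algebra A"
  shows "ad_stable (adjoint_orbit A e) u"
  unfolding ad_stable_def
proof (intro ballI)
  fix f y assume f: "f \<in> vanishing_ideal mat_coords (adjoint_orbit A e)" and y: "y \<in> adjoint_orbit A e"
  note AD = algebraic_groupD[OF A]
  have fp: "f \<in> polyfun mat_coords" using f by (simp add: vanishing_ideal_def)
  have orb: "f (g ** y ** matrix_inv g) = 0" if "g \<in> A" for g
    using adjoint_orbit_stable[OF A that y] f by (simp add: vanishing_ideal_def)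
  let ?\<Psi> = "\<lambda>q. f (fst q ** y ** snd q)"
  have "?\<Psi> \<in> polyfun pair_coords"
    by (rule polyfun_mat_compose[where m = "\<lambda>q. fst q ** y ** snd q", OF fp],
        rule matrix_mult_entries[where m = "\<lambda>q. fst q ** y" and k = snd],
        rule matrix_mult_entries[where m = fst and k = "\<lambda>_. y"], rule fst_entry_polyfun, rule polyfun.const, rule snd_entry_polyfun)
  then obtain m F where F: "F \<in> polyfun mat_coords"
    "\<And>g. invertible g \<Longrightarrow> det g ^ m * f (g ** y ** matrix_inv g) = F g"
    using clear_denominators[of ?\<Psi>] by auto
  have "F \<in> vanishing_ideal mat_coords A" using F(1) F(2)[OF AD(4), symmetric] orb by (simp add: vanishing_ideal_def)
  then have dF: "dd F (mat 1) u = 0" using u by (simp add: lie_algebra_iff)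
  let ?g = "\<lambda>t. mat 1 + cscale t u"
  let ?N = "\<lambda>t. matrix_inv (?g t)"
  have g0: "mderiv ?g u 0" by (rule mderiv_line)
  have g0': "mat 1 + cscale 0 u = mat 1" by simp
  have cof: "(\<lambda>g. det (\<chi> i j. if j = k then (if i = l then 1 else 0) else g $ i $ j) :: complex) \<in> polyfun mat_coords" for k l :: 'n
  proof (rule det_polyfun)
    fix i j
    show "(\<lambda>g. (\<chi> i j. if j = k then (if i = l then 1 else 0) else g $ i $ j) $ i $ j :: complex) \<in> polyfun mat_coords"
      by (cases "j = k") (simp_all add: polyfun.const entry_polyfun)
  qed
  have detp: "(\<lambda>g. det g :: complex) \<in> polyfun mat_coords" by (rule det_polyfun[OF entry_polyfun])
  have ddet: "((\<lambda>t. det (?g t)) has_field_derivative dd det (mat 1) u) (at 0)" using dd_line[OF detp, of "mat 1" u] .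
  have "((\<lambda>t. det (?g t)) \<longlongrightarrow> 1) (at 0)" using DERIV_isCont[OF ddet] by (simp add: isCont_def)
  from tendsto_imp_eventually_ne[OF this, of 0] have "eventually (\<lambda>t. det (?g t) \<noteq> 0) (nhds 0)"
    by (simp add: eventually_nhds_conv_at)
  then have ev: "eventually (\<lambda>t. invertible (?g t)) (nhds 0)" by (rule eventually_mono) (simp add: invertible_det_nz)
  have "\<exists>d. ((\<lambda>t. ?N t $ k $ l) has_field_derivative d) (at 0)" for k l
  proof -
    let ?c = "\<lambda>g. det (\<chi> i j. if j = k then (if i = l then 1 else 0) else g $ i $ j) :: complex"
    have "((\<lambda>t. ?c (?g t)) has_field_derivative dd ?c (mat 1) u) (at 0)" using dd_line[OF cof, where y = "mat 1" and v = u] .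
    from DERIV_divide[OF this ddet] have ex: "\<exists>d. ((\<lambda>t. ?c (?g t) / det (?g t)) has_field_derivative d) (at 0)" by auto
    have ev': "eventually (\<lambda>t. ?c (?g t) / det (?g t) = ?N t $ k $ l) (nhds 0)"
      using ev by (rule eventually_mono)
        (simp add: matrix_inv_cramer[symmetric] invertible_det_nz)
    from ex obtain d where "((\<lambda>t. ?c (?g t) / det (?g t)) has_field_derivative d) (at 0)" by (elim exE)
    then have "((\<lambda>t. ?N t $ k $ l) has_field_derivative d) (at 0)"
      by (rule DERIV_cong_ev[OF refl ev' refl, THEN iffD1])
    then show ?thesis by (rule exI)
  qed
  then obtain n where n: "\<And>k l. ((\<lambda>t. ?N t $ k $ l) has_field_derivative n k l) (at 0)" by metis
  define n' where "n' = (\<chi> k l. n k l)"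
  have N0: "mderiv ?N n' 0" using n by (simp add: mderiv_def n'_def)
  have inv1: "matrix_inv (mat 1) = (mat 1 :: complex^'n^'n)" by (rule matrix_inv_unique) simp_all
  \<comment> \<open>The product with the inverse is constant near 0, which identifies the derivative
    \<open>n'\<close> of the inverse as \<open>- u\<close>.\<close>
  have "mderiv (\<lambda>t. ?g t ** ?N t) (u + n') 0" using mderiv_mult[OF g0 N0] by (simp add: inv1)
  moreover have "mderiv (\<lambda>t. ?g t ** ?N t) 0 0"
    unfolding mderiv_def
  proof (intro allI)
    fix i j
    have "eventually (\<lambda>t. (?g t ** ?N t) $ i $ j = mat 1 $ i $ j) (nhds 0)"
      using ev by (rule eventually_mono) (simp add: matrix_inv_works)
    from DERIV_cong_ev[OF refl this refl]
    show "((\<lambda>t. (?g t ** ?N t) $ i $ j) has_field_derivative 0 $ i $ j) (at 0)" by simp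
  qed
  ultimately have "u + n' = 0" by (rule mderiv_unique)
  then have n'u: "n' = - u" by (simp add: eq_neg_iff_add_eq_0 add.commute)
  have "mderiv (\<lambda>t. ?g t ** y ** ?N t) (lie_bracket u y) 0"
    using mderiv_mult[OF mderiv_mult[OF g0 mderiv_const, of y] N0] by (simp add: inv1 n'u lie_bracket_def matrix_mult_minus)
  from dd_mderiv[OF fp this] have d1: "((\<lambda>t. f (?g t ** y ** ?N t)) has_field_derivative dd f y (lie_bracket u y)) (at 0)"
    by (simp add: inv1)
  have fy: "f y = 0" using orb[OF AD(1)] by (simp add: inv1)
  \<comment> \<open>Since f(y) = 0, the derivative of the determinant factor does not
    contribute.\<close>
  have "((\<lambda>t. det (?g t) ^ m) has_field_derivative of_nat m * (dd det (mat 1) u * det (?g 0) ^ (m - Suc 0))) (at 0)"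
    by (rule DERIV_power[OF ddet])
  from DERIV_mult[OF this d1]
  have "((\<lambda>t. det (?g t) ^ m * f (?g t ** y ** ?N t)) has_field_derivative dd f y (lie_bracket u y)) (at 0)"
    by (simp add: inv1 fy)
  moreover have "eventually (\<lambda>t. det (?g t) ^ m * f (?g t ** y ** ?N t) = F (?g t)) (nhds 0)"
    using ev by (rule eventually_mono) (rule F(2))
  ultimately have "((\<lambda>t. F (?g t)) has_field_derivative dd f y (lie_bracket u y)) (at 0)"
    by (rule DERIV_cong_ev[OF refl _ refl, THEN iffD1, rotated])
  with dd_line[OF F(1), of "mat 1" u] dF show "ad_deriv u f y = 0" unfolding ad_deriv_def using DERIV_unique by metis
qed

section \<open>Algebraic relations between polynomials\<close>

text \<open>On the line joining a point where \<open>f\<close> is nonzero to one where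
  \<open>g\<close> is nonzero, a vanishing product would be a zero product of nonzero polynomials in
  one variable.\<close>

lemma irreducible_on_vars: "irreducible_on (vars I) UNIV"
  unfolding irreducible_on_def
proof (intro ballI impI)
  fix f g :: "('a \<Rightarrow> complex) \<Rightarrow> complex"
  assume f: "f \<in> polyfun (vars I)" and g: "g \<in> polyfun (vars I)" and z: "\<forall>x\<in>UNIV. f x * g x = 0"
  show "(\<forall>x\<in>UNIV. f x = 0) \<or> (\<forall>x\<in>UNIV. g x = 0)"
  proof (rule ccontr)
    assume "\<not> ?thesis"
    then obtain a b where ab: "f a \<noteq> 0" "g b \<noteq> 0" by auto
    define \<gamma> where "\<gamma> s = (\<lambda>i. a i + s * (b i - a i))" for s
    have curve: "\<exists>p. \<forall>s. h (\<gamma> s) = poly p s" if "h \<in> polyfun (vars I)" for h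
    proof (rule polyfun_on_polynomial_curve[OF that])
      fix c assume "c \<in> vars I"
      then obtain i where "c = (\<lambda>z. z i)" by (auto simp: vars_def)
      then show "\<exists>p. \<forall>s. c (\<gamma> s) = poly p s" by (intro exI[of _ "[:a i, b i - a i:]"]) (simp add: \<gamma>_def)
    qed
    obtain p q where pq: "\<And>s. f (\<gamma> s) = poly p s" "\<And>s. g (\<gamma> s) = poly q s" using curve[OF f] curve[OF g] by auto
    have "\<gamma> 0 = a" "\<gamma> 1 = b" by (simp_all add: \<gamma>_def fun_eq_iff)
    then have "p \<noteq> 0" "q \<noteq> 0" using ab pq(1)[of 0] pq(2)[of 1] by auto
    moreover have "poly (p * q) s = 0" for s using z pq by (metis UNIV_I poly_mult)
    then have "p * q = 0" using poly_all_0_iff_0 by blast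
    ultimately show False by simp
  qed
qed

definition monomial_fun :: "'i set \<Rightarrow> ('i \<Rightarrow> nat) \<Rightarrow> ('i \<Rightarrow> complex) \<Rightarrow> complex" where
  "monomial_fun I \<alpha> = (\<lambda>z. \<Prod>i\<in>I. z i ^ \<alpha> i)"

lemma monomials_vars:
  assumes "finite I" "b \<in> monomials (vars I) n"
  shows "b \<in> monomial_fun I ` (PiE I (\<lambda>_. {..n}))"
proof -
  have "\<exists>\<alpha>. (\<forall>i\<in>I. \<alpha> i \<le> n) \<and> b = monomial_fun I \<alpha>"
    using assms(2)
  proof (induction n arbitrary: b)
    case 0
    then show ?case by (intro exI[of _ "\<lambda>_. 0"]) (simp add: monomial_fun_def)
  next
    case (Suc n)
    show ?case
    proof (cases "b \<in> monomials (vars I) n")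
      case True
      from Suc.IH[OF this] obtain \<alpha> where "\<forall>i\<in>I. \<alpha> i \<le> n" "b = monomial_fun I \<alpha>" by blast
      then show ?thesis by (intro exI[of _ \<alpha>]) auto
    next
      case False
      then obtain j b' where j: "j \<in> I" "b' \<in> monomials (vars I) n" "b = (\<lambda>z. z j * b' z)"
        using Suc.prems by (auto simp: vars_def)
      obtain \<alpha> where \<alpha>: "\<forall>i\<in>I. \<alpha> i \<le> n" "b' = monomial_fun I \<alpha>" using Suc.IH[OF j(2)] by blast
      have "b = monomial_fun I (\<alpha>(j := Suc (\<alpha> j)))"
        by (simp add: j(3) \<alpha>(2) monomial_fun_def prod.remove[OF assms(1) j(1)] fun_eq_iff)
      moreover have "\<forall>i\<in>I. (\<alpha>(j := Suc (\<alpha> j))) i \<le> Suc n" using \<alpha>(1) by auto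
      ultimately show ?thesis by blast
    qed
  qed
  then obtain \<alpha> where \<alpha>: "\<forall>i\<in>I. \<alpha> i \<le> n" "b = monomial_fun I \<alpha>" by blast
  have "monomial_fun I \<alpha> = monomial_fun I (restrict \<alpha> I)" by (simp add: monomial_fun_def)
  then show ?thesis using \<alpha> by (intro image_eqI[of _ _ "restrict \<alpha> I"]) auto
qed

text \<open>A crude count of exponent vectors with entries at most \<open>n\<close>; its order of
  growth in \<open>n\<close> is what the comparison in \<open>algebraic_relation\<close> relies
  on.\<close>

lemma poly_deg_vars_span:
  assumes "finite I"
  obtains T where "finite T" "poly_deg (vars I) n \<subseteq> fs.span T" "card T \<le> (n + 1) ^ card I"
proof (rule that[of "monomial_fun I ` (PiE I (\<lambda>_. {..n}))"])
  show fin: "finite (monomial_fun I ` (PiE I (\<lambda>_. {..n})))" using assms by (intro finite_imageI finite_PiE) auto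
  show "poly_deg (vars I) n \<subseteq> fs.span (monomial_fun I ` (PiE I (\<lambda>_. {..n})))"
    unfolding poly_deg_def by (rule fs.span_mono) (use monomials_vars[OF assms] in blast)
  have "card (monomial_fun I ` (PiE I (\<lambda>_. {..n}))) \<le> card (PiE I (\<lambda>_. {..n}))"
    using assms by (intro card_image_le finite_PiE) auto
  then show "card (monomial_fun I ` (PiE I (\<lambda>_. {..n}))) \<le> (n + 1) ^ card I" using assms by (simp add: card_PiE)
qed

lemma dependent_family:
  fixes F :: "nat \<Rightarrow> 'x \<Rightarrow> complex"
  assumes T: "finite T" "card T < M" and F: "\<And>N. N < M \<Longrightarrow> F N \<in> fs.span T"
  shows "\<exists>c. (\<exists>N<M. c N \<noteq> 0) \<and> (\<forall>x. (\<Sum>N<M. c N * F N x) = 0)"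
proof (rule ccontr)
  assume "\<not> ?thesis"
  then have ind: "c N = 0" if "\<And>x. (\<Sum>N<M. c N * F N x) = 0" "N < M" for c N using that by blast
  have inj: "inj_on F {..<M}"
  proof (rule inj_onI, rule ccontr)
    fix i j assume ij: "i \<in> {..<M}" "j \<in> {..<M}" "F i = F j" "i \<noteq> j"
    let ?c = "\<lambda>N. if N = i then 1 else if N = j then -1 else 0 :: complex"
    have "(\<Sum>N<M. ?c N * F N x) = (\<Sum>N<M. (if N = i then F i x else 0) + (if N = j then - F j x else 0))" for x
      using ij(4) by (intro sum.cong) auto
    then have "(\<Sum>N<M. ?c N * F N x) = 0" for x using ij by (simp add: sum.distrib)
    from ind[OF this, of i] ij(1) show False by simp
  qed
  have "fs.independent (F ` {..<M})"
  proof (rule fs.independent_if_scalars_zero)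
    fix f x assume s: "(\<Sum>x\<in>F ` {..<M}. fscale (f x) x) = 0" and x: "x \<in> F ` {..<M}"
    then obtain i where i: "i < M" "x = F i" by auto
    have "(\<Sum>i<M. f (F i) * F i y) = 0" for y
    proof -
      have "(\<Sum>i<M. f (F i) * F i y) = (\<Sum>x\<in>F ` {..<M}. fscale (f x) x) y"
        by (simp add: fun_sum_apply sum.reindex[OF inj])
      then show ?thesis using s by simp
    qed
    from ind[OF this i(1)] show "f x = 0" using i by simp
  qed simp
  then have "card (F ` {..<M}) \<le> card T" using fs.independent_span_bound[OF T(1), of "F ` {..<M}"] F by auto
  then show False using T(2) by (simp add: card_image[OF inj])
qed

lemma digit_expansion: "(\<Sum>i<m. (N div B ^ i mod B) * B ^ i) = N mod B ^ m" for N B :: nat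
proof (induction m)
  case (Suc m)
  have "N mod B ^ Suc m = B ^ m * (N div B ^ m mod B) + N mod B ^ m"
    unfolding power_Suc2 by (rule mod_mult2_eq)
  then show ?case using Suc by (simp add: mult.commute)
qed simp

lemma poly_deg_power: "f \<in> poly_deg C e \<Longrightarrow> (\<lambda>x. f x ^ n) \<in> poly_deg C (e * n)"
proof (induction n)
  case (Suc n)
  then show ?case using poly_deg_mult[of f C e "\<lambda>x. f x ^ n" "e * n"] by simp
qed (simp add: poly_deg_const)

lemma poly_deg_prod:
  "(\<And>i. i < m \<Longrightarrow> f i \<in> poly_deg C e) \<Longrightarrow> (\<lambda>x. \<Prod>i<m. f i x) \<in> poly_deg C (m * e)" for m :: nat
proof (induction m)
  case (Suc m)
  then have "(\<lambda>x. (\<Prod>i<m. f i x) * f m x) \<in> poly_deg C (m * e + e)" by (intro poly_deg_mult) auto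
  then show ?case by (simp add: add.commute)
qed (simp add: poly_deg_const)

text \<open>More functions than variables are dependent, by counting: with exponents below
  \<open>B\<close> there are B^m monomials in the functions, in a space whose dimension grows like
  B^k with k < m.\<close>

theorem algebraic_relation:
  fixes H :: "'j \<Rightarrow> ('i \<Rightarrow> complex) \<Rightarrow> complex"
  assumes I: "finite I" and J: "finite J" "card I < card J" and H: "\<And>j. j \<in> J \<Longrightarrow> H j \<in> polyfun (vars I)"
  shows "\<exists>R\<in>polyfun (vars J). (\<exists>z. R z \<noteq> 0) \<and> (\<forall>t. R (\<lambda>j. H j t) = 0)"
proof -
  define m k where "m = card J" and "k = card I"
  have "\<forall>j\<in>J. \<exists>n. H j \<in> poly_deg (vars I) n" using H polyfun_imp_poly_deg by blast
  then obtain n where n: "\<And>j. j \<in> J \<Longrightarrow> H j \<in> poly_deg (vars I) (n j)" by metis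
  define e where "e = (\<Sum>j\<in>J. n j)"
  have He: "H j \<in> poly_deg (vars I) e" if "j \<in> J" for j
    using n[OF that] poly_deg_mono[of "n j" e "vars I"] member_le_sum[OF that, of n] J(1) by (auto simp: e_def)
  obtain h where h: "bij_betw h {..<m} J" using ex_bij_betw_nat_finite[OF J(1)] by (auto simp: m_def atLeast0LessThan)
  have hJ: "h i \<in> J" if "i < m" for i using h that by (auto simp: bij_betw_def)
  \<comment> \<open>\<open>B\<close> exceeds the constant (e m + 1)^k, so that (m e B + 1)^k <
    B^(k+1) \<le> B^m. The digits of \<open>N\<close> in base \<open>B\<close> serve as
    exponents.\<close>
  define B where "B = (e * m + 1) ^ k + 1"
  define dig where "dig N i = N div B ^ i mod B" for N i :: nat
  have dig: "dig N i \<le> B" for N i unfolding dig_def by (rule less_imp_le, rule mod_less_divisor) (simp add: B_def)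
  define F where "F N t = (\<Prod>i<m. H (h i) t ^ dig N i)" for N t
  have F: "F N \<in> poly_deg (vars I) (m * (e * B))" for N
    unfolding F_def
  proof (rule poly_deg_prod)
    fix i assume "i < m"
    then have "(\<lambda>t. H (h i) t ^ dig N i) \<in> poly_deg (vars I) (e * dig N i)" by (intro poly_deg_power He hJ)
    then show "(\<lambda>t. H (h i) t ^ dig N i) \<in> poly_deg (vars I) (e * B)"
      using poly_deg_mono[of "e * dig N i" "e * B" "vars I"] dig by auto
  qed
  obtain T where T: "finite T" "poly_deg (vars I) (m * (e * B)) \<subseteq> fs.span T" "card T \<le> (m * (e * B) + 1) ^ k"
    using poly_deg_vars_span[OF I] unfolding k_def by blast
  have B1: "1 \<le> B" and Bk: "(e * m + 1) ^ k < B" by (simp_all add: B_def)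
  have "(m * (e * B) + 1) ^ k \<le> ((e * m + 1) * B) ^ k" using B1 by (intro power_mono) (simp_all add: algebra_simps)
  also have "\<dots> = (e * m + 1) ^ k * B ^ k" by (rule power_mult_distrib)
  also have "\<dots> < B * B ^ k" using B1 Bk by (intro mult_strict_right_mono) simp_all
  also have "\<dots> \<le> B ^ m" using J(2) power_increasing[of "Suc k" m B] by (simp add: B_def m_def k_def)
  finally have cardT: "card T < B ^ m" using T(3) by simp
  obtain c N0 where c: "N0 < B ^ m" "c N0 \<noteq> 0" "\<And>t. (\<Sum>N<B ^ m. c N * F N t) = 0"
    using dependent_family[OF T(1) cardT, of F] F T(2) by blast
  define R where "R z = (\<Sum>N<B ^ m. c N * (\<Prod>i<m. z (h i) ^ dig N i))" for z :: "'j \<Rightarrow> complex"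
  have "R \<in> polyfun (vars J)"
    unfolding R_def by (intro polyfun_sum polyfun_scale polyfun_prod polyfun_power polyfun.coord vars_coord hJ) simp
  moreover have "R (\<lambda>j. H j t) = 0" for t using c(3) by (simp add: R_def F_def)
  moreover have "\<exists>z. R z \<noteq> 0"
  proof (rule ccontr)
    assume "\<not> ?thesis"
    then have R0: "R z = 0" for z by blast
    have "poly (\<Sum>N<B ^ m. monom (c N) N) s = 0" for s
    proof -
      \<comment> \<open>Kronecker's substitution: distinct monomials become distinct powers of
        \<open>s\<close>, so a nonzero coefficient makes \<open>R\<close> nonzero.\<close>
      define z where "z j = s ^ (B ^ inv_into {..<m} h j)" for j
      have zh: "z (h i) = s ^ (B ^ i)" if "i < m" for i
        using h that by (simp add: z_def bij_betw_def inv_into_f_f)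
      have "(\<Prod>i<m. z (h i) ^ dig N i) = s ^ N" if "N < B ^ m" for N
      proof -
        have "(\<Prod>i<m. z (h i) ^ dig N i) = (\<Prod>i<m. s ^ (dig N i * B ^ i))"
          by (rule prod.cong) (simp_all add: zh power_mult[symmetric] mult.commute)
        also have "\<dots> = s ^ (\<Sum>i<m. dig N i * B ^ i)" by (simp add: power_sum)
        also have "(\<Sum>i<m. dig N i * B ^ i) = N" using that by (simp add: dig_def digit_expansion)
        finally show ?thesis .
      qed
      then have "R z = (\<Sum>N<B ^ m. c N * s ^ N)" by (simp add: R_def)
      then show ?thesis using R0 by (simp add: poly_sum poly_monom)
    qed
    then have "(\<Sum>N<B ^ m. monom (c N) N) = 0" using poly_all_0_iff_0 by blast
    then have "coeff (\<Sum>N<B ^ m. monom (c N) N) N0 = 0" by simp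
    then show False using c(1,2) by (simp add: coeff_sum coeff_monom)
  qed
  ultimately show ?thesis by blast
qed

lemma minimal_relation:
  assumes "R \<in> polyfun (vars J)" "\<exists>z. R z \<noteq> 0" "\<forall>t. R (\<lambda>j. H j t) = 0"
  shows "\<exists>R n. R \<in> poly_deg (vars J) n \<and> (\<exists>z. R z \<noteq> 0) \<and> (\<forall>t. R (\<lambda>j. H j t) = 0) \<and>
    (\<forall>R' n'. R' \<in> poly_deg (vars J) n' \<longrightarrow> n' < n \<longrightarrow> (\<forall>t. R' (\<lambda>j. H j t) = 0) \<longrightarrow> (\<forall>z. R' z = 0))"
proof -
  let ?P = "\<lambda>n. \<exists>R\<in>poly_deg (vars J) n. (\<exists>z. R z \<noteq> 0) \<and> (\<forall>t. R (\<lambda>j. H j t) = 0)"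
  define n where "n = (LEAST n. ?P n)"
  obtain n0 where "R \<in> poly_deg (vars J) n0" using polyfun_imp_poly_deg[OF assms(1)] by blast
  then have "?P n0" using assms(2,3) by blast
  then have "?P n" unfolding n_def by (rule LeastI)
  then obtain R' where R': "R' \<in> poly_deg (vars J) n" "\<exists>z. R' z \<noteq> 0" "\<forall>t. R' (\<lambda>j. H j t) = 0" by blast
  have min: "\<not> ?P n'" if "n' < n" for n' using not_less_Least that unfolding n_def by blast
  show ?thesis
    by (rule exI[of _ R'], rule exI[of _ n]) (use R' min in blast)
qed

lemma pd_zero_imp_const:
  assumes "R \<in> polyfun (vars J)" "finite J" "\<And>j z. j \<in> J \<Longrightarrow> pd j R z = 0"
  shows "R y = R z"
proof -
  define \<gamma> where "\<gamma> t = (\<lambda>i. y i + t * (z i - y i))" for t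
  have "((\<lambda>t. R (\<gamma> t)) has_field_derivative 0) (at t)" for t
  proof -
    have "((\<lambda>t. R (\<gamma> t)) has_field_derivative (\<Sum>i\<in>J. (z i - y i) * pd i R (\<gamma> t))) (at t)"
      by (rule polyfun_curve_derivative[OF assms(2,1)]) (auto simp: \<gamma>_def intro!: derivative_eq_intros)
    then show ?thesis by (simp add: assms(3))
  qed
  then have "\<exists>c. \<forall>t\<in>UNIV. R (\<gamma> t) = c" by (intro has_field_derivative_zero_constant) auto
  then have "R (\<gamma> 0) = R (\<gamma> 1)" by auto
  then show ?thesis by (simp add: \<gamma>_def)
qed

lemma pd_zero_imp_independent:
  assumes R: "R \<in> polyfun (vars J)" "\<And>z. pd j R z = 0" shows "R (z(j := a)) = R z"
proof -
  have "((\<lambda>t. R (z(j := t))) has_field_derivative 0) (at t)" for t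
    using polyfun_var_derivative[OF R(1), of "z(j := t)" j] by (simp add: R(2))
  then have "\<exists>c. \<forall>t\<in>UNIV. R (z(j := t)) = c" by (intro has_field_derivative_zero_constant) auto
  then obtain c where "R (z(j := t)) = c" for t by auto
  then have "R (z(j := a)) = R (z(j := z j))" by (simp del: fun_upd_triv)
  then show ?thesis by simp
qed

lemma polyfun_line_through_0:
  "f \<in> polyfun (vars J) \<Longrightarrow> \<exists>p. \<forall>\<tau>. f (\<lambda>i. \<tau> * s i) = poly p \<tau>"
proof (erule polyfun_on_polynomial_curve)
  fix c assume "c \<in> vars J"
  then obtain i where "c = (\<lambda>z. z i)" by (auto simp: vars_def)
  then show "\<exists>p. \<forall>\<tau>. c (\<lambda>i. \<tau> * s i) = poly p \<tau>" by (intro exI[of _ "[:0, s i:]"]) simp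
qed

text \<open>Along a line through the origin the partial derivatives of \<open>R\<close> satisfy a linear system whose matrix
  is the identity modulo the parameter, hence they are divisible by every power of the parameter.\<close>

theorem unit_jacobian_imp_injective:
  fixes H :: "'i \<Rightarrow> ('i \<Rightarrow> complex) \<Rightarrow> complex"
  assumes J: "finite J" and H: "\<And>i. i \<in> J \<Longrightarrow> H i \<in> polyfun (vars J)"
    and jac: "\<And>i j. i \<in> J \<Longrightarrow> j \<in> J \<Longrightarrow> pd j (H i) (\<lambda>_. 0) = (if i = j then 1 else 0)"
    and R: "R \<in> polyfun (vars J)" "\<And>s. R (\<lambda>i. H i s) = 0"
  shows "R z = 0"
proof -
  have "R z = 0" if "R \<in> poly_deg (vars J) n" "\<And>s. R (\<lambda>i. H i s) = 0" for R n z
    using that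
  proof (induction n arbitrary: R z)
    case 0
    then obtain a where "R = (\<lambda>_. a)" using poly_deg_0 by blast
    then show ?case using 0(2) by simp
  next
    case (Suc n)
    have Rp: "R \<in> polyfun (vars J)" using Suc.prems(1) by (rule poly_deg_imp_polyfun)
    \<comment> \<open>If the partial derivatives of \<open>R\<close> also vanish on the image, the
      induction on the degree makes them zero and \<open>R\<close> is constant.\<close>
    have Z: "pd i R (\<lambda>i. H i s) = 0" if i: "i \<in> J" for i s
    proof -
      define r where "r i s = pd i R (\<lambda>i. H i s)" for i s
      have rp: "r i \<in> polyfun (vars J)" for i
        unfolding r_def by (rule polyfun_vars_compose[OF pd_polyfun[OF Rp] H])
      have lin: "(\<Sum>i\<in>J. pd j (H i) s * r i s) = 0" for j s
      proof -
        have "pd j (\<lambda>x. R (\<lambda>i. H i x)) s = (\<Sum>i\<in>J. pd j (H i) s * r i s)"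
          unfolding r_def by (rule polyfun_chain_rule[OF J Rp point_derivation_pd H])
        then show ?thesis by (simp add: Suc.prems(2) pd_const)
      qed
      have "\<exists>p. \<forall>\<tau>. r i (\<lambda>l. \<tau> * s l) = poly p \<tau>" for i by (rule polyfun_line_through_0[OF rp])
      then obtain P where P: "\<And>i \<tau>. r i (\<lambda>l. \<tau> * s l) = poly (P i) \<tau>" by metis
      have "\<exists>M. \<forall>\<tau>. pd j (H i) (\<lambda>l. \<tau> * s l) = poly (pCons (if i = j then 1 else 0) M) \<tau>"
        if ij: "i \<in> J" "j \<in> J" for i j
      proof -
        obtain p where p: "\<And>\<tau>. pd j (H i) (\<lambda>l. \<tau> * s l) = poly p \<tau>"
          using polyfun_line_through_0[OF pd_polyfun[OF H[OF ij(1)]]] by blast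
        obtain a M where aM: "p = pCons a M" by (cases p) auto
        have "a = (if i = j then 1 else 0)" using p[of 0] jac[OF ij] by (simp add: aM)
        then show ?thesis using p aM by auto
      qed
      then have "\<forall>i j. \<exists>M. i \<in> J \<longrightarrow> j \<in> J \<longrightarrow>
          (\<forall>\<tau>. pd j (H i) (\<lambda>l. \<tau> * s l) = poly (pCons (if i = j then 1 else 0) M) \<tau>)" by blast
      then obtain M where M: "\<And>i j \<tau>. i \<in> J \<Longrightarrow> j \<in> J \<Longrightarrow>
          pd j (H i) (\<lambda>l. \<tau> * s l) = poly (pCons (if i = j then 1 else 0) (M i j)) \<tau>" by metis
      have eq: "P j = [:0, 1:] * (- (\<Sum>i\<in>J. M i j * P i))" if j: "j \<in> J" for j
      proof -
        have "poly (P j + [:0, 1:] * (\<Sum>i\<in>J. M i j * P i)) \<tau> = 0" for \<tau>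
        proof -
          have "0 = (\<Sum>i\<in>J. pd j (H i) (\<lambda>l. \<tau> * s l) * r i (\<lambda>l. \<tau> * s l))" using lin by simp
          also have "\<dots> = (\<Sum>i\<in>J. (if i = j then poly (P j) \<tau> else 0) + \<tau> * (poly (M i j) \<tau> * poly (P i) \<tau>))"
            by (rule sum.cong) (simp_all add: M j P distrib_right mult.assoc)
          also have "\<dots> = poly (P j + [:0, 1:] * (\<Sum>i\<in>J. M i j * P i)) \<tau>"
            using j J by (simp add: sum.distrib poly_sum sum_distrib_left)
          finally show ?thesis by simp
        qed
        then have "P j + [:0, 1:] * (\<Sum>i\<in>J. M i j * P i) = 0" using poly_all_0_iff_0 by blast
        then show ?thesis by (simp only: mult_minus_right eq_neg_iff_add_eq_0)
      qed
      have dvd: "\<forall>j\<in>J. [:0, 1:] ^ q dvd P j" for q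
      proof (induction q)
        case (Suc q)
        show ?case
        proof
          fix j assume j: "j \<in> J"
          have "[:0, 1:] ^ q dvd (\<Sum>i\<in>J. M i j * P i)" by (rule dvd_sum) (use Suc in \<open>auto intro: dvd_mult\<close>)
          then have "[:0, 1:] ^ q dvd - (\<Sum>i\<in>J. M i j * P i)" by (simp only: dvd_minus_iff)
          then show "[:0, 1:] ^ Suc q dvd P j" unfolding eq[OF j] power_Suc by (rule mult_dvd_mono[OF dvd_refl])
        qed
      qed simp
      have "P i = 0"
      proof (rule ccontr)
        assume "P i \<noteq> 0"
        then have "degree ([:0, 1 :: complex:] ^ Suc (degree (P i))) \<le> degree (P i)" 
          by (rule dvd_imp_degree_le[OF bspec[OF dvd i]])
        then show False by (simp add: degree_power_eq del: power_Suc)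
      qed
      then show ?thesis using P[of i 1] by (simp add: r_def)
    qed
    have "pd i R z = 0" if "i \<in> J" for i z
    proof (rule Suc.IH[where R = "pd i R"])
      show "pd i R \<in> poly_deg (vars J) n" using pd_poly_deg[OF Suc.prems(1), of i] by simp
    qed (use Z that in blast)
    from pd_zero_imp_const[OF Rp J this, of z "\<lambda>i. H i (\<lambda>_. 0)"] show ?case by (simp add: Suc.prems(2))
  qed
  then show ?thesis using R polyfun_imp_poly_deg by blast
qed

text \<open>\<open>S\<close> is a maximal set of indices whose functions satisfy no relation; it has
  at most as many elements as there are variables. A relation of least degree for a further
  \<open>j\<close> has a derivative in the variable \<open>j\<close> that does not vanish
  identically on the image, which is separability in characteristic zero.\<close>

theorem separating_transcendence_basis:
  fixes H :: "'j \<Rightarrow> ('i \<Rightarrow> complex) \<Rightarrow> complex"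
  assumes I: "finite I" and J: "finite J" and H: "\<And>j. j \<in> J \<Longrightarrow> H j \<in> polyfun (vars I)"
  obtains S Q where "S \<subseteq> J" "card S \<le> card I"
    "\<And>j. j \<in> J - S \<Longrightarrow> Q j \<in> polyfun (vars (insert j S))"
    "\<And>j t. j \<in> J - S \<Longrightarrow> Q j (\<lambda>i. H i t) = 0"
    "\<And>j. j \<in> J - S \<Longrightarrow> \<exists>t. pd j (Q j) (\<lambda>i. H i t) \<noteq> 0"
proof -
  define ind where "ind S \<longleftrightarrow> (\<forall>R\<in>polyfun (vars S). (\<forall>t. R (\<lambda>j. H j t) = 0) \<longrightarrow> (\<forall>z. R z = 0))" for S
  define \<A> where "\<A> = {S. S \<subseteq> J \<and> ind S}"
  have "ind {}"
    unfolding ind_def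
  proof (intro ballI impI allI)
    fix R z assume R: "R \<in> polyfun (vars {})" "\<forall>t. R (\<lambda>j. H j t) = 0"
    have "R z = R (\<lambda>j. H j t)" for t by (rule polyfun_vars_cong[OF R(1)]) simp
    then show "R z = 0" using R(2) by simp
  qed
  then have "{} \<in> \<A>" by (simp add: \<A>_def)
  moreover have "finite \<A>" using J by (rule_tac finite_subset[of _ "Pow J"]) (auto simp: \<A>_def)
  ultimately obtain S where S: "S \<in> \<A>" "\<And>S'. S' \<in> \<A> \<Longrightarrow> S \<subseteq> S' \<Longrightarrow> S = S'"
    using finite_has_maximal[of \<A>] by blast
  have SJ: "S \<subseteq> J" and indS: "ind S" using S(1) by (auto simp: \<A>_def)
  have "card S \<le> card I"
  proof (rule ccontr)
    assume "\<not> card S \<le> card I"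
    then have "\<exists>R\<in>polyfun (vars S). (\<exists>z. R z \<noteq> 0) \<and> (\<forall>t. R (\<lambda>j. H j t) = 0)"
      using SJ J H by (intro algebraic_relation[OF I]) (auto intro: finite_subset)
    then show False using indS by (auto simp: ind_def)
  qed
  have ex: "\<exists>Q. Q \<in> polyfun (vars (insert j S)) \<and> (\<forall>t. Q (\<lambda>i. H i t) = 0) \<and> (\<exists>t. pd j Q (\<lambda>i. H i t) \<noteq> 0)"
    if j: "j \<in> J - S" for j
  proof -
    have "insert j S \<notin> \<A>" using S(2)[of "insert j S"] j by auto
    then have "\<not> ind (insert j S)" using j SJ by (auto simp: \<A>_def)
    then obtain R0 where R0: "R0 \<in> polyfun (vars (insert j S))" "\<exists>z. R0 z \<noteq> 0" "\<forall>t. R0 (\<lambda>j. H j t) = 0"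
      unfolding ind_def by blast
    from minimal_relation[OF R0] obtain R n where R: "R \<in> poly_deg (vars (insert j S)) n" "\<exists>z. R z \<noteq> 0"
      "\<forall>t. R (\<lambda>j. H j t) = 0" and min: "\<forall>R' n'. R' \<in> poly_deg (vars (insert j S)) n' \<longrightarrow> n' < n \<longrightarrow>
        (\<forall>t. R' (\<lambda>j. H j t) = 0) \<longrightarrow> (\<forall>z. R' z = 0)"
      by (elim exE conjE) (rule that, assumption, erule exI, assumption+)
    have Rp: "R \<in> polyfun (vars (insert j S))" using R(1) by (rule poly_deg_imp_polyfun)
    \<comment> \<open>Otherwise the derivative is a relation of smaller degree, hence 0, and
      \<open>R\<close> does not depend on the variable \<open>j\<close>: it would be a relation
      within \<open>S\<close>.\<close>
    have "\<exists>t. pd j R (\<lambda>i. H i t) \<noteq> 0"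
    proof (rule ccontr)
      assume "\<not> ?thesis"
      then have z: "pd j R (\<lambda>i. H i t) = 0" for t by blast
      have "n \<noteq> 0" using R(1-3) poly_deg_0 by fastforce
      then have pd0: "pd j R z = 0" for z
        using min[rule_format, of "pd j R" "n - 1" z] pd_poly_deg[OF R(1), of j] z \<open>n \<noteq> 0\<close> by simp
      define R1 where "R1 z = R (\<lambda>i. if i = j then 0 else z i)" for z
      have eq: "R1 z = R z" for z
      proof -
        have "R1 z = R (z(j := 0))" unfolding R1_def by (rule arg_cong[of _ _ R]) (simp add: fun_eq_iff)
        then show ?thesis using pd_zero_imp_independent[OF Rp pd0] by simp
      qed
      have "R1 \<in> polyfun (vars S)" unfolding R1_def
      proof (rule polyfun_vars_compose[OF Rp])
        fix i assume "i \<in> insert j S"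
        then show "(\<lambda>z. if i = j then 0 else z i) \<in> polyfun (vars S)"
          by (cases "i = j") (auto intro: polyfun.intros vars_coord)
      qed
      then have "R1 z = 0" for z using indS eq R(3) by (auto simp: ind_def)
      then show False using eq R(2) by simp
    qed
    then show ?thesis using Rp R(3) by blast
  qed
  then obtain Q where "\<And>j. j \<in> J - S \<Longrightarrow>
      Q j \<in> polyfun (vars (insert j S)) \<and> (\<forall>t. Q j (\<lambda>i. H i t) = 0) \<and> (\<exists>t. pd j (Q j) (\<lambda>i. H i t) \<noteq> 0)" by metis
  then show thesis using that[OF SJ \<open>card S \<le> card I\<close>] by blast
qed

section \<open>Conjugation by products of exponentials\<close>

primrec conjs :: "((complex^'n^'n) \<times> complex) list \<Rightarrow> complex^'n^'n \<Rightarrow> complex^'n^'n" where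
  "conjs [] y = y"
| "conjs (p # ps) y = nconj (fst p) (snd p) (conjs ps y)"

lemma conjs_append: "conjs (ps @ qs) y = conjs ps (conjs qs y)"
  by (induction ps) auto

lemma conjs_add: "conjs ps (y + w) = conjs ps y + conjs ps w"
  and conjs_scale: "conjs ps (cscale c y) = cscale c (conjs ps y)"
  and conjs_zero [simp]: "conjs ps 0 = 0"
  by (induction ps) (auto simp: nconj_add nconj_scale)

lemma conjs_inverse:
  "(\<And>p. p \<in> set ps \<Longrightarrow> mnilpotent (fst p)) \<Longrightarrow> conjs (rev (map (\<lambda>p. (fst p, - snd p)) ps)) (conjs ps y) = y"
  by (induction ps) (auto simp: conjs_append nconj_inverse)

lemma conjs_polyfun:
  assumes "\<And>i j. (\<lambda>x. m x $ i $ j) \<in> polyfun C" shows "(\<lambda>x. conjs ps (m x) $ i $ j) \<in> polyfun C"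
proof (induction ps arbitrary: i j)
  case (Cons p ps)
  show ?case unfolding conjs.simps
    by (rule nconj_polyfun[where \<sigma> = "\<lambda>_. snd p" and m = "\<lambda>x. conjs ps (m x)", OF polyfun.const Cons])
qed (simp add: assms)

text \<open>Scaling all parameters gives a polynomial path from the identity at \<tau> = 0 to the
  given product at \<tau> = 1.\<close>

lemma conjs_scaled_polyfun:
  "(\<lambda>\<tau>. conjs (map (\<lambda>p. (fst p, \<tau> * snd p)) ps) y $ i $ j) \<in> polyfun {\<lambda>s. s}"
proof (induction ps arbitrary: i j)
  case (Cons p ps)
  show ?case unfolding conjs.simps list.map fst_conv snd_conv
    by (rule nconj_polyfun[where \<sigma> = "\<lambda>\<tau>. \<tau> * snd p", OF polyfun.mult[OF polyfun_id polyfun.const] Cons])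
qed (simp add: polyfun.const)

lemma conjs_scaled_0:
  "(\<And>p. p \<in> set ps \<Longrightarrow> mnilpotent (fst p)) \<Longrightarrow> conjs (map (\<lambda>p. (fst p, 0 * snd p)) ps) y = y"
  by (induction ps) (auto simp: nconj_0)

text \<open>The orbit of \<open>y\<close> under the group generated by the exponentials; inverses
  only change the signs of parameters, so products described by lists suffice.\<close>

definition conj_orbit :: "(complex^'n^'n) set \<Rightarrow> complex^'n^'n \<Rightarrow> (complex^'n^'n) set" where
  "conj_orbit U y = {conjs ps y |ps. fst ` set ps \<subseteq> U}"

lemma conj_orbit_conjs: "fst ` set ps \<subseteq> U \<Longrightarrow> z \<in> conj_orbit U y \<Longrightarrow> conjs ps z \<in> conj_orbit U y"
proof -
  assume ps: "fst ` set ps \<subseteq> U" and "z \<in> conj_orbit U y"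
  then obtain qs where qs: "fst ` set qs \<subseteq> U" "z = conjs qs y" by (auto simp: conj_orbit_def)
  then have "conjs ps z = conjs (ps @ qs) y" "fst ` set (ps @ qs) \<subseteq> U" using ps by (simp_all add: conjs_append image_Un)
  then show ?thesis unfolding conj_orbit_def by blast
qed

lemma conj_orbit_sym:
  assumes "\<And>u. u \<in> U \<Longrightarrow> mnilpotent u" "fst ` set ps \<subseteq> U" shows "y \<in> conj_orbit U (conjs ps y)"
proof -
  let ?qs = "rev (map (\<lambda>p. (fst p, - snd p)) ps)"
  have "conjs ?qs (conjs ps y) = y" by (rule conjs_inverse) (use assms in auto)
  moreover have "fst ` set ?qs \<subseteq> U" using assms(2) by auto
  ultimately have "\<exists>qs. y = conjs qs (conjs ps y) \<and> fst ` set qs \<subseteq> U" by (intro exI[of _ ?qs]) simp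
  then show ?thesis by (auto simp: conj_orbit_def)
qed

lemma conj_orbit_ad_stable:
  assumes "mnilpotent u" "u \<in> U" shows "ad_stable (conj_orbit U y) u"
proof (rule nconj_stable_imp_ad_stable[OF assms(1)])
  fix f z s assume f: "f \<in> vanishing_ideal mat_coords (conj_orbit U y)" and z: "z \<in> conj_orbit U y"
  from conj_orbit_conjs[of "[(u, s)]", OF _ z] have "nconj u s z \<in> conj_orbit U y" using assms(2) by simp
  then show "f (nconj u s z) = 0" using f by (simp add: vanishing_ideal_def)
qed

lemma adjoint_orbit_nconj:
  assumes "algebraic_group G" "u \<in> lie_algebra G" "mnilpotent u" "y \<in> adjoint_orbit G e"
  shows "nconj u s y \<in> adjoint_orbit G e"
  using adjoint_orbit_stable[OF assms(1) nexp_in_group(1)[OF assms(1-3)] assms(4), of s]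
  by (simp add: nconj_def nexp_in_group(2)[OF assms(1-3)])

lemma adjoint_orbit_refl: "algebraic_group G \<Longrightarrow> e \<in> adjoint_orbit G e"
proof -
  assume G: "algebraic_group G"
  have "matrix_inv (mat 1) = (mat 1 :: complex^'a^'a)" by (rule matrix_inv_unique) simp_all
  then show ?thesis using algebraic_groupD(1)[OF G] unfolding adjoint_orbit_def
    by (intro CollectI exI[of _ "mat 1"]) simp
qed

section \<open>Zariski closures and tangent spaces\<close>

definition zclosure :: "(complex^'n^'n) set \<Rightarrow> (complex^'n^'n) set" where
  "zclosure S = {y. \<forall>f\<in>vanishing_ideal mat_coords S. f y = 0}"

text \<open>For \<open>y\<close> in the closure of \<open>S\<close> this is the Zariski tangent
  space of the reduced closure, since \<open>S\<close> and its closure have the same ideal.\<close>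

definition tangent :: "(complex^'n^'n) set \<Rightarrow> complex^'n^'n \<Rightarrow> (complex^'n^'n) set" where
  "tangent S y = {w. \<forall>f\<in>vanishing_ideal mat_coords S. dd f y w = 0}"

lemma zclosure_subset: "S \<subseteq> zclosure S"
  by (auto simp: zclosure_def vanishing_ideal_def)

lemma closedin_zclosure: "closedin mat_zariski (zclosure S)"
  unfolding closedin_zariski_iff zclosure_def
  by (rule exI[of _ "vanishing_ideal mat_coords S"]) (auto simp: vanishing_ideal_def)

lemma zclosure_minimal:
  assumes "closedin mat_zariski T" "S \<subseteq> T" shows "zclosure S \<subseteq> T"
proof -
  obtain F where F: "F \<subseteq> polyfun mat_coords" "T = {x. \<forall>f\<in>F. f x = 0}" using assms(1) unfolding closedin_zariski_iff by blast
  then have "F \<subseteq> vanishing_ideal mat_coords S" using assms(2) by (auto simp: vanishing_ideal_def)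
  then show ?thesis using F(2) by (auto simp: zclosure_def)
qed

lemma zclosure_eq_closure_of: "mat_zariski closure_of S = zclosure S"
  by (intro subset_antisym closure_of_minimal zclosure_subset closedin_zclosure zclosure_minimal)
    (simp_all add: closure_of_subset)

lemma vanishing_ideal_zclosure: "vanishing_ideal mat_coords (zclosure S) = vanishing_ideal mat_coords S"
  using zclosure_subset[of S] by (auto simp: vanishing_ideal_def zclosure_def)

lemma zclosure_nconj:
  assumes "\<And>z. z \<in> S \<Longrightarrow> nconj u s z \<in> zclosure S" "y \<in> zclosure S"
  shows "nconj u s y \<in> zclosure S"
  unfolding zclosure_def
proof (intro CollectI ballI)
  fix f assume f: "f \<in> vanishing_ideal mat_coords S"
  have "(\<lambda>y. f (nconj u s y)) \<in> polyfun mat_coords"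
    by (rule polyfun_mat_compose[where m = "nconj u s"])
      (use f nconj_polyfun[where m = "\<lambda>y. y", OF polyfun.const entry_polyfun] in \<open>auto simp: vanishing_ideal_def\<close>)
  moreover have "f (nconj u s z) = 0" if "z \<in> S" for z using assms(1)[OF that] f by (auto simp: zclosure_def)
  ultimately have "(\<lambda>y. f (nconj u s y)) \<in> vanishing_ideal mat_coords S" by (simp add: vanishing_ideal_def)
  then show "f (nconj u s y) = 0" using assms(2) by (auto simp: zclosure_def)
qed

lemma tangent_conjs:
  assumes stable: "\<And>z. z \<in> S \<Longrightarrow> conjs ps z \<in> zclosure S" and w: "w \<in> tangent S y"
  shows "conjs ps w \<in> tangent S (conjs ps y)"
  unfolding tangent_def
proof (intro CollectI ballI)
  fix f assume f: "f \<in> vanishing_ideal mat_coords S"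
  let ?f = "\<lambda>y. f (conjs ps y)"
  have "?f \<in> polyfun mat_coords"
    by (rule polyfun_mat_compose[where m = "conjs ps"])
      (use f conjs_polyfun[where m = "\<lambda>y. y", OF entry_polyfun] in \<open>auto simp: vanishing_ideal_def\<close>)
  then have fI: "?f \<in> vanishing_ideal mat_coords S" using stable f by (auto simp: vanishing_ideal_def zclosure_def)
  then have fp: "?f \<in> polyfun mat_coords" by (simp add: vanishing_ideal_def)
  from dd_line[OF fp, of y w]
  have "((\<lambda>t. f (conjs ps y + cscale t (conjs ps w))) has_field_derivative dd ?f y w) (at 0)"
    by (simp add: conjs_add conjs_scale)
  then have "dd f (conjs ps y) (conjs ps w) = dd ?f y w"
    using f by (intro DERIV_unique[OF dd_line]) (auto simp: vanishing_ideal_def)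
  also have "\<dots> = 0" using w fI by (simp add: tangent_def)
  finally show "dd f (conjs ps y) (conjs ps w) = 0" .
qed

text \<open>Divisibility of f(\<gamma> 0 + t \<gamma> 1) by t^2 concerns only the value and the
  first derivative at t = 0, so 1-jets are tangent vectors.\<close>

lemma jet_scheme_1_iff:
  "\<gamma> \<in> jet_scheme 1 (mat_zariski closure_of S) \<longleftrightarrow> (\<forall>k>1. \<gamma> k = 0) \<and> \<gamma> 0 \<in> zclosure S \<and> \<gamma> 1 \<in> tangent S (\<gamma> 0)"
proof -
  have "(\<exists>p. \<forall>t. f (\<Sum>k\<le>1. cscale (t ^ k) (\<gamma> k)) = t ^ (1 + 1) * poly p t) \<longleftrightarrow> f (\<gamma> 0) = 0 \<and> dd f (\<gamma> 0) (\<gamma> 1) = 0"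
    if "f \<in> vanishing_ideal mat_coords S" for f
  proof -
    have fp: "f \<in> polyfun mat_coords" using that by (simp add: vanishing_ideal_def)
    have line: "(\<Sum>k\<le>1. cscale (t ^ k) (\<gamma> k)) = \<gamma> 0 + cscale t (\<gamma> 1)" for t by simp
    note D = dd_line[OF fp, of "\<gamma> 0" "\<gamma> 1"]
    have "\<exists>p. \<forall>t. f (\<gamma> 0 + cscale t (\<gamma> 1)) = poly p t"
      by (rule curve_polynomial[OF fp, where \<gamma> = "\<lambda>t. \<gamma> 0 + cscale t (\<gamma> 1)"])
        (simp, intro polyfun.add polyfun.mult polyfun.const polyfun_id)
    then obtain p where p: "\<And>t. f (\<gamma> 0 + cscale t (\<gamma> 1)) = poly p t" by blast
    obtain a b r where abr: "p = pCons a (pCons b r)" by (metis pCons_cases)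
    have a: "f (\<gamma> 0) = a" using p[of 0] by (simp add: abr)
    have "((\<lambda>t. poly p t) has_field_derivative dd f (\<gamma> 0) (\<gamma> 1)) (at 0)" using D by (simp only: p)
    then have "dd f (\<gamma> 0) (\<gamma> 1) = poly (pderiv p) 0" using poly_DERIV DERIV_unique by blast
    then have b: "dd f (\<gamma> 0) (\<gamma> 1) = b" by (simp add: abr pderiv_pCons)
    show ?thesis
    proof
      assume "\<exists>p. \<forall>t. f (\<Sum>k\<le>1. cscale (t ^ k) (\<gamma> k)) = t ^ (1 + 1) * poly p t"
      then obtain q where q: "\<And>t. poly p t = t ^ 2 * poly q t" unfolding line p by (auto simp: power2_eq_square)
      have "poly (p - [:0, 0, 1:] * q) t = 0" for t using q[of t] by (simp add: power2_eq_square)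
      then have "p - [:0, 0, 1:] * q = 0" using poly_all_0_iff_0 by blast
      then have "pCons a (pCons b r) = pCons 0 (pCons 0 q)" by (simp add: abr)
      then show "f (\<gamma> 0) = 0 \<and> dd f (\<gamma> 0) (\<gamma> 1) = 0" using a b by simp
    next
      assume "f (\<gamma> 0) = 0 \<and> dd f (\<gamma> 0) (\<gamma> 1) = 0"
      then show "\<exists>p. \<forall>t. f (\<Sum>k\<le>1. cscale (t ^ k) (\<gamma> k)) = t ^ (1 + 1) * poly p t"
        using a b by (intro exI[of _ r]) (simp only: line p, simp add: abr)
    qed
  qed
  then show ?thesis
    unfolding jet_scheme_def zclosure_eq_closure_of vanishing_ideal_zclosure by (auto simp: zclosure_def tangent_def)
qed

section \<open>The tangent space at the origin of a nilpotent orbit closure\<close>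

lemma tangent_const_direction: "f \<in> polyfun mat_coords \<Longrightarrow> (\<lambda>y. dd f y v) \<in> polyfun mat_coords"
proof -
  assume "f \<in> polyfun mat_coords"
  then obtain n where "f \<in> poly_deg mat_coords n" using polyfun_imp_poly_deg by blast
  from dd_poly_deg[OF this, of "\<lambda>_. v"] show ?thesis using poly_deg_const poly_deg_imp_polyfun by blast
qed

text \<open>Restricted to the line through \<open>e\<close>, the ideal gives a set of polynomials
  that vanish at 1 and is stable under p \<mapsto> X p', because [h,e] = e. For nonzero
  \<open>p\<close> this step lowers the order of vanishing at 1, so all of them are zero.\<close>

lemma orbit_contains_line:
  fixes e :: "complex^'n^'n"
  assumes stable: "\<And>u. u \<in> \<aa> \<Longrightarrow> ad_stable Y u" and h: "h \<in> \<aa>" "lie_bracket h e = e" and e: "e \<in> Y"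
    and f: "f \<in> vanishing_ideal mat_coords Y"
  shows "f (cscale c e) = 0"
proof -
  define W where "W = {p. \<exists>f\<in>vanishing_ideal mat_coords Y. \<forall>c. f (cscale c e) = poly p c}"
  have W1: "poly p 1 = 0" if pW: "p \<in> W" for p
  proof -
    obtain f where f: "f \<in> vanishing_ideal mat_coords Y" "\<And>c. f (cscale c e) = poly p c" using pW by (auto simp: W_def)
    then have "f e = 0" using e by (simp add: vanishing_ideal_def)
    then show ?thesis using f(2)[of 1] by simp
  qed
  have W2: "[:0, 1:] * pderiv p \<in> W" if pW: "p \<in> W" for p
  proof -
    obtain f where f: "f \<in> vanishing_ideal mat_coords Y" "\<And>c. f (cscale c e) = poly p c" using pW by (auto simp: W_def)
    have fp: "f \<in> polyfun mat_coords" using f(1) by (simp add: vanishing_ideal_def)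
    have "ad_deriv h f (cscale c e) = poly ([:0, 1:] * pderiv p) c" for c
    proof -
      have "mderiv (\<lambda>c. cscale c e) e c" using mderiv_line[of 0 e c] by simp
      from dd_mderiv[OF fp this] have "((\<lambda>c. poly p c) has_field_derivative dd f (cscale c e) e) (at c)" by (simp add: f(2))
      then have "dd f (cscale c e) e = poly (pderiv p) c" using poly_DERIV DERIV_unique by blast
      then show ?thesis by (simp add: ad_deriv_def lie_bilinear h(2) dd_scale_direction)
    qed
    then show ?thesis using ad_stableD[OF stable[OF h(1)] f(1)] unfolding W_def by blast
  qed
  have "p = 0" if "p \<in> W" "order 1 p = n" for p n
    using that
  proof (induction n arbitrary: p)
    case 0
    then show ?case using W1[OF 0(1)] order_root by blast
  next
    case (Suc n)
    show ?case
    proof (rule ccontr)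
      assume nz: "p \<noteq> 0"
      have ord: "order 1 p = Suc (order 1 (pderiv p))" using order_pderiv[OF nz W1[OF Suc.prems(1)]] .
      have "pderiv p \<noteq> 0"
      proof
        assume "pderiv p = 0"
        then obtain a where "p = [:a:]" using pderiv_eq_0_iff degree_eq_zeroE by blast
        then show False using W1[OF Suc.prems(1)] nz by simp
      qed
      then have nz': "[:0, 1:] * pderiv p \<noteq> 0" by (simp only: mult_eq_0_iff) simp
      have "order 1 [:0, 1 :: complex:] = 0" by (rule order_0I) simp
      then have "order 1 ([:0, 1:] * pderiv p) = n" using order_mult[OF nz'] ord Suc.prems(2) by simp
      from Suc.IH[OF W2[OF Suc.prems(1)] this] nz' show False by simp
    qed
  qed
  moreover have "\<exists>p. \<forall>c. f (cscale c e) = poly p c"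
    by (rule curve_polynomial) (use f in \<open>auto simp: vanishing_ideal_def intro: polyfun.mult polyfun_id polyfun.const\<close>)
  then obtain p where p: "\<And>c. f (cscale c e) = poly p c" by blast
  ultimately have "p = 0" using f by (auto simp: W_def)
  then show ?thesis using p by simp
qed

text \<open>The vectors of \<aa> tangent at 0 form an ideal: the field of \<open>u\<close> vanishes
  at 0, and differentiating its action on \<open>f\<close> there in direction \<open>v\<close> gives
  the derivative of \<open>f\<close> in direction [u,v]. The line through \<open>e\<close> makes
  this ideal nonzero.\<close>

lemma orbit_tangent_at_0:
  fixes e :: "complex^'n^'n"
  assumes simple: "lie_simple \<aa>" and stable: "\<And>u. u \<in> \<aa> \<Longrightarrow> ad_stable Y u"
    and h: "h \<in> \<aa>" "lie_bracket h e = e" and e: "e \<in> Y" "e \<in> \<aa>" "e \<noteq> 0"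
  shows "0 \<in> zclosure Y" "v \<in> \<aa> \<Longrightarrow> v \<in> tangent Y 0"
proof -
  have line: "f (cscale c e) = 0" if "f \<in> vanishing_ideal mat_coords Y" for f c
    using orbit_contains_line[of \<aa> Y h e f c, OF stable h e(1) that] .
  show "0 \<in> zclosure Y" using line[of _ 0] by (simp add: zclosure_def)
  define I where "I = {v \<in> \<aa>. v \<in> tangent Y 0}"
  have "e \<in> tangent Y 0"
    unfolding tangent_def
  proof (intro CollectI ballI)
    fix f assume f: "f \<in> vanishing_ideal mat_coords Y"
    then have "((\<lambda>t. f (0 + cscale t e)) has_field_derivative dd f 0 e) (at 0)"
      by (intro dd_line) (simp add: vanishing_ideal_def)
    then have "((\<lambda>t. 0) has_field_derivative dd f 0 e) (at 0)" by (simp add: line[OF f])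
    from DERIV_unique[OF this DERIV_const] show "dd f 0 e = 0" .
  qed
  then have eI: "e \<in> I" using e(2) by (simp add: I_def)
  have "lie_ideal I \<aa>"
    unfolding lie_ideal_def
  proof (intro conjI ballI)
    show "I \<subseteq> \<aa>" by (auto simp: I_def)
    show "cmat.subspace I" using subspace_lie_simple[OF simple]
      by (auto simp: cmat.subspace_def I_def tangent_def dd_add_direction dd_scale_direction)
    fix u v assume u: "u \<in> \<aa>" and v: "v \<in> I"
    have "lie_bracket u v \<in> tangent Y 0"
      unfolding tangent_def
    proof (intro CollectI ballI)
      fix f assume f: "f \<in> vanishing_ideal mat_coords Y"
      have fp: "f \<in> polyfun mat_coords" using f by (simp add: vanishing_ideal_def)
      have D: "ad_deriv u f \<in> vanishing_ideal mat_coords Y" by (rule ad_stableD[OF stable[OF u] f])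
      then have "dd (ad_deriv u f) 0 v = 0" using v by (simp add: I_def tangent_def)
      moreover have "((\<lambda>t. ad_deriv u f (0 + cscale t v)) has_field_derivative dd (ad_deriv u f) 0 v) (at 0)"
        by (rule dd_line[OF ad_deriv_polyfun[OF fp]])
      \<comment> \<open>At \<open>cscale t v\<close> the function \<open>ad_deriv u f\<close> is
        \<open>t\<close> times a polynomial in \<open>t\<close>, whose value at 0 is therefore the
        derivative.\<close>
      ultimately have D0: "((\<lambda>t. t * dd f (cscale t v) (lie_bracket u v)) has_field_derivative 0) (at 0)"
        by (simp add: ad_deriv_def lie_bilinear dd_scale_direction)
      have "\<exists>p. \<forall>t. dd f (cscale t v) (lie_bracket u v) = poly p t"
        by (rule curve_polynomial[OF tangent_const_direction[OF fp], where \<gamma> = "\<lambda>t. cscale t v"])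
          (auto intro: polyfun.mult polyfun_id polyfun.const)
      then obtain p where p: "\<And>t. dd f (cscale t v) (lie_bracket u v) = poly p t" by blast
      have "((\<lambda>t. poly (pCons 0 p) t) has_field_derivative 0) (at 0)" using D0 by (simp add: p)
      with poly_DERIV have "poly (pderiv (pCons 0 p)) 0 = 0" by (rule DERIV_unique)
      then have "poly p 0 = 0" by (simp add: pderiv_pCons)
      then show "dd f 0 (lie_bracket u v) = 0" using p[of 0] by simp
    qed
    then show "lie_bracket u v \<in> I" using lie_simple_bracket[OF simple u] v by (simp add: I_def)
  qed
  from lie_ideal_trivial[OF simple this] eI e(3) have "I = \<aa>" by auto
  then show "v \<in> \<aa> \<Longrightarrow> v \<in> tangent Y 0" by (auto simp: I_def)
qed

section \<open>Polynomially parametrised subsets of an orbit\<close>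

text \<open>The head of the list is the outermost factor and uses the variable
  \<open>length us\<close>, so that prefixing an element leaves the variables of the tail
  unchanged.\<close>

primrec chain :: "complex^'n^'n \<Rightarrow> (complex^'n^'n) list \<Rightarrow> (nat \<Rightarrow> complex) \<Rightarrow> complex^'n^'n" where
  "chain e [] t = e"
| "chain e (u # us) t = nconj u (t (length us)) (chain e us t)"

lemma chain_polyfun: "(\<lambda>t. chain e us t $ i $ j) \<in> polyfun (vars {..<length us})"
proof (induction us arbitrary: i j)
  case (Cons u us)
  have "(\<lambda>t. chain e us t $ i $ j) \<in> polyfun (vars {..<length (u # us)})" for i j
    by (rule polyfun_mono[OF Cons vars_mono]) auto
  then show ?case unfolding chain.simps
    by (rule nconj_polyfun[where m = "chain e us" and \<sigma> = "\<lambda>t. t (length us)", rotated])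
      (rule polyfun.coord, rule vars_coord, simp)
qed (simp add: polyfun.const)

lemma chain_zero: "(\<And>u. u \<in> set us \<Longrightarrow> mnilpotent u) \<Longrightarrow> chain e us (\<lambda>_. 0) = e"
  by (induction us) (auto simp: nconj_0)

lemma chain_cong: "(\<And>i. i < length us \<Longrightarrow> t i = t' i) \<Longrightarrow> chain e us t = chain e us t'"
  by (induction us) auto

lemma chain_extend: "chain e (u # us) (t(length us := s)) = nconj u s (chain e us t)"
  using chain_cong[of us "t(length us := s)" t e] by simp

lemma chain_conjs: "\<exists>ps. fst ` set ps = set us \<and> chain e us t = conjs ps e"
proof (induction us)
  case (Cons u us)
  then obtain ps where "fst ` set ps = set us" "chain e us t = conjs ps e" by blast
  then show ?case by (intro exI[of _ "(u, t (length us)) # ps"]) auto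
qed simp

primrec strict_chain :: "complex^'n^'n \<Rightarrow> (complex^'n^'n) set \<Rightarrow> (complex^'n^'n) list \<Rightarrow> bool" where
  "strict_chain e U [] \<longleftrightarrow> True"
| "strict_chain e U (u # us) \<longleftrightarrow> u \<in> U \<and> strict_chain e U us \<and> \<not> range (chain e (u # us)) \<subseteq> zclosure (range (chain e us))"

lemma strict_chain_set: "strict_chain e U us \<Longrightarrow> set us \<subseteq> U"
  by (induction us) auto

lemma zclosure_mono: "S \<subseteq> T \<Longrightarrow> zclosure S \<subseteq> zclosure T"
  by (auto simp: zclosure_def vanishing_ideal_def)

text \<open>The image of an affine space is irreducible. Its closure may leave the orbit and is cut
  with it, since the dimension is that of the orbit.\<close>

lemma chain_irreducible_closedin:
  assumes "range (chain e us) \<subseteq> \<O>"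
  shows "irreducible_closedin (subtopology mat_zariski \<O>) (zclosure (range (chain e us)) \<inter> \<O>)"
  unfolding irreducible_closedin_def
proof (intro conjI allI impI)
  let ?R = "range (chain e us)"
  show "closedin (subtopology mat_zariski \<O>) (zclosure ?R \<inter> \<O>)"
    unfolding closedin_subtopology by (rule exI[of _ "zclosure ?R"]) (simp add: closedin_zclosure)
  have RZ: "?R \<subseteq> zclosure ?R \<inter> \<O>" using assms zclosure_subset[of ?R] by simp
  then show "zclosure ?R \<inter> \<O> \<noteq> {}" by blast
  fix A B assume AB: "closedin (subtopology mat_zariski \<O>) A \<and> closedin (subtopology mat_zariski \<O>) B \<and> zclosure ?R \<inter> \<O> \<subseteq> A \<union> B"
  then obtain A' B' where A': "closedin mat_zariski A'" "A = A' \<inter> \<O>" and B': "closedin mat_zariski B'" "B = B' \<inter> \<O>"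
    unfolding closedin_subtopology by blast
  have "?R \<subseteq> A' \<or> ?R \<subseteq> B'"
  proof (rule ccontr)
    assume "\<not> ?thesis"
    then obtain s t where st: "chain e us s \<notin> A'" "chain e us t \<notin> B'" by auto
    obtain f where f: "f \<in> polyfun mat_coords" "f (chain e us s) \<noteq> 0" "\<And>y. y \<in> A' \<Longrightarrow> f y = 0"
      using A'(1) st(1) unfolding closedin_zariski_iff by blast
    obtain g where g: "g \<in> polyfun mat_coords" "g (chain e us t) \<noteq> 0" "\<And>y. y \<in> B' \<Longrightarrow> g y = 0"
      using B'(1) st(2) unfolding closedin_zariski_iff by blast
    have "(\<forall>x\<in>UNIV. f (chain e us x) = 0) \<or> (\<forall>x\<in>UNIV. g (chain e us x) = 0)"
    proof (rule irreducible_onD[OF irreducible_on_vars])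
      show "(\<lambda>x. f (chain e us x)) \<in> polyfun (vars {..<length us})" "(\<lambda>x. g (chain e us x)) \<in> polyfun (vars {..<length us})"
        by (rule polyfun_mat_compose[OF f(1) chain_polyfun], rule polyfun_mat_compose[OF g(1) chain_polyfun])
      fix x
      have "chain e us x \<in> A' \<union> B'" using AB RZ A'(2) B'(2) by blast
      then show "f (chain e us x) * g (chain e us x) = 0" using f(3) g(3) by auto
    qed
    then show False using f(2) g(2) by auto
  qed
  then show "zclosure ?R \<inter> \<O> \<subseteq> A \<or> zclosure ?R \<inter> \<O> \<subseteq> B"
    using zclosure_minimal A' B' by blast
qed

text \<open>The closures of the successive images, cut with the orbit, form a strictly increasing
  chain of irreducible closed sets, whose length the Krull dimension bounds.\<close>

lemma strict_chain_length:
  assumes U: "\<And>u. u \<in> U \<Longrightarrow> mnilpotent u" "U \<subseteq> lie_algebra G" and G: "algebraic_group G" and us: "strict_chain e U us"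
  shows "enat (length us) \<le> zdim (adjoint_orbit G e)"
proof -
  let ?O = "adjoint_orbit G e"
  let ?T = "subtopology mat_zariski ?O"
  have orb: "chain e us t \<in> ?O" if "set us \<subseteq> U" for us t
    using that
  proof (induction us)
    case Nil
    show ?case using adjoint_orbit_refl[OF G] by simp
  next
    case (Cons u us)
    then show ?case using U by (auto intro!: adjoint_orbit_nconj[OF G])
  qed
  have "\<exists>Z. (\<forall>i\<le>length us. irreducible_closedin ?T (Z i)) \<and> (\<forall>i<length us. Z i \<subset> Z (Suc i)) \<and>
      Z (length us) = zclosure (range (chain e us)) \<inter> ?O"
    using us
  proof (induction us)
    case Nil
    show ?case by (rule exI[of _ "\<lambda>_. zclosure (range (chain e [])) \<inter> ?O"])
      (use chain_irreducible_closedin[of e "[]" ?O] adjoint_orbit_refl[OF G] in auto)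
  next
    case (Cons u us)
    then obtain Z where Z: "\<forall>i\<le>length us. irreducible_closedin ?T (Z i)" "\<forall>i<length us. Z i \<subset> Z (Suc i)"
      "Z (length us) = zclosure (range (chain e us)) \<inter> ?O" by auto
    let ?Z = "zclosure (range (chain e (u # us))) \<inter> ?O"
    have sub: "set (u # us) \<subseteq> U" using strict_chain_set[OF Cons.prems] .
    then have r: "range (chain e (u # us)) \<subseteq> ?O" using orb by blast
    have "range (chain e us) \<subseteq> range (chain e (u # us))"
    proof
      fix y assume "y \<in> range (chain e us)"
      then obtain t where "y = chain e us t" by auto
      then have "y = chain e (u # us) (t(length us := 0))" using sub U(1) by (simp only: chain_extend) (simp add: nconj_0)
      then show "y \<in> range (chain e (u # us))" by blast
    qed
    then have "zclosure (range (chain e us)) \<inter> ?O \<subseteq> ?Z" using zclosure_mono by blast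
    moreover have "range (chain e (u # us)) \<subseteq> ?Z" using r zclosure_subset[of "range (chain e (u # us))"] by simp
    then have "?Z \<noteq> zclosure (range (chain e us)) \<inter> ?O" using Cons.prems by auto
    ultimately have "Z (length us) \<subset> ?Z" using Z(3) by blast
    moreover have "irreducible_closedin ?T ?Z" by (rule chain_irreducible_closedin[OF r])
    ultimately show ?case using Z
      by (intro exI[of _ "Z(Suc (length us) := ?Z)"]) (auto simp: le_Suc_eq less_Suc_eq)
  qed
  then show ?thesis unfolding zdim_def krull_dim_def by (intro Sup_upper) blast
qed

section \<open>Vector fields spanning the tangent spaces\<close>

lemma entries_of_entries [simp]: "entries (of_entries z) = z"
  by (simp add: entries_def)

lemma pd_outside: "f \<in> polyfun (vars I) \<Longrightarrow> i \<notin> I \<Longrightarrow> pd i f z = 0"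
proof (rule pd_eqI)
  assume f: "f \<in> polyfun (vars I)" and i: "i \<notin> I"
  have "f (z(i := t)) = f z" for t by (rule polyfun_vars_cong[OF f]) (use i in auto)
  then show "((\<lambda>t. f (z(i := t))) has_field_derivative 0) (at (z i))" by simp
qed

lemma dd_entries: "dd (\<lambda>X. Q (entries X)) y w = (\<Sum>p\<in>UNIV. w $ fst p $ snd p * pd p Q (entries y))"
  by (simp add: dd_def)

lemma polyfun_entries:
  assumes "Q \<in> polyfun (vars J)" "\<And>i j. (\<lambda>x. m x $ i $ j) \<in> polyfun C"
  shows "(\<lambda>x. Q (entries (m x))) \<in> polyfun C"
  by (rule polyfun_compose[OF assms(1)]) (auto simp: vars_def entries_def assms(2))

text \<open>\<open>Q j\<close> is a relation between the coordinate \<open>j\<close> and the coordinates in the transcendence basis \<open>S\<close>;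
  a tangent vector is determined by its coordinates in \<open>S\<close>, rationally in the base point. The common
  denominator is cleared.\<close>

definition frame_denominator ::
    "('n \<times> 'n) set \<Rightarrow> ('n \<times> 'n \<Rightarrow> ('n \<times> 'n \<Rightarrow> complex) \<Rightarrow> complex) \<Rightarrow> complex^'n^'n \<Rightarrow> complex" where
  "frame_denominator S Q y = (\<Prod>j\<in>-S. pd j (Q j) (entries y))"

definition frame ::
    "('n \<times> 'n) set \<Rightarrow> ('n \<times> 'n \<Rightarrow> ('n \<times> 'n \<Rightarrow> complex) \<Rightarrow> complex) \<Rightarrow> complex^'n^'n \<Rightarrow> ('n \<times> 'n \<Rightarrow> complex) \<Rightarrow> complex^'n^'n" where
  "frame S Q y c = of_entries (\<lambda>l. if l \<in> S then frame_denominator S Q y * c l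
     else - ((\<Sum>i\<in>S. c i * pd i (Q l) (entries y)) * (\<Prod>j\<in>-S - {l}. pd j (Q j) (entries y))))"

lemma frame_denominator_polyfun:
  assumes "\<And>j. j \<in> -S \<Longrightarrow> Q j \<in> polyfun (vars (insert j S))"
  shows "frame_denominator S Q \<in> polyfun mat_coords"
  unfolding frame_denominator_def[abs_def]
  by (rule polyfun_prod, rule polyfun_entries[OF pd_polyfun[OF assms] entry_polyfun])

lemma frame_polyfun:
  assumes Q: "\<And>j. j \<in> -S \<Longrightarrow> Q j \<in> polyfun (vars (insert j S))"
    and m: "\<And>i j. (\<lambda>x. m x $ i $ j) \<in> polyfun C" and c: "\<And>i. i \<in> S \<Longrightarrow> (\<lambda>x. c x i) \<in> polyfun C"
  shows "(\<lambda>x. frame S Q (m x) (c x) $ a $ b) \<in> polyfun C"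
proof -
  have pdC: "(\<lambda>x. pd i (Q j) (entries (m x))) \<in> polyfun C" if "j \<in> -S" for i j
    by (rule polyfun_entries[OF pd_polyfun[OF Q[OF that]] m])
  show ?thesis
  proof (cases "(a, b) \<in> S")
    case True
    have "(\<lambda>x. frame_denominator S Q (m x) * c x (a, b)) \<in> polyfun C"
      by (rule polyfun.mult[OF polyfun_mat_compose[OF frame_denominator_polyfun[OF Q] m] c[OF True]])
    then show ?thesis using True by (simp add: frame_def)
  next
    case False
    have "(\<lambda>x. - ((\<Sum>i\<in>S. c x i * pd i (Q (a, b)) (entries (m x))) * (\<Prod>j\<in>-S - {(a, b)}. pd j (Q j) (entries (m x))))) \<in> polyfun C"
      using False by (intro polyfun_uminus polyfun.mult polyfun_sum polyfun_prod pdC c) auto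
    then show ?thesis using False by (simp add: frame_def)
  qed
qed

text \<open>Differentiating the relation \<open>Q l\<close> along a tangent vector expresses the
  coordinate \<open>l\<close> through those in \<open>S\<close>. Dividing the coefficients by the
  common denominator makes the frame reproduce \<open>w\<close>.\<close>

lemma frame_tangent:
  assumes Q: "\<And>j. j \<in> -S \<Longrightarrow> Q j \<in> polyfun (vars (insert j S))"
    and QY: "\<And>j y. j \<in> -S \<Longrightarrow> y \<in> Y \<Longrightarrow> Q j (entries y) = 0"
    and w: "w \<in> tangent Y y" and nz: "frame_denominator S Q y \<noteq> 0"
  shows "frame S Q y (\<lambda>l. entries w l / frame_denominator S Q y) = w"
proof (rule matrix_eqI)
  fix a b
  let ?P = "frame_denominator S Q y"
  show "frame S Q y (\<lambda>l. entries w l / ?P) $ a $ b = w $ a $ b"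
  proof (cases "(a, b) \<in> S")
    case True
    then show ?thesis using nz by (simp add: frame_def entries_def)
  next
    case False
    let ?l = "(a, b)"
    define d where "d i = pd i (Q ?l) (entries y)" for i
    define r where "r = (\<Prod>j\<in>-S - {?l}. pd j (Q j) (entries y))"
    have P: "?P = d ?l * r"
      unfolding frame_denominator_def d_def r_def using False by (subst prod.remove[of _ ?l]) auto
    have "(\<lambda>X. Q ?l (entries X)) \<in> vanishing_ideal mat_coords Y"
      using polyfun_entries[OF Q entry_polyfun, of ?l] QY False by (auto simp: vanishing_ideal_def)
    then have "0 = dd (\<lambda>X. Q ?l (entries X)) y w" using w by (simp add: tangent_def)
    also have "\<dots> = (\<Sum>i\<in>UNIV. entries w i * d i)" unfolding dd_entries[of "Q ?l"] d_def by (simp add: entries_def)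
    also have "\<dots> = (\<Sum>i\<in>insert ?l S. entries w i * d i)"
      by (rule sum.mono_neutral_right) (use pd_outside[OF Q, of ?l] False in \<open>auto simp: d_def\<close>)
    also have "\<dots> = entries w ?l * d ?l + (\<Sum>i\<in>S. entries w i * d i)" using False by simp
    finally have rel: "(\<Sum>i\<in>S. entries w i * d i) = - (entries w ?l * d ?l)" by (simp add: eq_neg_iff_add_eq_0 add.commute)
    have "frame S Q y (\<lambda>l. entries w l / ?P) $ a $ b = - ((\<Sum>i\<in>S. entries w i / ?P * d i) * r)"
      using False by (simp add: frame_def d_def r_def)
    also have "(\<Sum>i\<in>S. entries w i / ?P * d i) = (\<Sum>i\<in>S. entries w i * d i) / ?P"
      by (simp add: sum_divide_distrib)
    also have "- ((\<Sum>i\<in>S. entries w i * d i) / ?P * r) = entries w ?l * (d ?l * r) / ?P" by (simp add: rel)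
    also have "\<dots> = entries w ?l" using nz by (simp add: P)
    finally show ?thesis by (simp add: entries_def)
  qed
qed

lemma pair_polyfun_compose:
  assumes "f \<in> polyfun pair_coords" "\<And>i j. (\<lambda>x. m x $ i $ j) \<in> polyfun C" "\<And>i j. (\<lambda>x. k x $ i $ j) \<in> polyfun C"
  shows "(\<lambda>x. f (m x, k x)) \<in> polyfun C"
  by (rule polyfun_compose[OF assms(1), where m = "\<lambda>x. (m x, k x)"])
    (auto simp: pair_coords_def mat_coords_def assms(2,3))

text \<open>Where the denominator is nonzero, \<open>w\<close> is a frame vector with certain
  coefficients \<open>c\<close>. For this fixed \<open>c\<close> the equation holds on
  \<open>Y\<close>, hence on the closure. The factor makes the statement polynomial and true at all
  points.\<close>

lemma frame_exhausts_tangent: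
  assumes Q: "\<And>j. j \<in> -S \<Longrightarrow> Q j \<in> polyfun (vars (insert j S))"
    and QY: "\<And>j y. j \<in> -S \<Longrightarrow> y \<in> Y \<Longrightarrow> Q j (entries y) = 0"
    and f: "f \<in> polyfun pair_coords" "\<And>y c. y \<in> Y \<Longrightarrow> f (y, frame S Q y c) = 0"
    and y: "y \<in> zclosure Y" and w: "w \<in> tangent Y y"
  shows "f (y, w) * frame_denominator S Q y = 0"
proof (cases "frame_denominator S Q y = 0")
  case False
  define c where "c = (\<lambda>l. entries w l / frame_denominator S Q y)"
  have "(\<lambda>y. f (y, frame S Q y c)) \<in> polyfun mat_coords"
    by (rule pair_polyfun_compose[OF f(1), where m = "\<lambda>y. y" and k = "\<lambda>y. frame S Q y c", OF entry_polyfun])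
      (rule frame_polyfun[where c = "\<lambda>_. c" and m = "\<lambda>y. y", OF Q entry_polyfun polyfun.const], simp)
  then have "(\<lambda>y. f (y, frame S Q y c)) \<in> vanishing_ideal mat_coords Y" using f(2) by (simp add: vanishing_ideal_def)
  then have "f (y, frame S Q y c) = 0" using y by (auto simp: zclosure_def)
  moreover have "frame S Q y c = w" unfolding c_def using frame_tangent[of S Q, OF Q QY w False] by simp
  ultimately show ?thesis by simp
qed simp

section \<open>Jets over the orbit\<close>

context regular_simple
begin

text \<open>The elements whose vector field is tangent to \<open>Y\<close> form a Lie algebra
  containing \<open>U\<close>, hence \<gg>; from there \<open>ad_stable_imp_group_stable\<close>
  reaches the group.\<close>

lemma group_stable:
  assumes A: "algebraic_group A" "irreducible_on mat_coords A" "lie_simple (lie_algebra A)" "lie_algebra A \<subseteq> \<gg>"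
    and stable: "\<And>u. u \<in> U \<Longrightarrow> ad_stable Y u"
    and f: "f \<in> vanishing_ideal mat_coords Y" and g: "g \<in> A" and p: "p \<in> Y"
  shows "f (g ** p ** matrix_inv g) = 0"
proof (rule ad_stable_imp_group_stable[OF A(1,2) lie_simple_perfect[OF A(3)] _ f g p])
  fix u assume "u \<in> lie_algebra A"
  moreover have "\<gg> \<subseteq> {u. ad_stable Y u}"
    by (rule generated_by_U[OF subspace_ad_stable]) (use ad_stable_bracket stable in auto)
  ultimately show "ad_stable Y u" using A(4) by auto
qed

text \<open>At the end of a longest strict chain no further exponential enlarges the closure of the
  image, which is therefore stable under all of them.\<close>

lemma maximal_chain:
  assumes G: "algebraic_group G" "\<gg> = lie_algebra G" and dim: "2 * zdim (adjoint_orbit G e) < enat D"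
  obtains us where "set us \<subseteq> U" "2 * length us < D"
    "\<And>u s y. u \<in> U \<Longrightarrow> y \<in> range (chain e us) \<Longrightarrow> nconj u s y \<in> zclosure (range (chain e us))"
proof -
  have UG: "U \<subseteq> lie_algebra G" unfolding G(2)[symmetric] by (auto simp: U_def)
  obtain d where d: "zdim (adjoint_orbit G e) = enat d"
    using dim by (cases "zdim (adjoint_orbit G e)") (auto simp: numeral_eq_enat)
  then have "2 * d < D" using dim by (simp add: numeral_eq_enat)
  define P where "P n \<longleftrightarrow> (\<exists>us. strict_chain e U us \<and> length us = n)" for n
  have bound: "n \<le> d" if "P n" for n
    using that strict_chain_length[OF U_mnilpotent UG G(1), of e] d by (auto simp: P_def)
  have "P 0" unfolding P_def by (rule exI[of _ "[]"]) simp
  then have "P (Greatest P)" and max: "\<And>n. P n \<Longrightarrow> n \<le> Greatest P"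
    using bound GreatestI_nat[of P 0 d] Greatest_le_nat[of P _ d] by auto
  then obtain us where us: "strict_chain e U us" "length us = Greatest P" unfolding P_def by blast
  have "2 * length us < D" using bound[OF \<open>P (Greatest P)\<close>] us(2) \<open>2 * d < D\<close> by simp
  moreover have "nconj u s y \<in> zclosure (range (chain e us))" if u: "u \<in> U" and y: "y \<in> range (chain e us)" for u s y
  proof -
    have "\<not> strict_chain e U (u # us)"
    proof
      assume "strict_chain e U (u # us)"
      then have "P (Suc (length us))" unfolding P_def by (intro exI[of _ "u # us"]) simp
      then show False using max us(2) by fastforce
    qed
    then have sub: "range (chain e (u # us)) \<subseteq> zclosure (range (chain e us))" using u us(1) by auto
    obtain t where "y = chain e us t" using y by auto
    then have "nconj u s y = chain e (u # us) (t(length us := s))" by (simp only: chain_extend)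
    then show ?thesis using sub by blast
  qed
  ultimately show thesis using that strict_chain_set[OF us(1)] by blast
qed

text \<open>The frame controls only points with nonzero denominator, and a point over the orbit of
  \<open>A\<close> may be a bad one. Exponentials move it to a good one: otherwise the denominator
  vanishes on its whole orbit under them. The closure of that orbit contains \<open>e\<close>, so
  the denominator would vanish at every image of \<open>e\<close>, in particular at the good point
  of the chain.\<close>

lemma jets_over_orbit:
  assumes A: "algebraic_group A" "irreducible_on mat_coords A" "lie_simple (lie_algebra A)" "lie_algebra A \<subseteq> \<gg>"
    and us: "set us \<subseteq> U"
      "\<And>u s y. u \<in> U \<Longrightarrow> y \<in> range (chain e us) \<Longrightarrow> nconj u s y \<in> zclosure (range (chain e us))"
    and Q: "\<And>j. j \<in> -S \<Longrightarrow> Q j \<in> polyfun (vars (insert j S))"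
      "\<And>j t. j \<in> -S \<Longrightarrow> Q j (entries (chain e us t)) = 0"
      "frame_denominator S Q (chain e us t0) \<noteq> 0"
    and f: "f \<in> polyfun pair_coords" "\<And>t c. f (chain e us t, frame S Q (chain e us t) c) = 0"
    and y0: "y0 \<in> adjoint_orbit A e" and w0: "w0 \<in> tangent (adjoint_orbit A e) y0" and ps: "fst ` set ps \<subseteq> U"
  shows "f (conjs ps y0, conjs ps w0) = 0"
proof -
  define Y where "Y = range (chain e us)"
  let ?p = "frame_denominator S Q"
  have pp: "?p \<in> polyfun mat_coords" by (rule frame_denominator_polyfun[OF Q(1)])
  have e0: "chain e us (\<lambda>_. 0) = e" by (rule chain_zero) (use us(1) U_mnilpotent in auto)
  have eY: "e \<in> Y" unfolding Y_def using e0 by (metis rangeI)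
  have stepY: "nconj u s y \<in> zclosure Y" if "u \<in> U" "y \<in> zclosure Y" for u s y
    using zclosure_nconj[of Y u s y] us(2)[OF that(1)] that(2) by (simp add: Y_def)
  have conjsY: "conjs qs y \<in> zclosure Y" if "fst ` set qs \<subseteq> U" "y \<in> zclosure Y" for qs y
    using that(1) by (induction qs) (auto intro: stepY that(2))
  have stableY: "ad_stable Y u" if u: "u \<in> U" for u
  proof (rule nconj_stable_imp_ad_stable[OF U_mnilpotent[OF u]])
    fix f y s assume "f \<in> vanishing_ideal mat_coords Y" "y \<in> Y"
    then show "f (nconj u s y) = 0" using stepY[OF u, of y s] zclosure_subset[of Y] by (auto simp: zclosure_def)
  qed
  have AeY: "adjoint_orbit A e \<subseteq> zclosure Y"
    unfolding zclosure_def adjoint_orbit_def using group_stable[OF A stableY _ _ eY] by auto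
  have "vanishing_ideal mat_coords Y \<subseteq> vanishing_ideal mat_coords (adjoint_orbit A e)"
    using AeY by (auto simp: vanishing_ideal_def zclosure_def)
  then have w0Y: "w0 \<in> tangent Y y0" using w0 by (auto simp: tangent_def)
  have y0Y: "y0 \<in> zclosure Y" using y0 AeY by auto
  define y w where "y = conjs ps y0" and "w = conjs ps w0"
  have tan: "conjs qs v \<in> tangent Y (conjs qs z)" if "fst ` set qs \<subseteq> U" "v \<in> tangent Y z" for qs v z
    by (rule tangent_conjs[OF _ that(2)]) (use conjsY[OF that(1)] zclosure_subset[of Y] in auto)
  have yY: "y \<in> zclosure Y" and wY: "w \<in> tangent Y y" using conjsY[OF ps y0Y] tan[OF ps w0Y] by (simp_all add: y_def w_def)
  have "\<exists>qs. fst ` set qs \<subseteq> U \<and> ?p (conjs qs y) \<noteq> 0"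
  proof (rule ccontr)
    assume neg: "\<not> ?thesis"
    have pz: "?p z = 0" if "z \<in> conj_orbit U y" for z using neg that by (auto simp: conj_orbit_def)
    have Ost: "ad_stable (conj_orbit U y) u" if "u \<in> U" for u
      by (rule conj_orbit_ad_stable[OF U_mnilpotent[OF that] that])
    have y0O: "y0 \<in> conj_orbit U y" unfolding y_def by (rule conj_orbit_sym[OF U_mnilpotent ps])
    obtain a where a: "a \<in> A" "y0 = a ** e ** matrix_inv a" using y0 by (auto simp: adjoint_orbit_def)
    define b where "b = matrix_inv a"
    have ab: "a ** b = mat 1" "b ** a = mat 1" using matrix_inv_works[OF algebraic_groupD(4)[OF A(1) a(1)]] by (auto simp: b_def)
    have ib: "matrix_inv b = a" by (rule matrix_inv_unique[OF ab(2,1)])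
    have bA: "b \<in> A" using algebraic_groupD(3)[OF A(1) a(1)] by (simp add: b_def)
    have "b ** y0 ** matrix_inv b = (b ** a) ** e ** (b ** a)" by (simp add: ib a(2) b_def[symmetric] matrix_mul_assoc)
    then have be: "b ** y0 ** matrix_inv b = e" by (simp add: ab)
    have eO: "f e = 0" if "f \<in> vanishing_ideal mat_coords (conj_orbit U y)" for f
      using group_stable[OF A Ost that bA y0O] by (simp add: be)
    obtain qs where qs: "fst ` set qs = set us" "chain e us t0 = conjs qs e" using chain_conjs by blast
    have "(\<lambda>z. ?p (conjs qs z)) \<in> polyfun mat_coords"
      by (rule polyfun_mat_compose[where m = "conjs qs", OF pp])
        (rule conjs_polyfun[where m = "\<lambda>y. y", OF entry_polyfun])
    moreover have "?p (conjs qs z) = 0" if "z \<in> conj_orbit U y" for z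
      using pz conj_orbit_conjs[OF _ that, of qs] qs(1) us(1) by simp
    ultimately have "(\<lambda>z. ?p (conjs qs z)) \<in> vanishing_ideal mat_coords (conj_orbit U y)" by (simp add: vanishing_ideal_def)
    from eO[OF this] show False using Q(3) qs(2) by simp
  qed
  then obtain qs where qs: "fst ` set qs \<subseteq> U" "?p (conjs qs y) \<noteq> 0" by blast
  \<comment> \<open>A polynomial path from the given point at \<tau> = 0 to a good one at \<tau> =
    1. Along it the product of \<open>f\<close> and the denominator is the zero polynomial and the
    second factor is not, so \<open>f\<close> vanishes at the start.\<close>
  define \<sigma> where "\<sigma> \<tau> = map (\<lambda>p. (fst p, \<tau> * snd p)) qs" for \<tau>
  have \<sigma>U: "fst ` set (\<sigma> \<tau>) \<subseteq> U" for \<tau> using qs(1) by (auto simp: \<sigma>_def)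
  have \<sigma>p: "(\<lambda>\<tau>. conjs (\<sigma> \<tau>) z $ i $ j) \<in> polyfun {\<lambda>s. s}" for z i j unfolding \<sigma>_def by (rule conjs_scaled_polyfun)
  have prod0: "f (conjs (\<sigma> \<tau>) y, conjs (\<sigma> \<tau>) w) * ?p (conjs (\<sigma> \<tau>) y) = 0" for \<tau>
    by (rule frame_exhausts_tangent[of S Q Y f, OF Q(1) _ f(1) _ conjsY[OF \<sigma>U yY] tan[OF \<sigma>U wY]])
      (use Q(2) f(2) in \<open>auto simp: Y_def\<close>)
  obtain r where r: "\<And>\<tau>. f (conjs (\<sigma> \<tau>) y, conjs (\<sigma> \<tau>) w) = poly r \<tau>"
    using polyfun_identity[OF pair_polyfun_compose[OF f(1) \<sigma>p \<sigma>p]] by blast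
  obtain q where q: "\<And>\<tau>. ?p (conjs (\<sigma> \<tau>) y) = poly q \<tau>"
    using curve_polynomial[OF pp \<sigma>p] by blast
  have "poly (r * q) \<tau> = 0" for \<tau> using prod0[of \<tau>] by (simp add: r q)
  then have "r * q = 0" using poly_all_0_iff_0 by blast
  moreover have "q \<noteq> 0" using q[of 1] qs(2) by (auto simp: \<sigma>_def)
  ultimately have "r = 0" by simp
  moreover have "conjs (\<sigma> 0) z = z" for z
    unfolding \<sigma>_def by (rule conjs_scaled_0) (use qs(1) U_mnilpotent in auto)
  ultimately show ?thesis using r[of 0] by (simp add: y_def w_def)
qed

text \<open>The vectors [u,x] + a are the tangent directions of E.\<aa> at \<open>x\<close>. Since
  \<open>x\<close> acts on \<open>U\<close> by nonzero scalars they span U + \<aa>, which one more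
  vector completes to \<gg>; so there are \<open>m\<close> independent ones, and \<open>q\<close> is
  a dual family.\<close>

lemma test_vectors:
  assumes cod: "\<And>y. y \<in> \<gg> \<Longrightarrow> \<exists>r\<in>cmat.span U. \<exists>v\<in>\<aa>. \<exists>c. y = r + v + cscale c z"
    and sub: "cmat.subspace \<aa>" and m: "m < cmat.dim \<gg>"
  obtains u a q where "\<And>j. j < m \<Longrightarrow> u j \<in> insert 0 U" "\<And>j. j < m \<Longrightarrow> a j \<in> \<aa>"
    "\<And>i v w. i < m \<Longrightarrow> q i (v + w) = q i v + q i w" "\<And>i c v. i < m \<Longrightarrow> q i (cscale c v) = c * q i v"
    "\<And>i j. i < m \<Longrightarrow> j < m \<Longrightarrow> q i (lie_bracket (u j) x + a j) = (if i = j then 1 else 0 :: complex)"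
proof -
  obtain B where B: "B \<subseteq> U \<union> \<aa>" "cmat.independent B" "U \<union> \<aa> \<subseteq> cmat.span B"
    using cmat.maximal_independent_subset[of "U \<union> \<aa>"] by blast
  have finB: "finite B" using B(2) cmatf.finiteI_independent by blast
  have "\<gg> \<subseteq> cmat.span (insert z B)"
  proof
    fix y assume "y \<in> \<gg>"
    then obtain r v c where y: "r \<in> cmat.span U" "v \<in> \<aa>" "y = r + v + cscale c z" using cod by blast
    have mono: "cmat.span B \<subseteq> cmat.span (insert z B)" by (rule cmat.span_mono) auto
    have "cmat.span U \<subseteq> cmat.span B" using B(3) by (intro cmat.span_minimal) auto
    then have "r \<in> cmat.span (insert z B)" "v \<in> cmat.span (insert z B)" using y(1,2) B(3) mono by auto
    moreover have "z \<in> cmat.span (insert z B)" by (rule cmat.span_base) simp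
    ultimately show "y \<in> cmat.span (insert z B)" unfolding y(3) by (intro cmat.span_add cmat.span_scale)
  qed
  then have "cmat.dim \<gg> \<le> card (insert z B)" using finB by (intro cmat.dim_le_card) auto
  also have "\<dots> \<le> Suc (card B)" by (rule card_insert_le_m1[of "Suc (card B)", simplified]) simp
  finally have "m \<le> card B" using m by simp
  then obtain B' where B': "B' \<subseteq> B" "card B' = m" by (meson obtain_subset_with_card_n)
  have indB': "cmat.independent B'" using cmat.independent_mono[OF B(2) B'(1)] .
  have "finite B'" using finB B'(1) finite_subset by blast
  then obtain b where b: "bij_betw b {..<m} B'" using ex_bij_betw_nat_finite[of B'] B'(2) by (auto simp: atLeast0LessThan)
  have bB': "b j \<in> B'" if "j < m" for j using b that by (auto simp: bij_betw_def)
  have "\<exists>u a. u \<in> insert 0 U \<and> a \<in> \<aa> \<and> lie_bracket u x + a = b j" if "j < m" for j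
  proof (cases "b j \<in> U")
    case True
    then obtain c where c: "b j \<in> \<gg>" "c \<noteq> 0" "lie_bracket x (b j) = cscale c (b j)" by (auto simp: U_def)
    \<comment> \<open>The scalar compensates the weight \<open>c\<close>, the sign the position of
      \<open>x\<close> on the right of the bracket.\<close>
    let ?u = "cscale (- inverse c) (b j)"
    have "lie_bracket x ?u = cscale c ?u" by (simp only: lie_bilinear c(3) cmat.scale_scale mult.commute)
    then have "?u \<in> U" using c(2) cmat.subspace_scale[OF sub\<gg> c(1)] unfolding U_def by blast
    moreover have "lie_bracket ?u x = b j"
    proof -
      have "lie_bracket ?u x = cscale (- inverse c) (- lie_bracket x (b j))"
        by (simp only: lie_bilinear lie_bracket_anti[of "b j" x])
      also have "\<dots> = cscale (inverse c * c) (b j)" by (simp add: c(3))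
      finally show ?thesis using c(2) by simp
    qed
    ultimately show ?thesis using cmat.subspace_0[OF sub] by (intro exI[of _ ?u] exI[of _ 0]) simp
  next
    case False
    then have "b j \<in> \<aa>" using B(1) B'(1) bB'[OF that] by auto
    then show ?thesis by (intro exI[of _ 0] exI[of _ "b j"]) (simp add: lie_bracket_0)
  qed
  then have "\<forall>j. \<exists>u a. j < m \<longrightarrow> u \<in> insert 0 U \<and> a \<in> \<aa> \<and> lie_bracket u x + a = b j" by blast
  then obtain u a where ua: "\<And>j. j < m \<Longrightarrow> u j \<in> insert 0 U \<and> a j \<in> \<aa> \<and> lie_bracket (u j) x + a j = b j" by metis
  have "\<exists>l. (\<forall>v w. l (v + w) = l v + l w) \<and> (\<forall>c v. l (cscale c v) = c * l v) \<and>
      (\<forall>b'\<in>B'. l b' = (if b' = b i then 1 else 0 :: complex))" if i: "i < m" for i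
  proof -
    obtain l :: "complex^'n^'n \<Rightarrow> complex" where "\<And>u v. l (u + v) = l u + l v" "\<And>c u. l (cscale c u) = c * l u"
      "\<And>b'. b' \<in> B' \<Longrightarrow> l b' = (if b' = b i then 1 else 0)"
      by (rule coordinate_functional[OF indB' bB'[OF i]], rule that)
    then show ?thesis by (intro exI[of _ l]) simp
  qed
  then have "\<forall>i. \<exists>l. i < m \<longrightarrow> (\<forall>v w. l (v + w) = l v + l w) \<and> (\<forall>c v. l (cscale c v) = c * l v) \<and>
      (\<forall>b'\<in>B'. l b' = (if b' = b i then 1 else 0 :: complex))" by blast
  then obtain q where q: "\<And>i. i < m \<Longrightarrow> (\<forall>v w. q i (v + w) = q i v + q i w) \<and> (\<forall>c v. q i (cscale c v) = c * q i v) \<and>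
      (\<forall>b'\<in>B'. q i b' = (if b' = b i then 1 else 0 :: complex))" by metis
  show thesis
  proof (rule that[of u a q])
    fix i j assume ij: "i < m" "j < m"
    have "b j = b i \<longleftrightarrow> i = j" using b ij by (auto simp: bij_betw_def inj_on_def)
    then show "q i (lie_bracket (u j) x + a j) = (if i = j then 1 else 0)" using ua[OF ij(2)] q[OF ij(1)] bB'[OF ij(2)] by simp
  qed (use ua q in auto)
qed

end

section \<open>A family of conjugates with independent differential\<close>

text \<open>Meant for a family in E.\<aa> through \<open>x\<close> with one parameter per test
  vector: \<open>s l\<close> moves the base point \<open>v s\<close> inside \<aa> and is at the same
  time the parameter of the exponential of \<open>u l\<close>.\<close>

primrec sweep :: "(nat \<Rightarrow> complex^'n^'n) \<Rightarrow> ((nat \<Rightarrow> complex) \<Rightarrow> complex^'n^'n) \<Rightarrow> nat \<Rightarrow> (nat \<Rightarrow> complex) \<Rightarrow> complex^'n^'n" where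
  "sweep u v 0 s = v s"
| "sweep u v (Suc l) s = nconj (u l) (s l) (sweep u v l s)"

lemma sweep_polyfun:
  assumes "l \<le> m" "\<And>i j. (\<lambda>s. v s $ i $ j) \<in> polyfun (vars {..<m})"
  shows "(\<lambda>s. sweep u v l s $ i $ j) \<in> polyfun (vars {..<m})"
  using assms(1)
proof (induction l arbitrary: i j)
  case (Suc l)
  then have "(\<lambda>s. sweep u v l s $ i $ j) \<in> polyfun (vars {..<m})" for i j by simp
  then show ?case unfolding sweep.simps
    by (rule nconj_polyfun[where m = "sweep u v l" and \<sigma> = "\<lambda>s. s l", rotated])
      (rule polyfun.coord, rule vars_coord, use Suc.prems in simp)
qed (simp add: assms(2))

lemma sweep_conjs:
  assumes "\<And>j. j < l \<Longrightarrow> u j \<in> insert 0 U"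
  shows "\<exists>ps. fst ` set ps \<subseteq> U \<and> sweep u v l s = conjs ps (v s)"
  using assms
proof (induction l)
  case 0
  show ?case by (rule exI[of _ "[]"]) simp
next
  case (Suc l)
  then obtain ps where ps: "fst ` set ps \<subseteq> U" "sweep u v l s = conjs ps (v s)" by auto
  show ?case
  proof (cases "u l = 0")
    case True
    then show ?thesis using ps by (intro exI[of _ ps]) simp
  next
    case False
    then have "u l \<in> U" using Suc.prems[of l] by auto
    then show ?thesis using ps by (intro exI[of _ "(u l, s l) # ps"]) simp
  qed
qed

lemma sweep_axis:
  assumes "\<And>i. i < l \<Longrightarrow> mnilpotent (u i)"
  shows "sweep u v l ((\<lambda>_. 0)(j := t)) = (if j < l then nconj (u j) t (v ((\<lambda>_. 0)(j := t))) else v ((\<lambda>_. 0)(j := t)))"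
  using assms
proof (induction l)
  case (Suc l)
  then have IH: "sweep u v l ((\<lambda>_. 0)(j := t)) = (if j < l then nconj (u j) t (v ((\<lambda>_. 0)(j := t))) else v ((\<lambda>_. 0)(j := t)))"
    by (simp del: fun_upd_apply)
  have "mnilpotent (u l)" using Suc.prems by simp
  moreover have "((\<lambda>_. 0)(j := t)) l = (if j = l then t else 0)" by simp
  ultimately show ?case unfolding sweep.simps IH
    by (cases "j < l"; cases "j = l") (simp_all add: nconj_0 less_Suc_eq del: fun_upd_apply)
qed simp

lemma linear_polyfun:
  fixes q :: "complex^'n^'n \<Rightarrow> complex"
  assumes "\<And>v w. q (v + w) = q v + q w" "\<And>c v. q (cscale c v) = c * q v"
  shows "q \<in> polyfun mat_coords"
proof -
  have q0: "q 0 = 0" using assms(2)[of 0 0] by simp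
  have qs: "q (\<Sum>p\<in>P. g p) = (\<Sum>p\<in>P. q (g p))" for P and g :: "'n \<times> 'n \<Rightarrow> complex^'n^'n"
    by (induction P rule: infinite_finite_induct) (simp_all add: q0 assms(1))
  have "q = (\<lambda>X. \<Sum>p\<in>UNIV. X $ fst p $ snd p * q (munit (fst p) (snd p)))"
    by (rule ext, subst munit_expansion) (simp only: qs assms(2))
  moreover have "(\<lambda>X. \<Sum>p\<in>UNIV. X $ fst p $ snd p * q (munit (fst p) (snd p))) \<in> polyfun mat_coords"
    by (intro polyfun_sum polyfun.mult entry_polyfun polyfun.const)
  ultimately show ?thesis by simp
qed

text \<open>On a coordinate axis all other exponentials are the identity, so the partial derivative
  is that of a single conjugated line.\<close>

lemma sweep_derivative:
  assumes u: "\<And>i. i < m \<Longrightarrow> mnilpotent (u i)" and j: "j < m"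
    and q: "\<And>v w. q (v + w) = q v + q w" "\<And>c v. q (cscale c v) = c * q v"
  shows "pd j (\<lambda>s. q (sweep u (\<lambda>s. x + (\<Sum>i<m. cscale (s i) (a i))) m s)) (\<lambda>_. 0) = q (lie_bracket (u j) x + a j)"
proof (rule pd_eqI)
  let ?v = "\<lambda>s. x + (\<Sum>i<m. cscale (s i) (a i))"
  have v: "?v ((\<lambda>_. 0)(j := t)) = x + cscale t (a j)" for t
  proof -
    have "(\<Sum>i<m. cscale (((\<lambda>_. 0)(j := t)) i) (a i)) = (\<Sum>i<m. if i = j then cscale t (a j) else 0)"
      by (rule sum.cong) auto
    then show ?thesis using j by simp
  qed
  have ddq: "dd q y w = q w" for y w
  proof (rule DERIV_unique[OF dd_line[OF linear_polyfun[OF q]]])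
    show "((\<lambda>t. q (y + cscale t w)) has_field_derivative q w) (at 0)"
      unfolding q by (auto intro!: derivative_eq_intros)
  qed
  have "((\<lambda>t. q (nconj (u j) t (x + cscale t (a j)))) has_field_derivative q (lie_bracket (u j) x + a j)) (at 0)"
    using dd_mderiv[OF linear_polyfun[OF q] nconj_mderiv[OF u[OF j]], of x "a j"] by (simp only: ddq)
  moreover have "sweep u ?v m ((\<lambda>_. 0)(j := t)) = nconj (u j) t (x + cscale t (a j))" for t
  proof -
    have "sweep u ?v m ((\<lambda>_. 0)(j := t)) =
        (if j < m then nconj (u j) t (?v ((\<lambda>_. 0)(j := t))) else ?v ((\<lambda>_. 0)(j := t)))"
      by (rule sweep_axis) (rule u)
    then show ?thesis by (simp only: v j if_True)
  qed
  ultimately show "((\<lambda>t. q (sweep u ?v m ((\<lambda>_. 0)(j := t)))) has_field_derivative q (lie_bracket (u j) x + a j)) (at 0)"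
    by (simp only:)
qed

text \<open>Splits off the part divisible by the variable \<open>i\<close> with control of the
  degree of the cofactor; the clause for \<open>n = 0\<close> covers the truncated
  subtraction.\<close>

lemma poly_deg_split_variable:
  assumes "R \<in> poly_deg (vars J) n" "i \<in> J"
  shows "\<exists>R'\<in>poly_deg (vars J) (n - 1). (\<forall>z. R z = R (z(i := 0)) + z i * R' z) \<and> (n = 0 \<longrightarrow> R' = (\<lambda>_. 0))"
proof -
  let ?P = "\<lambda>n R. \<exists>R'\<in>poly_deg (vars J) (n - 1). (\<forall>z. R z = R (z(i := 0)) + z i * R' z) \<and> (n = 0 \<longrightarrow> R' = (\<lambda>_. 0))"
  have sub: "fs.subspace {R. ?P n R}" for n
  proof (rule fs.subspaceI)
    show "0 \<in> {R. ?P n R}" unfolding mem_Collect_eq by (rule bexI[of _ "\<lambda>_. 0"]) (simp_all add: poly_deg_const)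
  next
    fix f g assume fg: "f \<in> {R. ?P n R}" "g \<in> {R. ?P n R}"
    obtain f' where f': "f' \<in> poly_deg (vars J) (n - 1)"
      "(\<forall>z. f z = f (z(i := 0)) + z i * f' z) \<and> (n = 0 \<longrightarrow> f' = (\<lambda>_. 0))"
      using fg(1)[unfolded mem_Collect_eq] by (rule bexE)
    obtain g' where g': "g' \<in> poly_deg (vars J) (n - 1)"
      "(\<forall>z. g z = g (z(i := 0)) + z i * g' z) \<and> (n = 0 \<longrightarrow> g' = (\<lambda>_. 0))"
      using fg(2)[unfolded mem_Collect_eq] by (rule bexE)
    note f = conjunct1[OF f'(2)] conjunct2[OF f'(2)] f'(1) and g = conjunct1[OF g'(2)] conjunct2[OF g'(2)] g'(1)
    have "(f + g) z = (f + g) (z(i := 0)) + z i * (f' z + g' z)" for z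
      using f(1)[rule_format, of z] g(1)[rule_format, of z] unfolding plus_fun_def by (simp only: distrib_left ac_simps)
    note eq = this
    have "n = 0 \<longrightarrow> (\<lambda>z. f' z + g' z) = (\<lambda>_. 0)" using f(2) g(2) by auto
    then show "f + g \<in> {R. ?P n R}"
      unfolding mem_Collect_eq by (intro bexI[OF _ poly_deg_add[OF f(3) g(3)]] conjI allI eq)
  next
    fix c f assume f0: "f \<in> {R. ?P n R}"
    obtain f' where f': "f' \<in> poly_deg (vars J) (n - 1)"
      "(\<forall>z. f z = f (z(i := 0)) + z i * f' z) \<and> (n = 0 \<longrightarrow> f' = (\<lambda>_. 0))"
      using f0[unfolded mem_Collect_eq] by (rule bexE)
    note f = conjunct1[OF f'(2)] conjunct2[OF f'(2)] f'(1)
    have "fscale c f z = fscale c f (z(i := 0)) + z i * (c * f' z)" for z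
      using f(1)[rule_format, of z] unfolding fscale_apply by (simp only: distrib_left mult.left_commute)
    note eq = this
    have "n = 0 \<longrightarrow> (\<lambda>z. c * f' z) = (\<lambda>_. 0)" using f(2) by auto
    then show "fscale c f \<in> {R. ?P n R}"
      unfolding mem_Collect_eq by (intro bexI[OF _ poly_deg_scale[OF f(3), of c]] conjI allI eq)
  qed
  have "?P n b" if "b \<in> monomials (vars J) n" for b n
    using that
  proof (induction n arbitrary: b)
    case 0
    then show ?case by (intro bexI[of _ "\<lambda>_. 0"]) (simp_all add: poly_deg_const)
  next
    case (Suc n)
    show ?case
    proof (cases "b \<in> monomials (vars J) n")
      case True
      obtain r where r: "r \<in> poly_deg (vars J) (n - 1)" "(\<forall>z. b z = b (z(i := 0)) + z i * r z) \<and> (n = 0 \<longrightarrow> r = (\<lambda>_. 0))"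
        using Suc.IH[OF True] by (rule bexE)
      have "r \<in> poly_deg (vars J) (Suc n - 1)" using r(1) poly_deg_mono[of "n - 1" n "vars J"] by auto
      then show ?thesis by (intro bexI[of _ r] conjI conjunct1[OF r(2)]) simp
    next
      case False
      then obtain j b' where j: "j \<in> J" "b' \<in> monomials (vars J) n" "b = (\<lambda>z. z j * b' z)"
        using Suc.prems by (auto simp: vars_def)
      show ?thesis
      proof (cases "j = i")
        case True
        have "b' \<in> poly_deg (vars J) n" unfolding poly_deg_def by (rule fs.span_base[OF j(2)])
        then have bp: "b' \<in> poly_deg (vars J) (Suc n - 1)" by simp
        have "b z = b (z(i := 0)) + z i * b' z" for z using True by (simp add: j(3))
        then show ?thesis by (intro bexI[OF _ bp] conjI allI) (assumption, simp)
      next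
        case ne: False
        obtain r where r': "r \<in> poly_deg (vars J) (n - 1)" "(\<forall>z. b' z = b' (z(i := 0)) + z i * r z) \<and> (n = 0 \<longrightarrow> r = (\<lambda>_. 0))"
          using Suc.IH[OF j(2)] by (rule bexE)
        note r = r'(1) conjunct1[OF r'(2)] conjunct2[OF r'(2)]
        have "(\<lambda>z. z j * r z) \<in> poly_deg (vars J) n"
        proof (cases n)
          case 0
          then show ?thesis using r(3) by (simp add: poly_deg_const)
        next
          case (Suc k)
          then show ?thesis using poly_deg_coord_mult[OF vars_coord[OF j(1)] r(1)] by simp
        qed
        then have rp: "(\<lambda>z. z j * r z) \<in> poly_deg (vars J) (Suc n - 1)" by simp
        have eq: "b z = b (z(i := 0)) + z i * (z j * r z)" for z
        proof -
          have "b z = z j * (b' (z(i := 0)) + z i * r z)" unfolding j(3) by (rule arg_cong[OF r(2)[rule_format]])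
          also have "\<dots> = (z(i := 0)) j * b' (z(i := 0)) + z i * (z j * r z)"
            using ne by (simp add: distrib_left mult.left_commute)
          finally show ?thesis by (simp only: j(3))
        qed
        show ?thesis by (intro bexI[OF _ rp] conjI allI eq) simp
      qed
    qed
  qed
  then have "poly_deg (vars J) n \<subseteq> {R. ?P n R}" by (intro poly_deg_subset[OF sub]) auto
  then show ?thesis using assms(1) by auto
qed

section \<open>Jets over the origin\<close>

lemma polyfun_vanishes_on_jet_closure:
  assumes F: "F \<in> polyfun jet_coords" and sub: "\<And>\<gamma>. \<gamma> \<in> S \<Longrightarrow> F \<gamma> = 0"
    and S: "S \<subseteq> jet_scheme m X" and \<gamma>: "\<gamma> \<in> jet_topology m X closure_of S"
  shows "F \<gamma> = 0"
proof -
  let ?Z = "{\<gamma>. F \<gamma> = 0}"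
  have "closedin (zariski jet_coords) ?Z"
    unfolding closedin_zariski_iff by (rule exI[of _ "{F}"]) (use F in auto)
  then have "closedin (jet_topology m X) (?Z \<inter> jet_scheme m X)"
    unfolding jet_topology_def closedin_subtopology by blast
  moreover have "S \<subseteq> ?Z \<inter> jet_scheme m X" using sub S by auto
  ultimately have "jet_topology m X closure_of S \<subseteq> ?Z \<inter> jet_scheme m X" by (intro closure_of_minimal)
  then show ?thesis using \<gamma> by auto
qed

lemma jet_entry_polyfun: "(\<lambda>\<gamma>. \<gamma> k $ i $ j) \<in> polyfun jet_coords"
  by (rule polyfun.coord) (unfold jet_coords_def, blast)

theorem proposition1:
  fixes G A :: "(complex^'n^'n) set"
    and \<gg> \<ll> \<aa> :: "(complex^'n^'n) set"
    and e :: "complex^'n^'n"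
  assumes "reductive_group G" and "connectedin mat_zariski G"
    and "\<gg> = lie_algebra G" and "lie_simple \<gg>"
    and "levi_subalgebra \<ll> \<gg>" and "cmat.dim (lie_center \<ll>) = 1"
    and "\<aa> = lie_comm \<ll> \<ll>" and "lie_simple \<aa>"
    and "algebraic_group A" and "connectedin mat_zariski A"
    and "A \<subseteq> G" and "lie_algebra A = \<aa>"
    and "e \<in> \<aa>" and "e \<noteq> 0" and "nilpotent_element \<aa> e"
    and "\<exists>x\<in>\<aa>. regular_semisimple_element \<gg> x"
    and "2 * zdim (adjoint_orbit G e) < enat (cmat.dim \<gg>)"
  shows "RC1 (adjoint_orbit A e)"
proof (rule ccontr)
  obtain x where x: "x \<in> \<aa>" "regular_semisimple_element \<gg> x" using assms(16) by blast
  interpret regular_simple \<gg> x by standard (use assms(4) x(2) in auto)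
  let ?O = "adjoint_orbit A e"
  let ?X = "mat_zariski closure_of ?O"
  assume "\<not> RC1 ?O"
  then have neg: "jet_preimage 1 ?X {0} \<subseteq> jet_topology 1 ?X closure_of jet_preimage 1 ?X ?O"
    by (simp add: RC1_def Let_def)
  have G: "algebraic_group G" using assms(1) by (simp add: reductive_group_def)
  have irr: "irreducible_on mat_coords A" by (rule connected_algebraic_group_irreducible[OF assms(9,10)])
  have simpleA: "lie_simple (lie_algebra A)" using assms(8,12) by simp
  have sub\<aa>: "cmat.subspace \<aa>" by (rule subspace_lie_simple[OF assms(8)])
  have AG: "lie_algebra A \<subseteq> \<gg>"
    using assms(11) unfolding assms(3) lie_algebra_def vanishing_ideal_def by blast
  obtain h where h: "h \<in> \<aa>" "lie_bracket h e = e"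
    using nilpotent_in_ad_image[OF assms(8) x(1) x_not_nilpotent assms(15)] by blast
  have st: "ad_stable ?O u" if "u \<in> \<aa>" for u using orbit_ad_stable[OF assms(9), of u e] that assms(12) by simp
  have O0: "0 \<in> zclosure ?O" and T0: "\<And>v. v \<in> \<aa> \<Longrightarrow> v \<in> tangent ?O 0"
    using orbit_tangent_at_0[OF assms(8) st h adjoint_orbit_refl[OF assms(9)] assms(13,14)] by (simp, simp)
  obtain us where us: "set us \<subseteq> U" "2 * length us < cmat.dim \<gg>"
    "\<And>u s y. u \<in> U \<Longrightarrow> y \<in> range (chain e us) \<Longrightarrow> nconj u s y \<in> zclosure (range (chain e us))"
    using maximal_chain[OF G assms(3,17)] by metis
  define k where "k = length us"
  define c where "c p t = entries (chain e us t) p" for p t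
  have cp: "c p \<in> polyfun (vars {..<k})" for p
    unfolding c_def entries_def k_def by (rule chain_polyfun)
  have centries: "(\<lambda>p. c p t) = entries (chain e us t)" for t by (simp add: c_def fun_eq_iff)
  obtain S Q where SQ: "card S \<le> card {..<k}"
    "\<And>j. j \<in> UNIV - S \<Longrightarrow> Q j \<in> polyfun (vars (insert j S))"
    "\<And>j t. j \<in> UNIV - S \<Longrightarrow> Q j (\<lambda>i. c i t) = 0"
    "\<And>j. j \<in> UNIV - S \<Longrightarrow> \<exists>t. pd j (Q j) (\<lambda>i. c i t) \<noteq> 0"
    by (rule separating_transcendence_basis[of "{..<k}" UNIV c]) (auto intro: cp)
  have Qp: "Q j \<in> polyfun (vars (insert j S))" if "j \<in> -S" for j using SQ(2) that by auto
  have Q0: "Q j (entries (chain e us t)) = 0" if "j \<in> -S" for j t using SQ(3)[of j t] that by (simp add: centries)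
  have "\<exists>t. frame_denominator S Q (chain e us t) \<noteq> 0"
  proof (rule ccontr)
    assume "\<not> ?thesis"
    then have z: "\<forall>t\<in>UNIV. (\<Prod>j\<in>-S. pd j (Q j) (entries (chain e us t))) = 0" by (simp add: frame_denominator_def)
    have "\<exists>j\<in>-S. \<forall>t\<in>UNIV. pd j (Q j) (entries (chain e us t)) = 0"
      by (rule irreducible_on_prod[OF irreducible_on_vars[of "{..<length us}"] _ _ polyfun_entries[OF pd_polyfun[OF Qp] chain_polyfun] z]) auto
    then show False using SQ(4) by (auto simp: centries)
  qed
  then obtain t0 where t0: "frame_denominator S Q (chain e us t0) \<noteq> 0" by blast
  obtain z0 where z0: "\<And>y. y \<in> \<gg> \<Longrightarrow> \<exists>r\<in>cmat.span U. \<exists>v\<in>\<aa>. \<exists>c. y = r + v + cscale c z0"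
    using levi_codimension[OF assms(5,6,7) x(1)] by metis
  define m where "m = 2 * k"
  have mdim: "m < cmat.dim \<gg>" using us(2) by (simp add: m_def k_def)
  obtain u a q where uaq: "\<And>j. j < m \<Longrightarrow> u j \<in> insert 0 U" "\<And>j. j < m \<Longrightarrow> a j \<in> \<aa>"
    "\<And>i v w. i < m \<Longrightarrow> q i (v + w) = q i v + q i w" "\<And>i c v. i < m \<Longrightarrow> q i (cscale c v) = c * q i v"
    "\<And>i j. i < m \<Longrightarrow> j < m \<Longrightarrow> q i (lie_bracket (u j) x + a j) = (if i = j then 1 else 0 :: complex)"
    by (rule test_vectors[OF z0 sub\<aa> mdim], assumption, rule that)
  have qp: "q i \<in> polyfun mat_coords" if "i < m" for i using uaq(3,4)[OF that] by (rule linear_polyfun)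
  obtain i0 j0 where ij0: "e $ i0 $ j0 \<noteq> 0" using assms(14) by (metis matrix_eqI zero_index)
  let ?I = "{..<k} <+> S"
  \<comment> \<open>The variables \<open>Inl\<close> parametrise the chain and the variables
    \<open>Inr\<close> are the frame coefficients indexed by \<open>S\<close>. Function 0 is an
    entry that is nonzero at \<open>e\<close>; function \<open>Suc i\<close> is the i-th test
    functional on the tangent vector.\<close>
  define H where "H n z = (case n of 0 \<Rightarrow> chain e us (\<lambda>i. z (Inl i)) $ i0 $ j0
    | Suc i \<Rightarrow> q i (frame S Q (chain e us (\<lambda>i. z (Inl i))) (\<lambda>l. z (Inr l))))" for n z
  have chp: "(\<lambda>z. chain e us (\<lambda>i. z (Inl i)) $ i $ j) \<in> polyfun (vars ?I)" for i j
    by (rule polyfun_vars_compose[OF chain_polyfun, where h = "\<lambda>i z. z (Inl i)"])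
      (auto intro!: polyfun.coord vars_coord simp: k_def)
  have frp: "(\<lambda>z. frame S Q (chain e us (\<lambda>i. z (Inl i))) (\<lambda>l. z (Inr l)) $ i $ j) \<in> polyfun (vars ?I)" for i j
    by (rule frame_polyfun[where m = "\<lambda>z. chain e us (\<lambda>i. z (Inl i))" and c = "\<lambda>z l. z (Inr l)", OF Qp chp])
      (auto intro!: polyfun.coord vars_coord)
  have Hp: "H n \<in> polyfun (vars ?I)" if "n \<in> {..m}" for n
  proof (cases n)
    case 0
    then show ?thesis using chp by (simp add: H_def[abs_def])
  next
    case (Suc i)
    then have "i < m" using that by simp
    then show ?thesis using polyfun_mat_compose[OF qp frp] Suc by (simp add: H_def[abs_def])
  qed
  have finS: "finite S" by (rule finite_subset[OF subset_UNIV finite_class.finite_UNIV])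
  \<comment> \<open>At most \<open>k\<close> variables for the chain and \<open>k\<close> for
    \<open>S\<close>, against 2k + 1 functions.\<close>
  have "card ?I < card {..m}" using SQ(1) finS by (simp add: card_Plus m_def)
  then have "\<exists>R\<in>polyfun (vars {..m}). (\<exists>z. R z \<noteq> 0) \<and> (\<forall>t. R (\<lambda>j. H j t) = 0)"
    using Hp finS by (intro algebraic_relation[of ?I]) auto
  then obtain R1 where R1: "R1 \<in> polyfun (vars {..m})" "\<exists>z. R1 z \<noteq> 0" "\<forall>t. R1 (\<lambda>j. H j t) = 0" by blast
  from minimal_relation[OF R1] obtain R n where R: "R \<in> poly_deg (vars {..m}) n" "\<exists>z. R z \<noteq> 0" "\<forall>t. R (\<lambda>j. H j t) = 0"
    and min: "\<forall>R' n'. R' \<in> poly_deg (vars {..m}) n' \<longrightarrow> n' < n \<longrightarrow> (\<forall>t. R' (\<lambda>j. H j t) = 0) \<longrightarrow> (\<forall>z. R' z = 0)"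
    by (elim exE conjE) (rule that, assumption, erule exI, assumption+)
  have Rp: "R \<in> polyfun (vars {..m})" by (rule poly_deg_imp_polyfun[OF R(1)])
  \<comment> \<open>The relation as a function of a jet, given by base point and tangent vector; it
    vanishes on the frame vectors over the chain.\<close>
  define f where "f p = R (\<lambda>j. case j of 0 \<Rightarrow> fst p $ i0 $ j0 | Suc i \<Rightarrow> q i (snd p))" for p
  have fp: "f \<in> polyfun pair_coords"
    unfolding f_def
  proof (rule polyfun_vars_compose[OF Rp, where h = "\<lambda>j p. case j of 0 \<Rightarrow> fst p $ i0 $ j0 | Suc i \<Rightarrow> q i (snd p)"])
    fix j assume j: "j \<in> {..m}"
    show "(\<lambda>p. case j of 0 \<Rightarrow> fst p $ i0 $ j0 | Suc i \<Rightarrow> q i (snd p)) \<in> polyfun pair_coords"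
    proof (cases j)
      case 0
      then show ?thesis using fst_entry_polyfun by simp
    next
      case (Suc i)
      then show ?thesis using polyfun_mat_compose[OF qp snd_entry_polyfun, of i] j by simp
    qed
  qed
  have f0: "f (chain e us t, frame S Q (chain e us t) c) = 0" for t c
  proof -
    have "R (\<lambda>j. H j (case_sum t c)) = 0" using R(3) by blast
    then show ?thesis unfolding H_def f_def sum.case fst_conv snd_conv .
  qed
  \<comment> \<open>A vector of \<aa> is a 1-jet over 0, so by assumption a limit of jets over the
    orbit. The conjugation by \<open>ps\<close> is put into the function, a polynomial in the jet,
    so that the equation passes to the limit.\<close>
  have f\<aa>: "f (0, conjs ps v) = 0" if ps: "fst ` set ps \<subseteq> U" and v: "v \<in> \<aa>" for ps v
  proof -
    let ?F = "\<lambda>\<gamma> :: nat \<Rightarrow> complex^'n^'n. f (conjs ps (\<gamma> 0), conjs ps (\<gamma> 1))"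
    define \<gamma> where "\<gamma> = (\<lambda>k :: nat. if k = 1 then v else 0)"
    have "\<gamma> \<in> jet_scheme 1 ?X" unfolding jet_scheme_1_iff using O0 T0[OF v] by (simp add: \<gamma>_def)
    then have "\<gamma> \<in> jet_preimage 1 ?X {0}" by (simp add: jet_preimage_def \<gamma>_def)
    then have cl: "\<gamma> \<in> jet_topology 1 ?X closure_of jet_preimage 1 ?X ?O" using neg by blast
    have "?F \<gamma> = 0"
    proof (rule polyfun_vanishes_on_jet_closure[OF _ _ _ cl])
      show "?F \<in> polyfun jet_coords"
        by (rule pair_polyfun_compose[OF fp, where m = "\<lambda>\<gamma>. conjs ps (\<gamma> 0)" and k = "\<lambda>\<gamma>. conjs ps (\<gamma> 1)"])
          (rule conjs_polyfun, rule jet_entry_polyfun)+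
      show "jet_preimage 1 ?X ?O \<subseteq> jet_scheme 1 ?X" by (auto simp: jet_preimage_def)
      fix \<gamma> assume "\<gamma> \<in> jet_preimage 1 ?X ?O"
      then have "\<gamma> 0 \<in> ?O" "\<gamma> 1 \<in> tangent ?O (\<gamma> 0)" unfolding jet_preimage_def jet_scheme_1_iff by simp_all
      then show "f (conjs ps (\<gamma> 0), conjs ps (\<gamma> 1)) = 0"
        using jets_over_orbit[OF assms(9) irr simpleA AG us(1,3) Qp Q0 t0 fp f0 _ _ ps] by blast
    qed
    then show ?thesis by (simp add: \<gamma>_def)
  qed
  define v where "v s = x + (\<Sum>i<m. cscale (s i) (a i))" for s
  have v\<aa>: "v s \<in> \<aa>" for s
    unfolding v_def
    by (intro cmat.subspace_add[OF sub\<aa>] x(1) cmat.subspace_sum[OF sub\<aa>] cmat.subspace_scale[OF sub\<aa>]) (simp add: uaq(2))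
  have vp: "(\<lambda>s. v s $ i $ j) \<in> polyfun (vars {..<m})" for i j
    unfolding v_def by (simp add: sum_component) (intro polyfun.intros(2-) polyfun_sum polyfun.coord vars_coord; simp)
  have umn: "mnilpotent (u i)" if "i < m" for i
  proof -
    have "mnilpotent (0 :: complex^'n^'n)" unfolding mnilpotent_def by (rule exI[of _ 1]) (simp add: mpow_Suc matrix_mult_0)
    then show ?thesis using uaq(1)[OF that] U_mnilpotent by auto
  qed
  \<comment> \<open>Setting the base coordinate to 0 restricts the relation to jets over the
    origin.\<close>
  define R0 where "R0 z = R (\<lambda>j. case j of 0 \<Rightarrow> 0 | Suc i \<Rightarrow> z i)" for z
  have R0p: "R0 \<in> polyfun (vars {..<m})"
    unfolding R0_def
  proof (rule polyfun_vars_compose[OF Rp, where h = "\<lambda>j z. case j of 0 \<Rightarrow> 0 | Suc i \<Rightarrow> z i"])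
    fix j assume "j \<in> {..m}"
    then show "(\<lambda>z. case j of 0 \<Rightarrow> 0 | Suc i \<Rightarrow> z i) \<in> polyfun (vars {..<m})"
      by (cases j) (simp_all add: polyfun.const polyfun.coord vars_coord)
  qed
  \<comment> \<open>The test functionals on the sweep have the identity as Jacobian at 0, so they
    satisfy no nonzero relation.\<close>
  have R0z: "R0 z = 0" for z
  proof (rule unit_jacobian_imp_injective[OF finite_lessThan _ _ R0p, where H = "\<lambda>i s. q i (sweep u v m s)"])
    show "(\<lambda>s. q i (sweep u v m s)) \<in> polyfun (vars {..<m})" if "i \<in> {..<m}" for i
      by (rule polyfun_mat_compose[OF qp sweep_polyfun[OF order_refl vp]]) (use that in simp)
    show "pd j (\<lambda>s. q i (sweep u v m s)) (\<lambda>_. 0) = (if i = j then 1 else 0)" if "i \<in> {..<m}" "j \<in> {..<m}" for i j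
    proof -
      have ij: "i < m" "j < m" using that by auto
      show ?thesis unfolding v_def
        using sweep_derivative[of m u j "q i" x a, OF umn ij(2) uaq(3,4)[OF ij(1)]] uaq(5)[OF ij] by simp
    qed
    fix s
    obtain ps where ps: "fst ` set ps \<subseteq> U" "sweep u v m s = conjs ps (v s)" using sweep_conjs[of m u U v s] uaq(1) by blast
    have "R0 (\<lambda>i. q i (sweep u v m s)) = f (0, conjs ps (v s))"
      unfolding R0_def f_def ps(2) fst_conv snd_conv zero_index ..
    then show "R0 (\<lambda>i. q i (sweep u v m s)) = 0" using f\<aa>[OF ps(1) v\<aa>] by simp
  qed
  \<comment> \<open>\<open>R\<close> is thus divisible by its variable 0. The cofactor has smaller
    degree and, as function 0 is not identically zero, is again a relation, against
    minimality.\<close>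
  obtain R' where R': "R' \<in> poly_deg (vars {..m}) (n - 1)"
    "(\<forall>z. R z = R (z(0 := 0)) + z 0 * R' z) \<and> (n = 0 \<longrightarrow> R' = (\<lambda>_. 0))"
    using poly_deg_split_variable[OF R(1), of 0] by auto
  have RR': "R z = z 0 * R' z" for z
  proof -
    have "(\<lambda>j. case j of 0 \<Rightarrow> 0 | Suc i \<Rightarrow> z (Suc i)) = z(0 := 0)" by (rule ext) (simp split: nat.split)
    then have "R (z(0 := 0)) = R0 (\<lambda>i. z (Suc i))" unfolding R0_def by (simp only:)
    moreover have "R z = R (z(0 := 0)) + z 0 * R' z" using R'(2) by blast
    ultimately show ?thesis by (simp only: R0z add_0)
  qed
  have R'p: "R' \<in> polyfun (vars {..m})" by (rule poly_deg_imp_polyfun[OF R'(1)])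
  have "(\<forall>z\<in>UNIV. H 0 z = 0) \<or> (\<forall>z\<in>UNIV. R' (\<lambda>j. H j z) = 0)"
  proof (rule irreducible_onD[OF irreducible_on_vars[of ?I]])
    show "H 0 \<in> polyfun (vars ?I)" by (rule Hp) simp
    show "(\<lambda>z. R' (\<lambda>j. H j z)) \<in> polyfun (vars ?I)" by (rule polyfun_vars_compose[OF R'p Hp])
    fix z
    show "H 0 z * R' (\<lambda>j. H j z) = 0" using R(3) RR'[of "\<lambda>j. H j z"] by simp
  qed
  moreover have "H 0 (\<lambda>_. 0) \<noteq> 0"
  proof -
    have "chain e us (\<lambda>_. 0) = e" by (rule chain_zero) (use us(1) U_mnilpotent in auto)
    then show ?thesis using ij0 by (simp add: H_def)
  qed
  ultimately have R'0: "\<forall>z. R' (\<lambda>j. H j z) = 0" by auto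
  have "R' z = 0" for z
  proof (cases "n = 0")
    case False
    then show ?thesis using min R'(1) R'0 by (metis diff_less less_one neq0_conv)
  qed (use R'(2) in simp)
  then show False using R(2) RR' by simp
qed

end
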